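(* Assume that $l_n=2^{\kappa(n)}$, $n\ge1$, where $\kappa$ takes positive integer values and $\kappa(n+1)\ge\kappa(n)+1$ for all $n$. Let $\Gamma$ be the cyclic Neumann-Segal group associated with $(l_n)_1^\infty$ and let $V_n=l_1\cdots l_n$. There are constants $c,C\in(0,\infty)$ such that for all $n\ge2$ and $r\in[l_{n-1},l_n]$, $$\Lambda_{1,\mathbb Z\wr_{\mathcal S}\Gamma}(v)\ge\frac{c}{r}\quad\text{for } v\le\exp(cV_{n-1}r\log r),$$ and $$\Lambda_{2,\mathbb Z\wr_{\mathcal S}\Gamma}(v)\le\frac{C}{r^2}\quad\text{for } v\ge\exp(CV_{n-1}r\log r).$$ Equivalently, $$\Lambda^2_{1,\mathbb Z\wr_{\mathcal S}\Gamma}(v)\asymp\Lambda_{2,\mathbb Z\wr_{\mathcal S}\Gamma}(v)\asymp\begin{cases} r^{-2} & \text{for }\log v=V_{n-1}r\log r,\ r\in[l_{n-1},l_n],\\ l_n^{-2} & \text{for }\log v\in[V_{n-1}l_n\log l_n,\,V_nl_n\log l_n].\end{cases}$$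
   Context: Cyclic Neumann-Segal group. Let $(l_i)_{i\ge1}$ be a sequence of even positive integers, $X_i=\{0,\dots,l_i-1\}$ (residues mod $l_i$), and $y_i=l_i/2\in X_i$. For $i\ge0$ define automorphisms $\alpha_i,\beta_i$ of the rooted tree of words $x_{i+1}x_{i+2}\cdots$, $x_j\in X_j$, recursively: $\alpha_i(xw)=(x+1\bmod l_{i+1})w$, and $\beta_i(0w)=0\,\beta_{i+1}(w)$, $\beta_i(y_{i+1}w)=y_{i+1}\,\alpha_{i+1}(w)$, $\beta_i(xw)=xw$ for all other $x\in X_{i+1}$. Put $\alpha=\alpha_0$, $\beta=\beta_0$ and $\Gamma=\langle\alpha,\beta\rangle$. $\mathcal S$ is the orbit of the infinite word $o=0^\infty$ under $\Gamma$, with its Schreier graph structure for the generators $\alpha,\beta$. Permutation wreath product: $\mathbb Z\wr_{\mathcal S}\Gamma=\left(\bigoplus_{x\in\mathcal S}\mathbb Z\right)\rtimes\Gamma$ with product $(f,g)(f',g')=(f+g\cdot f',gg')$, $(g\cdot f')(x)=f'(g^{-1}\cdot x)$. For a symmetric probability measure $\phi$ on a group $G$, $$\Lambda_{1,G,\phi}(v)=\inf\Big\{\tfrac12\sum_{x,y}|f(yx)-f(x)|\phi(y): |\mathrm{supp} f|\le v,\ \|f\|_1=1\Big\},$$ $$\Lambda_{2,G,\phi}(v)=\inf\Big\{\tfrac12\sum_{x,y}|f(yx)-f(x)|^2\phi(y): |\mathrm{supp} f|\le v,\ \|f\|_2=1\Big\}$$ over $f:G\to\mathbb R$. For $G$ finitely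 generated, $\Lambda_{i,G}$ stands for $\Lambda_{i,G,\phi}$ with $\phi$ a fixed symmetric probability measure with finite generating support (constants may depend on the choice). $f_1\asymp f_2$ means that there are constants $c_1,c_2\in(0,\infty)$ with $c_1f_1\le f_2\le c_2f_1$ (uniformly over all indicated values of $n\ge 2$, $r$ and $v$). *)

theory Defs
  imports
    "HOL-Algebra.Product_Groups"
    "HOL-Algebra.Group_Action"
    "HOL-Probability.Probability"
begin

section \<open>Isoperimetric profiles\<close>

definition symmetric_measure :: "('a, 'b) monoid_scheme \<Rightarrow> 'a pmf \<Rightarrow> bool" where
  "symmetric_measure G \<phi> \<longleftrightarrow>
     set_pmf \<phi> \<subseteq> carrier G \<and> (\<forall>x\<in>carrier G. pmf \<phi> (inv\<^bsub>G\<^esub> x) = pmf \<phi> x)"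

definition finite_generating_support :: "('a, 'b) monoid_scheme \<Rightarrow> 'a pmf \<Rightarrow> bool" where
  "finite_generating_support G \<phi> \<longleftrightarrow>
     finite (set_pmf \<phi>) \<and> generate G (set_pmf \<phi>) = carrier G"

definition supp :: "('a, 'b) monoid_scheme \<Rightarrow> ('a \<Rightarrow> real) \<Rightarrow> 'a set" where
  "supp G f = {x \<in> carrier G. f x \<noteq> 0}"

definition lp_norm :: "nat \<Rightarrow> ('a, 'b) monoid_scheme \<Rightarrow> ('a \<Rightarrow> real) \<Rightarrow> real" where
  "lp_norm p G f = root p (\<Sum>\<^sub>\<infinity>x\<in>carrier G. \<bar>f x\<bar> ^ p)"

definition dirichlet :: "nat \<Rightarrow> ('a, 'b) monoid_scheme \<Rightarrow> 'a pmf \<Rightarrow> ('a \<Rightarrow> real) \<Rightarrow> real" where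
  "dirichlet p G \<phi> f =
     1 / 2 * (\<Sum>\<^sub>\<infinity>(x, y)\<in>carrier G \<times> carrier G. \<bar>f (y \<otimes>\<^bsub>G\<^esub> x) - f x\<bar> ^ p * pmf \<phi> y)"

text \<open>
  The infimum is taken in the extended reals, so that it is \<open>\<infinity>\<close> when no function is admissible,
  that is, for \<open>v < 1\<close>. For finitely supported \<open>f\<close> the double sum above always converges, so that
  the convention for divergent sums plays no role.
\<close>

definition profile :: "nat \<Rightarrow> ('a, 'b) monoid_scheme \<Rightarrow> 'a pmf \<Rightarrow> real \<Rightarrow> ereal" where
  "profile p G \<phi> v =
     Inf {ereal (dirichlet p G \<phi> f) |f.
            finite (supp G f) \<and> real (card (supp G f)) \<le> v \<and> lp_norm p G f = 1}"

definition comparable_on :: "'i set \<Rightarrow> ('i \<Rightarrow> ereal) \<Rightarrow> ('i \<Rightarrow> ereal) \<Rightarrow> bool" where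
  "comparable_on A f g \<longleftrightarrow>
     (\<exists>c1>0. \<exists>c2>0. \<forall>i\<in>A. ereal c1 * f i \<le> g i \<and> g i \<le> ereal c2 * f i)"


section \<open>Permutation wreath products with lamp group the integers\<close>

definition int_wreath ::
    "('g, 'm) monoid_scheme \<Rightarrow> ('g \<Rightarrow> 's \<Rightarrow> 's) \<Rightarrow> 's set \<Rightarrow> (('s \<Rightarrow> int) \<times> 'g) monoid" where
  "int_wreath G act S =
     (let L = sum_group S (\<lambda>_. integer_group) in
      \<lparr>carrier = carrier L \<times> carrier G,
       monoid.mult = (\<lambda>(f, g) (f', g'). (f \<otimes>\<^bsub>L\<^esub> (\<lambda>x\<in>S. f' (act (inv\<^bsub>G\<^esub> g) x)), g \<otimes>\<^bsub>G\<^esub> g')),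
       one = (\<one>\<^bsub>L\<^esub>, \<one>\<^bsub>G\<^esub>)\<rparr>)"

lemma group_int_wreath:
  assumes "group G"
    and closed: "\<And>g x. g \<in> carrier G \<Longrightarrow> x \<in> S \<Longrightarrow> act g x \<in> S"
    and one: "\<And>x. x \<in> S \<Longrightarrow> act \<one>\<^bsub>G\<^esub> x = x"
    and mult: "\<And>g h x. g \<in> carrier G \<Longrightarrow> h \<in> carrier G \<Longrightarrow> x \<in> S \<Longrightarrow>
                 act (g \<otimes>\<^bsub>G\<^esub> h) x = act g (act h x)"
  shows "group (int_wreath G act S)"
proof -
  interpret group G by fact
  have cL: "carrier (sum_group S (\<lambda>_. integer_group))
              = {f \<in> extensional S. finite {x \<in> S. f x \<noteq> 0}}"
    by (subst carrier_sum_group) (auto simp: PiE_def)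
  have inv_act: "act g (act (inv\<^bsub>G\<^esub> g) x) = x" "act (inv\<^bsub>G\<^esub> g) (act g x) = x"
    if "g \<in> carrier G" "x \<in> S" for g x
    using that by (simp_all flip: mult add: one)
  have fin: "finite {x \<in> S. f (act g x) \<noteq> 0}"
    if "g \<in> carrier G" "finite {x \<in> S. f x \<noteq> 0}" for g and f :: "_ \<Rightarrow> int"
  proof (rule finite_subset)
    show "{x \<in> S. f (act g x) \<noteq> 0} \<subseteq> act (inv\<^bsub>G\<^esub> g) ` {x \<in> S. f x \<noteq> 0}"
    proof
      fix x assume "x \<in> {x \<in> S. f (act g x) \<noteq> 0}"
      then show "x \<in> act (inv\<^bsub>G\<^esub> g) ` {x \<in> S. f x \<noteq> 0}"
        using that closed inv_act by (intro image_eqI[of _ _ "act g x"]) auto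
    qed
  qed (use that in auto)
  have fin2: "finite {x \<in> S. f x + h x \<noteq> 0}"
    if "finite {x \<in> S. f x \<noteq> 0}" "finite {x \<in> S. h x \<noteq> 0}" for f h :: "_ \<Rightarrow> int"
    by (rule finite_subset[OF _ finite_UnI[OF that]]) auto
  let ?W = "int_wreath G act S"
  show ?thesis
  proof (rule groupI)
    fix a b assume "a \<in> carrier ?W" "b \<in> carrier ?W"
    then show "a \<otimes>\<^bsub>?W\<^esub> b \<in> carrier ?W"
      by (auto simp: int_wreath_def Let_def cL fin fin2 cong: conj_cong)
  next
    show "\<one>\<^bsub>?W\<^esub> \<in> carrier ?W"
      by (auto simp: int_wreath_def Let_def cL cong: conj_cong)
  next
    fix a b c assume "a \<in> carrier ?W" "b \<in> carrier ?W" "c \<in> carrier ?W"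
    then show "a \<otimes>\<^bsub>?W\<^esub> b \<otimes>\<^bsub>?W\<^esub> c = a \<otimes>\<^bsub>?W\<^esub> (b \<otimes>\<^bsub>?W\<^esub> c)"
      by (auto simp: int_wreath_def Let_def m_assoc closed inv_mult_group mult fun_eq_iff)
  next
    fix a assume "a \<in> carrier ?W"
    then show "\<one>\<^bsub>?W\<^esub> \<otimes>\<^bsub>?W\<^esub> a = a"
      by (auto simp: int_wreath_def Let_def cL one fun_eq_iff extensional_def)
  next
    fix a assume "a \<in> carrier ?W"
    then show "\<exists>b\<in>carrier ?W. b \<otimes>\<^bsub>?W\<^esub> a = \<one>\<^bsub>?W\<^esub>"
      by (intro bexI[of _ "(\<lambda>x\<in>S. - fst a (act (snd a) x), inv\<^bsub>G\<^esub> (snd a))"])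
         (auto simp: int_wreath_def Let_def cL fin fun_eq_iff cong: conj_cong)
  qed
qed


section \<open>The cyclic Neumann--Segal group\<close>

text \<open>
  A vertex \<open>x\<^sub>i\<^sub>+\<^sub>1 \<dots> x\<^sub>i\<^sub>+\<^sub>k\<close> of the \<open>i\<close>-th tree is a list whose entry at position \<open>j\<close>
  (counted from 0) is the letter \<open>x\<^sub>i\<^sub>+\<^sub>j\<^sub>+\<^sub>1\<close>. The value \<open>l 0\<close> is never used.
\<close>

definition words :: "(nat \<Rightarrow> nat) \<Rightarrow> nat \<Rightarrow> nat list set" where
  "words l i = {w. \<forall>j<length w. w ! j < l (i + j + 1)}"

fun ns_alpha :: "(nat \<Rightarrow> nat) \<Rightarrow> nat \<Rightarrow> nat list \<Rightarrow> nat list" where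
  "ns_alpha l i [] = []"
| "ns_alpha l i (x # w) = ((x + 1) mod l (i + 1)) # w"

fun ns_beta :: "(nat \<Rightarrow> nat) \<Rightarrow> nat \<Rightarrow> nat list \<Rightarrow> nat list" where
  "ns_beta l i [] = []"
| "ns_beta l i (x # w) =
     (if x = 0 then 0 # ns_beta l (i + 1) w
      else if x = l (i + 1) div 2 then x # ns_alpha l (i + 1) w
      else x # w)"

definition ns_group :: "(nat \<Rightarrow> nat) \<Rightarrow> (nat list \<Rightarrow> nat list) monoid" where
  "ns_group l =
     subgroup_generated (BijGroup (words l 0))
       {restrict (ns_alpha l 0) (words l 0), restrict (ns_beta l 0) (words l 0)}"

text \<open>
  Infinite words are functions whose value at \<open>n\<close> is the letter \<open>x\<^sub>n\<^sub>+\<^sub>1\<close>. A tree automorphism acts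
  on them through their finite prefixes.
\<close>

definition ray_action :: "(nat list \<Rightarrow> nat list) \<Rightarrow> (nat \<Rightarrow> nat) \<Rightarrow> (nat \<Rightarrow> nat)" where
  "ray_action g \<xi> = (\<lambda>n. g (map \<xi> [0..<Suc n]) ! n)"

definition ns_orbit :: "(nat \<Rightarrow> nat) \<Rightarrow> (nat \<Rightarrow> nat) set" where
  "ns_orbit l = orbit (ns_group l) ray_action (\<lambda>_. 0)"

definition ns_wreath ::
    "(nat \<Rightarrow> nat) \<Rightarrow> (((nat \<Rightarrow> nat) \<Rightarrow> int) \<times> (nat list \<Rightarrow> nat list)) monoid" where
  "ns_wreath l = int_wreath (ns_group l) ray_action (ns_orbit l)"

definition level_size :: "(nat \<Rightarrow> nat) \<Rightarrow> nat \<Rightarrow> nat" where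
  "level_size l n = (\<Prod>i=1..n. l i)"

text \<open>
  The pairs \<open>(v, r)\<close> for which \<open>r\<^sup>-\<^sup>2\<close> is the predicted size of the profile \<open>\<Lambda>\<^sub>2(v)\<close>;
  along the second family \<open>r\<close> stays equal to \<open>l\<^sub>n\<close>.
\<close>

definition regime :: "(nat \<Rightarrow> nat) \<Rightarrow> (real \<times> real) set" where
  "regime l =
     {(v, r). v > 0 \<and> (\<exists>n\<ge>2. r \<in> {real (l (n - 1))..real (l n)} \<and>
        ln v = real (level_size l (n - 1)) * r * ln r)}
     \<union> {(v, r). v > 0 \<and> (\<exists>n\<ge>2. r = real (l n) \<and>
        ln v \<in> {real (level_size l (n - 1)) * real (l n) * ln (real (l n))
                 ..real (level_size l n) * real (l n) * ln (real (l n))})}"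


subsection \<open>Well-definedness\<close>

lemma words_Nil [simp]: "[] \<in> words l i"
  by (simp add: words_def)

lemma words_Cons [simp]: "x # w \<in> words l i \<longleftrightarrow> x < l (i + 1) \<and> w \<in> words l (i + 1)"
  by (auto simp: words_def nth_Cons less_Suc_eq_0_disj split: nat.splits)

lemma take_words: "w \<in> words l i \<Longrightarrow> take n w \<in> words l i"
  by (auto simp: words_def)

lemma ns_alpha_Bij:
  assumes "\<And>i. i \<ge> 1 \<Longrightarrow> 0 < l i"
  shows "restrict (ns_alpha l i) (words l i) \<in> Bij (words l i)"
proof -
  have pos: "0 < l (Suc i)" using assms by simp
  have "inj_on (ns_alpha l i) (words l i)"
  proof (rule inj_onI)
    fix u w assume "u \<in> words l i" "w \<in> words l i" "ns_alpha l i u = ns_alpha l i w"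
    then show "u = w"
      by (cases u; cases w) (auto simp: mod_Suc split: if_splits)
  qed
  moreover have "ns_alpha l i ` words l i = words l i"
  proof (intro equalityI subsetI)
    fix w assume w: "w \<in> words l i"
    show "w \<in> ns_alpha l i ` words l i"
    proof (cases w)
      case Nil
      then show ?thesis by (auto intro!: image_eqI[of _ _ "[]"])
    next
      case (Cons x v)
      have "ns_alpha l i ((if x = 0 then l (Suc i) - 1 else x - 1) # v) = w"
        using Cons w pos by auto
      moreover have "(if x = 0 then l (Suc i) - 1 else x - 1) # v \<in> words l i"
        using Cons w pos by auto
      ultimately show ?thesis by (metis image_eqI)
    qed
  next
    fix w assume "w \<in> ns_alpha l i ` words l i"
    then obtain u where "u \<in> words l i" "w = ns_alpha l i u" by blast
    then show "w \<in> words l i" using pos by (cases u) auto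
  qed
  ultimately have "bij_betw (ns_alpha l i) (words l i) (words l i)"
    by (simp add: bij_betw_def)
  then show ?thesis
    by (simp add: Bij_def cong: bij_betw_cong)
qed

lemma ns_beta_Bij:
  assumes pos: "\<And>i. i \<ge> 1 \<Longrightarrow> 0 < l i"
  shows "restrict (ns_beta l i) (words l i) \<in> Bij (words l i)"
proof -
  have bij: "bij_betw (ns_alpha l i) (words l i) (words l i)" for i
    using ns_alpha_Bij[OF pos] by (simp add: Bij_def cong: bij_betw_cong)
  have inj: "u = w"
    if "u \<in> words l i" "w \<in> words l i" "ns_beta l i u = ns_beta l i w" for u w i
    using that
  proof (induction u arbitrary: i w)
    case Nil
    then show ?case by (cases w) (auto split: if_splits)
  next
    case (Cons x u)
    then show ?case
      using bij[of "Suc i"]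
      by (cases w) (auto split: if_splits simp: bij_betw_def dest: inj_onD)
  qed
  have into: "ns_beta l i u \<in> words l i" if "u \<in> words l i" for u i
    using that
  proof (induction u arbitrary: i)
    case (Cons x u)
    then show ?case using bij[of "Suc i"] by (auto dest: bij_betwE)
  qed simp
  have onto: "\<exists>u\<in>words l i. ns_beta l i u = w" if "w \<in> words l i" for w i
    using that
  proof (induction w arbitrary: i)
    case Nil
    then show ?case by (auto intro: bexI[of _ "[]"])
  next
    case (Cons x w)
    then obtain u where u: "u \<in> words l (Suc i)" "ns_beta l (Suc i) u = w" by auto
    have "w \<in> ns_alpha l (Suc i) ` words l (Suc i)"
      using Cons.prems bij[of "Suc i"] by (simp add: bij_betw_def)
    then obtain v where v: "v \<in> words l (Suc i)" "ns_alpha l (Suc i) v = w"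
      by blast
    have "(if x = 0 then 0 # u else if x = l (Suc i) div 2 then x # v else x # w) \<in> words l i"
      using Cons.prems u v by auto
    moreover have "ns_beta l i
        (if x = 0 then 0 # u else if x = l (Suc i) div 2 then x # v else x # w) = x # w"
      using u v by auto
    ultimately show ?case by blast
  qed
  have "bij_betw (ns_beta l i) (words l i) (words l i)"
    unfolding bij_betw_def inj_on_def using inj into onto by (auto simp: image_iff) metis
  then show ?thesis
    by (simp add: Bij_def cong: bij_betw_cong)
qed

lemma group_ns_group: "group (ns_group l)"
  unfolding ns_group_def by (intro group.group_subgroup_generated group_BijGroup)

lemma ns_group_generators:
  assumes "\<And>i. i \<ge> 1 \<Longrightarrow> 0 < l i"
  shows "restrict (ns_alpha l 0) (words l 0) \<in> carrier (ns_group l)"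
    and "restrict (ns_beta l 0) (words l 0) \<in> carrier (ns_group l)"
  using ns_alpha_Bij[of l 0] ns_beta_Bij[of l 0] assms
  by (auto simp: ns_group_def carrier_subgroup_generated BijGroup_def intro!: generate.incl)

lemma ns_group_Bij:
  assumes "g \<in> carrier (ns_group l)"
  shows "g \<in> Bij (words l 0)"
  using assms group.generate_incl[OF group_BijGroup, of "carrier (BijGroup (words l 0)) \<inter> _" "words l 0"]
  by (auto simp: ns_group_def carrier_subgroup_generated BijGroup_def)

lemma ns_group_mult:
  "g \<in> carrier (ns_group l) \<Longrightarrow> h \<in> carrier (ns_group l) \<Longrightarrow>
     g \<otimes>\<^bsub>ns_group l\<^esub> h = compose (words l 0) g h"
  using ns_group_Bij[of g l] ns_group_Bij[of h l]
  by (simp add: ns_group_def BijGroup_def subgroup_generated_def)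

lemma ns_group_one: "\<one>\<^bsub>ns_group l\<^esub> = (\<lambda>w\<in>words l 0. w)"
  by (simp add: ns_group_def BijGroup_def subgroup_generated_def)

lemma ns_alpha_prefix: "length (ns_alpha l i w) = length w"
    "take n (ns_alpha l i w) = ns_alpha l i (take n w)"
  by (cases w; cases n; simp)+

lemma ns_beta_prefix: "length (ns_beta l i w) = length w"
    "take n (ns_beta l i w) = ns_beta l i (take n w)"
proof -
  show "length (ns_beta l i w) = length w"
    by (induction w arbitrary: i) (auto simp: ns_alpha_prefix)
  show "take n (ns_beta l i w) = ns_beta l i (take n w)"
  proof (induction w arbitrary: i n)
    case (Cons x w)
    then show ?case by (cases n) (auto simp: ns_alpha_prefix)
  qed simp
qed

text \<open>The elements of \<open>ns_group l\<close> are automorphisms of the rooted tree.\<close>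

lemma ns_group_prefix:
  assumes "g \<in> carrier (ns_group l)" "w \<in> words l 0"
  shows "length (g w) = length w" "take n (g w) = g (take n w)"
proof -
  let ?B = "BijGroup (words l 0)"
  let ?P = "\<lambda>g. \<forall>w\<in>words l 0. length (g w) = length w \<and> (\<forall>n. take n (g w) = g (take n w))"
  let ?H = "{restrict (ns_alpha l 0) (words l 0), restrict (ns_beta l 0) (words l 0)}"
  interpret B: group ?B by (rule group_BijGroup)
  have BijD: "h \<in> Bij (words l 0)" if "h \<in> carrier ?B" for h
    using that by (simp add: BijGroup_def)
  have gen: "?P h" if "h \<in> carrier ?B \<inter> ?H" for h
    using that by (auto simp: ns_alpha_prefix ns_beta_prefix take_words)
  have "g \<in> generate ?B (carrier ?B \<inter> ?H)"
    using assms(1) by (simp add: ns_group_def carrier_subgroup_generated)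
  then have "g \<in> carrier ?B \<and> ?P g"
  proof (induction rule: generate.induct)
    case one
    then show ?case by (intro conjI B.one_closed) (simp add: BijGroup_def take_words)
  next
    case (incl h)
    then show ?case using gen by blast
  next
    case (inv h)
    then have h: "h \<in> carrier ?B" "?P h" using gen by blast+
    let ?k = "inv\<^bsub>?B\<^esub> h"
    have k: "?k \<in> carrier ?B" using h by simp
    have hk: "h (?k w) = w" "?k (h w) = w" if "w \<in> words l 0" for w
      using that fun_cong[OF B.r_inv[OF h(1)], of w] fun_cong[OF B.l_inv[OF h(1)], of w] h(1) k
      by (auto simp: BijGroup_def compose_def)
    have kw: "?k w \<in> words l 0" if "w \<in> words l 0" for w
      by (rule funcset_mem[OF Bij_imp_funcset[OF BijD[OF k]] that])
    have "?P ?k"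
    proof (intro ballI conjI allI)
      fix w n assume w: "w \<in> words l 0"
      show "length (?k w) = length w" using h(2) hk kw w by metis
      have "take n w = h (take n (?k w))" using h(2) hk kw w by metis
      then show "take n (?k w) = ?k (take n w)" using hk kw w take_words by metis
    qed
    then show ?case using k by blast
  next
    case (eng g h)
    then have c: "g \<otimes>\<^bsub>?B\<^esub> h = compose (words l 0) g h" by (simp add: BijGroup_def)
    have hw: "h w \<in> words l 0" if "w \<in> words l 0" for w
      using eng.IH(2) that BijD Bij_imp_funcset funcset_mem by metis
    have "?P (g \<otimes>\<^bsub>?B\<^esub> h)"
      unfolding c using eng hw by (auto simp: compose_def take_words)
    then show ?case using eng B.m_closed by blast
  qed
  then show "length (g w) = length w" "take n (g w) = g (take n w)"
    using assms(2) by blast+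
qed

definition rays :: "(nat \<Rightarrow> nat) \<Rightarrow> (nat \<Rightarrow> nat) set" where
  "rays l = {\<xi>. \<forall>n. \<xi> n < l (n + 1)}"

lemma map_ray_words: "\<xi> \<in> rays l \<Longrightarrow> map \<xi> [0..<n] \<in> words l 0"
  by (auto simp: rays_def words_def)

lemma map_ray_action:
  assumes "g \<in> carrier (ns_group l)" "\<xi> \<in> rays l"
  shows "map (ray_action g \<xi>) [0..<n] = g (map \<xi> [0..<n])"
proof (rule nth_equalityI)
  have w: "map \<xi> [0..<m] \<in> words l 0" for m by (rule map_ray_words[OF assms(2)])
  show len: "length (map (ray_action g \<xi>) [0..<n]) = length (g (map \<xi> [0..<n]))"
    by (simp add: ns_group_prefix(1)[OF assms(1) w])
  fix j assume "j < length (map (ray_action g \<xi>) [0..<n])"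
  then have j: "j < n" by simp
  have "g (map \<xi> [0..<Suc j]) = take (Suc j) (g (map \<xi> [0..<n]))"
    using j by (simp add: ns_group_prefix(2)[OF assms(1) w] take_map del: upt_Suc)
  then show "map (ray_action g \<xi>) [0..<n] ! j = g (map \<xi> [0..<n]) ! j"
    using j by (simp add: ray_action_def del: upt_Suc)
qed

lemma ray_action_rays:
  assumes "g \<in> carrier (ns_group l)" "\<xi> \<in> rays l"
  shows "ray_action g \<xi> \<in> rays l"
proof -
  have "map (ray_action g \<xi>) [0..<Suc n] \<in> words l 0" for n
    unfolding map_ray_action[OF assms]
    by (rule funcset_mem[OF Bij_imp_funcset[OF ns_group_Bij[OF assms(1)]]
          map_ray_words[OF assms(2)]])
  then have "map (ray_action g \<xi>) [0..<Suc n] ! n < l (n + 1)" for n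
    unfolding words_def by (auto simp del: upt_Suc)
  then show ?thesis by (simp add: rays_def del: upt_Suc)
qed

lemma ray_action_mult:
  assumes "g \<in> carrier (ns_group l)" "h \<in> carrier (ns_group l)" "\<xi> \<in> rays l"
  shows "ray_action (g \<otimes>\<^bsub>ns_group l\<^esub> h) \<xi> = ray_action g (ray_action h \<xi>)"
  unfolding ray_action_def[of "g \<otimes>\<^bsub>ns_group l\<^esub> h"] ray_action_def[of g]
  using assms by (simp add: map_ray_action ns_group_mult compose_def map_ray_words del: upt_Suc)

lemma ray_action_one: "\<xi> \<in> rays l \<Longrightarrow> ray_action \<one>\<^bsub>ns_group l\<^esub> \<xi> = \<xi>"
  by (auto simp: ray_action_def ns_group_one map_ray_words simp del: upt_Suc)

lemma group_ns_wreath: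
  assumes "\<And>i. i \<ge> 1 \<Longrightarrow> 0 < l i"
  shows "group (ns_wreath l)"
proof -
  interpret group "ns_group l" by (rule group_ns_group)
  have o: "(\<lambda>_. 0) \<in> rays l" using assms by (simp add: rays_def)
  have S: "ns_orbit l \<subseteq> rays l"
    using o ray_action_rays by (auto simp: ns_orbit_def orbit_def)
  show ?thesis
    unfolding ns_wreath_def
  proof (rule group_int_wreath[OF group_ns_group])
    fix g \<xi> assume g: "g \<in> carrier (ns_group l)" and "\<xi> \<in> ns_orbit l"
    then obtain h where h: "h \<in> carrier (ns_group l)" "\<xi> = ray_action h (\<lambda>_. 0)"
      by (auto simp: ns_orbit_def orbit_def)
    then have "ray_action g \<xi> = ray_action (g \<otimes>\<^bsub>ns_group l\<^esub> h) (\<lambda>_. 0)"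
      using g o by (simp add: ray_action_mult)
    then show "ray_action g \<xi> \<in> ns_orbit l"
      using g h by (auto simp: ns_orbit_def orbit_def)
  qed (use S ray_action_mult ray_action_one in blast)+
qed

end

theory Submission
  imports Defs
begin

text \<open>
  Throughout, \<open>y\<^sub>i\<close> is the letter \<open>l i div 2\<close>, \<open>V\<^sub>n\<close> is \<open>level_size l n\<close>, and the base point is the ray
  \<open>0\<^sup>\<infinity>\<close>.

  An element \<open>(\<phi>, g)\<close> of the wreath product is described by \<open>g\<close> together with the pulled back lamps
  \<open>z \<mapsto> \<phi>(g z)\<close>. In these coordinates left multiplication by an element of the base group changes
  only \<open>g\<close>, and the lamp generator adds 1 to the pulled back lamp at the site \<open>g\<^sup>-\<^sup>1 0\<^sup>\<infinity>\<close>.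

  For the lower bound on \<open>\<Lambda>\<^sub>1\<close>, fix the pulled back lamps: a function with small gradient becomes a
  weight on the base group which is almost invariant under \<open>\<alpha>\<close> and \<open>\<beta>\<close>. Such a weight spreads the
  inverted orbit: if the gradient is at most a small multiple of \<open>1/r\<close>, no set of fewer than about
  \<open>V\<^sub>n\<^sub>-\<^sub>1 r\<close> sites carries an eighth of the mass (\<open>base_point_spreads\<close>). If a single pulled back
  lamp varies instead, small gradient means that about \<open>r\<close> values of this lamp are needed to carry the
  mass. Removing the poor configurations and lamp lines one after the other leaves a nonempty set of
  configurations, each of which has \<open>N \<approx> V\<^sub>n\<^sub>-\<^sub>1 r\<close> lamps that can take \<open>L \<approx> r\<close> values within the set; such
  a set has at least \<open>L^N = exp (N log L)\<close> elements (\<open>lamp_support_bound\<close>).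

  Spreading rests on a comparison in total variation. Let \<open>\<tau> = g\<^sup>-\<^sup>1\<close>. The base point lies below the
  vertex \<open>0\<^sup>k\<close>, where \<open>\<beta>\<close> acts only through deeper levels; but below \<open>0\<^sup>k\<^sup>-\<^sup>1 y\<^sub>k\<close> a power of \<open>\<beta>\<close>
  rotates the next letter, so that there the image of the first letter can be averaged over \<open>r\<close>
  values at the cost of \<open>r\<close> steps. Hence the law of the restriction of \<open>\<tau>\<close> to the subtree below
  \<open>0\<^sup>k\<close> has to be compared with the law below \<open>0\<^sup>k\<^sup>-\<^sup>1 y\<^sub>k\<close> (\<open>tv_bound\<close>). Both subtrees are children
  of one vertex, and exchanging the children of \<open>0\<^sup>i\<^sup>-\<^sup>1 y\<^sub>i\<close> costs \<open>y\<^sub>i\<^sub>+\<^sub>1\<close> steps. Writing a statistic of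
  the two subtrees as a sum over the levels above, every level contributes the sup norm of an \<open>n\<close>-fold
  difference, up to \<open>2\<^sup>n\<close>, times the cost \<open>2\<^sup>-\<^sup>n\<close>; when \<open>l (i + 1) = 2 l i\<close> this sum diverges
  logarithmically. The remedy is to clip the differences so that they grow by a factor slightly below
  2. The differences form an approximate martingale when the levels are revealed one by one, so a
  fourth moment bound shows that large values, and with them the parts that are clipped off, are rare.

  For the upper bound on \<open>\<Lambda>\<^sub>2\<close>, permute the vertices of level \<open>n - 1\<close> arbitrarily and, below each of
  them, use parameters from \<open>{-R..R}\<close> with \<open>R\<close> comparable to \<open>r\<close>: the rotation of the next letter, a
  power of \<open>\<beta>\<close> or \<open>\<alpha>\<close> below each of the letters within distance \<open>R\<close> of the two active letters 0
  and \<open>y\<^sub>n\<close>, and the lamps at the rays that continue with zeros after a letter close to 0. A generator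
  changes at most three parameters by 1, so the product of tent functions of all parameters has energy
  of order \<open>1/R\<^sup>2\<close> relative to its mass (\<open>weight_correlation\<close>), and there are \<open>exp (O(V\<^sub>n\<^sub>-\<^sub>1 r log r))\<close> parameter values. These tree maps need not belong to the group;
  the product is a function on a set with a free action of the wreath product, and some orbit carries
  a function with energy as small as the average (\<open>orbit_test_function\<close>).

  Cheeger's inequality \<open>\<Lambda>\<^sub>1\<^sup>2 \<le> 2 \<Lambda>\<^sub>2\<close> and a change of \<open>r\<close> by a constant factor turn the
  two bounds into the comparison of the profiles.
\<close>

section \<open>Comparison of two columns by clipped differences\<close>

definition clip :: "real \<Rightarrow> real \<Rightarrow> real" where
  "clip T x = max (- T) (min T x)"

lemma clip_bound: "0 \<le> T \<Longrightarrow> \<bar>clip T x\<bar> \<le> T"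
  by (auto simp: clip_def)

lemma clip_minus: "0 \<le> T \<Longrightarrow> clip T (- x) = - clip T x"
  by (auto simp: clip_def max_def min_def)

lemma clip_id: "\<bar>x\<bar> \<le> T \<Longrightarrow> clip T x = x"
  by (auto simp: clip_def)

locale weighted =
  fixes D :: "'w set" and F :: "'w \<Rightarrow> real"
  assumes finD: "finite D" and Fnn: "\<And>x. x \<in> D \<Longrightarrow> 0 \<le> F x" and Fsum: "sum F D = 1"
begin

definition E :: "('w \<Rightarrow> real) \<Rightarrow> real" where "E \<phi> = (\<Sum>x\<in>D. F x * \<phi> x)"

lemma E_add: "E (\<lambda>x. f x + g x) = E f + E g" by (simp add: E_def ring_distribs sum.distrib)

lemma E_diff: "E (\<lambda>x. f x - g x) = E f - E g" by (simp add: E_def ring_distribs sum_subtractf)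

lemma E_minus: "E (\<lambda>x. - f x) = - E f" by (simp add: E_def sum_negf)

lemma E_cmult: "E (\<lambda>x. c * f x) = c * E f" by (simp add: E_def sum_distrib_left mult_ac)

lemma E_const: "E (\<lambda>x. c) = c" using Fsum by (simp add: E_def flip: sum_distrib_right)

lemma E_mono: "(\<And>x. x \<in> D \<Longrightarrow> f x \<le> g x) \<Longrightarrow> E f \<le> E g"
  by (auto simp: E_def intro!: sum_mono mult_left_mono Fnn)

lemma E_cong: "(\<And>x. x \<in> D \<Longrightarrow> f x = g x) \<Longrightarrow> E f = E g" by (simp add: E_def)

lemma E_nonneg: "(\<And>x. x \<in> D \<Longrightarrow> 0 \<le> f x) \<Longrightarrow> 0 \<le> E f"
  using E_mono[of "\<lambda>_. 0" f] by (simp add: E_const)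

lemma E_abs: "\<bar>E f\<bar> \<le> E (\<lambda>x. \<bar>f x\<bar>)"
proof -
  have "E f \<le> E (\<lambda>x. \<bar>f x\<bar>)" "E (\<lambda>x. - f x) \<le> E (\<lambda>x. \<bar>f x\<bar>)" by (auto intro!: E_mono)
  then show ?thesis by (simp add: E_minus)
qed

lemma E_sum: "E (\<lambda>x. \<Sum>i\<in>A. f i x) = (\<Sum>i\<in>A. E (f i))"
proof (induction A rule: infinite_finite_induct)
  case empty show ?case by (simp add: E_def)
qed (simp_all add: E_def E_add ring_distribs sum.distrib)

lemma E_Cauchy: "(E (\<lambda>x. f x * g x))\<^sup>2 \<le> E (\<lambda>x. (f x)\<^sup>2) * E (\<lambda>x. (g x)\<^sup>2)"
proof -
  have "(\<Sum>x\<in>D. (sqrt (F x) * f x) * (sqrt (F x) * g x))\<^sup>2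
      \<le> (\<Sum>x\<in>D. (sqrt (F x) * f x)\<^sup>2) * (\<Sum>x\<in>D. (sqrt (F x) * g x)\<^sup>2)"
    by (rule Cauchy_Schwarz_ineq_sum)
  moreover have "(\<Sum>x\<in>D. (sqrt (F x) * f x) * (sqrt (F x) * g x)) = E (\<lambda>x. f x * g x)"
    unfolding E_def by (rule sum.cong) (auto simp: Fnn mult_ac)
  moreover have "(\<Sum>x\<in>D. (sqrt (F x) * f x)\<^sup>2) = E (\<lambda>x. (f x)\<^sup>2)" for f
    unfolding E_def by (rule sum.cong) (auto simp: Fnn power_mult_distrib)
  ultimately show ?thesis by simp
qed
end

text \<open>
  The factor \<open>(50/49)\<^sup>3\<close> is so close to 1 that it still fits between the constant 0.9083 of
  \<open>walk_bound_9\<close> and 1.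
\<close>

lemma fourth_power_split:
  fixes a b :: real
  shows "(a + b) ^ 4 \<le> (50 / 49) ^ 3 * a ^ 4 + 50 ^ 3 * b ^ 4"
proof -
  have sq: "(x + y)\<^sup>2 \<le> (50/49) * x\<^sup>2 + 50 * y\<^sup>2" for x y :: real
  proof -
    have "0 \<le> (x / 7 - 7 * y)\<^sup>2" by simp
    then show ?thesis by (simp add: power2_eq_square field_simps)
  qed
  have "(a + b) ^ 4 = ((a + b)\<^sup>2)\<^sup>2" by (simp flip: power_mult)
  also have "\<dots> \<le> ((50/49) * a\<^sup>2 + 50 * b\<^sup>2)\<^sup>2" by (intro power_mono sq) auto
  also have "\<dots> \<le> (50/49) * ((50/49) * a\<^sup>2)\<^sup>2 + 50 * (50 * b\<^sup>2)\<^sup>2" by (rule sq)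
  also have "\<dots> = (50 / 49) ^ 3 * a ^ 4 + 50 ^ 3 * b ^ 4"
    by (simp add: power2_eq_square power4_eq_xxxx power3_eq_cube)
  finally show ?thesis .
qed

lemma fourth_power_sum2: "(a + b :: real) ^ 4 \<le> 8 * (a ^ 4 + b ^ 4)"
proof -
  have sq: "(x + y)\<^sup>2 \<le> 2 * (x\<^sup>2 + y\<^sup>2)" for x y :: real
    using sum_squares_bound[of x y] by (simp add: power2_eq_square algebra_simps)
  have "(a + b) ^ 4 = ((a + b)\<^sup>2)\<^sup>2" by (simp flip: power_mult)
  also have "\<dots> \<le> (2 * (a\<^sup>2 + b\<^sup>2))\<^sup>2" by (intro power_mono sq) auto
  also have "\<dots> = 4 * (a\<^sup>2 + b\<^sup>2)\<^sup>2" by (simp only: power_mult_distrib) simp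
  also have "\<dots> \<le> 4 * (2 * ((a\<^sup>2)\<^sup>2 + (b\<^sup>2)\<^sup>2))" by (intro mult_left_mono sq) auto
  also have "\<dots> = 8 * (a ^ 4 + b ^ 4)" by (simp add: power2_eq_square power4_eq_xxxx)
  finally show ?thesis .
qed

lemma fourth_power_sum:
  fixes f :: "'i \<Rightarrow> real"
  assumes "finite A"
  shows "(\<Sum>i\<in>A. f i) ^ 4 \<le> real (card A) ^ 3 * (\<Sum>i\<in>A. f i ^ 4)"
proof -
  have sq: "(\<Sum>i\<in>A. h i)\<^sup>2 \<le> real (card A) * (\<Sum>i\<in>A. (h i)\<^sup>2)" for h :: "'i \<Rightarrow> real"
    using Cauchy_Schwarz_ineq_sum[of h "\<lambda>_. 1" A] by (simp add: mult.commute)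
  have "(\<Sum>i\<in>A. f i) ^ 4 = ((\<Sum>i\<in>A. f i)\<^sup>2)\<^sup>2" by (simp flip: power_mult)
  also have "\<dots> \<le> (real (card A) * (\<Sum>i\<in>A. (f i)\<^sup>2))\<^sup>2" by (intro power_mono sq) auto
  also have "\<dots> = (real (card A))\<^sup>2 * (\<Sum>i\<in>A. (f i)\<^sup>2)\<^sup>2" by (simp add: power_mult_distrib)
  also have "\<dots> \<le> (real (card A))\<^sup>2 * (real (card A) * (\<Sum>i\<in>A. ((f i)\<^sup>2)\<^sup>2))"
    by (intro mult_left_mono sq) auto
  also have "\<dots> = real (card A) ^ 3 * (\<Sum>i\<in>A. f i ^ 4)"
    by (simp add: power2_eq_square power3_eq_cube power4_eq_xxxx mult_ac)
  finally show ?thesis .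
qed

text \<open>
  The growth rate \<open>2 - slack\<close> of the caps must be so close to 2 that a difference above its cap forces
  54 consecutive levels to be aligned, \<open>(2^54 - 1) slack \<le> 1/2\<close>, and this is so rare that it
  outweighs the factor \<open>1/slack\<close> lost in summing over the levels.
\<close>

definition slack :: real where "slack = 1 / 2 ^ 55"

definition cap :: "nat \<Rightarrow> nat \<Rightarrow> real" where
  "cap m n = (if n \<le> m then 2 ^ n else 2 ^ m * (2 - slack) ^ (n - m))"

lemma slack_pos: "0 < slack" and slack_less: "slack < 1 / 10 ^ 16"
  by (simp_all add: slack_def)

lemma cap_pos: "0 < cap m n" using slack_less by (simp add: cap_def)

lemma cap_0 [simp]: "cap m 0 = 1" by (simp add: cap_def)

lemma cap_Suc_lt: "n < m \<Longrightarrow> cap m (Suc n) = 2 * cap m n" by (simp add: cap_def)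

lemma cap_Suc_ge: "m \<le> n \<Longrightarrow> cap m (Suc n) = (2 - slack) * cap m n"
  by (auto simp: cap_def Suc_diff_le le_Suc_eq)

lemma cap_Suc_bounds: "(2 - slack) * cap m n \<le> cap m (Suc n)" "cap m (Suc n) \<le> 2 * cap m n"
  using cap_pos[of m n] slack_pos
  by (cases "n < m"; simp add: cap_Suc_lt cap_Suc_ge mult_right_mono)+

lemma cap_le: "cap m n \<le> 2 ^ n"
proof (induction n)
  case (Suc n) then show ?case using cap_Suc_bounds(2)[of m n] by simp
qed simp

lemma cap_half: "cap m n \<le> cap m (Suc n) * (51/100)"
proof -
  have "cap m n * (1 / (51/100)) \<le> cap m n * (2 - slack)" using cap_pos[of m n] slack_less
    by (intro mult_left_mono) auto
  then have "cap m n * (1 / (51/100)) \<le> cap m (Suc n)"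
    using cap_Suc_bounds(1)[of m n] by (simp only: mult.commute)
  then show ?thesis by simp
qed

lemma cap_mono: "n \<le> n' \<Longrightarrow> cap m n \<le> cap m n'"
proof (induction n' rule: dec_induct)
  case (step i) then show ?case using cap_half[of m i] cap_pos[of m "Suc i"] by linarith
qed simp

lemma cap_ge: "m \<le> n \<Longrightarrow> cap m n = 2 ^ n * (1 - slack / 2) ^ (n - m)"
proof (induction n rule: dec_induct)
  case base then show ?case by (simp add: cap_def)
next
  case (step i) then show ?case by (simp add: cap_Suc_ge Suc_diff_le algebra_simps)
qed

lemma geometric_bound: "0 \<le> q \<Longrightarrow> q < 1 \<Longrightarrow> (\<Sum>i<N. q ^ i) \<le> 1 / (1 - q :: real)"
  by (simp add: sum_gp_strict divide_right_mono)

lemma geometric_bound1: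
  assumes "0 \<le> q" "q < (1::real)"
  shows "(\<Sum>i<N. real i * q ^ i) \<le> 1 / (1 - q)\<^sup>2"
proof -
  have eq: "(1 - q) * (\<Sum>i<N. real i * q ^ i) = (\<Sum>i<N. q ^ i) - 1 - (real N - 1) * q ^ N" if "N > 0"
    using that
  proof (induction N rule: nat_induct_non_zero)
    case (Suc n)
    then show ?case by (simp add: algebra_simps)
  qed simp
  show ?thesis
  proof (cases "N = 0")
    case False
    have "0 \<le> (real N - 1) * q ^ N" using False assms by (intro mult_nonneg_nonneg) auto
    then have "(1 - q) * (\<Sum>i<N. real i * q ^ i) \<le> 1 / (1 - q)"
      using eq False geometric_bound[OF assms, of N] by simp
    then have "(\<Sum>i<N. real i * q ^ i) \<le> 1 / (1 - q) / (1 - q)"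
      using assms by (subst pos_le_divide_eq) (simp_all add: mult.commute)
    then show ?thesis by (simp add: power2_eq_square)
  qed (use assms in simp)
qed

text \<open>
  Up to level \<open>cut C\<close> the caps are the trivial bounds \<open>2^n\<close>; there the logarithmic loss is harmless.
  Past it, the typical size \<open>(14/5)^(n/2)\<close> of a difference is below the cap by a factor which is a
  power of \<open>C\<close>.
\<close>

definition cut :: "real \<Rightarrow> nat" where "cut C = 54 + nat \<lceil>35 * log 2 (1 / C)\<rceil>"

lemma cut_power:
  assumes "0 < C" "C \<le> 1"
  shows "(98 / 100) ^ cut C \<le> C"
proof -
  let ?m = "nat \<lceil>35 * log 2 (1 / C)\<rceil>"
  have log_inv: "0 \<le> log 2 (1 / C)" using assms by simp
  have "(98/100 :: real) ^ 35 \<le> 1 / 2" by (simp add: field_simps)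
  have "(98 / 100) ^ cut C \<le> (98/100 :: real) ^ ?m" by (simp add: cut_def power_decreasing)
  also have "\<dots> = (98/100) powr real ?m" by (simp add: powr_realpow)
  also have "\<dots> \<le> (98/100) powr (35 * log 2 (1/C))"
    using log_inv by (intro powr_mono') (auto simp: le_nat_iff)
  also have "\<dots> = ((98/100) ^ 35) powr log 2 (1/C)"
    by (simp only: powr_powr[symmetric]) (simp add: powr_numeral)
  also have "\<dots> \<le> (1/2) powr log 2 (1/C)"
    using \<open>_ \<le> 1 / 2\<close> log_inv by (intro powr_mono2) auto
  also have "\<dots> = C" using assms by (simp add: powr_divide log_divide powr_minus)
  finally show ?thesis .
qed

text \<open>
  The differences seen from one statistic: \<open>u n\<close> and \<open>v n\<close> are clipped \<open>n\<close>-fold differences below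
  \<open>0\<^sup>k\<^sup>-\<^sup>n\<close> and below \<open>0\<^sup>k\<^sup>-\<^sup>n\<^sup>-\<^sup>1 y\<close>. Assumption \<open>tv\<close> is the statement to be proved, at the smaller
  levels \<open>k - n\<close>; it allows to replace \<open>v n\<close> by \<open>u n\<close> in moment estimates.
\<close>

locale clip_chain = weighted D F for D :: "'w set" and F +
  fixes u v :: "nat \<Rightarrow> 'w \<Rightarrow> real" and flip :: "nat \<Rightarrow> 'w \<Rightarrow> 'w" and k :: nat and C :: real
  assumes C_pos: "0 < C" and C_le: "C \<le> 1" and k_pos: "1 \<le> k"
    and u_le: "\<And>n x. n \<le> k \<Longrightarrow> \<bar>u n x\<bar> \<le> cap (cut C) n"
    and v_le: "\<And>n x. n \<le> k \<Longrightarrow> \<bar>v n x\<bar> \<le> cap (cut C) n"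
    and u_Suc: "\<And>n x. n < k \<Longrightarrow> u (Suc n) x = clip (cap (cut C) (Suc n)) (u n x - v n x)"
    and v_flip: "\<And>n x. 1 \<le> n \<Longrightarrow> n \<le> k \<Longrightarrow> v n (flip n x) = - v n x"
    and v_flip_other: "\<And>n m x. 1 \<le> n \<Longrightarrow> n < m \<Longrightarrow> m < k \<Longrightarrow> v m (flip n x) = v m x"
    and flip_cost: "\<And>n \<phi> M. 1 \<le> n \<Longrightarrow> n \<le> k \<Longrightarrow> (\<And>x. \<bar>\<phi> x\<bar> \<le> M) \<Longrightarrow>
        \<bar>E \<phi> - E (\<lambda>x. \<phi> (flip n x))\<bar> \<le> M * (2 * C / 2 ^ n)"
    and tv: "\<And>n h. 1 \<le> n \<Longrightarrow> n < k \<Longrightarrow> (\<And>y :: real. \<bar>h y\<bar> \<le> 1) \<Longrightarrow>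
        \<bar>E (\<lambda>x. h (u n x)) - E (\<lambda>x. h (v n x))\<bar> \<le> 64 * C / 2 ^ n * (2 ^ 58 + log 2 (1 / C) + n)"
    and uv_last: "\<And>x. u k x = v k x"
begin

abbreviation "T \<equiv> cap (cut C)"

definition log_inv where "log_inv = log 2 (1 / C)"

definition \<theta> where "\<theta> n = 64 * C / 2 ^ n * (2 ^ 58 + log_inv + real n)"

text \<open>
  The scale of the fourth moment of \<open>u n\<close>. The rate \<open>784/100 = (14/5)\<^sup>2\<close> is below 8, so that its
  quotient by \<open>T n ^ 3\<close> decays, and large enough for \<open>walk_bound\<close> to stay below 1; the second term
  accounts for the replacement of \<open>v\<close> by \<open>u\<close>.
\<close>

definition moment_scale where "moment_scale n = (784 / 100) ^ n + T n ^ 4 * \<theta> n"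

definition excess where "excess n x = (u n x - v n x) - u (Suc n) x"

lemma log_inv_nonneg: "0 \<le> log_inv" using C_pos C_le by (simp add: log_inv_def)

lemma T_pos: "0 < T n" by (rule cap_pos)

lemma theta_pos: "0 < \<theta> n"
  using C_pos log_inv_nonneg by (simp add: \<theta>_def add_pos_nonneg)

lemma moment_scale_pos: "0 < moment_scale n"
  unfolding moment_scale_def by (intro add_pos_pos mult_pos_pos zero_less_power theta_pos T_pos) auto

text \<open>
  A function that changes sign under the flip has mean 0 up to half of the cost of the flip.
\<close>

lemma odd_expectation:
  assumes "1 \<le> n" "n \<le> k" "\<And>x. \<bar>\<phi> x\<bar> \<le> M" "\<And>x. \<phi> (flip n x) = - \<phi> x"
  shows "\<bar>E \<phi>\<bar> \<le> M * C / 2 ^ n"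
proof -
  have "\<bar>E \<phi> - E (\<lambda>x. - \<phi> x)\<bar> \<le> M * (2 * C / 2 ^ n)"
    using flip_cost[of n \<phi> M] assms by simp
  then have "2 * \<bar>E \<phi>\<bar> \<le> 2 * (M * C / 2 ^ n)" by (simp add: E_minus abs_if mult_ac split: if_splits)
  then show ?thesis by simp
qed

lemma excess_bound:
  assumes "n < k"
  shows "\<bar>excess n x\<bar> \<le> slack * T n"
    and "\<bar>u n x - v n x\<bar> \<le> T (Suc n) \<Longrightarrow> excess n x = 0"
    and "n < cut C \<Longrightarrow> excess n x = 0"
proof -
  have le: "\<bar>u n x - v n x\<bar> \<le> 2 * T n" using u_le[of n x] v_le[of n x] assms by linarith
  show z: "excess n x = 0" if "\<bar>u n x - v n x\<bar> \<le> T (Suc n)"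
    using that by (simp add: excess_def u_Suc[OF assms] clip_id)
  show "excess n x = 0" if "n < cut C"
    using z le cap_Suc_lt[OF that] by simp
  show "\<bar>excess n x\<bar> \<le> slack * T n"
  proof (cases "\<bar>u n x - v n x\<bar> \<le> T (Suc n)")
    case True then show ?thesis using z slack_pos T_pos[of n] by simp
  next
    case False
    then have "\<bar>excess n x\<bar> = \<bar>u n x - v n x\<bar> - T (Suc n)"
      using T_pos[of "Suc n"] by (auto simp: excess_def u_Suc[OF assms] clip_def)
    then show ?thesis using le cap_Suc_bounds(1)[of "cut C" n] by (simp add: algebra_simps)
  qed
qed

lemma excess_le_diff:
  assumes "n < k" shows "\<bar>excess n x\<bar> \<le> slack * \<bar>u n x - v n x\<bar>"
proof (cases "\<bar>u n x - v n x\<bar> \<le> T (Suc n)")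
  case True then show ?thesis using excess_bound(2)[OF assms True] slack_pos by simp
next
  case False
  then have "T n \<le> \<bar>u n x - v n x\<bar>" using cap_mono[of n "Suc n" "cut C"] by simp
  then show ?thesis using excess_bound(1)[OF assms, of x] slack_pos
    by (meson order_trans mult_left_mono less_imp_le)
qed

text \<open>
  By definition \<open>u n = v n + u (n + 1) + excess n\<close>, and at the root \<open>u k = v k\<close>.
\<close>

lemma telescope:
  "\<bar>E (u 0) - E (v 0)\<bar> \<le> (\<Sum>n=1..k. \<bar>E (v n)\<bar>) + (\<Sum>n=cut C..<k. E (\<lambda>x. \<bar>excess n x\<bar>))"
proof -
  have "E (u 1) = (\<Sum>n=1..<k'. E (v n) + E (excess n)) + E (u k')" if "1 \<le> k'" "k' \<le> k" for k'
    using that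
  proof (induction k' rule: dec_induct)
    case (step n)
    have "E (u n) = E (\<lambda>x. v n x + excess n x + u (Suc n) x)" by (rule E_cong) (simp add: excess_def)
    then show ?case using step by (simp add: E_add)
  qed simp
  from this[of k] have "E (u 1) = (\<Sum>n=1..<k. E (v n)) + (\<Sum>n=1..<k. E (excess n)) + E (v k)"
    using k_pos E_cong[of "u k" "v k"] by (simp add: uv_last sum.distrib)
  moreover have "(\<Sum>n=1..<k. E (v n)) + E (v k) = (\<Sum>n=1..k. E (v n))"
    using k_pos by (simp add: sum.last_plus add.commute flip: atLeastLessThanSuc_atLeastAtMost)
  ultimately have "E (u 1) = (\<Sum>n=1..k. E (v n)) + (\<Sum>n=1..<k. E (excess n))" by simp
  moreover have "(\<Sum>n=1..<k. E (excess n)) = (\<Sum>n=cut C..<k. E (excess n))"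
  proof (rule sum.mono_neutral_right)
    show "\<forall>n\<in>{1..<k} - {cut C..<k}. E (excess n) = 0"
    proof
      fix n assume "n \<in> {1..<k} - {cut C..<k}"
      then have "E (excess n) = E (\<lambda>x. 0)" by (intro E_cong excess_bound(3)) auto
      then show "E (excess n) = 0" by (simp add: E_const)
    qed
  qed (auto simp: cut_def)
  moreover have "E (u 0) - E (v 0) = E (u 1)"
  proof -
    have "E (u 1) = E (\<lambda>x. u 0 x - v 0 x)"
    proof (rule E_cong)
      fix x
      have "excess 0 x = 0" by (rule excess_bound(3)) (use k_pos in \<open>auto simp: cut_def\<close>)
      then show "u 1 x = u 0 x - v 0 x" by (simp add: excess_def)
    qed
    then show ?thesis by (simp add: E_diff)
  qed
  moreover have "\<bar>\<Sum>n=1..k. E (v n)\<bar> \<le> (\<Sum>n=1..k. \<bar>E (v n)\<bar>)" by (rule sum_abs)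
  moreover have "\<bar>\<Sum>n=cut C..<k. E (excess n)\<bar> \<le> (\<Sum>n=cut C..<k. E (\<lambda>x. \<bar>excess n x\<bar>))"
    by (rule order_trans[OF sum_abs]) (intro sum_mono E_abs)
  ultimately show ?thesis by linarith
qed

lemma moment_scale_step: "(784 / 100) * moment_scale n \<le> moment_scale (Suc n)"
proof -
  have "(784/100) * (T n ^ 4 * \<theta> n) \<le> ((2 - slack) ^ 4 / 2) * (T n ^ 4 * \<theta> n)"
  proof (rule mult_right_mono)
    have "(1999/1000) ^ 4 \<le> (2 - slack) ^ 4" using slack_less by (intro power_mono) auto
    moreover have "(1568/100 :: real) \<le> (1999/1000) ^ 4" by (simp add: field_simps)
    ultimately show "784/100 \<le> (2 - slack) ^ 4 / 2" by linarith
  qed (use T_pos theta_pos in \<open>simp add: less_imp_le\<close>)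
  also have "\<dots> = ((2 - slack) * T n) ^ 4 * (\<theta> n / 2)" by (simp add: power_mult_distrib)
  also have "\<dots> \<le> T (Suc n) ^ 4 * \<theta> (Suc n)"
  proof (rule mult_mono)
    show "((2 - slack) * T n) ^ 4 \<le> T (Suc n) ^ 4"
      using slack_less T_pos[of n] cap_Suc_bounds(1)[of "cut C" n] by (intro power_mono) auto
    have "64 * C / 2 ^ n * (2 ^ 58 + log_inv + real n) \<le> 64 * C / 2 ^ n * (2 ^ 58 + log_inv + real (Suc n))"
      using C_pos by (intro mult_left_mono) auto
    then show "\<theta> n / 2 \<le> \<theta> (Suc n)" by (simp add: \<theta>_def)
  qed (use T_pos theta_pos in \<open>auto intro: less_imp_le\<close>)
  finally show ?thesis by (simp add: moment_scale_def ring_distribs)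
qed

lemma moment_scale_back: "moment_scale m \<le> moment_scale (m + j) * (25 / 196) ^ j"
proof (induction j)
  case (Suc j)
  have "moment_scale (m + j) * (25/196) ^ j \<le> (moment_scale (m + Suc j) * (25/196)) * (25/196) ^ j"
    using moment_scale_step[of "m + j"] by (intro mult_right_mono) auto
  also have "\<dots> = moment_scale (m + Suc j) * (25 / 196) ^ Suc j" by simp
  finally show ?case using Suc by linarith
qed simp

lemma abs_power4: "\<bar>y\<bar> \<le> M \<Longrightarrow> y ^ 4 \<le> (M :: real) ^ 4"
  using power_mono[of "\<bar>y\<bar>" M 4] by simp

text \<open>
  The bounded statistic is the fourth power of the clipped value divided by \<open>T m ^ 4\<close>.
\<close>

lemma v_fourth_le:
  assumes "1 \<le> m" "m < k" "E (\<lambda>x. u m x ^ 4) \<le> 2 ^ 40 * moment_scale m"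
  shows "E (\<lambda>x. v m x ^ 4) \<le> (2 ^ 40 + 1) * moment_scale m"
proof -
  define h where "h y = (clip (T m) y / T m) ^ 4" for y
  have h1: "\<bar>h y\<bar> \<le> 1" for y
    using abs_power4[of "clip (T m) y / T m" 1] clip_bound[of "T m" y] T_pos[of m] by (simp add: h_def)
  have hu: "u m x ^ 4 = T m ^ 4 * h (u m x)" and hv: "v m x ^ 4 = T m ^ 4 * h (v m x)" for x
    using u_le[of m x] v_le[of m x] assms T_pos[of m] by (simp_all add: h_def clip_id power_divide)
  have "E (\<lambda>x. h (v m x)) \<le> E (\<lambda>x. h (u m x)) + \<theta> m"
    using tv[of m h] assms h1 by (simp add: \<theta>_def log_inv_def)
  then have "T m ^ 4 * E (\<lambda>x. h (v m x)) \<le> T m ^ 4 * (E (\<lambda>x. h (u m x)) + \<theta> m)"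
    using T_pos[of m] by (intro mult_left_mono) auto
  then have "E (\<lambda>x. v m x ^ 4) \<le> E (\<lambda>x. u m x ^ 4) + T m ^ 4 * \<theta> m"
    by (simp add: hu hv E_cmult ring_distribs)
  also have "T m ^ 4 * \<theta> m \<le> moment_scale m" by (simp add: moment_scale_def)
  finally show ?thesis using assms(3) by (simp add: ring_distribs)
qed

lemma partial_sum_bound: 
  assumes "n \<le> k" "t < n" shows "\<bar>\<Sum>j=1..t. v (n - j) x\<bar> \<le> 2 * T n"
proof -
  have "(\<Sum>j=1..t. T (n - j)) \<le> 2 * (T n - T (n - t))" using assms(2)
  proof (induction t)
    case (Suc t)
    have "T (n - Suc t) * 3 \<le> 2 * T (n - t)"
      using cap_half[of "cut C" "n - Suc t"] Suc.prems T_pos[of "n - t"] by (simp add: Suc_diff_Suc)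
    then show ?case using Suc T_pos[of "n - Suc t"] by simp
  qed simp
  moreover have "\<bar>\<Sum>j=1..t. v (n - j) x\<bar> \<le> (\<Sum>j=1..t. T (n - j))"
    using assms by (intro order_trans[OF sum_abs] sum_mono v_le) auto
  moreover have "2 * (T n - T (n - t)) \<le> 2 * T n" using T_pos[of "n-t"] by simp
  ultimately show ?thesis by (meson order_trans)
qed

lemma odd_err:
  assumes "n \<le> k" "10 < n" "1 \<le> t" "t < 10"
  shows "40 * T n ^ 4 * C / 2 ^ (n - Suc t) \<le> moment_scale n / 10 ^ 12"
proof -
  have "40 * T n ^ 4 * C / 2 ^ (n - Suc t) \<le> 40 * T n ^ 4 * C * 2 ^ 10 / 2 ^ n"
  proof -
    have "(2::real) ^ n \<le> 2 ^ 10 * 2 ^ (n - Suc t)"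
      unfolding power_add[symmetric] using assms by (intro power_increasing) auto
    then have "1 / 2 ^ (n - Suc t) \<le> (2 ^ 10 / 2 ^ n :: real)" by (simp add: field_simps)
    then have "40 * T n ^ 4 * C * (1 / 2 ^ (n - Suc t)) \<le> 40 * T n ^ 4 * C * (2 ^ 10 / 2 ^ n)"
      using C_pos by (intro mult_left_mono) auto
    then show ?thesis by simp
  qed
  also have "\<dots> = T n ^ 4 * (64 * C / 2 ^ n * 640)" by simp
  also have "\<dots> \<le> T n ^ 4 * (64 * C / 2 ^ n * ((2 ^ 58 + log_inv + real n) / 10 ^ 12))"
    using C_pos log_inv_nonneg by (intro mult_left_mono) auto
  also have "\<dots> = T n ^ 4 * \<theta> n / 10 ^ 12" by (simp add: \<theta>_def)
  also have "\<dots> \<le> moment_scale n / 10 ^ 12" by (simp add: moment_scale_def)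
  finally show ?thesis .
qed

lemma v_back:
  assumes v4: "\<And>m. 1 \<le> m \<Longrightarrow> m < n \<Longrightarrow> E (\<lambda>x. v m x ^ 4) \<le> (2 ^ 40 + 1) * moment_scale m"
    and "1 \<le> j" "j < n"
  shows "E (\<lambda>x. v (n - j) x ^ 4) \<le> (2 ^ 40 + 1) * moment_scale n * ((5/14) ^ j)\<^sup>2"
proof -
  have "E (\<lambda>x. v (n - j) x ^ 4) \<le> (2 ^ 40 + 1) * moment_scale (n - j)" using assms by (intro v4) auto
  also have "\<dots> \<le> (2 ^ 40 + 1) * (moment_scale (n - j + j) * (25/196) ^ j)"
    using moment_scale_back[of "n - j" j] by (intro mult_left_mono) auto
  also have "\<dots> = (2 ^ 40 + 1) * moment_scale n * ((5/14) ^ j)\<^sup>2"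
  proof -
    have "(25/196 :: real) ^ j = ((5/14)\<^sup>2) ^ j" by (simp add: power2_eq_square)
    also have "\<dots> = ((5/14) ^ j)\<^sup>2" by (simp only: power_mult[symmetric] mult.commute)
    finally show ?thesis using assms by simp
  qed
  finally show ?thesis .
qed

text \<open>
  The square root of the fourth moment of ten steps, in units of the bound for \<open>u n\<close>.
  A step that lies \<open>j\<close> levels deeper has fourth moment \<open>(5/14)^(2 j)\<close>, and the mixed term
  \<open>6 E a\<^sup>2 b\<^sup>2\<close> contributes through the factor 3. The term \<open>1/10^6\<close> absorbs the costs of the flips.
\<close>

fun walk_bound :: "nat \<Rightarrow> real" where
  "walk_bound 0 = 5 / 14"
| "walk_bound (Suc t) = walk_bound t + 3 * (5 / 14) ^ (t + 2) + 1 / 10 ^ 6"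

lemma walk_bound_pos: "0 < walk_bound t" by (induction t) (simp_all add: add_pos_pos del: power_Suc)

text \<open>
  The flip of the deepest level changes the sign of the last summand and fixes the others. So the odd
  terms in the expansion of the fourth power have small mean, as for a martingale.
\<close>

lemma martingale_fourth:
  assumes n: "n \<le> k" "10 < n"
    and v4: "\<And>m. 1 \<le> m \<Longrightarrow> m < n \<Longrightarrow> E (\<lambda>x. v m x ^ 4) \<le> (2 ^ 40 + 1) * moment_scale m"
  shows "t < 10 \<Longrightarrow> E (\<lambda>x. (\<Sum>j=1..Suc t. v (n - j) x) ^ 4) \<le> (2 ^ 40 + 1) * moment_scale n * (walk_bound t)\<^sup>2"
proof (induction t)
  case 0
  then show ?case using v_back[of n 1] v4 n by simp
next
  case (Suc t)
  define X where "X = (2 ^ 40 + 1) * moment_scale n"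
  have X: "0 \<le> X" "moment_scale n \<le> X" using moment_scale_pos[of n] by (auto simp: X_def)
  define N where "N x = (\<Sum>j=1..Suc t. v (n - j) x)" for x
  let ?m = "n - Suc (Suc t)" and ?q = "(5/14 :: real) ^ (t + 2)"
  have m: "1 \<le> ?m" "?m < k" "?m < n" using Suc.prems n by auto
  have N4: "E (\<lambda>x. N x ^ 4) \<le> X * (walk_bound t)\<^sup>2" using Suc by (simp add: N_def X_def)
  have w4: "E (\<lambda>x. v ?m x ^ 4) \<le> X * ?q\<^sup>2" using v_back[OF v4, of n "Suc (Suc t)"] Suc.prems n by (simp add: X_def)
  have odd: "\<bar>E (\<lambda>x. 4 * N x ^ 3 * v ?m x + 4 * N x * v ?m x ^ 3)\<bar> \<le> 40 * T n ^ 4 * C / 2 ^ ?m"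
  proof (rule odd_expectation)
    show "1 \<le> ?m" "?m \<le> k" using m by auto
    fix x
    have a: "\<bar>N x\<bar> \<le> 2 * T n" unfolding N_def using n Suc.prems by (intro partial_sum_bound) auto
    have b: "\<bar>v ?m x\<bar> \<le> T n" using v_le[of ?m x] cap_mono[of ?m n "cut C"] m by simp
    have "\<bar>4 * N x ^ 3 * v ?m x + 4 * N x * v ?m x ^ 3\<bar> \<le> 4 * (\<bar>N x\<bar> ^ 3 * \<bar>v ?m x\<bar>) + 4 * (\<bar>N x\<bar> * \<bar>v ?m x\<bar> ^ 3)"
      by (rule order_trans[OF abs_triangle_ineq]) (simp add: abs_mult power_abs)
    also have "\<dots> \<le> 4 * ((2 * T n) ^ 3 * T n) + 4 * (2 * T n * T n ^ 3)"
      using a b T_pos[of n] by (intro add_mono mult_left_mono mult_mono power_mono) auto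
    also have "\<dots> = 40 * T n ^ 4" by (simp add: power3_eq_cube power4_eq_xxxx)
    finally show "\<bar>4 * N x ^ 3 * v ?m x + 4 * N x * v ?m x ^ 3\<bar> \<le> 40 * T n ^ 4" .
    have "N (flip ?m x) = N x"
      unfolding N_def using Suc.prems m n by (intro sum.cong refl v_flip_other) auto
    then show "4 * N (flip ?m x) ^ 3 * v ?m (flip ?m x) + 4 * N (flip ?m x) * v ?m (flip ?m x) ^ 3
       = - (4 * N x ^ 3 * v ?m x + 4 * N x * v ?m x ^ 3)"
      using v_flip[of ?m x] m by simp
  qed
  have even: "E (\<lambda>x. (N x)\<^sup>2 * (v ?m x)\<^sup>2) \<le> X * walk_bound t * ?q"
  proof (rule power2_le_imp_le)
    have "(E (\<lambda>x. (N x)\<^sup>2 * (v ?m x)\<^sup>2))\<^sup>2 \<le> E (\<lambda>x. ((N x)\<^sup>2)\<^sup>2) * E (\<lambda>x. ((v ?m x)\<^sup>2)\<^sup>2)" by (rule E_Cauchy)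
    also have "\<dots> = E (\<lambda>x. N x ^ 4) * E (\<lambda>x. v ?m x ^ 4)" by (simp flip: power_mult)
    also have "\<dots> \<le> (X * (walk_bound t)\<^sup>2) * (X * ?q\<^sup>2)"
      using X by (intro mult_mono N4 w4) (auto intro!: E_nonneg)
    also have "\<dots> = (X * walk_bound t * ?q)\<^sup>2" by (simp add: power2_eq_square mult_ac)
    finally show "(E (\<lambda>x. (N x)\<^sup>2 * (v ?m x)\<^sup>2))\<^sup>2 \<le> (X * walk_bound t * ?q)\<^sup>2" .
    show "0 \<le> X * walk_bound t * ?q" using X walk_bound_pos[of t] by simp
  qed
  have "E (\<lambda>x. (\<Sum>j=1..Suc (Suc t). v (n - j) x) ^ 4)
      = E (\<lambda>x. N x ^ 4 + 6 * ((N x)\<^sup>2 * (v ?m x)\<^sup>2) + v ?m x ^ 4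
              + (4 * N x ^ 3 * v ?m x + 4 * N x * v ?m x ^ 3))"
  proof (rule E_cong)
    fix x
    have "(\<Sum>j=1..Suc (Suc t). v (n - j) x) = N x + v ?m x" by (simp add: N_def)
    then show "(\<Sum>j=1..Suc (Suc t). v (n - j) x) ^ 4 = N x ^ 4 + 6 * ((N x)\<^sup>2 * (v ?m x)\<^sup>2) + v ?m x ^ 4
              + (4 * N x ^ 3 * v ?m x + 4 * N x * v ?m x ^ 3)"
      by (simp add: power4_eq_xxxx power3_eq_cube power2_eq_square algebra_simps)
  qed
  also have "\<dots> = E (\<lambda>x. N x ^ 4) + 6 * E (\<lambda>x. (N x)\<^sup>2 * (v ?m x)\<^sup>2) + E (\<lambda>x. v ?m x ^ 4)
       + E (\<lambda>x. 4 * N x ^ 3 * v ?m x + 4 * N x * v ?m x ^ 3)"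
    by (simp only: E_add E_cmult)
  also have "\<dots> \<le> X * (walk_bound t)\<^sup>2 + 6 * (X * walk_bound t * ?q) + X * ?q\<^sup>2 + X * (1 / 10 ^ 6)\<^sup>2"
  proof -
    have "E (\<lambda>x. 4 * N x ^ 3 * v ?m x + 4 * N x * v ?m x ^ 3) \<le> X * (1 / 10 ^ 6)\<^sup>2"
    proof -
      have "E (\<lambda>x. 4 * N x ^ 3 * v ?m x + 4 * N x * v ?m x ^ 3) \<le> 40 * T n ^ 4 * C / 2 ^ ?m"
        using odd by linarith
      also have "\<dots> \<le> moment_scale n / 10 ^ 12" using odd_err[OF n, of "Suc t"] Suc.prems by simp
      also have "\<dots> \<le> X / 10 ^ 12" using X by simp
      finally show ?thesis by (simp add: power2_eq_square)
    qed
    then show ?thesis using N4 even w4 by linarith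
  qed
  also have "\<dots> \<le> X * (walk_bound (Suc t))\<^sup>2"
  proof -
    have "(walk_bound t)\<^sup>2 + 6 * (walk_bound t * ?q) + ?q\<^sup>2 + (1 / 10 ^ 6)\<^sup>2
       \<le> (walk_bound t + 3 * ?q + 1 / 10 ^ 6)\<^sup>2"
    proof -
      have "(walk_bound t + 3 * ?q + 1 / 10 ^ 6)\<^sup>2 = (walk_bound t)\<^sup>2 + 6 * (walk_bound t * ?q) + 9 * ?q\<^sup>2 + (1 / 10 ^ 6)\<^sup>2
         + 2 * (1 / 10 ^ 6) * (walk_bound t + 3 * ?q)" by (simp only: power2_eq_square) (simp add: algebra_simps)
      moreover have "0 \<le> 2 * (1 / 10 ^ 6) * (walk_bound t + 3 * ?q)" using walk_bound_pos[of t] by simp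
      moreover have "0 \<le> ?q\<^sup>2" by simp
      ultimately show ?thesis by linarith
    qed
    then have "X * ((walk_bound t)\<^sup>2 + 6 * (walk_bound t * ?q) + ?q\<^sup>2 + (1 / 10 ^ 6)\<^sup>2) \<le> X * (walk_bound (Suc t))\<^sup>2"
      using X by (intro mult_left_mono) auto
    then show ?thesis by (simp only: ring_distribs mult_ac)
  qed
  finally show ?case by (simp add: X_def)
qed

lemma walk_bound_9: "(walk_bound 9)\<^sup>2 \<le> 9083 / 10000"
proof -
  have "walk_bound 9 \<le> 953 / 1000" by (simp add: eval_nat_numeral)
  then have "(walk_bound 9)\<^sup>2 \<le> (953/1000)\<^sup>2" using walk_bound_pos[of 9] by (intro power_mono) auto
  then show ?thesis by (simp add: power2_eq_square)
qed

text \<open>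
  Ten steps back, \<open>u (n - 10)\<close> is negligible and \<open>u n\<close> is the sum of the last ten steps. Their fourth
  moment is at most 0.97 times the claimed bound, which leaves room for the passage from \<open>u\<close> to \<open>v\<close>.
\<close>

lemma fourth_moment: "n \<le> k \<Longrightarrow> E (\<lambda>x. u n x ^ 4) \<le> 2 ^ 40 * moment_scale n"
proof (induction n rule: less_induct)
  case (less n)
  show ?case
  proof (cases "n \<le> 10")
    case True
    have "u n x ^ 4 \<le> 2 ^ 40" for x
    proof -
      have "u n x ^ 4 \<le> T n ^ 4" using u_le less.prems by (intro abs_power4) auto
      also have "\<dots> \<le> (2 ^ n) ^ 4" using cap_le T_pos[of n] by (intro power_mono) auto
      also have "\<dots> \<le> (2 ^ 10) ^ 4" using True by (intro power_mono power_increasing) auto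
      finally show ?thesis by simp
    qed
    then have "E (\<lambda>x. u n x ^ 4) \<le> 2 ^ 40" using E_mono[of "\<lambda>x. u n x ^ 4" "\<lambda>x. 2 ^ 40"] by (simp add: E_const)
    also have "\<dots> \<le> 2 ^ 40 * moment_scale n"
    proof -
      have "1 \<le> (784/100 :: real) ^ n" by simp
      moreover have "0 \<le> T n ^ 4 * \<theta> n" using theta_pos[of n] by simp
      ultimately have "1 \<le> moment_scale n" unfolding moment_scale_def by linarith
      then show ?thesis by simp
    qed
    finally show ?thesis .
  next
    case False
    define X where "X = (2 ^ 40 + 1) * moment_scale n"
    have X: "0 \<le> X" using moment_scale_pos[of n] by (auto simp: X_def)
    have u4: "E (\<lambda>x. u m x ^ 4) \<le> 2 ^ 40 * moment_scale m" if "m < n" for m using less that by auto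
    have v4: "E (\<lambda>x. v m x ^ 4) \<le> (2 ^ 40 + 1) * moment_scale m" if "1 \<le> m" "m < n" for m
      using that less.prems u4 by (intro v_fourth_le) auto
    have GX: "(2 ^ 40 + 1) * moment_scale m \<le> X" if "m \<le> n" for m
    proof -
      have "moment_scale m \<le> moment_scale n * (25/196) ^ (n - m)" using moment_scale_back[of m "n - m"] that by simp
      also have "\<dots> \<le> moment_scale n * 1" using moment_scale_pos[of n] by (intro mult_left_mono power_le_one) auto
      finally show ?thesis by (simp add: X_def)
    qed
    have k4: "E (\<lambda>x. excess m x ^ 4) \<le> slack ^ 4 * (16 * X)" if "1 \<le> m" "m < n" for m
    proof -
      have "excess m x ^ 4 \<le> slack ^ 4 * (8 * (u m x ^ 4 + v m x ^ 4))" for x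
      proof -
        have "excess m x ^ 4 \<le> (slack * \<bar>u m x - v m x\<bar>) ^ 4"
          using excess_le_diff[of m x] that less.prems by (intro abs_power4) auto
        also have "\<dots> = slack ^ 4 * (u m x + - v m x) ^ 4" by (simp add: power_mult_distrib)
        also have "\<dots> \<le> slack ^ 4 * (8 * (u m x ^ 4 + (- v m x) ^ 4))"
          by (intro mult_left_mono fourth_power_sum2) auto
        finally show ?thesis by simp
      qed
      then have "E (\<lambda>x. excess m x ^ 4) \<le> slack ^ 4 * (8 * (E (\<lambda>x. u m x ^ 4) + E (\<lambda>x. v m x ^ 4)))"
        using E_mono[of "\<lambda>x. excess m x ^ 4" "\<lambda>x. slack ^ 4 * (8 * (u m x ^ 4 + v m x ^ 4))"]
        by (simp add: E_cmult E_add)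
      also have "\<dots> \<le> slack ^ 4 * (8 * (X + X))"
        using u4[of m] v4[of m] GX[of m] that moment_scale_pos[of m] by (intro mult_left_mono add_mono) auto
      finally show ?thesis by simp
    qed
    have u10: "E (\<lambda>x. u (n - 10) x ^ 4) \<le> X * (25/196) ^ 10"
    proof -
      have "E (\<lambda>x. u (n - 10) x ^ 4) \<le> (2 ^ 40 + 1) * moment_scale (n - 10)"
        using u4[of "n - 10"] False moment_scale_pos[of "n - 10"] by simp
      also have "\<dots> \<le> (2 ^ 40 + 1) * (moment_scale n * (25/196) ^ 10)"
        using moment_scale_back[of "n - 10" 10] False by (intro mult_left_mono) auto
      finally show ?thesis by (simp only: X_def mult.assoc)
    qed
    define N where "N x = (\<Sum>j=1..10. v (n - j) x)" for x
    \<comment> \<open>everything except the last ten steps\<close>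
    define R where "R x = u (n - 10) x - (\<Sum>j=1..10. excess (n - j) x)" for x
    have uNR: "u n x = - N x + R x" for x
    proof -
      have "u n x = u (n - t) x - (\<Sum>j=1..t. v (n - j) x) - (\<Sum>j=1..t. excess (n - j) x)" if "t \<le> 10" for t
        using that
      proof (induction t)
        case (Suc t)
        then show ?case using False by (simp add: excess_def Suc_diff_Suc)
      qed simp
      from this[of 10] show ?thesis by (simp add: N_def R_def)
    qed
    have N4: "E (\<lambda>x. N x ^ 4) \<le> X * (9083 / 10000)"
    proof -
      have "E (\<lambda>x. (\<Sum>j=1..Suc 9. v (n - j) x) ^ 4) \<le> X * (walk_bound 9)\<^sup>2"
        unfolding X_def using False less.prems v4 by (intro martingale_fourth) auto
      also have "\<dots> \<le> X * (9083/10000)" using X walk_bound_9 by (intro mult_left_mono)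
      finally show ?thesis by (simp add: N_def)
    qed
    have R4: "E (\<lambda>x. R x ^ 4) \<le> X * (1 / 10 ^ 8)"
    proof -
      have "R x ^ 4 \<le> 8 * (u (n - 10) x ^ 4 + 1000 * (\<Sum>j=1..10. excess (n - j) x ^ 4))" for x
      proof -
        have "R x ^ 4 \<le> 8 * (u (n - 10) x ^ 4 + (- (\<Sum>j=1..10. excess (n - j) x)) ^ 4)"
          unfolding R_def using fourth_power_sum2[of "u (n - 10) x" "- (\<Sum>j=1..10. excess (n - j) x)"] by simp
        also have "(- (\<Sum>j=1..10. excess (n - j) x)) ^ 4 \<le> 1000 * (\<Sum>j=1..10. excess (n - j) x ^ 4)"
          using fourth_power_sum[of "{1..10}" "\<lambda>j. excess (n - j) x"] by simp
        finally show ?thesis by simp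
      qed
      then have "E (\<lambda>x. R x ^ 4) \<le> 8 * (E (\<lambda>x. u (n - 10) x ^ 4) + 1000 * (\<Sum>j=1..10. E (\<lambda>x. excess (n - j) x ^ 4)))"
        using E_mono[of "\<lambda>x. R x ^ 4" "\<lambda>x. 8 * (u (n - 10) x ^ 4 + 1000 * (\<Sum>j=1..10. excess (n - j) x ^ 4))"]
        by (simp only: E_cmult E_add E_sum)
      also have "(\<Sum>j=1..10. E (\<lambda>x. excess (n - j) x ^ 4)) \<le> (\<Sum>j=1..(10::nat). slack ^ 4 * (16 * X))"
        using False by (intro sum_mono k4) auto
      also have "8 * (E (\<lambda>x. u (n - 10) x ^ 4) + 1000 * (\<Sum>j=1..(10::nat). slack ^ 4 * (16 * X)))
         \<le> X * (8 * ((25/196) ^ 10 + 160000 * slack ^ 4))" using u10 by (simp add: algebra_simps)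
      also have "\<dots> \<le> X * (1 / 10 ^ 8)" using X by (intro mult_left_mono) (simp_all add: slack_def power_divide)
      finally show ?thesis by simp
    qed
    have "E (\<lambda>x. u n x ^ 4) \<le> E (\<lambda>x. (50/49) ^ 3 * (N x ^ 4) + 50 ^ 3 * R x ^ 4)"
    proof (rule E_mono)
      fix x show "u n x ^ 4 \<le> (50/49) ^ 3 * (N x ^ 4) + 50 ^ 3 * R x ^ 4"
        using fourth_power_split[of "- N x" "R x"] by (simp only: uNR) simp
    qed
    also have "\<dots> = (50/49) ^ 3 * E (\<lambda>x. N x ^ 4) + 50 ^ 3 * E (\<lambda>x. R x ^ 4)" by (simp only: E_add E_cmult)
    also have "\<dots> \<le> (50/49) ^ 3 * (X * (9083 / 10000)) + 50 ^ 3 * (X * (1 / 10 ^ 8))"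
      by (intro add_mono mult_left_mono N4 R4) auto
    also have "\<dots> \<le> X * (97 / 100)" using X by (simp add: power3_eq_cube)
    also have "\<dots> \<le> 2 ^ 40 * moment_scale n" using moment_scale_pos[of n] by (simp add: X_def)
    finally show ?thesis .
  qed
qed

lemma v_fourth: "1 \<le> n \<Longrightarrow> n < k \<Longrightarrow> E (\<lambda>x. v n x ^ 4) \<le> (2 ^ 40 + 1) * moment_scale n"
  by (intro v_fourth_le fourth_moment) auto

lemma clip_le_self: "0 < clip M y \<Longrightarrow> 0 \<le> M \<Longrightarrow> clip M y \<le> y"
  by (auto simp: clip_def max_def min_def split: if_splits)

text \<open>
  A difference above its cap needs both terms to be almost extremal, and a term that is almost
  extremal is itself an almost extremal difference; the error doubles with each level.
\<close>

lemma aligned: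
  assumes n: "n < k" "cut C \<le> n" and s: "s = 1 \<or> s = -1" and big: "T (Suc n) < s * (v n x - u n x)"
  shows "j < 54 \<Longrightarrow> (1 - (2 ^ Suc j - 1) * slack) * T (n - j) \<le> - s * u (n - j) x
      \<and> (1 - (2 ^ Suc j - 1) * slack) * T (n - j) \<le> s * v (n - j) x"
proof (induction j)
  case 0
  have "- s * u n x \<le> T n" "s * v n x \<le> T n" using u_le[of n x] v_le[of n x] n s by auto
  then show ?case using big cap_Suc_ge[OF n(2)] by (simp add: algebra_simps)
next
  case (Suc j)
  let ?e = "(2 ^ Suc j - 1) * slack"
  have e: "?e \<le> 1 / 2"
  proof -
    have "(2 :: real) ^ Suc j \<le> 2 ^ 54" using Suc.prems by (intro power_increasing) auto
    then have "?e \<le> (2 ^ 54) * slack" using slack_pos by (intro mult_right_mono) auto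
    then show ?thesis by (simp add: slack_def)
  qed
  have nj: "Suc (n - Suc j) = n - j" "n - Suc j < k" using n Suc.prems by (auto simp: cut_def)
  let ?d = "- s * (u (n - Suc j) x - v (n - Suc j) x)"
  have IH: "(1 - ?e) * T (n - j) \<le> - s * u (n - j) x" using Suc by auto
  have "- s * u (n - j) x = clip (T (n - j)) ?d"
  proof -
    have u': "u (n - j) x = clip (T (n - j)) (u (n - Suc j) x - v (n - Suc j) x)"
      using u_Suc[OF nj(2), of x] by (simp only: nj(1))
    have "clip (T (n - j)) (- y) = - clip (T (n - j)) y" for y
      using clip_minus[of "T (n - j)" y] T_pos[of "n - j"] by simp
    then have "- s * clip (T (n - j)) y = clip (T (n - j)) (- s * y)" for y using s by auto
    then show ?thesis unfolding u' .
  qed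
  moreover have "0 < (1 - ?e) * T (n - j)" using e T_pos[of "n - j"] by simp
  ultimately have "(1 - ?e) * T (n - j) \<le> ?d"
    using IH clip_le_self[of "T (n - j)" ?d] T_pos[of "n - j"] by linarith
  moreover have "(1 - ?e) * ((2 - slack) * T (n - Suc j)) \<le> (1 - ?e) * T (n - j)"
    using cap_Suc_bounds(1)[of "cut C" "n - Suc j"] nj(1) e by (intro mult_left_mono) auto
  moreover have "(1 - (2 ^ Suc (Suc j) - 1) * slack) * T (n - Suc j) + T (n - Suc j)
      \<le> (1 - ?e) * ((2 - slack) * T (n - Suc j))"
  proof -
    have "(1 - ?e) * ((2 - slack) * T (n - Suc j)) - ((1 - (2 ^ Suc (Suc j) - 1) * slack) * T (n - Suc j) + T (n - Suc j))
       = ?e * slack * T (n - Suc j)" by (simp add: algebra_simps)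
    moreover have "0 \<le> ?e * slack * T (n - Suc j)"
      using slack_pos T_pos[of "n - Suc j"] one_le_power[of "2 :: real" "Suc j"] by (intro mult_nonneg_nonneg) auto
    ultimately show ?thesis by linarith
  qed
  moreover have "- s * u (n - Suc j) x \<le> T (n - Suc j)" "s * v (n - Suc j) x \<le> T (n - Suc j)"
    using u_le[of "n - Suc j" x] v_le[of "n - Suc j" x] nj s by (auto simp: abs_le_iff)
  moreover have "?d = - s * u (n - Suc j) x + s * v (n - Suc j) x" by (simp add: algebra_simps)
  ultimately show ?case by linarith
qed

definition run_event :: "real \<Rightarrow> nat \<Rightarrow> nat \<Rightarrow> 'w \<Rightarrow> real" where
  "run_event s n j x = of_bool (T n / 2 \<le> s * v n x \<and> (\<forall>i\<in>{1..j}. 0 < s * v (n - i) x))"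

text \<open>
  The flip that changes the sign of the next, deeper, value fixes the previous ones. So the next sign
  is balanced given the previous ones, up to the cost of the flip.
\<close>

lemma run_probability:
  assumes "n < k"
  shows "j < n \<Longrightarrow> E (run_event s n j) \<le> E (run_event s n 0) / 2 ^ j + 2 ^ j * C / 2 ^ n"
proof (induction j)
  case 0 then show ?case using C_pos by simp
next
  case (Suc j)
  let ?m = "n - Suc j"
  have m: "1 \<le> ?m" "?m \<le> k" using Suc.prems assms by auto
  \<comment> \<open>odd under the flip; the longer run is bounded by the mean of the shorter run and \<open>\<phi>\<close>\<close>
  define \<phi> where "\<phi> x = run_event s n j x * sgn (s * v ?m x)" for x
  have "\<bar>E \<phi>\<bar> \<le> 1 * C / 2 ^ ?m"
  proof (rule odd_expectation[OF m])
    fix x show "\<bar>\<phi> x\<bar> \<le> 1" by (simp add: \<phi>_def run_event_def abs_mult abs_sgn_eq)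
    have "run_event s n j (flip ?m x) = run_event s n j x"
    proof -
      have "v (n - i) (flip ?m x) = v (n - i) x" if "i \<le> j" for i
        using that m assms Suc.prems by (intro v_flip_other) auto
      from this this[of 0] show ?thesis by (simp add: run_event_def)
    qed
    then show "\<phi> (flip ?m x) = - \<phi> x" by (simp add: \<phi>_def v_flip[OF m] sgn_minus)
  qed
  moreover have "E (run_event s n (Suc j)) \<le> E (\<lambda>x. (1/2) * (run_event s n j x + \<phi> x))"
  proof (rule E_mono)
    fix x
    have "{1..Suc j} = insert (Suc j) {1..j}" by auto
    then show "run_event s n (Suc j) x \<le> 1 / 2 * (run_event s n j x + \<phi> x)"
      by (auto simp: run_event_def \<phi>_def sgn_if)
  qed
  moreover have "E (\<lambda>x. (1/2) * (run_event s n j x + \<phi> x)) = (1/2) * (E (run_event s n j) + E \<phi>)"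
    by (simp only: E_cmult E_add)
  moreover have "C / 2 ^ ?m = 2 * (2 ^ j * C / 2 ^ n)"
  proof -
    have "(2::real) ^ n = 2 ^ ?m * 2 ^ Suc j" unfolding power_add[symmetric] using Suc.prems by simp
    then show ?thesis by simp
  qed
  moreover have "0 \<le> 2 ^ j * C / 2 ^ n" using C_pos by simp
  moreover have "E (run_event s n j) \<le> E (run_event s n 0) / 2 ^ j + 2 ^ j * C / 2 ^ n" using Suc by simp
  ultimately have "E (run_event s n (Suc j)) \<le> (1/2) * (E (run_event s n 0) / 2 ^ j + 2 ^ j * C / 2 ^ n) + 2 ^ j * C / 2 ^ n"
    by argo
  also have "\<dots> = E (run_event s n 0) / 2 ^ Suc j + (3/2) * (2 ^ j * C / 2 ^ n)" by (simp add: add_divide_distrib mult_ac)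
  also have "\<dots> \<le> E (run_event s n 0) / 2 ^ Suc j + 2 * (2 ^ j * C / 2 ^ n)"
    using \<open>0 \<le> 2 ^ j * C / 2 ^ n\<close> by (intro add_left_mono mult_right_mono) auto
  finally show ?case by simp
qed

text \<open>
  What is clipped off is at most \<open>slack * T n\<close>, and it vanishes outside the event of \<open>aligned\<close>. Up
  to the costs of the flips, that event has probability at most \<open>2^(-53)\<close> times the probability that
  \<open>v n\<close> is of the size of its cap, and the latter is controlled by the fourth moment.
\<close>

lemma excess_mean:
  assumes n: "n < k" "cut C \<le> n"
  shows "E (\<lambda>x. \<bar>excess n x\<bar>) \<le> slack * T n * (16 * (2 ^ 40 + 1) * moment_scale n / T n ^ 4 / 2 ^ 53 + 2 ^ 54 * C / 2 ^ n)"
proof -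
  have n54: "53 < n" using n by (auto simp: cut_def)
  have "\<bar>excess n x\<bar> \<le> slack * T n * (run_event 1 n 53 x + run_event (-1) n 53 x)" for x
  proof (cases "\<bar>u n x - v n x\<bar> \<le> T (Suc n)")
    case True then show ?thesis using excess_bound(2)[OF n(1)] slack_pos T_pos[of n] by (simp add: run_event_def)
  next
    case False
    define s :: real where "s = (if u n x < v n x then 1 else -1)"
    have s: "s = 1 \<or> s = -1" by (simp add: s_def)
    have big: "T (Suc n) < s * (v n x - u n x)" using False by (auto simp: s_def)
    have v: "T (n - j) / 2 \<le> s * v (n - j) x" if "j < 54" for j
    proof -
      have "(2 :: real) ^ Suc j \<le> 2 ^ 54" using that by (intro power_increasing) auto
      then have "(2 ^ Suc j - 1) * slack \<le> (2 ^ 54) * slack" using slack_pos by (intro mult_right_mono) auto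
      then have "1 / 2 \<le> 1 - (2 ^ Suc j - 1) * slack" by (simp add: slack_def)
      then have "1 / 2 * T (n - j) \<le> (1 - (2 ^ Suc j - 1) * slack) * T (n - j)"
        using T_pos[of "n - j"] by (intro mult_right_mono) auto
      also have "\<dots> \<le> s * v (n - j) x" using aligned[OF n s big that] by simp
      finally show ?thesis by simp
    qed
    have "0 < s * v (n - i) x" if "i < 54" for i using v[OF that] T_pos[of "n - i"] by linarith
    then have "run_event s n 53 x = 1" using v[of 0] by (simp add: run_event_def)
    then have "1 \<le> run_event 1 n 53 x + run_event (-1) n 53 x" using s by (auto simp: run_event_def)
    then have "slack * T n * 1 \<le> slack * T n * (run_event 1 n 53 x + run_event (-1) n 53 x)"
      using slack_pos T_pos[of n] by (intro mult_left_mono) auto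
    then show ?thesis using excess_bound(1)[OF n(1), of x] by linarith
  qed
  then have "E (\<lambda>x. \<bar>excess n x\<bar>) \<le> slack * T n * (E (run_event 1 n 53) + E (run_event (-1) n 53))"
    using E_mono[of "\<lambda>x. \<bar>excess n x\<bar>" "\<lambda>x. slack * T n * (run_event 1 n 53 x + run_event (-1) n 53 x)"] by (simp only: E_cmult E_add)
  also have "\<dots> \<le> slack * T n * (16 * (2 ^ 40 + 1) * moment_scale n / T n ^ 4 / 2 ^ 53 + 2 ^ 54 * C / 2 ^ n)"
  proof (rule mult_left_mono)
    have "E (run_event 1 n 0) + E (run_event (-1) n 0) \<le> E (\<lambda>x. 16 / T n ^ 4 * v n x ^ 4)"
      unfolding E_add[symmetric]
    proof (rule E_mono)
      fix x
      have pos: "0 < T n" by (rule T_pos)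
      have "run_event 1 n 0 x + run_event (-1) n 0 x \<le> of_bool (T n / 2 \<le> \<bar>v n x\<bar>)" using pos by (auto simp: run_event_def)
      also have "\<dots> \<le> 16 / T n ^ 4 * v n x ^ 4"
      proof (cases "T n / 2 \<le> \<bar>v n x\<bar>")
        case True
        then have "(T n / 2) ^ 4 \<le> \<bar>v n x\<bar> ^ 4" using pos by (intro power_mono) auto
        then show ?thesis using True pos by (simp add: power_divide field_simps)
      qed (simp add: pos)
      finally show "run_event 1 n 0 x + run_event (-1) n 0 x \<le> 16 / T n ^ 4 * v n x ^ 4" .
    qed
    also have "\<dots> = 16 / T n ^ 4 * E (\<lambda>x. v n x ^ 4)" by (simp only: E_cmult)
    also have "\<dots> \<le> 16 / T n ^ 4 * ((2 ^ 40 + 1) * moment_scale n)"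
      using v_fourth[of n] n54 n by (intro mult_left_mono) auto
    finally have "E (run_event 1 n 0) + E (run_event (-1) n 0) \<le> 16 * (2 ^ 40 + 1) * moment_scale n / T n ^ 4" by simp
    moreover have "E (run_event 1 n 53) + E (run_event (-1) n 53) \<le> (E (run_event 1 n 0) + E (run_event (-1) n 0)) / 2 ^ 53 + 2 ^ 54 * C / 2 ^ n"
      using run_probability[OF n(1) n54, of 1] run_probability[OF n(1) n54, of "-1"] by (simp add: field_simps)
    ultimately show "E (run_event 1 n 53) + E (run_event (-1) n 53)
        \<le> 16 * (2 ^ 40 + 1) * moment_scale n / T n ^ 4 / 2 ^ 53 + 2 ^ 54 * C / 2 ^ n"
      by (meson add_right_mono divide_right_mono order_trans zero_le_numeral zero_le_power)
  qed (use slack_pos T_pos[of n] in auto)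
  finally show ?thesis .
qed

lemma shifted_geometric:
  fixes q :: real
  assumes "0 \<le> q" "q < 1"
  shows "(\<Sum>n=m..<N. q ^ (n - m)) \<le> 1 / (1 - q)"
    and "(\<Sum>n=m..<N. real (n - m) * q ^ (n - m)) \<le> 1 / (1 - q)\<^sup>2"
  using geometric_bound[OF assms, of "N - m"] geometric_bound1[OF assms, of "N - m"]
  by (simp_all add: sum.atLeastLessThan_shift_0[of _ m N] lessThan_atLeast0)

definition late_ratio :: real where "late_ratio = 1 - slack / 2"

lemma late_ratio: "0 \<le> late_ratio" "late_ratio < 1" "1 - late_ratio = 1 / 2 ^ 56" by (simp_all add: late_ratio_def slack_def)

lemma T_late: "cut C \<le> n \<Longrightarrow> T n = 2 ^ n * late_ratio ^ (n - cut C)" by (simp add: cap_ge late_ratio_def)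

lemma cut_le: "real (cut C) \<le> 55 + 35 * log_inv"
proof -
  have "0 \<le> \<lceil>35 * log_inv\<rceil>" using log_inv_nonneg by simp
  then show ?thesis unfolding cut_def log_inv_def[symmetric] by simp linarith
qed

lemma sum_v: "(\<Sum>n=1..k. \<bar>E (v n)\<bar>) \<le> C * (55 + 35 * log_inv + 2 ^ 56)"
proof -
  have "(\<Sum>n=1..k. \<bar>E (v n)\<bar>) \<le> (\<Sum>n=1..k. C * (if n < cut C then 1 else late_ratio ^ (n - cut C)))"
  proof (rule sum_mono)
    fix n assume n: "n \<in> {1..k}"
    have "\<bar>E (v n)\<bar> \<le> T n * C / 2 ^ n" using n by (intro odd_expectation v_le v_flip) auto
    also have "\<dots> \<le> C * (if n < cut C then 1 else late_ratio ^ (n - cut C))"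
      using C_pos by (cases "n < cut C") (simp_all add: T_late, simp add: cap_def)
    finally show "\<bar>E (v n)\<bar> \<le> C * (if n < cut C then 1 else late_ratio ^ (n - cut C))" .
  qed
  also have "\<dots> = C * (\<Sum>n=1..k. (if n < cut C then 1 else late_ratio ^ (n - cut C)))" by (simp add: sum_distrib_left)
  also have "\<dots> \<le> C * (\<Sum>n\<in>{..<cut C} \<union> {cut C..<Suc k}. (if n < cut C then 1 else late_ratio ^ (n - cut C)))"
    using C_pos late_ratio by (intro mult_left_mono sum_mono2) auto
  also have "(\<Sum>n\<in>{..<cut C} \<union> {cut C..<Suc k}. (if n < cut C then 1 else late_ratio ^ (n - cut C)))
     = real (cut C) + (\<Sum>n=cut C..<Suc k. late_ratio ^ (n - cut C))"
    by (subst sum.union_disjoint) auto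
  also have "C * \<dots> \<le> C * (55 + 35 * log_inv + 2 ^ 56)"
    using shifted_geometric(1)[OF late_ratio(1,2), of "cut C" "Suc k"] cut_le C_pos by (intro mult_left_mono) (simp_all add: late_ratio(3))
  finally show ?thesis .
qed

text \<open>
  The sum of \<open>T n * \<theta> n\<close> is of order \<open>C * (2^58 + log 2 (1 / C)) / slack\<close>. The factor \<open>1/slack\<close> cancels with
  \<open>slack\<close>, and \<open>2^(-53)\<close> with the constant \<open>2^40\<close> of the fourth moment: the recursion closes with room.
\<close>

lemma sum_excess: "(\<Sum>n=cut C..<k. E (\<lambda>x. \<bar>excess n x\<bar>)) \<le> C * (12 * (2 ^ 58 + log_inv))"
proof -
  let ?m = "cut C"
  let ?K = "16 * (2 ^ 40 + 1) / 2 ^ 53 :: real"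
  have summand: "E (\<lambda>x. \<bar>excess n x\<bar>) \<le> slack * (?K * (C * (981/1000) ^ (n - ?m)
        + (64 * C * (2 ^ 58 + log_inv + real ?m) * late_ratio ^ (n - ?m) + 64 * C * (real (n - ?m) * late_ratio ^ (n - ?m))))
        + 2 ^ 54 * C * late_ratio ^ (n - ?m))" if n: "n \<in> {?m..<k}" for n
  proof -
    have Tq: "T n = 2 ^ n * late_ratio ^ (n - ?m)" using T_late n by auto
    have "(784/100) ^ n / T n ^ 3 \<le> C * (981/1000) ^ (n - ?m)"
    proof -
      have "(784/100 :: real) ^ n = (2 ^ 3 * (98/100)) ^ n" by simp
      also have "\<dots> = (2 ^ n) ^ 3 * (98/100) ^ n"
        by (simp only: power_mult_distrib) (simp only: power_mult[symmetric] mult.commute)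
      also have "(98/100 :: real) ^ n = (98/100) ^ ?m * (98/100) ^ (n - ?m)"
        unfolding power_add[symmetric] using n by simp
      also have "\<dots> \<le> C * ((981/1000) * late_ratio ^ 3) ^ (n - ?m)"
      proof (intro mult_mono cut_power C_pos C_le power_mono)
        have "(9999/10000) ^ 3 \<le> late_ratio ^ 3" by (intro power_mono) (simp_all add: late_ratio_def slack_def)
        moreover have "98/100 \<le> (981/1000) * (9999/10000 :: real) ^ 3" by (simp add: field_simps)
        ultimately show "98/100 \<le> 981/1000 * late_ratio ^ 3" by linarith
      qed (use C_pos in auto)
      also have "(2 ^ n) ^ 3 * (C * ((981/1000) * late_ratio ^ 3) ^ (n - ?m)) = C * (981/1000) ^ (n - ?m) * T n ^ 3"
        by (simp only: Tq power_mult_distrib) (simp only: power_mult[symmetric] mult_ac)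
      finally have "(784/100) ^ n \<le> C * (981/1000) ^ (n - ?m) * T n ^ 3" by simp
      then show ?thesis using T_pos[of n] by (simp add: divide_le_eq)
    qed
    moreover have "T n * \<theta> n = 64 * C * (2 ^ 58 + log_inv + real ?m) * late_ratio ^ (n - ?m) + 64 * C * (real (n - ?m) * late_ratio ^ (n - ?m))"
      using n by (simp add: \<theta>_def Tq algebra_simps of_nat_diff)
    moreover have "T n * moment_scale n / T n ^ 4 = (784/100) ^ n / T n ^ 3 + T n * \<theta> n"
      using T_pos[of n] by (simp add: moment_scale_def field_simps power3_eq_cube power4_eq_xxxx)
    ultimately have le: "T n * moment_scale n / T n ^ 4 \<le> C * (981/1000) ^ (n - ?m)
        + (64 * C * (2 ^ 58 + log_inv + real ?m) * late_ratio ^ (n - ?m) + 64 * C * (real (n - ?m) * late_ratio ^ (n - ?m)))" by linarith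
    have "E (\<lambda>x. \<bar>excess n x\<bar>) \<le> slack * T n * (16 * (2 ^ 40 + 1) * moment_scale n / T n ^ 4 / 2 ^ 53 + 2 ^ 54 * C / 2 ^ n)"
      using n by (intro excess_mean) auto
    also have "\<dots> = slack * (?K * (T n * moment_scale n / T n ^ 4) + 2 ^ 54 * C * late_ratio ^ (n - ?m))"
      by (simp only: ring_distribs) (simp add: Tq)
    also have "\<dots> \<le> slack * (?K * (C * (981/1000) ^ (n - ?m)
        + (64 * C * (2 ^ 58 + log_inv + real ?m) * late_ratio ^ (n - ?m) + 64 * C * (real (n - ?m) * late_ratio ^ (n - ?m))))
        + 2 ^ 54 * C * late_ratio ^ (n - ?m))"
      using slack_pos by (intro mult_left_mono add_right_mono le) auto
    finally show ?thesis .
  qed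
  have "(\<Sum>n=?m..<k. E (\<lambda>x. \<bar>excess n x\<bar>)) \<le> (\<Sum>n=?m..<k. slack * (?K * (C * (981/1000) ^ (n - ?m)
        + (64 * C * (2 ^ 58 + log_inv + real ?m) * late_ratio ^ (n - ?m) + 64 * C * (real (n - ?m) * late_ratio ^ (n - ?m))))
        + 2 ^ 54 * C * late_ratio ^ (n - ?m)))" by (intro sum_mono summand)
  also have "\<dots> = slack * (?K * (C * (\<Sum>n=?m..<k. (981/1000) ^ (n - ?m))
        + (64 * C * (2 ^ 58 + log_inv + real ?m) * (\<Sum>n=?m..<k. late_ratio ^ (n - ?m)) + 64 * C * (\<Sum>n=?m..<k. real (n - ?m) * late_ratio ^ (n - ?m))))
        + 2 ^ 54 * C * (\<Sum>n=?m..<k. late_ratio ^ (n - ?m)))"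
    by (simp only: sum.distrib sum_distrib_left[symmetric])
  also have "\<dots> \<le> slack * (?K * (C * 53
        + (64 * C * (2 ^ 58 + log_inv + (55 + 35 * log_inv)) * 2 ^ 56 + 64 * C * 2 ^ 112)) + 2 ^ 54 * C * 2 ^ 56)"
  proof -
    have "(\<Sum>n=?m..<k. (981/1000) ^ (n - ?m)) \<le> (53 :: real)"
      using shifted_geometric(1)[of "981/1000" ?m k] by simp
    moreover have "(\<Sum>n=?m..<k. late_ratio ^ (n - ?m)) \<le> 2 ^ 56"
      using shifted_geometric(1)[OF late_ratio(1,2), of ?m k] by (simp add: late_ratio(3))
    moreover have "(\<Sum>n=?m..<k. real (n - ?m) * late_ratio ^ (n - ?m)) \<le> 2 ^ 112"
      using shifted_geometric(2)[OF late_ratio(1,2), of ?m k] by (simp add: late_ratio(3) power2_eq_square)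
    moreover have "0 \<le> (\<Sum>n=?m..<k. late_ratio ^ (n - ?m))" using late_ratio by (intro sum_nonneg) auto
    ultimately show ?thesis
      using slack_pos C_pos log_inv_nonneg cut_le
      by (intro mult_left_mono add_mono mult_mono) auto
  qed
  also have "\<dots> \<le> C * (12 * (2 ^ 58 + log_inv))"
  proof -
    have "0 \<le> C * log_inv" using C_pos log_inv_nonneg by simp
    then show ?thesis using C_pos by (simp add: slack_def ring_distribs)
  qed
  finally show ?thesis .
qed

lemma u_v_difference: "\<bar>E (u 0) - E (v 0)\<bar> \<le> 64 * C * (2 ^ 58 + log_inv)"
proof -
  have "0 \<le> C * log_inv" using C_pos log_inv_nonneg by simp
  then have "C * (55 + 35 * log_inv + 2 ^ 56) + C * (12 * (2 ^ 58 + log_inv)) \<le> 64 * C * (2 ^ 58 + log_inv)"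
    using C_pos by (simp add: ring_distribs)
  then show ?thesis using telescope sum_v sum_excess by linarith
qed
end

text \<open>
  An abstract form of the columns below \<open>0\<^sup>i\<close> (\<open>U i\<close>) and below \<open>0\<^sup>i\<^sup>-\<^sup>1 y\<^sub>i\<close> (\<open>V i\<close>): the flip of level
  \<open>i\<close> exchanges the two distinguished children of \<open>V i\<close> and fixes all \<open>V m\<close> above it, except the root.
\<close>

locale flip_tower = weighted D F for D :: "'w set" and F +
  fixes U V :: "nat \<Rightarrow> 'w \<Rightarrow> 'p" and zero_child half_child :: "nat \<Rightarrow> 'p \<Rightarrow> 'p"
    and flip :: "nat \<Rightarrow> 'w \<Rightarrow> 'w" and cost :: "nat \<Rightarrow> real"
  assumes V_0: "\<And>x. V 0 x = U 0 x"
    and zero_child_U: "\<And>i x. zero_child i (U i x) = U (Suc i) x"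
    and half_child_U: "\<And>i x. half_child i (U i x) = V (Suc i) x"
    and flip_swap: "\<And>i x. zero_child i (V i (flip i x)) = half_child i (V i x)"
      "\<And>i x. half_child i (V i (flip i x)) = zero_child i (V i x)"
    and flip_fix: "\<And>m i x. 1 \<le> m \<Longrightarrow> m < i \<Longrightarrow> V m (flip i x) = V m x"
    and flip_cost: "\<And>i \<phi> M. (\<And>x. \<bar>\<phi> x\<bar> \<le> M) \<Longrightarrow> \<bar>E \<phi> - E (\<lambda>x. \<phi> (flip i x))\<bar> \<le> M * cost i"
    and cost_pos: "\<And>i. 0 < cost i"
    and cost_double: "\<And>i. 2 * cost i \<le> cost (Suc i)"
begin

text \<open>
  The \<open>n\<close>-fold difference of the statistic \<open>s\<close> along the two distinguished children, clipped at every
  step.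
\<close>

fun defect :: "nat \<Rightarrow> nat \<Rightarrow> ('p \<Rightarrow> real) \<Rightarrow> nat \<Rightarrow> 'p \<Rightarrow> real" where
  "defect k m s 0 P = s P"
| "defect k m s (Suc n) P = clip (cap m (Suc n))
     (defect k m s n (zero_child (k - 1 - n) P) - defect k m s n (half_child (k - 1 - n) P))"

lemma cost_power: "2 ^ n * cost i \<le> cost (i + n)"
proof (induction n)
  case (Suc n) then show ?case using cost_double[of "i + n"] by simp
qed simp

text \<open>
  Induction on \<open>k\<close>. The costs of the levels above decay by a factor 2, so the claim for level
  \<open>k - n\<close> with \<open>C / 2^n\<close> in place of \<open>C\<close> is available inside \<open>clip_chain\<close>.
\<close>

theorem tv_bound:
  assumes "1 \<le> k" "cost (k - 1) \<le> C" "C \<le> 1" "\<And>P. \<bar>s P\<bar> \<le> 1"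
  shows "\<bar>E (\<lambda>x. s (U k x)) - E (\<lambda>x. s (V k x))\<bar> \<le> 64 * C * (2 ^ 58 + log 2 (1 / C))"
  using assms
proof (induction k arbitrary: C s rule: less_induct)
  case (less k)
  let ?S = "defect k (cut C) s"
  have C: "0 < C" using cost_pos[of "k - 1"] less.prems by linarith
  have cost_le: "cost (k - 1 - n) \<le> C / 2 ^ n" if "n < k" for n
  proof -
    have "2 ^ n * cost (k - 1 - n) \<le> cost (k - 1)" using cost_power[of n "k - 1 - n"] that by simp
    then show ?thesis using less.prems by (simp add: field_simps)
  qed
  have S_le: "\<bar>?S n P\<bar> \<le> cap (cut C) n" for n P
  proof (cases n)
    case (Suc n')
    then show ?thesis using clip_bound[of "cap (cut C) n"] cap_pos[of "cut C" n] by simp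
  qed (use less.prems in simp)
  interpret clip_chain D F "\<lambda>n x. ?S n (U (k - n) x)" "\<lambda>n x. ?S n (V (k - n) x)"
      "\<lambda>n. flip (k - n)" k C
  proof
    show "0 < C" "C \<le> 1" "1 \<le> k" using C less.prems by auto
    fix n x
    show "\<bar>?S n (U (k - n) x)\<bar> \<le> cap (cut C) n" "\<bar>?S n (V (k - n) x)\<bar> \<le> cap (cut C) n" by (rule S_le)+
    show "?S (Suc n) (U (k - Suc n) x) = clip (cap (cut C) (Suc n)) (?S n (U (k - n) x) - ?S n (V (k - n) x))"
      if "n < k"
      using that zero_child_U[of "k - Suc n" x] half_child_U[of "k - Suc n" x]
      by (simp add: Suc_diff_Suc)
    show "?S n (V (k - n) (flip (k - n) x)) = - ?S n (V (k - n) x)" if n: "1 \<le> n" "n \<le> k"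
    proof -
      obtain n' where n': "n = Suc n'" using n by (cases n) auto
      have "clip (cap (cut C) n) (- y) = - clip (cap (cut C) n) y" for y
        using cap_pos[of "cut C" n] by (intro clip_minus) auto
      then show ?thesis
        using flip_swap[of "k - n" x] by (simp add: n') (metis minus_diff_eq)
    qed
    show "?S m (V (k - m) (flip (k - n) x)) = ?S m (V (k - m) x)" if "1 \<le> n" "n < m" "m < k" for m
      using that flip_fix[of "k - m" "k - n" x] by simp
    show "\<bar>E \<phi> - E (\<lambda>x. \<phi> (flip (k - n) x))\<bar> \<le> M * (2 * C / 2 ^ n)"
      if n1: "1 \<le> n" and "n \<le> k" "\<And>x. \<bar>\<phi> x\<bar> \<le> M" for \<phi> M
    proof -
      obtain n' where n': "n = Suc n'" using n1 by (cases n) simp_all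
      have "cost (k - n) \<le> 2 * C / 2 ^ n" using cost_le[of n'] that n' by simp
      moreover have "0 \<le> M" using that(3)[of undefined] by linarith
      ultimately show ?thesis
        using order_trans[OF flip_cost[of \<phi> M "k - n", OF that(3)] mult_left_mono[of "cost (k - n)" "2 * C / 2 ^ n" M]]
        by blast
    qed
    show "\<bar>E (\<lambda>x. h (?S n (U (k - n) x))) - E (\<lambda>x. h (?S n (V (k - n) x)))\<bar>
        \<le> 64 * C / 2 ^ n * (2 ^ 58 + log 2 (1 / C) + real n)"
      if "1 \<le> n" "n < k" "\<And>y :: real. \<bar>h y\<bar> \<le> 1" for h
    proof -
      have "\<bar>E (\<lambda>x. h (?S n (U (k - n) x))) - E (\<lambda>x. h (?S n (V (k - n) x)))\<bar>
         \<le> 64 * (C / 2 ^ n) * (2 ^ 58 + log 2 (1 / (C / 2 ^ n)))"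
        using that cost_le[of n] C less.prems
        by (intro less.IH[of "k - n" "C / 2 ^ n" "\<lambda>P. h (?S n P)"]) (auto simp: field_simps intro: order_trans[of C 1])
      also have "log 2 (1 / (C / 2 ^ n)) = log 2 (1 / C) + real n"
        using C by (simp add: log_divide log_nat_power)
      finally show ?thesis by (simp add: add.assoc)
    qed
    show "?S k (U (k - k) x) = ?S k (V (k - k) x)" by (simp add: V_0)
  qed
  show ?case using u_v_difference by (simp add: log_inv_def)
qed
end

section \<open>The inverted orbit of the base point spreads\<close>

text \<open>
  Powers of 2 with strictly increasing exponents have these properties. By the last one, a rotation by
  \<open>l (i + 1) div 2\<close> is trivial modulo every earlier \<open>l j\<close>.
\<close>

locale ns_sequence =
  fixes l :: "nat \<Rightarrow> nat"
  assumes l_pos: "\<And>i. 1 \<le> i \<Longrightarrow> 0 < l i"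
    and l_even: "\<And>i. 1 \<le> i \<Longrightarrow> even (l i)"
    and l_dvd: "\<And>i. 1 \<le> i \<Longrightarrow> 2 * l i dvd l (Suc i)"
begin

abbreviation half :: "nat \<Rightarrow> nat" where "half i \<equiv> l i div 2"

lemma half: "1 \<le> i \<Longrightarrow> 0 < half i" "1 \<le> i \<Longrightarrow> half i < l i" "1 \<le> i \<Longrightarrow> 2 * half i = l i"
  using l_even[of i] l_pos[of i] by (auto elim!: evenE)

lemma l_ge2: "1 \<le> i \<Longrightarrow> 2 \<le> l i"
  using half[of i] by linarith

lemma l_double: "1 \<le> i \<Longrightarrow> 2 * l i \<le> l (Suc i)"
  using l_dvd[of i] l_pos[of "Suc i"] dvd_imp_le[of "2 * l i" "l (Suc i)"] by simp

lemma l_dvd_le: "i \<le> j \<Longrightarrow> 1 \<le> i \<Longrightarrow> l i dvd l j"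
proof (induction j rule: dec_induct)
  case (step j)
  then have "l j dvd l (Suc j)" using l_dvd[of j] by (meson dvd_mult_right order_trans)
  then show ?case using step by (meson dvd_trans)
qed simp

lemma l_dvd_half: "1 \<le> i \<Longrightarrow> i < j \<Longrightarrow> l i dvd half j"
proof -
  assume i: "1 \<le> i" "i < j"
  then obtain k where k: "j = Suc k" "i \<le> k" by (cases j) auto
  have "l i dvd l k" using i k by (intro l_dvd_le) auto
  moreover have "2 * l k dvd 2 * half j" using l_dvd[of k] half(3)[of j] i k by simp
  ultimately show ?thesis by (metis dvd_trans nat_mult_dvd_cancel_disj zero_neq_numeral)
qed

lemma alpha_words: "w \<in> words l i \<Longrightarrow> ns_alpha l i w \<in> words l i"
  using l_pos by (cases w) auto

lemma beta_words: "w \<in> words l i \<Longrightarrow> ns_beta l i w \<in> words l i"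
  by (induction w arbitrary: i) (auto intro: alpha_words)

lemma alpha_pow_Nil [simp]: "(ns_alpha l i ^^ t) [] = []" by (induction t) auto

lemma alpha_pow: "x < l (Suc i) \<Longrightarrow> (ns_alpha l i ^^ t) (x # w) = ((x + t) mod l (Suc i)) # w"
  by (induction t) (auto simp: mod_Suc_eq)

lemma beta_pow_zero: "(ns_beta l i ^^ t) (0 # w) = 0 # (ns_beta l (Suc i) ^^ t) w"
  by (induction t) auto

lemma beta_pow_half: "(ns_beta l i ^^ t) (half (Suc i) # w) = half (Suc i) # (ns_alpha l (Suc i) ^^ t) w"
  using half(1)[of "Suc i"] by (induction t) auto

lemma beta_pow_zeros: "(ns_beta l i ^^ t) (replicate k 0 @ w) = replicate k 0 @ (ns_beta l (i + k) ^^ t) w"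
  by (induction k arbitrary: i) (simp_all add: beta_pow_zero)

lemma zeros_words: "replicate k 0 @ w \<in> words l i \<longleftrightarrow> w \<in> words l (i + k)"
  using l_pos by (induction k arbitrary: i) auto

text \<open>
  A column is a function on the words of a subtree; it is made \<open>[]\<close> off these words, so that columns
  which agree on the subtree are equal.
\<close>

definition child :: "nat \<Rightarrow> nat \<Rightarrow> (nat list \<Rightarrow> nat list) \<Rightarrow> nat list \<Rightarrow> nat list" where
  "child i x P = (\<lambda>w. if w \<in> words l (Suc i) then P (x # w) else [])"

definition zero_column :: "nat \<Rightarrow> (nat list \<Rightarrow> nat list) \<Rightarrow> nat list \<Rightarrow> nat list" where
  "zero_column i \<tau> = (\<lambda>w. if w \<in> words l i then \<tau> (replicate i 0 @ w) else [])"

text \<open>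
  The column below \<open>0\<^sup>i\<^sup>-\<^sup>1 y\<^sub>i\<close>. At the root there is no such vertex, and the whole tree takes its
  place, because \<open>\<alpha>\<close> rotates the first letter.
\<close>

definition half_column :: "nat \<Rightarrow> (nat list \<Rightarrow> nat list) \<Rightarrow> nat list \<Rightarrow> nat list" where
  "half_column i \<tau> = (case i of 0 \<Rightarrow> zero_column 0 \<tau> | Suc j \<Rightarrow> child j (half (Suc j)) (zero_column j \<tau>))"

text \<open>
  Right multiplication of \<open>\<tau> = g\<^sup>-\<^sup>1\<close> by a generator, which is left multiplication of \<open>g\<close> by its
  inverse.
\<close>

definition alpha_rot :: "(nat list \<Rightarrow> nat list) \<Rightarrow> nat list \<Rightarrow> nat list" where
  "alpha_rot \<tau> = compose (words l 0) \<tau> (ns_alpha l 0)"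

definition beta_rot :: "(nat list \<Rightarrow> nat list) \<Rightarrow> nat list \<Rightarrow> nat list" where
  "beta_rot \<tau> = compose (words l 0) \<tau> (ns_beta l 0)"

definition rot :: "nat \<Rightarrow> (nat list \<Rightarrow> nat list) \<Rightarrow> nat list \<Rightarrow> nat list" where
  "rot i = (if i = 0 then alpha_rot else beta_rot)"

lemma alpha_rot_pow: "w \<in> words l 0 \<Longrightarrow> (alpha_rot ^^ t) \<tau> w = \<tau> ((ns_alpha l 0 ^^ t) w)"
proof (induction t arbitrary: w)
  case (Suc t)
  have "(alpha_rot ^^ Suc t) \<tau> w = (alpha_rot ^^ t) \<tau> (ns_alpha l 0 w)"
    using Suc.prems by (simp add: alpha_rot_def compose_def)
  then show ?case using Suc by (simp add: alpha_words funpow_swap1)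
qed simp

lemma beta_rot_pow: "w \<in> words l 0 \<Longrightarrow> (beta_rot ^^ t) \<tau> w = \<tau> ((ns_beta l 0 ^^ t) w)"
proof (induction t arbitrary: w)
  case (Suc t)
  have "(beta_rot ^^ Suc t) \<tau> w = (beta_rot ^^ t) \<tau> (ns_beta l 0 w)"
    using Suc.prems by (simp add: beta_rot_def compose_def)
  then show ?case using Suc by (simp add: beta_words funpow_swap1)
qed simp

lemma child_zero_column: "child i 0 (zero_column i \<tau>) = zero_column (Suc i) \<tau>"
  using l_pos[of "Suc i"] by (auto simp: child_def zero_column_def fun_eq_iff replicate_append_same[symmetric])

text \<open>
  Below \<open>0\<^sup>i\<^sup>-\<^sup>1 y\<^sub>i\<close>, and for \<open>i = 0\<close> at the root, powers of the generator rotate the next letter.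
\<close>

lemma child_half_column_rot:
  assumes "x < l (Suc i)"
  shows "child i x (half_column i ((rot i ^^ t) \<tau>)) = child i ((x + t) mod l (Suc i)) (half_column i \<tau>)"
proof
  fix w
  have lt: "(x + t) mod l (Suc i) < l (Suc i)" using l_pos[of "Suc i"] by simp
  show "child i x (half_column i ((rot i ^^ t) \<tau>)) w = child i ((x + t) mod l (Suc i)) (half_column i \<tau>) w"
  proof (cases i)
    case 0
    then show ?thesis using assms lt
      by (auto simp: child_def half_column_def zero_column_def rot_def alpha_rot_pow alpha_pow)
  next
    case (Suc j)
    show ?thesis
    proof (cases "w \<in> words l (Suc i)")
      case True
      have "replicate j 0 @ half (Suc j) # x # w \<in> words l 0"
        using True assms Suc half[of "Suc j"] by (simp add: zeros_words)
      then show ?thesis using True assms lt Suc half[of "Suc j"]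
        by (simp add: child_def half_column_def zero_column_def rot_def beta_rot_pow beta_pow_zeros beta_pow_half alpha_pow)
    qed (simp add: child_def)
  qed
qed

text \<open>
  The power of \<open>\<beta>\<close> that exchanges the children at level \<open>i\<close> rotates the letter at every earlier level
  \<open>m\<close> by a multiple of \<open>l (m + 1)\<close>.
\<close>

lemma half_column_rot_fix:
  assumes "1 \<le> m" "m < i"
  shows "half_column m ((beta_rot ^^ half (Suc i)) \<tau>) = half_column m \<tau>"
proof
  obtain j where j: "m = Suc j" using assms by (cases m) auto
  fix w
  show "half_column m ((beta_rot ^^ half (Suc i)) \<tau>) w = half_column m \<tau> w"
  proof (cases "w \<in> words l m")
    case True
    have word: "replicate j 0 @ half (Suc j) # w \<in> words l 0"
      using True j half[of "Suc j"] by (simp add: zeros_words)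
    have "(ns_alpha l m ^^ half (Suc i)) w = w"
    proof (cases w)
      case (Cons x w')
      have "l (Suc m) dvd half (Suc i)" using assms by (intro l_dvd_half) auto
      then have "(x + half (Suc i)) mod l (Suc m) = x" using True Cons by (auto elim!: dvdE)
      then show ?thesis using True Cons by (simp add: alpha_pow)
    qed simp
    then show ?thesis using True word j half[of "Suc j"]
      by (simp add: half_column_def child_def zero_column_def beta_rot_pow beta_pow_zeros beta_pow_half)
  qed (simp add: half_column_def child_def j)
qed

lemma half_column_Suc: "half_column (Suc i) \<tau> = child i (half (Suc i)) (zero_column i \<tau>)" by (simp add: half_column_def)

lemma half_column_0: "half_column 0 \<tau> = zero_column 0 \<tau>" by (simp add: half_column_def)

end

locale almost_invariant = weighted D F + ns_sequence l
    for D :: "(nat list \<Rightarrow> nat list) set" and F l +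
  fixes \<epsilon> :: real
  assumes eps_pos: "0 < \<epsilon>"
    and alpha_rot_cost: "\<And>\<phi> M. (\<And>\<tau>. \<bar>\<phi> \<tau>\<bar> \<le> M) \<Longrightarrow> \<bar>E \<phi> - E (\<lambda>\<tau>. \<phi> (alpha_rot \<tau>))\<bar> \<le> M * \<epsilon>"
    and beta_rot_cost: "\<And>\<phi> M. (\<And>\<tau>. \<bar>\<phi> \<tau>\<bar> \<le> M) \<Longrightarrow> \<bar>E \<phi> - E (\<lambda>\<tau>. \<phi> (beta_rot \<tau>))\<bar> \<le> M * \<epsilon>"
begin

lemma rot_pow_cost:
  assumes "\<And>\<tau>. \<bar>\<phi> \<tau>\<bar> \<le> M"
  shows "\<bar>E \<phi> - E (\<lambda>\<tau>. \<phi> ((rot i ^^ t) \<tau>))\<bar> \<le> M * (real t * \<epsilon>)"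
proof (induction t)
  case (Suc t)
  have "\<bar>E (\<lambda>\<tau>. \<phi> ((rot i ^^ t) \<tau>)) - E (\<lambda>\<tau>. \<phi> ((rot i ^^ t) (rot i \<tau>)))\<bar> \<le> M * \<epsilon>"
    using alpha_rot_cost[of "\<lambda>\<tau>. \<phi> ((alpha_rot ^^ t) \<tau>)" M] beta_rot_cost[of "\<lambda>\<tau>. \<phi> ((beta_rot ^^ t) \<tau>)" M] assms
    by (cases "i = 0") (simp_all add: rot_def)
  then show ?case using Suc by (simp add: funpow_swap1 ring_distribs)
qed simp

sublocale tower: flip_tower D F zero_column half_column "\<lambda>i. child i 0" "\<lambda>i. child i (half (Suc i))"
    "\<lambda>i. rot i ^^ half (Suc i)" "\<lambda>i. real (half (Suc i)) * \<epsilon>"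
proof
  fix i :: nat and x :: "nat list \<Rightarrow> nat list"
  show "half_column 0 x = zero_column 0 x" by (rule half_column_0)
  show "child i 0 (zero_column i x) = zero_column (Suc i) x" by (rule child_zero_column)
  show "child i (half (Suc i)) (zero_column i x) = half_column (Suc i) x" by (simp add: half_column_Suc)
  show "child i 0 (half_column i ((rot i ^^ half (Suc i)) x)) = child i (half (Suc i)) (half_column i x)"
    using half[of "Suc i"] by (simp add: child_half_column_rot)
  show "child i (half (Suc i)) (half_column i ((rot i ^^ half (Suc i)) x)) = child i 0 (half_column i x)"
    using half[of "Suc i"] by (simp add: child_half_column_rot flip: mult_2)
  show "half_column m ((rot i ^^ half (Suc i)) x) = half_column m x" if "1 \<le> m" "m < i" for m
    using that by (simp add: rot_def half_column_rot_fix)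
  show "\<bar>E \<phi> - E (\<lambda>x. \<phi> ((rot i ^^ half (Suc i)) x))\<bar> \<le> M * (real (half (Suc i)) * \<epsilon>)"
    if "\<And>x. \<bar>\<phi> x\<bar> \<le> M" for \<phi> M by (rule rot_pow_cost[OF that])
  show "0 < real (half (Suc i)) * \<epsilon>" using eps_pos half[of "Suc i"] by simp
  have "2 * half (Suc i) \<le> half (Suc (Suc i))" using l_double[of "Suc i"] by simp
  then have "real (2 * half (Suc i)) * \<epsilon> \<le> real (half (Suc (Suc i))) * \<epsilon>"
    using eps_pos by (intro mult_right_mono) (simp_all only: of_nat_le_iff less_imp_le)
  then show "2 * (real (half (Suc i)) * \<epsilon>) \<le> real (half (Suc (Suc i))) * \<epsilon>" by simp
qed

lemma tv_columns:
  assumes "1 \<le> k \<Longrightarrow> real (l k) * \<epsilon> \<le> C" "C \<le> 1" "\<And>P. \<bar>s P\<bar> \<le> 1"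
  shows "\<bar>E (\<lambda>\<tau>. s (zero_column k \<tau>)) - E (\<lambda>\<tau>. s (half_column k \<tau>))\<bar>
     \<le> (if k = 0 then 0 else 64 * C * (2 ^ 58 + log 2 (1 / C)))"
proof (cases k)
  case 0 then show ?thesis by (simp add: half_column_0)
next
  case (Suc j)
  have "real (half (Suc j)) * \<epsilon> \<le> real (l (Suc j)) * \<epsilon>"
    using eps_pos half[of "Suc j"] by (intro mult_right_mono) auto
  then show ?thesis using tower.tv_bound[of k C s] assms Suc by simp
qed

text \<open>
  Pass from the subtree below \<open>0\<^sup>k\<close> to the one below \<open>0\<^sup>k\<^sup>-\<^sup>1 y\<^sub>k\<close>, average over \<open>m\<close> rotations there, and
  pass back.
\<close>

lemma spread_step:
  assumes m: "1 \<le> m" "m \<le> l (Suc k)" and C: "1 \<le> k \<Longrightarrow> real (l k) * \<epsilon> \<le> C" "C \<le> 1" and s: "\<And>P. \<bar>s P\<bar> \<le> 1"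
  shows "E (\<lambda>\<tau>. s (zero_column (Suc k) \<tau>)) \<le> E (\<lambda>\<tau>. (\<Sum>t<m. s (child k t (zero_column k \<tau>))) / real m)
     + (if k = 0 then 0 else 128 * C * (2 ^ 58 + log 2 (1 / C))) + real m * \<epsilon>"
proof -
  let ?t = "if k = 0 then 0 else 64 * C * (2 ^ 58 + log 2 (1 / C))"
  let ?avg = "\<lambda>P. (\<Sum>t<m. s (child k t P)) / real m"
  have avg1: "\<bar>?avg P\<bar> \<le> 1" for P
  proof -
    have "\<bar>\<Sum>t<m. s (child k t P)\<bar> \<le> (\<Sum>t<m. 1)" by (intro order_trans[OF sum_abs] sum_mono s)
    then show ?thesis using m by simp
  qed
  have "E (\<lambda>\<tau>. s (zero_column (Suc k) \<tau>)) = E (\<lambda>\<tau>. s (child k 0 (zero_column k \<tau>)))" by (simp add: child_zero_column)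
  also have "\<dots> \<le> E (\<lambda>\<tau>. s (child k 0 (half_column k \<tau>))) + ?t"
    using tv_columns[OF C, of "\<lambda>P. s (child k 0 P)"] s by (simp add: abs_le_iff)
  also have "E (\<lambda>\<tau>. s (child k 0 (half_column k \<tau>))) \<le> E (\<lambda>\<tau>. ?avg (half_column k \<tau>)) + real m * \<epsilon>"
  proof -
    have "E (\<lambda>\<tau>. s (child k 0 (half_column k \<tau>))) \<le> E (\<lambda>\<tau>. s (child k t (half_column k \<tau>))) + real m * \<epsilon>" if "t < m" for t
    proof -
      have "\<bar>E (\<lambda>\<tau>. s (child k 0 (half_column k \<tau>))) - E (\<lambda>\<tau>. s (child k 0 (half_column k ((rot k ^^ t) \<tau>))))\<bar> \<le> 1 * (real t * \<epsilon>)"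
        by (rule rot_pow_cost[OF s])
      moreover have "child k 0 (half_column k ((rot k ^^ t) \<tau>)) = child k t (half_column k \<tau>)" for \<tau>
        using child_half_column_rot[of 0 k t \<tau>] that m l_pos[of "Suc k"] by simp
      moreover have "real t * \<epsilon> \<le> real m * \<epsilon>" using that eps_pos by (intro mult_right_mono) auto
      ultimately show ?thesis by simp
    qed
    then have "(\<Sum>t<m. E (\<lambda>\<tau>. s (child k 0 (half_column k \<tau>)))) \<le> (\<Sum>t<m. E (\<lambda>\<tau>. s (child k t (half_column k \<tau>))) + real m * \<epsilon>)"
      by (intro sum_mono) auto
    then have "real m * E (\<lambda>\<tau>. s (child k 0 (half_column k \<tau>))) \<le> E (\<lambda>\<tau>. \<Sum>t<m. s (child k t (half_column k \<tau>))) + real m * (real m * \<epsilon>)"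
      by (simp add: E_sum sum.distrib)
    moreover have "E (\<lambda>\<tau>. \<Sum>t<m. s (child k t (half_column k \<tau>))) = real m * E (\<lambda>\<tau>. ?avg (half_column k \<tau>))"
      unfolding E_cmult[symmetric] using m by simp
    ultimately have "real m * E (\<lambda>\<tau>. s (child k 0 (half_column k \<tau>))) \<le> real m * (E (\<lambda>\<tau>. ?avg (half_column k \<tau>)) + real m * \<epsilon>)"
      by (simp add: ring_distribs)
    then show ?thesis using m by simp
  qed
  also have "E (\<lambda>\<tau>. ?avg (half_column k \<tau>)) \<le> E (\<lambda>\<tau>. ?avg (zero_column k \<tau>)) + ?t"
    using tv_columns[OF C, of ?avg] avg1 by (simp add: abs_le_iff)
  finally show ?thesis by (cases "k = 0") auto
qed

context
  fixes n :: nat and m :: "nat \<Rightarrow> nat" and Z :: "nat list set"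
  assumes m: "\<And>k. k < n \<Longrightarrow> 1 \<le> m k" "\<And>k. k < n \<Longrightarrow> m k \<le> l (Suc k)" and Z: "finite Z"
begin

text \<open>
  The proportion of the words of a box of side lengths \<open>m k\<close> that the column sends into \<open>Z\<close>.
\<close>

fun density :: "nat \<Rightarrow> (nat list \<Rightarrow> nat list) \<Rightarrow> real" where
  "density 0 P = of_bool (P [] \<in> Z)"
| "density (Suc j) P = (\<Sum>t<m (n - Suc j). density j (child (n - Suc j) t P)) / real (m (n - Suc j))"

lemma density_bounds: "j \<le> n \<Longrightarrow> 0 \<le> density j P \<and> density j P \<le> 1"
proof (induction j arbitrary: P)
  case (Suc j)
  have "(\<Sum>t<m (n - Suc j). density j (child (n - Suc j) t P)) \<le> (\<Sum>t<m (n - Suc j). 1)"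
    using Suc by (intro sum_mono) auto
  then show ?case using Suc m[of "n - Suc j"] by (auto intro!: sum_nonneg divide_nonneg_nonneg simp: divide_le_eq)
qed simp

text \<open>
  The images of the children of an injective column are disjoint.
\<close>

lemma density_count:
  "j \<le> n \<Longrightarrow> inj_on P (words l (n - j)) \<Longrightarrow>
     (\<Prod>i=n-j..<n. real (m i)) * density j P \<le> real (card (Z \<inter> P ` words l (n - j)))"
proof (induction j arbitrary: P)
  case 0
  show ?case
  proof (cases "P [] \<in> Z")
    case True
    then have "P [] \<in> Z \<inter> P ` words l n" by auto
    then have "0 < card (Z \<inter> P ` words l n)" using Z by (auto simp: card_gt_0_iff)
    then show ?thesis using True by simp
  qed simp
next
  case (Suc j)
  let ?k = "n - Suc j"
  have k: "Suc ?k = n - j" "?k < n" using Suc.prems by auto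
  have cw: "child ?k t P w = P (t # w)" if "w \<in> words l (n - j)" for t w
    using that k by (simp add: child_def)
  have tw: "t # w \<in> words l ?k" if "t < m ?k" "w \<in> words l (n - j)" for t w
    using that k m[of ?k] by auto
  have inj: "inj_on (child ?k t P) (words l (n - j))" if "t < m ?k" for t
  proof (rule inj_onI)
    fix x y assume xy: "x \<in> words l (n - j)" "y \<in> words l (n - j)" "child ?k t P x = child ?k t P y"
    then have "P (t # x) = P (t # y)" using cw by simp
    then show "x = y" using inj_onD[OF Suc.prems(2) _ tw[OF that xy(1)] tw[OF that xy(2)]] by simp
  qed
  have "(\<Prod>i=?k..<n. real (m i)) * density (Suc j) P
      = (\<Prod>i=n-j..<n. real (m i)) * (\<Sum>t<m ?k. density j (child ?k t P))"
    using k m[of ?k] by (simp add: prod.atLeast_Suc_lessThan)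
  also have "\<dots> = (\<Sum>t<m ?k. (\<Prod>i=n-j..<n. real (m i)) * density j (child ?k t P))"
    by (simp add: sum_distrib_left)
  also have "\<dots> \<le> (\<Sum>t<m ?k. real (card (Z \<inter> child ?k t P ` words l (n - j))))"
    using Suc inj by (intro sum_mono Suc.IH) auto
  also have "\<dots> = real (card (\<Union>t<m ?k. Z \<inter> child ?k t P ` words l (n - j)))"
  proof (subst card_UN_disjoint)
    show "\<forall>t\<in>{..<m ?k}. \<forall>t'\<in>{..<m ?k}. t \<noteq> t' \<longrightarrow>
       (Z \<inter> child ?k t P ` words l (n - j)) \<inter> (Z \<inter> child ?k t' P ` words l (n - j)) = {}"
    proof (intro ballI impI)
      fix t t' assume t: "t \<in> {..<m ?k}" "t' \<in> {..<m ?k}" "t \<noteq> t'"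
      have "child ?k t P w \<noteq> child ?k t' P w'" if "w \<in> words l (n - j)" "w' \<in> words l (n - j)" for w w'
        using that t inj_onD[OF Suc.prems(2), of "t # w" "t' # w'"] tw by (auto simp: cw)
      then show "(Z \<inter> child ?k t P ` words l (n - j)) \<inter> (Z \<inter> child ?k t' P ` words l (n - j)) = {}" by auto
    qed
  qed (use Z in auto)
  also have "\<dots> \<le> real (card (Z \<inter> P ` words l ?k))"
    using Z tw by (intro of_nat_mono card_mono) (auto simp: cw)
  finally show ?case .
qed

lemma density_descent:
  assumes C: "\<And>k. 1 \<le> k \<Longrightarrow> k < n \<Longrightarrow> real (l k) * \<epsilon> \<le> C k" "\<And>k. C k \<le> 1"
  shows "j \<le> n \<Longrightarrow> E (\<lambda>\<tau>. density 0 (zero_column n \<tau>)) \<le> E (\<lambda>\<tau>. density j (zero_column (n - j) \<tau>))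
     + (\<Sum>k=n-j..<n. (if k = 0 then 0 else 128 * C k * (2 ^ 58 + log 2 (1 / C k))) + real (m k) * \<epsilon>)"
proof (induction j)
  case (Suc j)
  let ?k = "n - Suc j"
  have k: "Suc ?k = n - j" "?k < n" using Suc.prems by auto
  have "E (\<lambda>\<tau>. density j (zero_column (Suc ?k) \<tau>)) \<le> E (\<lambda>\<tau>. (\<Sum>t<m ?k. density j (child ?k t (zero_column ?k \<tau>))) / real (m ?k))
     + (if ?k = 0 then 0 else 128 * C ?k * (2 ^ 58 + log 2 (1 / C ?k))) + real (m ?k) * \<epsilon>"
    using m[of ?k] k C Suc.prems density_bounds[of j] by (intro spread_step) auto
  then show ?case using Suc k by (simp add: sum.atLeast_Suc_lessThan)
qed simp

end

lemma sum_dyadic: "(\<Sum>j<N. 1 / 2 ^ j) \<le> (2 :: real)" "(\<Sum>j<N. real j / 2 ^ j) \<le> 4"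
  using geometric_bound[of "1/2" N] geometric_bound1[of "1/2" N]
  by (simp_all add: power_one_over divide_simps power2_eq_square)

text \<open>
  Apply \<open>spread_step\<close> at every level from \<open>n - 1\<close> to the root, with \<open>q\<close> rotations at level \<open>n - 1\<close>
  and full rotations above. The errors decay geometrically towards the root, and at the root the
  density of \<open>Z\<close> in a box of \<open>V\<^sub>n\<^sub>-\<^sub>1 q\<close> words is at most 1/16.
\<close>

theorem base_point_spreads:
  assumes n: "2 \<le> n" and q: "l (n - 1) \<le> q" "q \<le> l n" and eps: "\<epsilon> * real q \<le> 1 / 2 ^ 80"
    and Z: "finite Z" "16 * card Z \<le> level_size l (n - 1) * q"
    and inj: "\<And>\<tau>. \<tau> \<in> D \<Longrightarrow> inj_on \<tau> (words l 0)"
  shows "E (\<lambda>\<tau>. of_bool (\<tau> (replicate n 0) \<in> Z)) \<le> 1 / 8"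
proof -
  define m where "m k = (if k = n - 1 then q else l (Suc k))" for k
  have q1: "1 \<le> q" using q l_ge2[of "n - 1"] n by linarith
  have m1: "1 \<le> m k" if "k < n" for k using that q1 l_ge2[of "Suc k"] by (simp add: m_def)
  have m2: "m k \<le> l (Suc k)" if "k < n" for k using that q n by (simp add: m_def)
  \<comment> \<open>an upper bound for the cost of a full rotation of the letter at level \<open>k\<close>\<close>
  define C where "C k = 1 / 2 ^ (n - 1 - k) / (2 :: real) ^ 80" for k
  have lk: "real (l k) \<le> real (l (n - 1)) / 2 ^ (n - 1 - k)" if "1 \<le> k" "k < n" for k
  proof -
    have "2 ^ j * l k \<le> l (k + j)" for j
    proof (induction j)
      case (Suc j) then show ?case using l_double[of "k + j"] that by simp
    qed simp
    from this[of "n - 1 - k"] have "2 ^ (n - 1 - k) * l k \<le> l (n - 1)" using that by simp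
    then have "real (2 ^ (n - 1 - k) * l k) \<le> real (l (n - 1))" by (simp only: of_nat_le_iff)
    then show ?thesis by (simp add: field_simps)
  qed
  have lC: "real (l k) * \<epsilon> \<le> C k" if "1 \<le> k" "k < n" for k
  proof -
    have "real (l k) * \<epsilon> \<le> real (l (n - 1)) / 2 ^ (n - 1 - k) * \<epsilon>"
      using lk[OF that] eps_pos by (intro mult_right_mono) auto
    also have "\<dots> = (\<epsilon> * real (l (n - 1))) / 2 ^ (n - 1 - k)" by simp
    also have "\<dots> \<le> (1 / 2 ^ 80) / 2 ^ (n - 1 - k)"
    proof (rule divide_right_mono)
      have "\<epsilon> * real (l (n - 1)) \<le> \<epsilon> * real q" using q eps_pos by (intro mult_left_mono) auto
      then show "\<epsilon> * real (l (n - 1)) \<le> 1 / 2 ^ 80" using eps by linarith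
    qed simp
    finally show ?thesis by (simp add: C_def)
  qed
  have C1: "C k \<le> 1" for k
  proof -
    have "1 / 2 ^ (n - 1 - k) \<le> (1 :: real)" by simp
    then show ?thesis unfolding C_def by (rule order_trans[OF divide_right_mono[where c="2^80"]]) simp_all
  qed
  have "E (\<lambda>\<tau>. density n m Z 0 (zero_column n \<tau>)) \<le> E (\<lambda>\<tau>. density n m Z n (zero_column (n - n) \<tau>))
     + (\<Sum>k=n-n..<n. (if k = 0 then 0 else 128 * C k * (2 ^ 58 + log 2 (1 / C k))) + real (m k) * \<epsilon>)"
    by (rule density_descent) (use m1 m2 Z lC C1 in auto)
  moreover have "density n m Z 0 (zero_column n \<tau>) = of_bool (\<tau> (replicate n 0) \<in> Z)" for \<tau>
    by (simp add: zero_column_def density.simps[OF m1 m2 Z(1)])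
  moreover have "E (\<lambda>\<tau>. density n m Z n (zero_column (n - n) \<tau>)) \<le> E (\<lambda>\<tau>. 1 / 16)"
  proof (rule E_mono)
    fix \<tau> assume \<tau>: "\<tau> \<in> D"
    have "(\<Prod>i=0..<n. m i) = level_size l (n - 1) * q"
    proof -
      have "(\<Prod>i=0..<n. m i) = (\<Prod>i=0..<n-1. m i) * m (n - 1)"
        using n by (metis One_nat_def Suc_diff_le diff_Suc_Suc diff_zero le0 numeral_2_eq_2 prod.atLeast0_lessThan_Suc Suc_le_D)
      also have "(\<Prod>i=0..<n-1. m i) = (\<Prod>i=0..<n-1. l (Suc i))" by (intro prod.cong) (auto simp: m_def)
      also have "\<dots> = level_size l (n - 1)"
        unfolding level_size_def by (simp add: prod.shift_bounds_Suc_ivl[symmetric] atLeastLessThanSuc_atLeastAtMost)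
      finally show ?thesis by (simp add: m_def)
    qed
    then have P: "(\<Prod>i=0..<n. real (m i)) = real (level_size l (n - 1) * q)" by (metis of_nat_prod)
    have pos: "0 < (\<Prod>i=0..<n. real (m i))" using m1 by (intro prod_pos) fastforce
    have "(\<Prod>i=n-n..<n. real (m i)) * density n m Z n (zero_column 0 \<tau>) \<le> real (card (Z \<inter> zero_column 0 \<tau> ` words l (n - n)))"
    proof (rule density_count[OF m1 m2 Z(1)])
      show "inj_on (zero_column 0 \<tau>) (words l (n - n))" using inj[OF \<tau>] by (auto simp: inj_on_def zero_column_def)
    qed auto
    also have "\<dots> \<le> real (card Z)" using Z by (intro of_nat_mono card_mono) auto
    also have "16 * card Z \<le> (\<Prod>i=0..<n. real (m i))" using Z unfolding P by (metis of_nat_le_iff of_nat_mult of_nat_numeral)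
    then have "real (card Z) \<le> (\<Prod>i=0..<n. real (m i)) * (1 / 16)" by simp
    finally show "density n m Z n (zero_column (n - n) \<tau>) \<le> 1 / 16" using pos by simp
  qed
  moreover have "(\<Sum>k=n-n..<n. (if k = 0 then 0 else 128 * C k * (2 ^ 58 + log 2 (1 / C k))) + real (m k) * \<epsilon>) \<le> 1 / 16"
  proof -
    have logC: "log 2 (1 / C k) = real (n - 1 - k) + 80" for k
    proof -
      have "1 / C k = 2 ^ (n - 1 - k + 80)" by (simp add: C_def power_add)
      then show ?thesis by (simp only: log_pow_cancel)
    qed
    have "(\<Sum>k=0..<n. (if k = 0 then 0 else 128 * C k * (2 ^ 58 + log 2 (1 / C k)))) \<le> 1 / 2 ^ 10"
    proof -
      have "(\<Sum>k=0..<n. (if k = 0 then 0 else 128 * C k * (2 ^ 58 + log 2 (1 / C k))))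
         \<le> (\<Sum>k=0..<n. (2 ^ 59 / 2 ^ 73) * (1 / 2 ^ (n - Suc k)) + (1 / 2 ^ 73) * (real (n - Suc k) / 2 ^ (n - Suc k)))"
      proof (rule sum_mono)
        fix k
        have "128 * C k * (2 ^ 58 + log 2 (1 / C k)) \<le> (2 ^ 59 / 2 ^ 73) * (1 / 2 ^ (n - Suc k)) + (1 / 2 ^ 73) * (real (n - Suc k) / 2 ^ (n - Suc k))"
          unfolding logC by (simp add: C_def field_simps)
        then show "(if k = 0 then 0 else 128 * C k * (2 ^ 58 + log 2 (1 / C k)))
          \<le> (2 ^ 59 / 2 ^ 73) * (1 / 2 ^ (n - Suc k)) + (1 / 2 ^ 73) * (real (n - Suc k) / 2 ^ (n - Suc k))" by simp
      qed
      also have "\<dots> = (\<Sum>j<n. (2 ^ 59 / 2 ^ 73) * (1 / 2 ^ j) + (1 / 2 ^ 73) * (real j / 2 ^ j))"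
        unfolding lessThan_atLeast0[symmetric] by (rule sum.nat_diff_reindex)
      also have "\<dots> = (2 ^ 59 / 2 ^ 73) * (\<Sum>j<n. 1 / 2 ^ j) + (1 / 2 ^ 73) * (\<Sum>j<n. real j / 2 ^ j)"
        by (simp only: sum.distrib sum_distrib_left)
      also have "\<dots> \<le> (2 ^ 59 / 2 ^ 73) * 2 + (1 / 2 ^ 73) * 4"
        by (intro add_mono mult_left_mono sum_dyadic) auto
      also have "\<dots> \<le> 1 / 2 ^ 10" by simp
      finally show ?thesis .
    qed
    moreover have "(\<Sum>k=0..<n. real (m k) * \<epsilon>) \<le> 5 / 2 ^ 80"
    proof -
      have "(\<Sum>k=0..<n. real (m k)) \<le> (\<Sum>k=0..<n. real q * of_bool (k = n - 1) + 2 * real q * (1 / 2 ^ (n - Suc k)))"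
      proof (rule sum_mono)
        fix k assume k: "k \<in> {0..<n}"
        show "real (m k) \<le> real q * of_bool (k = n - 1) + 2 * real q * (1 / 2 ^ (n - Suc k))"
        proof (cases "k = n - 1")
          case False
          then have "real (m k) \<le> real (l (n - 1)) / 2 ^ (n - 1 - Suc k)" using k lk[of "Suc k"] by (simp add: m_def)
          also have "\<dots> \<le> real q / 2 ^ (n - 1 - Suc k)" using q by (intro divide_right_mono) auto
          also have "\<dots> = 2 * real q * (1 / 2 ^ (n - Suc k))"
          proof -
            have "n - Suc k = Suc (n - 1 - Suc k)" using False k by auto
            then show ?thesis by simp
          qed
          finally show ?thesis using False by simp
        qed (simp add: m_def)
      qed
      also have "\<dots> = (\<Sum>k=0..<n. real q * of_bool (k = n - 1)) + (\<Sum>k=0..<n. 2 * real q * (1 / 2 ^ (n - Suc k)))"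
        by (rule sum.distrib)
      also have "(\<Sum>k=0..<n. real q * of_bool (k = n - 1)) = real q"
      proof -
        have "{0..<n} \<inter> {k. k = n - 1} = {n - 1}" using n by auto
        then show ?thesis by (simp flip: sum_distrib_left)
      qed
      also have "(\<Sum>k=0..<n. 2 * real q * (1 / 2 ^ (n - Suc k))) = (\<Sum>j<n. 2 * real q * (1 / 2 ^ j))"
        unfolding lessThan_atLeast0[symmetric] by (rule sum.nat_diff_reindex)
      also have "\<dots> \<le> 2 * real q * 2" using sum_dyadic(1)[of n] by (simp only: sum_distrib_left[symmetric] mult_left_mono)
      finally have "\<epsilon> * (\<Sum>k=0..<n. real (m k)) \<le> \<epsilon> * (5 * real q)" using eps_pos by (intro mult_left_mono) auto
      then show ?thesis using eps by (simp add: sum_distrib_left mult.commute)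
    qed
    ultimately show ?thesis by (simp add: sum.distrib)
  qed
  ultimately show ?thesis by (simp add: E_const)
qed
end

section \<open>Displacement energies\<close>

definition displacement :: "nat \<Rightarrow> ('a, 'b) monoid_scheme \<Rightarrow> 'a \<Rightarrow> ('a \<Rightarrow> real) \<Rightarrow> real" where
  "displacement p G h f = (\<Sum>\<^sub>\<infinity>x\<in>carrier G. \<bar>f (h \<otimes>\<^bsub>G\<^esub> x) - f x\<bar> ^ p)"

lemma power_sum_bound: "p = 1 \<or> p = 2 \<Longrightarrow> \<bar>a + b :: real\<bar> ^ p \<le> 2 * (\<bar>a\<bar> ^ p + \<bar>b\<bar> ^ p)"
  using sum_squares_bound[of a b] by (auto simp: power2_eq_square algebra_simps abs_if)

lemma infsum_finite_support:
  assumes "finite T" "T \<subseteq> A" "\<And>x. x \<in> A \<Longrightarrow> x \<notin> T \<Longrightarrow> f x = 0"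
  shows "infsum f A = sum f T"
  using assms by (subst infsum_cong_neutral[of T A f f]) auto

context group
begin

lemma displaced_support:
  assumes "h \<in> carrier G" "finite (supp G f)"
  shows "finite {x \<in> carrier G. f (h \<otimes> x) \<noteq> 0}"
proof (rule finite_subset)
  show "{x \<in> carrier G. f (h \<otimes> x) \<noteq> 0} \<subseteq> (\<lambda>y. inv h \<otimes> y) ` supp G f"
  proof
    fix x assume "x \<in> {x \<in> carrier G. f (h \<otimes> x) \<noteq> 0}"
    then show "x \<in> (\<lambda>y. inv h \<otimes> y) ` supp G f"
      using assms by (intro image_eqI[of _ _ "h \<otimes> x"]) (auto simp: supp_def m_assoc[symmetric])
  qed
qed (use assms in auto)

lemma displacement_finite:
  assumes h: "h \<in> carrier G" and f: "finite (supp G f)" and p: "0 < p"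
    and T: "finite T" "T \<subseteq> carrier G" "supp G f \<subseteq> T" "{x \<in> carrier G. f (h \<otimes> x) \<noteq> 0} \<subseteq> T"
  shows "displacement p G h f = (\<Sum>x\<in>T. \<bar>f (h \<otimes> x) - f x\<bar> ^ p)"
  unfolding displacement_def
proof (rule infsum_finite_support[OF T(1,2)])
  fix x assume "x \<in> carrier G" "x \<notin> T"
  then have "f x = 0" "f (h \<otimes> x) = 0" using T by (auto simp: supp_def)
  then show "\<bar>f (h \<otimes> x) - f x\<bar> ^ p = 0" using p by simp
qed

lemma displacement_le:
  assumes h: "h \<in> carrier G" and f: "finite (supp G f)" and p: "0 < p" and T: "finite T" "T \<subseteq> carrier G"
  shows "(\<Sum>x\<in>T. \<bar>f (h \<otimes> x) - f x\<bar> ^ p) \<le> displacement p G h f"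
proof -
  let ?T = "T \<union> supp G f \<union> {x \<in> carrier G. f (h \<otimes> x) \<noteq> 0}"
  have "displacement p G h f = (\<Sum>x\<in>?T. \<bar>f (h \<otimes> x) - f x\<bar> ^ p)"
    using displaced_support[OF h f] f T by (intro displacement_finite h f p) (auto simp: supp_def)
  moreover have "(\<Sum>x\<in>T. \<bar>f (h \<otimes> x) - f x\<bar> ^ p) \<le> (\<Sum>x\<in>?T. \<bar>f (h \<otimes> x) - f x\<bar> ^ p)"
    using displaced_support[OF h f] f T by (intro sum_mono2) auto
  ultimately show ?thesis by simp
qed

lemma displacement_nonneg: "0 \<le> displacement p G h f"
  unfolding displacement_def by (rule infsum_nonneg) auto

lemma displacement_one: "0 < p \<Longrightarrow> displacement p G \<one> f = 0"
proof -
  assume "0 < p"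
  then have "displacement p G \<one> f = infsum (\<lambda>_. 0) (carrier G)"
    unfolding displacement_def by (intro infsum_cong) auto
  then show ?thesis by simp
qed

lemma bij_left_mult: "h \<in> carrier G \<Longrightarrow> bij_betw (\<lambda>x. h \<otimes> x) (carrier G) (carrier G)"
  by (rule bij_betwI[where g = "\<lambda>x. inv h \<otimes> x"]) (auto simp: m_assoc[symmetric])

lemma displacement_inv:
  assumes "h \<in> carrier G"
  shows "displacement p G (inv h) f = displacement p G h f"
proof -
  have "displacement p G (inv h) f = (\<Sum>\<^sub>\<infinity>x\<in>carrier G. \<bar>f (inv h \<otimes> (h \<otimes> x)) - f (h \<otimes> x)\<bar> ^ p)"
    unfolding displacement_def
    by (rule infsum_reindex_bij_betw[OF bij_left_mult[OF assms], symmetric, of "\<lambda>x. \<bar>f (inv h \<otimes> x) - f x\<bar> ^ p"])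
  also have "\<dots> = displacement p G h f"
    unfolding displacement_def using assms
    by (intro infsum_cong) (simp add: m_assoc[symmetric] abs_minus_commute)
  finally show ?thesis .
qed

lemma displacement_mult:
  assumes h: "h \<in> carrier G" "k \<in> carrier G" and f: "finite (supp G f)" and p: "p = 1 \<or> p = 2"
  shows "displacement p G (h \<otimes> k) f \<le> 2 * (displacement p G h f + displacement p G k f)"
proof -
  let ?T = "supp G f \<union> {x \<in> carrier G. f (h \<otimes> k \<otimes> x) \<noteq> 0}"
  have T: "finite ?T" "?T \<subseteq> carrier G" using displaced_support[of "h \<otimes> k" f] f h by (auto simp: supp_def)
  have p0: "0 < p" using p by auto
  have "displacement p G (h \<otimes> k) f = (\<Sum>x\<in>?T. \<bar>f (h \<otimes> k \<otimes> x) - f x\<bar> ^ p)"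
    using T h by (intro displacement_finite f p0) auto
  also have "\<dots> \<le> (\<Sum>x\<in>?T. 2 * (\<bar>f (h \<otimes> (k \<otimes> x)) - f (k \<otimes> x)\<bar> ^ p + \<bar>f (k \<otimes> x) - f x\<bar> ^ p))"
  proof (rule sum_mono)
    fix x assume "x \<in> ?T"
    then have x: "x \<in> carrier G" using T by auto
    show "\<bar>f (h \<otimes> k \<otimes> x) - f x\<bar> ^ p \<le> 2 * (\<bar>f (h \<otimes> (k \<otimes> x)) - f (k \<otimes> x)\<bar> ^ p + \<bar>f (k \<otimes> x) - f x\<bar> ^ p)"
      using power_sum_bound[OF p, of "f (h \<otimes> (k \<otimes> x)) - f (k \<otimes> x)" "f (k \<otimes> x) - f x"] x h by (simp add: m_assoc)
  qed
  also have "\<dots> = 2 * ((\<Sum>x\<in>?T. \<bar>f (h \<otimes> (k \<otimes> x)) - f (k \<otimes> x)\<bar> ^ p) + (\<Sum>x\<in>?T. \<bar>f (k \<otimes> x) - f x\<bar> ^ p))"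
    by (simp only: sum_distrib_left[symmetric] sum.distrib)
  also have "(\<Sum>x\<in>?T. \<bar>f (h \<otimes> (k \<otimes> x)) - f (k \<otimes> x)\<bar> ^ p) = (\<Sum>y\<in>(\<lambda>x. k \<otimes> x) ` ?T. \<bar>f (h \<otimes> y) - f y\<bar> ^ p)"
  proof (subst sum.reindex)
    show "inj_on ((\<otimes>) k) ?T" by (rule inj_on_subset[OF bij_betw_imp_inj_on[OF bij_left_mult[OF h(2)]] T(2)])
  qed simp
  also have "\<dots> \<le> displacement p G h f"
    using T h by (intro displacement_le f p0) auto
  also have "(\<Sum>x\<in>?T. \<bar>f (k \<otimes> x) - f x\<bar> ^ p) \<le> displacement p G k f"
    using T h by (intro displacement_le f p0) auto
  finally show ?thesis by simp
qed

text \<open>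
  The displacement is subadditive up to a factor, so bounding it on generators bounds it on every
  fixed element; this makes the choice of the measure irrelevant up to constants.
\<close>

lemma displacement_generate:
  assumes p: "p = 1 \<or> p = 2" and H: "H \<subseteq> carrier G"
    and X: "\<And>f. finite (supp G f) \<Longrightarrow> 0 \<le> X f"
    and gen: "\<And>h. h \<in> H \<Longrightarrow> \<exists>C\<ge>0. \<forall>f. finite (supp G f) \<longrightarrow> displacement p G h f \<le> C * X f"
    and h: "h \<in> generate G H"
  shows "\<exists>C\<ge>0. \<forall>f. finite (supp G f) \<longrightarrow> displacement p G h f \<le> C * X f"
  using h
proof (induction rule: generate.induct)
  case one
  then show ?case using p X by (intro exI[of _ 0]) (auto simp: displacement_one)
next
  case (incl h) then show ?case by (rule gen)
next
  case (inv h)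
  then have "displacement p G (inv h) f = displacement p G h f" for f using H by (auto intro: displacement_inv)
  then show ?case using gen[OF inv] by simp
next
  case (eng h k)
  then obtain C1 C2 where C: "0 \<le> C1" "0 \<le> C2"
    "\<And>f. finite (supp G f) \<Longrightarrow> displacement p G h f \<le> C1 * X f"
    "\<And>f. finite (supp G f) \<Longrightarrow> displacement p G k f \<le> C2 * X f" by blast
  have hk: "h \<in> carrier G" "k \<in> carrier G" using eng.hyps generate_in_carrier[OF H] by auto
  have "displacement p G (h \<otimes> k) f \<le> (2 * (C1 + C2)) * X f" if f: "finite (supp G f)" for f
    using displacement_mult[OF hk f p] C(3)[OF f] C(4)[OF f] by (simp add: ring_distribs)
  then show ?case using C by (intro exI[of _ "2 * (C1 + C2)"]) auto
qed

lemma dirichlet_displacement: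
  assumes \<phi>: "finite (set_pmf \<phi>)" "set_pmf \<phi> \<subseteq> carrier G" and f: "finite (supp G f)" and p: "0 < p"
  shows "dirichlet p G \<phi> f = 1 / 2 * (\<Sum>y\<in>set_pmf \<phi>. pmf \<phi> y * displacement p G y f)"
proof -
  let ?T = "supp G f \<union> (\<Union>y\<in>set_pmf \<phi>. {x \<in> carrier G. f (y \<otimes> x) \<noteq> 0})"
  have T: "finite ?T" "?T \<subseteq> carrier G" using displaced_support[OF _ f] \<phi> f by (auto simp: supp_def)
  have "(\<Sum>\<^sub>\<infinity>(x, y)\<in>carrier G \<times> carrier G. \<bar>f (y \<otimes> x) - f x\<bar> ^ p * pmf \<phi> y)
     = (\<Sum>(x, y)\<in>?T \<times> set_pmf \<phi>. \<bar>f (y \<otimes> x) - f x\<bar> ^ p * pmf \<phi> y)"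
  proof (rule infsum_finite_support)
    fix z assume z: "z \<in> carrier G \<times> carrier G" "z \<notin> ?T \<times> set_pmf \<phi>"
    show "(case z of (x, y) \<Rightarrow> \<bar>f (y \<otimes> x) - f x\<bar> ^ p * pmf \<phi> y) = 0"
    proof (cases z)
      case (Pair x y)
      show ?thesis
      proof (cases "y \<in> set_pmf \<phi>")
        case True
        then have "f x = 0" "f (y \<otimes> x) = 0" using z Pair by (auto simp: supp_def)
        then show ?thesis using p Pair by simp
      qed (simp add: Pair set_pmf_iff)
    qed
  qed (use T \<phi> in auto)
  also have "\<dots> = (\<Sum>y\<in>set_pmf \<phi>. \<Sum>x\<in>?T. \<bar>f (y \<otimes> x) - f x\<bar> ^ p * pmf \<phi> y)"
    by (subst sum.swap) (simp add: sum.cartesian_product)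
  also have "\<dots> = (\<Sum>y\<in>set_pmf \<phi>. pmf \<phi> y * displacement p G y f)"
  proof (rule sum.cong[OF refl])
    fix y assume y: "y \<in> set_pmf \<phi>"
    have "displacement p G y f = (\<Sum>x\<in>?T. \<bar>f (y \<otimes> x) - f x\<bar> ^ p)"
      using T \<phi> y by (intro displacement_finite f p) auto
    then show "(\<Sum>x\<in>?T. \<bar>f (y \<otimes> x) - f x\<bar> ^ p * pmf \<phi> y) = pmf \<phi> y * displacement p G y f"
      by (simp add: sum_distrib_left mult.commute)
  qed
  finally show ?thesis by (simp add: dirichlet_def)
qed

lemma displacement_le_dirichlet:
  assumes \<phi>: "finite (set_pmf \<phi>)" "set_pmf \<phi> \<subseteq> carrier G" "generate G (set_pmf \<phi>) = carrier G"
    and p: "p = 1 \<or> p = 2" and h: "h \<in> carrier G"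
  shows "\<exists>C\<ge>0. \<forall>f. finite (supp G f) \<longrightarrow> displacement p G h f \<le> C * dirichlet p G \<phi> f"
proof (rule displacement_generate[OF p \<phi>(2)])
  have p0: "0 < p" using p by auto
  note dir = dirichlet_displacement[OF \<phi>(1,2) _ p0]
  show "0 \<le> dirichlet p G \<phi> f" if "finite (supp G f)" for f
    unfolding dir[OF that] by (auto intro!: sum_nonneg mult_nonneg_nonneg displacement_nonneg)
  show "\<exists>C\<ge>0. \<forall>f. finite (supp G f) \<longrightarrow> displacement p G y f \<le> C * dirichlet p G \<phi> f" if y: "y \<in> set_pmf \<phi>" for y
  proof (intro exI conjI allI impI)
    have pos: "0 < pmf \<phi> y" using y by (simp add: pmf_positive)
    then show "0 \<le> 2 / pmf \<phi> y" by simp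
    fix f assume f: "finite (supp G f)"
    have "pmf \<phi> y * displacement p G y f \<le> (\<Sum>y\<in>set_pmf \<phi>. pmf \<phi> y * displacement p G y f)"
      using \<phi> y by (intro member_le_sum) (auto intro!: mult_nonneg_nonneg displacement_nonneg)
    also have "\<dots> = 2 * dirichlet p G \<phi> f" unfolding dir[OF f] by simp
    finally show "displacement p G y f \<le> 2 / pmf \<phi> y * dirichlet p G \<phi> f"
      using pos by (simp add: field_simps)
  qed
  show "h \<in> generate G (set_pmf \<phi>)" using h \<phi> by simp
qed

lemma dirichlet_le_displacement:
  assumes \<phi>: "finite (set_pmf \<phi>)" "set_pmf \<phi> \<subseteq> carrier G"
    and p: "p = 1 \<or> p = 2" and H: "H \<subseteq> carrier G" "finite H" "generate G H = carrier G"
  shows "\<exists>C>0. \<forall>f. finite (supp G f) \<longrightarrow> dirichlet p G \<phi> f \<le> C * (\<Sum>h\<in>H. displacement p G h f)"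
proof -
  have p0: "0 < p" using p by auto
  have "\<exists>C\<ge>0. \<forall>f. finite (supp G f) \<longrightarrow> displacement p G y f \<le> C * (\<Sum>h\<in>H. displacement p G h f)"
    if "y \<in> set_pmf \<phi>" for y
  proof (rule displacement_generate[OF p H(1)])
    show "\<exists>C\<ge>0. \<forall>f. finite (supp G f) \<longrightarrow> displacement p G h f \<le> C * (\<Sum>h\<in>H. displacement p G h f)" if "h \<in> H" for h
      using member_le_sum[OF that, of "\<lambda>h. displacement p G h _"] H by (intro exI[of _ 1]) (auto simp: displacement_nonneg)
    show "y \<in> generate G H" using that \<phi> H by auto
  qed (auto intro!: sum_nonneg displacement_nonneg)
  then obtain C where C: "\<And>y. y \<in> set_pmf \<phi> \<Longrightarrow> 0 \<le> C y" "\<And>y f. y \<in> set_pmf \<phi> \<Longrightarrow> finite (supp G f) \<Longrightarrow>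
      displacement p G y f \<le> C y * (\<Sum>h\<in>H. displacement p G h f)" by metis
  have "dirichlet p G \<phi> f \<le> (1 + (\<Sum>y\<in>set_pmf \<phi>. pmf \<phi> y * C y)) * (\<Sum>h\<in>H. displacement p G h f)" if f: "finite (supp G f)" for f
  proof -
    let ?S = "\<Sum>h\<in>H. displacement p G h f"
    have S: "0 \<le> ?S" by (auto intro!: sum_nonneg displacement_nonneg)
    have "dirichlet p G \<phi> f = 1 / 2 * (\<Sum>y\<in>set_pmf \<phi>. pmf \<phi> y * displacement p G y f)"
      by (rule dirichlet_displacement[OF \<phi> f p0])
    also have "\<dots> \<le> (\<Sum>y\<in>set_pmf \<phi>. pmf \<phi> y * displacement p G y f)"
      using sum_nonneg[of "set_pmf \<phi>" "\<lambda>y. pmf \<phi> y * displacement p G y f"] by (simp add: displacement_nonneg)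
    also have "\<dots> \<le> (\<Sum>y\<in>set_pmf \<phi>. pmf \<phi> y * (C y * ?S))"
      using C f by (intro sum_mono mult_left_mono) auto
    also have "\<dots> = (\<Sum>y\<in>set_pmf \<phi>. pmf \<phi> y * C y) * ?S" by (simp add: sum_distrib_right mult.assoc)
    also have "\<dots> \<le> (1 + (\<Sum>y\<in>set_pmf \<phi>. pmf \<phi> y * C y)) * ?S" using S by (intro mult_right_mono) auto
    finally show ?thesis .
  qed
  moreover have "0 < 1 + (\<Sum>y\<in>set_pmf \<phi>. pmf \<phi> y * C y)" using C by (intro add_pos_nonneg sum_nonneg) auto
  ultimately show ?thesis by blast
qed

lemma lp_norm_1: "finite (supp G f) \<Longrightarrow> lp_norm 1 G f = (\<Sum>x\<in>supp G f. \<bar>f x\<bar>)"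
  unfolding lp_norm_def by (subst infsum_finite_support[of "supp G f"]) (auto simp: supp_def)

lemma lp_norm_2: "finite (supp G f) \<Longrightarrow> lp_norm 2 G f = sqrt (\<Sum>x\<in>supp G f. (f x)\<^sup>2)"
  unfolding lp_norm_def sqrt_def by (subst infsum_finite_support[of "supp G f"]) (auto simp: supp_def)

text \<open>
  Cauchy--Schwarz for \<open>|a\<^sup>2 - b\<^sup>2| = |a - b| |a + b|\<close>.
\<close>

lemma displacement_square:
  assumes h: "h \<in> carrier G" and f: "finite (supp G f)" "lp_norm 2 G f = 1"
  shows "displacement 1 G h (\<lambda>x. (f x)\<^sup>2) \<le> 2 * sqrt (displacement 2 G h f)"
proof -
  let ?T = "supp G f \<union> {x \<in> carrier G. f (h \<otimes> x) \<noteq> 0}"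
  have T: "finite ?T" "?T \<subseteq> carrier G" using displaced_support[of h f] f h by (auto simp: supp_def)
  have norm: "(\<Sum>x\<in>supp G f. (f x)\<^sup>2) = 1" using f by (simp add: lp_norm_2)
  have n1: "(\<Sum>x\<in>?T. (f x)\<^sup>2) = 1"
    unfolding norm[symmetric] by (rule sum.mono_neutral_right) (use T in \<open>auto simp: supp_def\<close>)
  have n2: "(\<Sum>x\<in>?T. (f (h \<otimes> x))\<^sup>2) \<le> 1"
  proof -
    have "(\<Sum>x\<in>?T. (f (h \<otimes> x))\<^sup>2) = (\<Sum>y\<in>(\<lambda>x. h \<otimes> x) ` ?T. (f y)\<^sup>2)"
      by (subst sum.reindex) (use inj_on_subset[OF bij_betw_imp_inj_on[OF bij_left_mult[OF h]] T(2)] in auto)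
    also have "\<dots> \<le> (\<Sum>y\<in>(\<lambda>x. h \<otimes> x) ` ?T \<union> supp G f. (f y)\<^sup>2)" using T f by (intro sum_mono2) auto
    also have "\<dots> = 1"
      unfolding norm[symmetric] by (rule sum.mono_neutral_right) (use T f h in \<open>auto simp: supp_def\<close>)
    finally show ?thesis .
  qed
  have "displacement 1 G h (\<lambda>x. (f x)\<^sup>2) = (\<Sum>x\<in>?T. \<bar>(f (h \<otimes> x))\<^sup>2 - (f x)\<^sup>2\<bar> ^ 1)"
    using T f by (intro displacement_finite h) (auto simp: supp_def)
  also have "\<dots> = (\<Sum>x\<in>?T. \<bar>f (h \<otimes> x) - f x\<bar> * \<bar>f (h \<otimes> x) + f x\<bar>)"
    by (intro sum.cong refl) (simp add: abs_mult[symmetric] power2_eq_square algebra_simps)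
  also have "\<dots> \<le> 2 * sqrt (displacement 2 G h f)"
  proof (rule power2_le_imp_le)
    have "(\<Sum>x\<in>?T. \<bar>f (h \<otimes> x) - f x\<bar> * \<bar>f (h \<otimes> x) + f x\<bar>)\<^sup>2
       \<le> (\<Sum>x\<in>?T. \<bar>f (h \<otimes> x) - f x\<bar>\<^sup>2) * (\<Sum>x\<in>?T. \<bar>f (h \<otimes> x) + f x\<bar>\<^sup>2)" by (rule Cauchy_Schwarz_ineq_sum)
    also have "\<dots> \<le> displacement 2 G h f * 4"
    proof (rule mult_mono)
      show "(\<Sum>x\<in>?T. \<bar>f (h \<otimes> x) - f x\<bar>\<^sup>2) \<le> displacement 2 G h f" using T f by (intro displacement_le h) auto
      have "(\<Sum>x\<in>?T. \<bar>f (h \<otimes> x) + f x\<bar>\<^sup>2) \<le> (\<Sum>x\<in>?T. 2 * (\<bar>f (h \<otimes> x)\<bar>\<^sup>2 + \<bar>f x\<bar>\<^sup>2))"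
        by (intro sum_mono power_sum_bound) auto
      also have "\<dots> = 2 * ((\<Sum>x\<in>?T. (f (h \<otimes> x))\<^sup>2) + (\<Sum>x\<in>?T. (f x)\<^sup>2))"
        by (simp add: sum_distrib_left sum.distrib)
      also have "\<dots> \<le> 4" using n1 n2 by simp
      finally show "(\<Sum>x\<in>?T. \<bar>f (h \<otimes> x) + f x\<bar>\<^sup>2) \<le> 4" .
    qed (auto simp: displacement_nonneg intro!: sum_nonneg)
    also have "\<dots> = (2 * sqrt (displacement 2 G h f))\<^sup>2" by (simp add: power_mult_distrib displacement_nonneg)
    finally show "(\<Sum>x\<in>?T. \<bar>f (h \<otimes> x) - f x\<bar> * \<bar>f (h \<otimes> x) + f x\<bar>)\<^sup>2 \<le> (2 * sqrt (displacement 2 G h f))\<^sup>2" .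
  qed (simp add: displacement_nonneg)
  finally show ?thesis .
qed

lemma Cheeger:
  assumes \<phi>: "finite (set_pmf \<phi>)" "set_pmf \<phi> \<subseteq> carrier G" and f: "finite (supp G f)" "lp_norm 2 G f = 1"
  shows "(dirichlet 1 G \<phi> (\<lambda>x. (f x)\<^sup>2))\<^sup>2 \<le> 2 * dirichlet 2 G \<phi> f"
proof -
  have f2: "finite (supp G (\<lambda>x. (f x)\<^sup>2))" using f by (simp add: supp_def)
  let ?D = "\<lambda>y. sqrt (displacement 2 G y f)"
  have "dirichlet 1 G \<phi> (\<lambda>x. (f x)\<^sup>2) = 1 / 2 * (\<Sum>y\<in>set_pmf \<phi>. pmf \<phi> y * displacement 1 G y (\<lambda>x. (f x)\<^sup>2))"
    by (rule dirichlet_displacement[OF \<phi> f2]) simp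
  also have "\<dots> \<le> 1 / 2 * (\<Sum>y\<in>set_pmf \<phi>. pmf \<phi> y * (2 * ?D y))"
    using \<phi> by (intro mult_left_mono sum_mono displacement_square f) auto
  also have "\<dots> = (\<Sum>y\<in>set_pmf \<phi>. sqrt (pmf \<phi> y) * (sqrt (pmf \<phi> y) * ?D y))"
    by (simp add: sum_distrib_left mult.assoc[symmetric])
  finally have le: "dirichlet 1 G \<phi> (\<lambda>x. (f x)\<^sup>2) \<le> (\<Sum>y\<in>set_pmf \<phi>. sqrt (pmf \<phi> y) * (sqrt (pmf \<phi> y) * ?D y))" .
  have "0 \<le> dirichlet 1 G \<phi> (\<lambda>x. (f x)\<^sup>2)"
    unfolding dirichlet_def by (auto intro!: infsum_nonneg mult_nonneg_nonneg)
  then have "(dirichlet 1 G \<phi> (\<lambda>x. (f x)\<^sup>2))\<^sup>2 \<le> (\<Sum>y\<in>set_pmf \<phi>. sqrt (pmf \<phi> y) * (sqrt (pmf \<phi> y) * ?D y))\<^sup>2"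
    using le by (intro power_mono) auto
  also have "\<dots> \<le> (\<Sum>y\<in>set_pmf \<phi>. (sqrt (pmf \<phi> y))\<^sup>2) * (\<Sum>y\<in>set_pmf \<phi>. (sqrt (pmf \<phi> y) * ?D y)\<^sup>2)"
    by (rule Cauchy_Schwarz_ineq_sum)
  also have "(\<Sum>y\<in>set_pmf \<phi>. (sqrt (pmf \<phi> y))\<^sup>2) = 1" using \<phi> by (simp add: sum_pmf_eq_1)
  also have "(\<Sum>y\<in>set_pmf \<phi>. (sqrt (pmf \<phi> y) * ?D y)\<^sup>2) = (\<Sum>y\<in>set_pmf \<phi>. pmf \<phi> y * displacement 2 G y f)"
    by (simp add: power_mult_distrib displacement_nonneg)
  also have "1 * \<dots> = 2 * dirichlet 2 G \<phi> f" using dirichlet_displacement[OF \<phi> f(1), of 2] by simp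
  finally show ?thesis .
qed

lemma profile_Cheeger:
  assumes \<phi>: "finite (set_pmf \<phi>)" "set_pmf \<phi> \<subseteq> carrier G"
    and lower: "ereal a \<le> profile 1 G \<phi> v" "0 \<le> a"
  shows "ereal (a\<^sup>2 / 2) \<le> profile 2 G \<phi> v"
  unfolding profile_def
proof (rule Inf_greatest, clarify)
  fix f assume f: "finite (supp G f)" "real (card (supp G f)) \<le> v" "lp_norm 2 G f = 1"
  have s: "supp G (\<lambda>x. (f x)\<^sup>2) = supp G f" by (simp add: supp_def)
  have "lp_norm 1 G (\<lambda>x. (f x)\<^sup>2) = 1"
    using f lp_norm_1[of "\<lambda>x. (f x)\<^sup>2"] by (simp add: lp_norm_2 s)
  then have "profile 1 G \<phi> v \<le> ereal (dirichlet 1 G \<phi> (\<lambda>x. (f x)\<^sup>2))"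
    unfolding profile_def using f s by (intro Inf_lower) auto
  then have "a \<le> dirichlet 1 G \<phi> (\<lambda>x. (f x)\<^sup>2)" using lower by (metis ereal_less_eq(3) order_trans)
  then have "a\<^sup>2 \<le> (dirichlet 1 G \<phi> (\<lambda>x. (f x)\<^sup>2))\<^sup>2" using lower by (intro power_mono) auto
  also have "\<dots> \<le> 2 * dirichlet 2 G \<phi> f" by (rule Cheeger[OF \<phi> f(1,3)])
  finally show "ereal (a\<^sup>2 / 2) \<le> ereal (dirichlet 2 G \<phi> f)" by simp
qed
end

section \<open>Incidences between lamp configurations and lines\<close>

text \<open>
  Slice the set by the value of one coordinate that takes many values; every slice inherits the
  hypothesis with one direction less.
\<close>

lemma box_size_lower_bound:
  fixes B :: "('s \<Rightarrow> 't) set"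
  assumes "finite B" "B \<noteq> {}"
    and "\<And>a. a \<in> B \<Longrightarrow> \<exists>Z. finite Z \<and> N \<le> card Z \<and> (\<forall>z\<in>Z. L \<le> card {t. a(z := t) \<in> B})"
  shows "L ^ N \<le> card B"
  using assms
proof (induction N arbitrary: B)
  case 0
  then show ?case by (simp add: Suc_leI card_gt_0_iff)
next
  case (Suc N)
  obtain a Z where a: "a \<in> B" and Z: "finite Z" "Suc N \<le> card Z" "\<forall>z\<in>Z. L \<le> card {t. a(z := t) \<in> B}"
    using Suc.prems by blast
  obtain z where z: "z \<in> Z" using Z by (metis card.empty ex_in_conv not_less_eq_eq zero_le)
  define V where "V = {t. a(z := t) \<in> B}"
  have V: "L \<le> card V" using Z z by (simp add: V_def)
  have finV: "finite V"
  proof (rule finite_subset[of _ "(\<lambda>b. b z) ` B"])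
    show "V \<subseteq> (\<lambda>b. b z) ` B"
    proof
      fix t assume "t \<in> V"
      then show "t \<in> (\<lambda>b. b z) ` B" by (intro image_eqI[of _ _ "a(z := t)"]) (auto simp: V_def)
    qed
  qed (use Suc.prems in auto)
  define S where "S t = {b \<in> B. b z = t}" for t
  have S: "L ^ N \<le> card (S t)" if t: "t \<in> V" for t
  proof (rule Suc.IH)
    show "finite (S t)" using Suc.prems by (simp add: S_def)
    show "S t \<noteq> {}" using t by (auto simp: S_def V_def intro!: exI[of _ "a(z := t)"])
    fix b assume b: "b \<in> S t"
    then have "b \<in> B" by (simp add: S_def)
    then obtain Z' where Z': "finite Z'" "Suc N \<le> card Z'" "\<forall>z\<in>Z'. L \<le> card {t. b(z := t) \<in> B}"
      using Suc.prems(3) by blast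
    have "{t'. b(z' := t') \<in> S t} = {t'. b(z' := t') \<in> B}" if "z' \<in> Z' - {z}" for z'
      using that b by (auto simp: S_def)
    moreover have "N \<le> card (Z' - {z})"
    proof (cases "z \<in> Z'")
      case True then show ?thesis using Z' by simp
    qed (use Z' in simp)
    ultimately show "\<exists>Z. finite Z \<and> N \<le> card Z \<and> (\<forall>z\<in>Z. L \<le> card {t'. b(z := t') \<in> S t})"
      using Z' by (intro exI[of _ "Z' - {z}"]) auto
  qed
  have "L ^ Suc N \<le> card V * L ^ N" using V by simp
  also have "\<dots> \<le> (\<Sum>t\<in>V. card (S t))" using sum_mono[of V "\<lambda>_. L ^ N" "\<lambda>t. card (S t)"] S by simp
  also have "\<dots> = card (\<Union>t\<in>V. S t)"
    using Suc.prems finV by (subst card_UN_disjoint) (auto simp: S_def)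
  also have "\<dots> \<le> card B" using Suc.prems by (intro card_mono) (auto simp: S_def)
  finally show ?case .
qed

text \<open>
  If there is no core, remove deficient points and lines one after the other until nothing is left;
  each removal costs at most a proportion \<open>\<theta>\<close> of the mass of the point or line, which is charged once.
\<close>

lemma stable_core:
  fixes X :: "('a \<times> 'z) set" and line :: "'a \<times> 'z \<Rightarrow> 'b" and W :: "'a \<times> 'z \<Rightarrow> real"
  assumes "finite X" and nonneg: "0 \<le> \<theta>" "\<And>a. 0 \<le> wa a" "\<And>b. 0 \<le> wb b"
    and point: "\<And>a Y. Y \<subseteq> {x \<in> X. fst x = a} \<Longrightarrow> card Y < N \<Longrightarrow> sum W Y \<le> \<theta> * wa a"
    and line: "\<And>b Y. Y \<subseteq> {x \<in> X. line x = b} \<Longrightarrow> card Y < L \<Longrightarrow> sum W Y \<le> \<theta> * wb b"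
    and no_core: "\<And>Y. Y \<subseteq> X \<Longrightarrow> (\<And>a. a \<in> fst ` Y \<Longrightarrow> N \<le> card {x \<in> Y. fst x = a}) \<Longrightarrow>
        (\<And>b. b \<in> line ` Y \<Longrightarrow> L \<le> card {x \<in> Y. line x = b}) \<Longrightarrow> Y = {}"
  shows "sum W X \<le> \<theta> * (sum wa (fst ` X) + sum wb (line ` X))"
proof -
  have "Y \<subseteq> X \<Longrightarrow> sum W Y \<le> \<theta> * (sum wa (fst ` Y) + sum wb (line ` Y))" for Y
  proof (induction "card Y" arbitrary: Y rule: less_induct)
    case less
    have fin: "finite Y" using less.prems assms(1) finite_subset by blast
    show ?case
    proof (cases "Y = {}")
      case False
      then consider (p) a where "a \<in> fst ` Y" "card {x \<in> Y. fst x = a} < N"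
        | (l) b where "b \<in> line ` Y" "card {x \<in> Y. line x = b} < L"
        using no_core[OF less.prems] by (meson not_le)
      then show ?thesis
      proof cases
        case p
        let ?R = "{x \<in> Y. fst x = a}"
        have "card (Y - ?R) < card Y" using p fin by (intro psubset_card_mono) auto
        then have "sum W (Y - ?R) \<le> \<theta> * (sum wa (fst ` (Y - ?R)) + sum wb (line ` (Y - ?R)))"
          using less by blast
        moreover have "sum W ?R \<le> \<theta> * wa a" using p less.prems by (intro point) auto
        moreover have "sum W Y = sum W (Y - ?R) + sum W ?R" using fin by (intro sum.subset_diff) auto
        moreover have "fst ` Y = insert a (fst ` (Y - ?R))" using p by auto
        moreover have "a \<notin> fst ` (Y - ?R)" by auto
        moreover have "\<theta> * sum wb (line ` (Y - ?R)) \<le> \<theta> * sum wb (line ` Y)"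
        proof -
          have "(\<Sum>b\<in>line ` (Y - ?R). \<theta> * wb b) \<le> (\<Sum>b\<in>line ` Y. \<theta> * wb b)"
            using fin nonneg by (intro sum_mono2) auto
          then show ?thesis by (simp add: sum_distrib_left)
        qed
        ultimately show ?thesis using fin by (simp add: ring_distribs)
      next
        case l
        let ?R = "{x \<in> Y. line x = b}"
        have "card (Y - ?R) < card Y" using l fin by (intro psubset_card_mono) auto
        then have "sum W (Y - ?R) \<le> \<theta> * (sum wa (fst ` (Y - ?R)) + sum wb (line ` (Y - ?R)))"
          using less by blast
        moreover have "sum W ?R \<le> \<theta> * wb b" using l less.prems by (intro line) auto
        moreover have "sum W Y = sum W (Y - ?R) + sum W ?R" using fin by (intro sum.subset_diff) auto
        moreover have "line ` Y = insert b (line ` (Y - ?R))" using l by auto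
        moreover have "b \<notin> line ` (Y - ?R)" by auto
        moreover have "\<theta> * sum wa (fst ` (Y - ?R)) \<le> \<theta> * sum wa (fst ` Y)"
        proof -
          have "(\<Sum>b\<in>fst ` (Y - ?R). \<theta> * wa b) \<le> (\<Sum>b\<in>fst ` Y. \<theta> * wa b)"
            using fin nonneg by (intro sum_mono2) auto
          then show ?thesis by (simp add: sum_distrib_left)
        qed
        ultimately show ?thesis using fin by (simp add: ring_distribs)
      qed
    qed simp
  qed
  then show ?thesis by blast
qed

text \<open>
  The incidences are the pairs of a configuration and a site, weighted by the mass of \<open>h\<close> with this
  configuration and this site; their lines vary one lamp. Configurations in \<open>Bad\<close>, and lines whose
  energy is much larger than average, carry at most a quarter of the mass. On the other lines no single
  point is heavy. So \<open>stable_core\<close> applies with \<open>\<theta> = 1/8\<close>.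
\<close>

lemma lamp_support_bound:
  fixes h :: "('s \<Rightarrow> int) \<Rightarrow> 'g \<Rightarrow> real" and site :: "'g \<Rightarrow> 's"
  defines "Spt \<equiv> {(a, g). h a g \<noteq> 0}"
  assumes fin: "finite Spt" and nonneg: "\<And>a g. 0 \<le> h a g"
    and total: "(\<Sum>(a, g)\<in>Spt. h a g) = 1"
    and bad: "(\<Sum>(a, g)\<in>{x \<in> Spt. fst x \<in> Bad}. h a g) \<le> 1 / 8"
    and spread: "\<And>a Z. a \<notin> Bad \<Longrightarrow> finite Z \<Longrightarrow> card Z < N \<Longrightarrow>
        8 * (\<Sum>g\<in>{g. h a g \<noteq> 0 \<and> site g \<in> Z}. h a g) \<le> (\<Sum>g\<in>{g. h a g \<noteq> 0}. h a g)"
    and lamp: "\<And>T. finite T \<Longrightarrow> (\<Sum>(a, g)\<in>T. \<bar>h (a(site g := a (site g) + 1)) g - h a g\<bar>) \<le> \<eta>"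
    and \<eta>: "0 < \<eta>" "64 * \<eta> * real L \<le> 1"
  shows "L ^ N \<le> card Spt"
proof -
  define A where "A = fst ` Spt"
  define Gs where "Gs = snd ` Spt"
  define Zs where "Zs = site ` Gs"
  define W where "W = (\<lambda>(a, z). \<Sum>g\<in>{g \<in> Gs. site g = z}. h a g)"
  define w where "w a = (\<Sum>g\<in>Gs. h a g)" for a
  define line :: "('s \<Rightarrow> int) \<times> 's \<Rightarrow> ('s \<Rightarrow> int) \<times> 's" where "line = (\<lambda>(a, z). (a(z := 0), z))"
  define up where "up = (\<lambda>(a :: 's \<Rightarrow> int, z :: 's). (a(z := a z + 1), z))"
  let ?I = "A \<times> Zs"
  define wb where "wb b = (\<Sum>x\<in>{x \<in> ?I. line x = b}. W x)" for b
  define eb where "eb b = (\<Sum>x\<in>{x \<in> ?I. line x = b}. \<bar>W (up x) - W x\<bar>)" for b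
  have finA: "finite A" "finite Gs" "finite Zs" using fin by (auto simp: A_def Gs_def Zs_def)
  have SA: "Spt \<subseteq> A \<times> Gs" by (auto simp: A_def Gs_def intro: rev_image_eqI)
  have S0: "h a g = 0" if "(a, g) \<notin> Spt" for a g using that by (simp add: Spt_def)
  have zero: "h a g = 0" if "a \<notin> A \<or> g \<notin> Gs" for a g
    using that by (force simp: A_def Gs_def Spt_def)
  have W0: "0 \<le> W x" for x by (auto simp: W_def nonneg intro!: sum_nonneg split: prod.splits)
  have Wz: "W (a, z) = 0" if "a \<notin> A" for a z using zero that by (simp add: W_def)
  have sumW: "(\<Sum>z\<in>Zs. W (a, z)) = w a" for a
    unfolding W_def w_def Zs_def using finA by (simp add: sum.group)
  have wG: "w a = (\<Sum>g\<in>{g. h a g \<noteq> 0}. h a g)" for a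
    unfolding w_def by (rule sum.mono_neutral_right) (use finA zero in auto)
  have wtotal: "(\<Sum>a\<in>A. w a) = 1"
  proof -
    have "(\<Sum>a\<in>A. w a) = (\<Sum>(a, g)\<in>A \<times> Gs. h a g)" by (simp add: w_def sum.cartesian_product)
    also have "\<dots> = (\<Sum>(a, g)\<in>Spt. h a g)"
      by (rule sum.mono_neutral_right) (use finA SA S0 in auto)
    finally show ?thesis using total by simp
  qed
  have Wtotal: "(\<Sum>x\<in>?I. W x) = 1"
    using wtotal sum.cartesian_product'[of W A Zs] by (simp add: sumW)
  have wb_total: "(\<Sum>b\<in>line ` ?I. wb b) = 1"
    unfolding wb_def using finA Wtotal by (simp add: sum.group)
  have eb_total: "(\<Sum>b\<in>line ` ?I. eb b) \<le> \<eta>"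
  proof -
    have "(\<Sum>b\<in>line ` ?I. eb b) = (\<Sum>x\<in>?I. \<bar>W (up x) - W x\<bar>)"
      unfolding eb_def using finA by (simp add: sum.group)
    also have "\<dots> \<le> (\<Sum>(a, z)\<in>?I. \<Sum>g\<in>{g \<in> Gs. site g = z}. \<bar>h (a(site g := a (site g) + 1)) g - h a g\<bar>)"
    proof (rule sum_mono, clarify)
      fix a z
      have "W (up (a, z)) - W (a, z) = (\<Sum>g\<in>{g \<in> Gs. site g = z}. h (a(site g := a (site g) + 1)) g - h a g)"
        by (simp add: W_def up_def sum_subtractf)
      then show "\<bar>W (up (a, z)) - W (a, z)\<bar> \<le> (\<Sum>g\<in>{g \<in> Gs. site g = z}. \<bar>h (a(site g := a (site g) + 1)) g - h a g\<bar>)"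
        by (simp add: sum_abs)
    qed
    also have "\<dots> = (\<Sum>a\<in>A. \<Sum>z\<in>Zs. \<Sum>g\<in>{g \<in> Gs. site g = z}. \<bar>h (a(site g := a (site g) + 1)) g - h a g\<bar>)"
      by (simp add: sum.cartesian_product)
    also have "\<dots> = (\<Sum>a\<in>A. \<Sum>g\<in>Gs. \<bar>h (a(site g := a (site g) + 1)) g - h a g\<bar>)"
      unfolding Zs_def by (intro sum.cong[OF refl] sum.group) (use finA in auto)
    also have "\<dots> \<le> \<eta>" using lamp[of "A \<times> Gs"] finA by (simp add: sum.cartesian_product)
    finally show ?thesis .
  qed
  \<comment> \<open>follow the line upwards until it leaves the support\<close>
  have W_le_eb: "W (a, z) \<le> eb (line (a, z))" if "z \<in> Zs" for a z
  proof -
    define p where "p t = a(z := a z + int t)" for t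
    have "finite {t. p t \<in> A}"
    proof (rule finite_imageD)
      show "finite (p ` {t. p t \<in> A})" using finA by (auto intro: finite_subset[of _ A])
      show "inj_on p {t. p t \<in> A}" by (auto simp: inj_on_def p_def fun_eq_iff split: if_splits)
    qed
    then obtain T where T: "\<And>t. p t \<in> A \<Longrightarrow> t < T" by (metis (mono_tags) finite_nat_set_iff_bounded mem_Collect_eq)
    have up_p: "up (p t, z) = (p (Suc t), z)" for t by (simp add: up_def p_def algebra_simps)
    have "W (a, z) = W (p 0, z) - W (p T, z)" using T[of T] Wz[of "p T" z] by (auto simp: p_def)
    also have "\<dots> = (\<Sum>t<T. W (p t, z) - W (p (Suc t), z))" using sum_lessThan_telescope'[of "\<lambda>t. W (p t, z)" T] by simp
    also have "\<dots> \<le> (\<Sum>t<T. if p t \<in> A then \<bar>W (up (p t, z)) - W (p t, z)\<bar> else 0)"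
    proof (rule sum_mono)
      fix t show "W (p t, z) - W (p (Suc t), z) \<le> (if p t \<in> A then \<bar>W (up (p t, z)) - W (p t, z)\<bar> else 0)"
        using Wz[of "p t" z] W0[of "(p (Suc t), z)"] abs_ge_minus_self[of "W (p (Suc t), z) - W (p t, z)"]
        by (simp add: up_p)
    qed
    also have "\<dots> = (\<Sum>t\<in>{t \<in> {..<T}. p t \<in> A}. \<bar>W (up (p t, z)) - W (p t, z)\<bar>)"
      by (simp add: sum.If_cases Int_def)
    also have "\<dots> = (\<Sum>x\<in>(\<lambda>t. (p t, z)) ` {t \<in> {..<T}. p t \<in> A}. \<bar>W (up x) - W x\<bar>)"
      by (subst sum.reindex) (auto simp: inj_on_def p_def fun_eq_iff split: if_splits)
    also have "\<dots> \<le> eb (line (a, z))"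
      unfolding eb_def using finA that by (intro sum_mono2) (auto simp: line_def p_def)
    finally show ?thesis .
  qed
  define Badl where "Badl = {b. 8 * \<eta> * wb b < eb b}"
  define X where "X = {x \<in> ?I. fst x \<notin> Bad \<and> line x \<notin> Badl}"
  have finX: "finite X" "X \<subseteq> ?I" using finA by (auto simp: X_def)
  have wb0: "0 \<le> wb b" for b by (auto simp: wb_def W0 intro!: sum_nonneg)
  have w0: "0 \<le> w a" for a by (auto simp: w_def nonneg intro!: sum_nonneg)
  have most: "3 / 4 \<le> sum W X"
  proof -
    have 1: "(\<Sum>x\<in>{x \<in> ?I. fst x \<in> Bad}. W x) \<le> 1 / 8"
    proof -
      have "{x \<in> ?I. fst x \<in> Bad} = (A \<inter> Bad) \<times> Zs" by auto
      then have "(\<Sum>x\<in>{x \<in> ?I. fst x \<in> Bad}. W x) = (\<Sum>a\<in>A \<inter> Bad. w a)"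
        using sum.cartesian_product'[of W "A \<inter> Bad" Zs] by (simp add: sumW)
      also have "\<dots> = (\<Sum>(a, g)\<in>(A \<inter> Bad) \<times> Gs. h a g)" by (simp add: w_def sum.cartesian_product)
      also have "\<dots> = (\<Sum>(a, g)\<in>{x \<in> Spt. fst x \<in> Bad}. h a g)"
        by (rule sum.mono_neutral_right) (use finA SA S0 in auto)
      finally show ?thesis using bad by simp
    qed
    have 2: "(\<Sum>x\<in>{x \<in> ?I. line x \<in> Badl}. W x) \<le> 1 / 8"
    proof -
      have "(\<Sum>x\<in>{x \<in> ?I. line x \<in> Badl}. W x) = (\<Sum>b\<in>line ` ?I \<inter> Badl. (\<Sum>x\<in>{x \<in> {x \<in> ?I. line x \<in> Badl}. line x = b}. W x))"
        by (rule sum.group[symmetric]) (use finA in auto)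
      also have "\<dots> = (\<Sum>b\<in>line ` ?I \<inter> Badl. wb b)"
        unfolding wb_def by (intro sum.cong) auto
      also have "\<dots> \<le> (\<Sum>b\<in>line ` ?I \<inter> Badl. eb b / (8 * \<eta>))"
        using \<eta> by (intro sum_mono) (auto simp: Badl_def field_simps)
      also have "\<dots> \<le> (\<Sum>b\<in>line ` ?I. eb b / (8 * \<eta>))"
        using finA \<eta> by (intro sum_mono2) (auto simp: eb_def intro!: divide_nonneg_pos sum_nonneg)
      also have "\<dots> \<le> 1 / 8" using eb_total \<eta> by (simp add: sum_divide_distrib[symmetric] field_simps)
      finally show ?thesis .
    qed
    have un: "sum W (P \<union> Q) \<le> sum W P + sum W Q" if "finite P" "finite Q" for P Q
      using sum_Un[OF that, of W] sum_nonneg[of "P \<inter> Q" W] W0 by simp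
    have "1 = (\<Sum>x\<in>X \<union> ({x \<in> ?I. fst x \<in> Bad} \<union> {x \<in> ?I. line x \<in> Badl}). W x)"
      unfolding Wtotal[symmetric] by (rule sum.cong) (auto simp: X_def)
    also have "\<dots> \<le> sum W X + ((\<Sum>x\<in>{x \<in> ?I. fst x \<in> Bad}. W x) + (\<Sum>x\<in>{x \<in> ?I. line x \<in> Badl}. W x))"
      using finA finX by (intro order_trans[OF un] add_left_mono un) auto
    finally show ?thesis using 1 2 by linarith
  qed
  have few: "sum W X \<le> 1 / 4" if no: "\<And>Y. Y \<subseteq> X \<Longrightarrow> (\<And>a. a \<in> fst ` Y \<Longrightarrow> N \<le> card {x \<in> Y. fst x = a}) \<Longrightarrow>
        (\<And>b. b \<in> line ` Y \<Longrightarrow> L \<le> card {x \<in> Y. line x = b}) \<Longrightarrow> Y = {}"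
  proof -
    have "sum W X \<le> (1 / 8) * (sum w (fst ` X) + sum wb (line ` X))"
    proof (rule stable_core[OF finX(1) _ w0 wb0 _ _ no])
      fix a Y assume Y: "Y \<subseteq> {x \<in> X. fst x = a}" "card Y < N"
      show "sum W Y \<le> 1 / 8 * w a"
      proof (cases "Y = {}")
        case False
        have a: "a \<notin> Bad" using Y False by (auto simp: X_def)
        have finY: "finite Y" by (rule finite_subset[OF Y(1)]) (use finX in auto)
        have Ya: "Y = (\<lambda>z. (a, z)) ` snd ` Y"
        proof (intro equalityI subsetI)
          fix x assume "x \<in> Y"
          moreover from this have "fst x = a" using Y by auto
          ultimately show "x \<in> (\<lambda>z. (a, z)) ` snd ` Y" by (metis image_eqI prod.collapse)
        next
          fix x assume "x \<in> (\<lambda>z. (a, z)) ` snd ` Y"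
          then obtain y where y: "y \<in> Y" "x = (a, snd y)" by auto
          then have "fst y = a" using Y by auto
          then have "x = y" using y by (simp add: prod_eq_iff)
          then show "x \<in> Y" using y by simp
        qed
        have "sum W Y = (\<Sum>z\<in>snd ` Y. W (a, z))"
          by (subst Ya, subst sum.reindex) (auto simp: inj_on_def)
        also have "\<dots> = (\<Sum>g\<in>{g \<in> Gs. site g \<in> snd ` Y}. h a g)"
        proof -
          have "(\<Sum>z\<in>snd ` Y. \<Sum>g\<in>{g \<in> {g \<in> Gs. site g \<in> snd ` Y}. site g = z}. h a g) = (\<Sum>g\<in>{g \<in> Gs. site g \<in> snd ` Y}. h a g)"
            using finA finY by (intro sum.group) auto
          moreover have "{g \<in> {g \<in> Gs. site g \<in> snd ` Y}. site g = z} = {g \<in> Gs. site g = z}" if "z \<in> snd ` Y" for z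
            using that by auto
          ultimately show ?thesis by (simp add: W_def)
        qed
        also have "\<dots> = (\<Sum>g\<in>{g. h a g \<noteq> 0 \<and> site g \<in> snd ` Y}. h a g)"
          by (rule sum.mono_neutral_right) (use finA zero in auto)
        also have "8 * \<dots> \<le> w a"
          unfolding wG using a finY Y(2) card_image_le[OF finY, of snd] by (intro spread) auto
        finally show ?thesis by simp
      qed (simp add: w0)
    next
      fix b Y assume Y: "Y \<subseteq> {x \<in> X. line x = b}" "card Y < L"
      show "sum W Y \<le> 1 / 8 * wb b"
      proof (cases "Y = {}")
        case False
        then have b: "b \<notin> Badl" using Y by (auto simp: X_def)
        have "sum W Y \<le> (\<Sum>x\<in>Y. eb b)"
        proof (rule sum_mono)
          fix x assume "x \<in> Y"
          then have x: "x \<in> X" "line x = b" using Y by auto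
          then have "snd x \<in> Zs" using finX by auto
          then show "W x \<le> eb b" using W_le_eb[of "snd x" "fst x"] x by simp
        qed
        also have "\<dots> \<le> real L * (8 * \<eta> * wb b)"
          using Y b wb0[of b] \<eta> by (simp, intro mult_mono) (auto simp: Badl_def eb_def intro!: sum_nonneg)
        also have "\<dots> = (64 * \<eta> * real L) * (wb b / 8)" by simp
        also have "\<dots> \<le> 1 * (wb b / 8)" using wb0 \<eta> by (intro mult_right_mono) auto
        finally show ?thesis by simp
      qed (simp add: wb0)
    qed auto
    also have "sum w (fst ` X) \<le> 1"
      unfolding wtotal[symmetric] using finA finX w0 by (intro sum_mono2) auto
    also have "sum wb (line ` X) \<le> 1"
      unfolding wb_total[symmetric] using finA finX wb0 by (intro sum_mono2) auto
    finally show ?thesis by simp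
  qed
  have "\<exists>Y\<subseteq>X. (\<forall>a\<in>fst ` Y. N \<le> card {x \<in> Y. fst x = a}) \<and>
      (\<forall>b\<in>line ` Y. L \<le> card {x \<in> Y. line x = b}) \<and> Y \<noteq> {}"
  proof (rule ccontr)
    assume no: "\<not> ?thesis"
    have "sum W X \<le> 1 / 4"
    proof (rule few, rule ccontr)
      fix Y
      assume Y: "Y \<subseteq> X" "\<And>a. a \<in> fst ` Y \<Longrightarrow> N \<le> card {x \<in> Y. fst x = a}"
        "\<And>b. b \<in> line ` Y \<Longrightarrow> L \<le> card {x \<in> Y. line x = b}" "Y \<noteq> {}"
      show False by (rule notE[OF no], intro exI[of _ Y] conjI ballI Y)
    qed
    then show False using most by simp
  qed
  then obtain Y where Y: "Y \<subseteq> X" "\<And>a. a \<in> fst ` Y \<Longrightarrow> N \<le> card {x \<in> Y. fst x = a}"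
      "\<And>b. b \<in> line ` Y \<Longrightarrow> L \<le> card {x \<in> Y. line x = b}" "Y \<noteq> {}" by meson
  have finY: "finite Y" using Y finX finite_subset by blast
  have "L ^ N \<le> card (fst ` Y)"
  proof (rule box_size_lower_bound)
    fix a assume a: "a \<in> fst ` Y"
    show "\<exists>Z. finite Z \<and> N \<le> card Z \<and> (\<forall>z\<in>Z. L \<le> card {t. a(z := t) \<in> fst ` Y})"
    proof (intro exI conjI ballI)
      have "inj_on snd {x \<in> Y. fst x = a}" by (auto simp: inj_on_def)
      then show "N \<le> card (snd ` {x \<in> Y. fst x = a})" using Y(2)[OF a] by (simp add: card_image)
      show "finite (snd ` {x \<in> Y. fst x = a})" using finY by auto
      fix z assume "z \<in> snd ` {x \<in> Y. fst x = a}"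
      then have az: "(a, z) \<in> Y" by auto
      have "L \<le> card {x \<in> Y. line x = line (a, z)}" using az by (intro Y(3)) auto
      also have "\<dots> \<le> card {t. a(z := t) \<in> fst ` Y}"
      proof (rule card_inj_on_le)
        show "inj_on (\<lambda>x. fst x z) {x \<in> Y. line x = line (a, z)}"
        proof (rule inj_onI, clarify)
          fix a1 z1 a2 z2
          assume "line (a1, z1) = line (a, z)" "line (a2, z2) = line (a, z)" "fst (a1, z1) z = fst (a2, z2) z"
          then have eq: "z1 = z" "z2 = z" "a1(z := 0) = a2(z := 0)" "a1 z = a2 z" by (auto simp: line_def)
          have "a1 x = a2 x" for x using eq(4) fun_cong[OF eq(3), of x] by (auto split: if_splits)
          then show "a1 = a2 \<and> z1 = z2" using eq by auto
        qed
        show "(\<lambda>x. fst x z) ` {x \<in> Y. line x = line (a, z)} \<subseteq> {t. a(z := t) \<in> fst ` Y}"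
        proof clarify
          fix a1 z1 assume x: "(a1, z1) \<in> Y" "line (a1, z1) = line (a, z)"
          then have eq: "z1 = z" "a1(z := 0) = a(z := 0)" by (auto simp: line_def)
          have "(a(z := a1 z)) x = a1 x" for x using fun_cong[OF eq(2), of x] by (auto split: if_splits)
          then have "a(z := a1 z) = a1" by auto
          then show "a(z := fst (a1, z1) z) \<in> fst ` Y" using x by force
        qed
        show "finite {t. a(z := t) \<in> fst ` Y}"
        proof (rule finite_subset[of _ "(\<lambda>b. b z) ` fst ` Y"])
          show "{t. a(z := t) \<in> fst ` Y} \<subseteq> (\<lambda>b. b z) ` fst ` Y"
          proof
            fix t assume "t \<in> {t. a(z := t) \<in> fst ` Y}"
            then show "t \<in> (\<lambda>b. b z) ` fst ` Y" by (intro image_eqI[of _ _ "a(z := t)"]) auto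
          qed
        qed (use finY in auto)
      qed
      finally show "L \<le> card {t. a(z := t) \<in> fst ` Y}" .
    qed
  qed (use finY Y in auto)
  also have "\<dots> \<le> card A" using Y finX finA by (intro card_mono) auto
  also have "\<dots> \<le> card Spt" unfolding A_def using fin by (rule card_image_le)
  finally show ?thesis .
qed

section \<open>The group and the wreath product\<close>

context ns_sequence
begin

abbreviation "\<Gamma> \<equiv> ns_group l"
abbreviation "S \<equiv> ns_orbit l"
abbreviation "base \<equiv> (\<lambda>_::nat. 0::nat)"

definition "gen_a = restrict (ns_alpha l 0) (words l 0)"

definition "gen_b = restrict (ns_beta l 0) (words l 0)"

sublocale Gam: group \<Gamma> by (rule group_ns_group)

lemma gens [simp]: "gen_a \<in> carrier \<Gamma>" "gen_b \<in> carrier \<Gamma>"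
  using ns_group_generators[of l] l_pos by (auto simp: gen_a_def gen_b_def)

lemma base_rays: "base \<in> rays l" using l_pos by (simp add: rays_def)

lemma S_rays: "S \<subseteq> rays l"
  using base_rays ray_action_rays by (auto simp: ns_orbit_def orbit_def)

lemma S_eq: "S = {ray_action g base |g. g \<in> carrier \<Gamma>}" by (simp add: ns_orbit_def orbit_def)

lemma S_closed: "g \<in> carrier \<Gamma> \<Longrightarrow> x \<in> S \<Longrightarrow> ray_action g x \<in> S"
proof -
  assume g: "g \<in> carrier \<Gamma>" and "x \<in> S"
  then obtain h where h: "h \<in> carrier \<Gamma>" "x = ray_action h base" by (auto simp: S_eq)
  then have "ray_action g x = ray_action (g \<otimes>\<^bsub>\<Gamma>\<^esub> h) base" using g base_rays by (simp add: ray_action_mult)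
  then show ?thesis using g h by (auto simp: S_eq)
qed

lemma base_S: "base \<in> S" using ray_action_one[OF base_rays] by (force simp: S_eq)

lemma act_mult: "g \<in> carrier \<Gamma> \<Longrightarrow> h \<in> carrier \<Gamma> \<Longrightarrow> x \<in> S \<Longrightarrow>
    ray_action (g \<otimes>\<^bsub>\<Gamma>\<^esub> h) x = ray_action g (ray_action h x)"
  using ray_action_mult S_rays by blast

lemma act_one: "x \<in> S \<Longrightarrow> ray_action \<one>\<^bsub>\<Gamma>\<^esub> x = x" using ray_action_one S_rays by blast

lemma act_inv: "g \<in> carrier \<Gamma> \<Longrightarrow> x \<in> S \<Longrightarrow> ray_action (inv\<^bsub>\<Gamma>\<^esub> g) (ray_action g x) = x"
  "g \<in> carrier \<Gamma> \<Longrightarrow> x \<in> S \<Longrightarrow> ray_action g (ray_action (inv\<^bsub>\<Gamma>\<^esub> g) x) = x"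
  by (simp_all add: act_mult[symmetric] act_one)

abbreviation "W \<equiv> ns_wreath l"

definition "Conf = {\<phi> \<in> extensional S. finite {x \<in> S. \<phi> x \<noteq> (0::int)}}"

sublocale Wr: group W using group_ns_wreath[of l] l_pos by simp

lemma carrier_W: "carrier W = Conf \<times> carrier \<Gamma>"
  by (auto simp: ns_wreath_def int_wreath_def Let_def carrier_sum_group PiE_def Conf_def)

lemma mult_W: "(f, g) \<otimes>\<^bsub>W\<^esub> (f', g') = (\<lambda>x\<in>S. f x + f' (ray_action (inv\<^bsub>\<Gamma>\<^esub> g) x), g \<otimes>\<^bsub>\<Gamma>\<^esub> g')"
  by (auto simp: ns_wreath_def int_wreath_def Let_def fun_eq_iff)

lemma one_W: "\<one>\<^bsub>W\<^esub> = (\<lambda>x\<in>S. 0, \<one>\<^bsub>\<Gamma>\<^esub>)"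
  by (auto simp: ns_wreath_def int_wreath_def Let_def fun_eq_iff)

definition lift :: "(nat list \<Rightarrow> nat list) \<Rightarrow> ((nat \<Rightarrow> nat) \<Rightarrow> int) \<times> (nat list \<Rightarrow> nat list)" where
  "lift g = (\<lambda>x\<in>S. 0, g)"

definition lamp :: "(nat \<Rightarrow> nat) \<Rightarrow> int \<Rightarrow> ((nat \<Rightarrow> nat) \<Rightarrow> int) \<times> (nat list \<Rightarrow> nat list)" where
  "lamp s k = (\<lambda>x\<in>S. if x = s then k else 0, \<one>\<^bsub>\<Gamma>\<^esub>)"

lemma lift_carrier [simp]: "g \<in> carrier \<Gamma> \<Longrightarrow> lift g \<in> carrier W"
  by (simp add: lift_def carrier_W Conf_def)

lemma lamp_carrier [simp]: "lamp s k \<in> carrier W"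
proof -
  have "{x \<in> S. (\<lambda>x\<in>S. if x = s then k else 0) x \<noteq> 0} \<subseteq> {s}" by auto
  then have "finite {x \<in> S. (\<lambda>x\<in>S. if x = s then k else 0) x \<noteq> 0}" by (rule finite_subset) simp
  then show ?thesis by (simp add: lamp_def carrier_W Conf_def)
qed

text \<open>
  The element with tree automorphism \<open>g\<close> and pulled back lamps \<open>a\<close>.
\<close>

definition body :: "((nat \<Rightarrow> nat) \<Rightarrow> int) \<times> (nat list \<Rightarrow> nat list) \<Rightarrow> ((nat \<Rightarrow> nat) \<Rightarrow> int) \<times> (nat list \<Rightarrow> nat list)" where
  "body = (\<lambda>(a, g). (\<lambda>x\<in>S. a (ray_action (inv\<^bsub>\<Gamma>\<^esub> g) x), g))"

definition unbody :: "((nat \<Rightarrow> nat) \<Rightarrow> int) \<times> (nat list \<Rightarrow> nat list) \<Rightarrow> ((nat \<Rightarrow> nat) \<Rightarrow> int) \<times> (nat list \<Rightarrow> nat list)" where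
  "unbody = (\<lambda>(a, g). (\<lambda>x\<in>S. a (ray_action g x), g))"

definition site :: "(nat list \<Rightarrow> nat list) \<Rightarrow> nat \<Rightarrow> nat" where "site g = ray_action (inv\<^bsub>\<Gamma>\<^esub> g) base"

lemma site_S: "g \<in> carrier \<Gamma> \<Longrightarrow> site g \<in> S" by (simp add: site_def S_closed base_S)

lemma Conf_act:
  assumes "a \<in> Conf" "g \<in> carrier \<Gamma>"
  shows "(\<lambda>x\<in>S. a (ray_action g x)) \<in> Conf"
proof -
  have "{x \<in> S. a (ray_action g x) \<noteq> 0} \<subseteq> ray_action (inv\<^bsub>\<Gamma>\<^esub> g) ` {x \<in> S. a x \<noteq> 0}"
  proof
    fix x assume "x \<in> {x \<in> S. a (ray_action g x) \<noteq> 0}"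
    then show "x \<in> ray_action (inv\<^bsub>\<Gamma>\<^esub> g) ` {x \<in> S. a x \<noteq> 0}"
      using assms S_closed act_inv by (intro image_eqI[of _ _ "ray_action g x"]) auto
  qed
  moreover have "finite (ray_action (inv\<^bsub>\<Gamma>\<^esub> g) ` {x \<in> S. a x \<noteq> 0})" using assms by (simp add: Conf_def)
  ultimately have "finite {x \<in> S. a (ray_action g x) \<noteq> 0}" by (rule finite_subset)
  moreover have "{x \<in> S. (\<lambda>x\<in>S. a (ray_action g x)) x \<noteq> 0} = {x \<in> S. a (ray_action g x) \<noteq> 0}" by auto
  ultimately show ?thesis by (simp add: Conf_def)
qed

lemma body_bij: "bij_betw body (Conf \<times> carrier \<Gamma>) (carrier W)"
proof (rule bij_betwI[where g = unbody])
  show "body \<in> Conf \<times> carrier \<Gamma> \<rightarrow> carrier W" "unbody \<in> carrier W \<rightarrow> Conf \<times> carrier \<Gamma>"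
    by (auto simp: body_def unbody_def carrier_W Conf_act)
  show "unbody (body x) = x" if "x \<in> Conf \<times> carrier \<Gamma>" for x
    using that by (auto simp: body_def unbody_def S_closed act_inv Conf_def extensional_def fun_eq_iff)
  show "body (unbody y) = y" if "y \<in> carrier W" for y
    using that by (auto simp: body_def unbody_def S_closed act_inv Conf_def carrier_W extensional_def fun_eq_iff)
qed

lemma lift_body:
  assumes "s \<in> carrier \<Gamma>" "g \<in> carrier \<Gamma>"
  shows "lift s \<otimes>\<^bsub>W\<^esub> body (a, g) = body (a, s \<otimes>\<^bsub>\<Gamma>\<^esub> g)"
  using assms by (auto simp: lift_def body_def mult_W fun_eq_iff S_closed act_mult Gam.inv_mult_group)

lemma lamp_body:
  assumes "g \<in> carrier \<Gamma>"
  shows "lamp base 1 \<otimes>\<^bsub>W\<^esub> body (a, g) = body (a(site g := a (site g) + 1), g)"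
proof -
  have "ray_action (inv\<^bsub>\<Gamma>\<^esub> g) x = site g \<longleftrightarrow> x = base" if "x \<in> S" for x
    using assms that act_inv(2)[OF assms] base_S by (metis site_def)
  then have "(\<lambda>x\<in>S. (\<lambda>x\<in>S. if x = base then 1 else 0) x + (\<lambda>x\<in>S. a (ray_action (inv\<^bsub>\<Gamma>\<^esub> g) x)) (ray_action (inv\<^bsub>\<Gamma>\<^esub> \<one>\<^bsub>\<Gamma>\<^esub>) x))
     = (\<lambda>x\<in>S. (a(site g := a (site g) + 1)) (ray_action (inv\<^bsub>\<Gamma>\<^esub> g) x))"
    by (intro restrict_ext) (auto simp: act_one site_def)
  then show ?thesis using assms by (simp add: lamp_def body_def mult_W)
qed

lemma Conf_upd: "z \<in> S \<Longrightarrow> a(z := t) \<in> Conf \<longleftrightarrow> a \<in> Conf"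
proof -
  assume z: "z \<in> S"
  have "{x \<in> S. (a(z := t)) x \<noteq> 0} \<subseteq> insert z {x \<in> S. a x \<noteq> 0}" "{x \<in> S. a x \<noteq> 0} \<subseteq> insert z {x \<in> S. (a(z := t)) x \<noteq> 0}"
    by auto
  then have "finite {x \<in> S. (a(z := t)) x \<noteq> 0} \<longleftrightarrow> finite {x \<in> S. a x \<noteq> 0}"
    by (meson finite.insertI finite_subset)
  then show ?thesis using z by (auto simp: Conf_def extensional_def)
qed

text \<open>
  \<open>base_point_spreads\<close> for the law of \<open>g\<^sup>-\<^sup>1\<close> under the normalized weight \<open>F\<close>.
\<close>

lemma spread_on_group:
  assumes F: "\<And>g. 0 \<le> F g" "finite (supp \<Gamma> F)" and w: "w = (\<Sum>g\<in>supp \<Gamma> F. F g)" "0 < w"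
    and \<epsilon>: "0 < \<epsilon>" "displacement 1 \<Gamma> gen_a F \<le> \<epsilon> * w" "displacement 1 \<Gamma> gen_b F \<le> \<epsilon> * w"
    and n: "2 \<le> n" and q: "l (n - 1) \<le> q" "q \<le> l n" and eps: "\<epsilon> * real q \<le> 1 / 2 ^ 80"
    and Z: "finite Z" "16 * card Z \<le> level_size l (n - 1) * q"
  shows "8 * (\<Sum>g\<in>{g \<in> supp \<Gamma> F. site g \<in> Z}. F g) \<le> w"
proof -
  let ?inv = "\<lambda>g. inv\<^bsub>\<Gamma>\<^esub> g"
  define D where "D = ?inv ` supp \<Gamma> F"
  have sub: "supp \<Gamma> F \<subseteq> carrier \<Gamma>" by (auto simp: supp_def)
  have inj: "inj_on ?inv (supp \<Gamma> F)" 
  proof (rule inj_onI)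
    fix x y assume "x \<in> supp \<Gamma> F" "y \<in> supp \<Gamma> F" and eq: "?inv x = ?inv y"
    then have "x \<in> carrier \<Gamma>" "y \<in> carrier \<Gamma>" using sub by auto
    then have "?inv (?inv x) = x" "?inv (?inv y) = y" by simp_all
    then show "x = y" using eq by metis
  qed
  define P where "P \<tau> = F (?inv \<tau>) / w" for \<tau>
  have sum_D: "(\<Sum>\<tau>\<in>D. P \<tau> * \<phi> \<tau>) = (\<Sum>g\<in>supp \<Gamma> F. F g / w * \<phi> (?inv g))" for \<phi> :: "_ \<Rightarrow> real"
  proof -
    have "(\<Sum>\<tau>\<in>D. P \<tau> * \<phi> \<tau>) = sum ((\<lambda>\<tau>. P \<tau> * \<phi> \<tau>) \<circ> ?inv) (supp \<Gamma> F)"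
      unfolding D_def by (rule sum.reindex[OF inj])
    also have "\<dots> = (\<Sum>g\<in>supp \<Gamma> F. F g / w * \<phi> (?inv g))"
    proof (rule sum.cong[OF refl])
      fix g assume "g \<in> supp \<Gamma> F"
      then have "?inv (?inv g) = g" using sub by (intro Gam.inv_inv) auto
      then show "((\<lambda>\<tau>. P \<tau> * \<phi> \<tau>) \<circ> ?inv) g = F g / w * \<phi> (?inv g)" by (simp add: P_def)
    qed
    finally show ?thesis .
  qed
  interpret weighted D P
  proof
    show "finite D" using F by (simp add: D_def)
    show "0 \<le> P \<tau>" for \<tau> using F w by (simp add: P_def)
    show "sum P D = 1" using sum_D[of "\<lambda>_. 1"] w by (simp flip: sum_divide_distrib)
  qed
  have step: "\<bar>E \<phi> - E (\<lambda>\<tau>. \<phi> (compose (words l 0) \<tau> s))\<bar> \<le> M * \<epsilon>"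
    if M: "\<And>\<tau>. \<bar>\<phi> \<tau>\<bar> \<le> M" and s: "restrict s (words l 0) \<in> carrier \<Gamma>" "\<And>w. w \<in> words l 0 \<Longrightarrow> s w \<in> words l 0"
      and e: "displacement 1 \<Gamma> (restrict s (words l 0)) F \<le> \<epsilon> * w" for \<phi> M s
  proof -
    let ?s = "restrict s (words l 0)"
    let ?T = "supp \<Gamma> F \<union> {g \<in> carrier \<Gamma>. F (?s \<otimes>\<^bsub>\<Gamma>\<^esub> g) \<noteq> 0}"
    have T: "finite ?T" "?T \<subseteq> carrier \<Gamma>" using Gam.displaced_support[OF s(1) F(2)] F sub by auto
    have "E \<phi> = (\<Sum>g\<in>?T. F g / w * \<phi> (?inv g))"
      unfolding E_def sum_D by (rule sum.mono_neutral_left) (use T in \<open>auto simp: supp_def\<close>)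
    moreover have "E (\<lambda>\<tau>. \<phi> (compose (words l 0) \<tau> s)) = (\<Sum>g\<in>?T. F (?s \<otimes>\<^bsub>\<Gamma>\<^esub> g) / w * \<phi> (?inv g))"
    proof -
      have "E (\<lambda>\<tau>. \<phi> (compose (words l 0) \<tau> s)) = (\<Sum>g\<in>supp \<Gamma> F. F g / w * \<phi> (compose (words l 0) (?inv g) s))"
        unfolding E_def sum_D ..
      also have "\<dots> = (\<Sum>g\<in>(\<lambda>g. ?s \<otimes>\<^bsub>\<Gamma>\<^esub> g) ` {g \<in> carrier \<Gamma>. F (?s \<otimes>\<^bsub>\<Gamma>\<^esub> g) \<noteq> 0}. F g / w * \<phi> (compose (words l 0) (?inv g) s))"
      proof (rule sum.cong[OF _ refl])
        show "supp \<Gamma> F = (\<lambda>g. ?s \<otimes>\<^bsub>\<Gamma>\<^esub> g) ` {g \<in> carrier \<Gamma>. F (?s \<otimes>\<^bsub>\<Gamma>\<^esub> g) \<noteq> 0}"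
        proof (intro equalityI subsetI)
          fix g assume "g \<in> supp \<Gamma> F"
          then show "g \<in> (\<lambda>g. ?s \<otimes>\<^bsub>\<Gamma>\<^esub> g) ` {g \<in> carrier \<Gamma>. F (?s \<otimes>\<^bsub>\<Gamma>\<^esub> g) \<noteq> 0}"
            using s by (intro image_eqI[of _ _ "?inv ?s \<otimes>\<^bsub>\<Gamma>\<^esub> g"]) (auto simp: supp_def Gam.m_assoc[symmetric])
        qed (use s in \<open>auto simp: supp_def\<close>)
      qed
      also have "\<dots> = (\<Sum>g\<in>{g \<in> carrier \<Gamma>. F (?s \<otimes>\<^bsub>\<Gamma>\<^esub> g) \<noteq> 0}. F (?s \<otimes>\<^bsub>\<Gamma>\<^esub> g) / w * \<phi> (compose (words l 0) (?inv (?s \<otimes>\<^bsub>\<Gamma>\<^esub> g)) s))"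
        by (subst sum.reindex) (use s(1) in \<open>auto simp: inj_on_def\<close>)
      also have "\<dots> = (\<Sum>g\<in>{g \<in> carrier \<Gamma>. F (?s \<otimes>\<^bsub>\<Gamma>\<^esub> g) \<noteq> 0}. F (?s \<otimes>\<^bsub>\<Gamma>\<^esub> g) / w * \<phi> (?inv g))"
      proof (rule sum.cong[OF refl])
        fix g assume g: "g \<in> {g \<in> carrier \<Gamma>. F (?s \<otimes>\<^bsub>\<Gamma>\<^esub> g) \<noteq> 0}"
        let ?k = "?inv (?s \<otimes>\<^bsub>\<Gamma>\<^esub> g)"
        have k: "?k \<in> carrier \<Gamma>" using g s by auto
        have "compose (words l 0) ?k s = ?k \<otimes>\<^bsub>\<Gamma>\<^esub> ?s"
          using k s by (auto simp: ns_group_mult compose_def fun_eq_iff)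
        also have "\<dots> = ?inv g" using g s by (simp add: Gam.inv_mult_group Gam.m_assoc)
        finally show "F (?s \<otimes>\<^bsub>\<Gamma>\<^esub> g) / w * \<phi> (compose (words l 0) ?k s) = F (?s \<otimes>\<^bsub>\<Gamma>\<^esub> g) / w * \<phi> (?inv g)" by simp
      qed
      also have "\<dots> = (\<Sum>g\<in>?T. F (?s \<otimes>\<^bsub>\<Gamma>\<^esub> g) / w * \<phi> (?inv g))"
        by (rule sum.mono_neutral_left) (use T sub in auto)
      finally show ?thesis .
    qed
    ultimately have eq: "E \<phi> - E (\<lambda>\<tau>. \<phi> (compose (words l 0) \<tau> s)) = (\<Sum>g\<in>?T. (F g - F (?s \<otimes>\<^bsub>\<Gamma>\<^esub> g)) / w * \<phi> (?inv g))"
      by (simp only: sum_subtractf[symmetric]) (simp add: diff_divide_distrib left_diff_distrib)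
    have "\<bar>E \<phi> - E (\<lambda>\<tau>. \<phi> (compose (words l 0) \<tau> s))\<bar> \<le> (\<Sum>g\<in>?T. \<bar>F (?s \<otimes>\<^bsub>\<Gamma>\<^esub> g) - F g\<bar> ^ 1 * (M / w))"
      unfolding eq
    proof (rule order_trans[OF sum_abs sum_mono])
      fix g
      have "\<bar>(F g - F (?s \<otimes>\<^bsub>\<Gamma>\<^esub> g)) / w * \<phi> (?inv g)\<bar> = \<bar>F (?s \<otimes>\<^bsub>\<Gamma>\<^esub> g) - F g\<bar> / w * \<bar>\<phi> (?inv g)\<bar>"
        using w by (simp add: abs_mult abs_minus_commute)
      also have "\<dots> \<le> \<bar>F (?s \<otimes>\<^bsub>\<Gamma>\<^esub> g) - F g\<bar> / w * M" using M w by (intro mult_left_mono) auto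
      finally show "\<bar>(F g - F (?s \<otimes>\<^bsub>\<Gamma>\<^esub> g)) / w * \<phi> (?inv g)\<bar> \<le> \<bar>F (?s \<otimes>\<^bsub>\<Gamma>\<^esub> g) - F g\<bar> ^ 1 * (M / w)" by simp
    qed
    also have "(\<Sum>g\<in>?T. \<bar>F (?s \<otimes>\<^bsub>\<Gamma>\<^esub> g) - F g\<bar> ^ 1 * (M / w)) = displacement 1 \<Gamma> ?s F * (M / w)"
    proof -
      have "displacement 1 \<Gamma> ?s F = (\<Sum>g\<in>?T. \<bar>F (?s \<otimes>\<^bsub>\<Gamma>\<^esub> g) - F g\<bar> ^ 1)"
        by (rule Gam.displacement_finite[OF s(1) F(2) _ T]) auto
      then show ?thesis by (simp only: sum_distrib_right)
    qed
    also have "displacement 1 \<Gamma> ?s F * (M / w) \<le> (\<epsilon> * w) * (M / w)"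
    proof (rule mult_right_mono[OF e])
      show "0 \<le> M / w" using order_trans[OF abs_ge_zero M[of undefined]] w by simp
    qed
    finally show ?thesis using w by (simp add: mult.commute)
  qed
  interpret almost_invariant D P l \<epsilon>
  proof
    show "0 < \<epsilon>" by fact
    show "\<bar>E \<phi> - E (\<lambda>\<tau>. \<phi> (alpha_rot \<tau>))\<bar> \<le> M * \<epsilon>" if "\<And>\<tau>. \<bar>\<phi> \<tau>\<bar> \<le> M" for \<phi> M
      unfolding alpha_rot_def using gens \<epsilon> alpha_words that by (intro step) (auto simp: gen_a_def)
    show "\<bar>E \<phi> - E (\<lambda>\<tau>. \<phi> (beta_rot \<tau>))\<bar> \<le> M * \<epsilon>" if "\<And>\<tau>. \<bar>\<phi> \<tau>\<bar> \<le> M" for \<phi> M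
      unfolding beta_rot_def using gens \<epsilon> beta_words that by (intro step) (auto simp: gen_b_def)
  qed
  \<comment> \<open>only the prefix of length \<open>n\<close> of the site matters\<close>
  define Zn where "Zn = (\<lambda>\<xi>. map \<xi> [0..<n]) ` Z"
  have "E (\<lambda>\<tau>. of_bool (\<tau> (replicate n 0) \<in> Zn)) \<le> 1 / 8"
  proof (rule base_point_spreads[OF n q eps])
    show "finite Zn" using Z by (simp add: Zn_def)
    show "16 * card Zn \<le> level_size l (n - 1) * q" using Z card_image_le[OF Z(1), of "\<lambda>\<xi>. map \<xi> [0..<n]"] by (simp add: Zn_def)
    show "inj_on \<tau> (words l 0)" if "\<tau> \<in> D" for \<tau>
    proof -
      have "\<tau> \<in> carrier \<Gamma>" using that sub by (auto simp: D_def)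
      then have "bij_betw \<tau> (words l 0) (words l 0)" using ns_group_Bij by (auto simp: Bij_def)
      then show ?thesis by (rule bij_betw_imp_inj_on)
    qed
  qed
  then have "(\<Sum>g\<in>supp \<Gamma> F. F g / w * of_bool (?inv g (replicate n 0) \<in> Zn)) \<le> 1 / 8"
    unfolding E_def sum_D .
  moreover have "(\<Sum>g\<in>{g \<in> supp \<Gamma> F. site g \<in> Z}. F g) / w \<le> (\<Sum>g\<in>supp \<Gamma> F. F g / w * of_bool (?inv g (replicate n 0) \<in> Zn))"
  proof -
    have "(\<Sum>g\<in>{g \<in> supp \<Gamma> F. site g \<in> Z}. F g) / w = (\<Sum>g\<in>supp \<Gamma> F. if site g \<in> Z then F g / w else 0)"
      using F by (simp add: sum_divide_distrib sum.If_cases Int_def)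
    also have "\<dots> \<le> (\<Sum>g\<in>supp \<Gamma> F. F g / w * of_bool (?inv g (replicate n 0) \<in> Zn))"
    proof (rule sum_mono)
      fix g assume g: "g \<in> supp \<Gamma> F"
      have "?inv g (replicate n 0) = map (site g) [0..<n]"
        using map_ray_action[of "?inv g" l base n] g sub base_rays by (auto simp: site_def map_replicate_const)
      then show "(if site g \<in> Z then F g / w else 0) \<le> F g / w * of_bool (?inv g (replicate n 0) \<in> Zn)"
        using F w by (auto simp: Zn_def)
    qed
    finally show ?thesis .
  qed
  ultimately have "(\<Sum>g\<in>{g \<in> supp \<Gamma> F. site g \<in> Z}. F g) / w \<le> 1 / 8" by (meson order_trans)
  then show ?thesis using w(2) by (simp only: pos_divide_le_eq)
qed

text \<open>
  A slice is bad if its energy exceeds the threshold of \<open>spread_on_group\<close> relative to its mass; since the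
  total energy is smaller by a factor 16, few slices are bad.
\<close>

theorem support_lower_bound:
  assumes \<phi>: "finite (set_pmf \<phi>)" "set_pmf \<phi> \<subseteq> carrier W" "generate W (set_pmf \<phi>) = carrier W"
  shows "\<exists>c>0. \<forall>n q f. 2 \<le> n \<longrightarrow> l (n - 1) \<le> q \<longrightarrow> q \<le> l n \<longrightarrow> finite (supp W f) \<longrightarrow> lp_norm 1 W f = 1 \<longrightarrow>
     dirichlet 1 W \<phi> f < c / real q \<longrightarrow> (2 * q) ^ (level_size l (n - 1) * q div 16 + 1) \<le> card (supp W f)"
proof -
  obtain Ca Cb Cd where C: "0 \<le> Ca" "0 \<le> Cb" "0 \<le> Cd"
    "\<And>f. finite (supp W f) \<Longrightarrow> displacement 1 W (lift gen_a) f \<le> Ca * dirichlet 1 W \<phi> f"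
    "\<And>f. finite (supp W f) \<Longrightarrow> displacement 1 W (lift gen_b) f \<le> Cb * dirichlet 1 W \<phi> f"
    "\<And>f. finite (supp W f) \<Longrightarrow> displacement 1 W (lamp base 1) f \<le> Cd * dirichlet 1 W \<phi> f"
    using Wr.displacement_le_dirichlet[OF \<phi>, of 1 "lift gen_a"] Wr.displacement_le_dirichlet[OF \<phi>, of 1 "lift gen_b"]
      Wr.displacement_le_dirichlet[OF \<phi>, of 1 "lamp base 1"] gens lift_carrier lamp_carrier by metis
  define K where "K = 1 + Ca + Cb + Cd"
  have K: "0 < K" "Ca \<le> K" "Cb \<le> K" "Cd \<le> K" using C by (auto simp: K_def)
  \<comment> \<open>keeps the total energies below 1/16 of the threshold \<open>1 / (2^80 q)\<close> for spreading\<close>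
  define c where "c = 1 / 2 ^ 84 / K"
  show ?thesis
  proof (intro exI[of _ c] conjI allI impI)
    show "0 < c" using K by (simp add: c_def)
    fix n q f
    assume n: "2 \<le> n" and q: "l (n - 1) \<le> q" "q \<le> l n"
      and f: "finite (supp W f)" "lp_norm 1 W f = 1" and small: "dirichlet 1 W \<phi> f < c / real q"
    have q2: "2 \<le> q" using q l_ge2[of "n - 1"] n by linarith
    define \<epsilon> where "\<epsilon> = 1 / (2 ^ 80 * real q)"
    have \<epsilon>: "0 < \<epsilon>" "\<epsilon> * real q \<le> 1 / 2 ^ 80" using q2 by (auto simp: \<epsilon>_def)
    have disp: "displacement 1 W x f \<le> \<epsilon> / 16" if "displacement 1 W x f \<le> k * dirichlet 1 W \<phi> f" "k \<le> K" for x k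
    proof -
      have d0: "0 \<le> dirichlet 1 W \<phi> f" unfolding dirichlet_def by (auto intro!: infsum_nonneg mult_nonneg_nonneg)
      have "k * dirichlet 1 W \<phi> f \<le> K * (c / real q)" using that K small d0 by (intro mult_mono) auto
      also have "\<dots> = \<epsilon> / 16" using K q2 by (simp add: c_def \<epsilon>_def)
      finally show ?thesis using that by linarith
    qed
    define h where "h a g = (if a \<in> Conf \<and> g \<in> carrier \<Gamma> then \<bar>f (body (a, g))\<bar> else 0)" for a g
    define Sp where "Sp = {(a, g). h a g \<noteq> 0}"
    have bij: "bij_betw body Sp (supp W f)"
    proof (rule bij_betw_subset[OF body_bij])
      show "Sp \<subseteq> Conf \<times> carrier \<Gamma>" by (auto simp: Sp_def h_def split: if_splits)
      show "body ` Sp = supp W f"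
      proof (intro equalityI subsetI)
        fix x assume "x \<in> body ` Sp"
        then show "x \<in> supp W f" using bij_betwE[OF body_bij] by (auto simp: Sp_def h_def supp_def split: if_splits)
      next
        fix x assume x: "x \<in> supp W f"
        then have "x \<in> body ` (Conf \<times> carrier \<Gamma>)"
          using bij_betw_imp_surj_on[OF body_bij] by (simp add: supp_def)
        then obtain y where "y \<in> Conf \<times> carrier \<Gamma>" "x = body y" by blast
        then show "x \<in> body ` Sp" using x by (auto simp: Sp_def h_def supp_def)
      qed
    qed
    have finSp: "finite Sp" using bij_betw_finite[OF bij] f by simp
    have total: "(\<Sum>(a, g)\<in>Sp. h a g) = 1"
    proof -
      have "(\<Sum>(a, g)\<in>Sp. h a g) = (\<Sum>x\<in>Sp. \<bar>f (body x)\<bar>)" by (intro sum.cong) (auto simp: Sp_def h_def split: if_splits)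
      also have "\<dots> = 1" using sum.reindex_bij_betw[OF bij, of "\<lambda>x. \<bar>f x\<bar>"] f(2) Wr.lp_norm_1[OF f(1)] by simp
      finally show ?thesis .
    qed
    have h0: "0 \<le> h a g" for a g by (simp add: h_def)
    have finh: "finite (supp \<Gamma> (h a))" for a
    proof (rule finite_subset)
      show "supp \<Gamma> (h a) \<subseteq> snd ` Sp" by (force simp: supp_def Sp_def)
    qed (use finSp in simp)
    define w where "w a = (\<Sum>g\<in>supp \<Gamma> (h a). h a g)" for a
    have supp_h: "supp \<Gamma> (h a) = {g. h a g \<noteq> 0}" for a by (auto simp: supp_def h_def split: if_splits)
    have w0: "0 \<le> w a" for a by (simp add: w_def sum_nonneg h0)
    define A where "A = fst ` Sp"
    have finA: "finite A" "A \<subseteq> Conf" using finSp by (auto simp: A_def Sp_def h_def split: if_splits)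
    have slices: "(\<Sum>a\<in>A. displacement 1 \<Gamma> s (h a)) \<le> displacement 1 W (lift s) f" if s: "s \<in> carrier \<Gamma>" for s
    proof -
      define T where "T a = supp \<Gamma> (h a) \<union> {g \<in> carrier \<Gamma>. h a (s \<otimes>\<^bsub>\<Gamma>\<^esub> g) \<noteq> 0}" for a
      have T: "finite (T a)" "T a \<subseteq> carrier \<Gamma>" for a
        using Gam.displaced_support[OF s finh] finh by (auto simp: T_def supp_def)
      have "(\<Sum>a\<in>A. displacement 1 \<Gamma> s (h a)) = (\<Sum>a\<in>A. \<Sum>g\<in>T a. \<bar>h a (s \<otimes>\<^bsub>\<Gamma>\<^esub> g) - h a g\<bar> ^ 1)"
        by (intro sum.cong refl Gam.displacement_finite s finh T) (auto simp: T_def)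
      also have "\<dots> \<le> (\<Sum>a\<in>A. \<Sum>g\<in>T a. \<bar>f (lift s \<otimes>\<^bsub>W\<^esub> body (a, g)) - f (body (a, g))\<bar> ^ 1)"
      proof (intro sum_mono)
        fix a g assume "a \<in> A" "g \<in> T a"
        then have "a \<in> Conf" "g \<in> carrier \<Gamma>" using finA T by auto
        then show "\<bar>h a (s \<otimes>\<^bsub>\<Gamma>\<^esub> g) - h a g\<bar> ^ 1 \<le> \<bar>f (lift s \<otimes>\<^bsub>W\<^esub> body (a, g)) - f (body (a, g))\<bar> ^ 1"
          using s by (simp add: h_def lift_body abs_triangle_ineq3)
      qed
      also have "\<dots> = (\<Sum>x\<in>Sigma A T. \<bar>f (lift s \<otimes>\<^bsub>W\<^esub> body x) - f (body x)\<bar> ^ 1)"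
        using finA T by (subst sum.Sigma) (auto intro!: sum.cong)
      also have "\<dots> = (\<Sum>x\<in>body ` Sigma A T. \<bar>f (lift s \<otimes>\<^bsub>W\<^esub> x) - f x\<bar> ^ 1)"
      proof (subst sum.reindex)
        show "inj_on body (Sigma A T)"
          by (rule inj_on_subset[OF bij_betw_imp_inj_on[OF body_bij]]) (use finA T in auto)
      qed simp
      also have "\<dots> \<le> displacement 1 W (lift s) f"
      proof (rule Wr.displacement_le)
        show "body ` Sigma A T \<subseteq> carrier W" using bij_betwE[OF body_bij] finA T by blast
      qed (use s f finA T in auto)
      finally show ?thesis .
    qed
    define Bad where "Bad = {a. \<epsilon> * w a < displacement 1 \<Gamma> gen_a (h a) \<or> \<epsilon> * w a < displacement 1 \<Gamma> gen_b (h a)}"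
    have "(2 * q) ^ (level_size l (n - 1) * q div 16 + 1) \<le> card {(a, g). h a g \<noteq> 0}"
    proof (rule lamp_support_bound[where Bad = Bad and site = site and \<eta> = "1 / (128 * real q)"])
      show "finite {(a, g). h a g \<noteq> 0}" using finSp by (simp add: Sp_def)
      show "0 \<le> h a g" for a g by (rule h0)
      show "(\<Sum>(a, g)\<in>{(a, g). h a g \<noteq> 0}. h a g) = 1" using total by (simp add: Sp_def)
      show "(\<Sum>(a, g)\<in>{x \<in> {(a, g). h a g \<noteq> 0}. fst x \<in> Bad}. h a g) \<le> 1 / 8"
      proof -
        have "{x \<in> {(a, g). h a g \<noteq> 0}. fst x \<in> Bad} = Sigma (A \<inter> Bad) (\<lambda>a. supp \<Gamma> (h a))"
          unfolding supp_h by (force simp: A_def Sp_def)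
        then have "(\<Sum>(a, g)\<in>{x \<in> {(a, g). h a g \<noteq> 0}. fst x \<in> Bad}. h a g) = (\<Sum>a\<in>A \<inter> Bad. w a)"
          using finA finh by (simp add: sum.Sigma w_def)
        also have "\<dots> \<le> (\<Sum>a\<in>A \<inter> Bad. (displacement 1 \<Gamma> gen_a (h a) + displacement 1 \<Gamma> gen_b (h a)) / \<epsilon>)"
        proof (rule sum_mono)
          fix a assume "a \<in> A \<inter> Bad"
          then have "\<epsilon> * w a \<le> displacement 1 \<Gamma> gen_a (h a) + displacement 1 \<Gamma> gen_b (h a)"
            using Gam.displacement_nonneg[of 1 gen_a "h a"] Gam.displacement_nonneg[of 1 gen_b "h a"] by (auto simp: Bad_def)
          then show "w a \<le> (displacement 1 \<Gamma> gen_a (h a) + displacement 1 \<Gamma> gen_b (h a)) / \<epsilon>"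
            using \<epsilon> by (simp add: field_simps)
        qed
        also have "\<dots> \<le> (\<Sum>a\<in>A. (displacement 1 \<Gamma> gen_a (h a) + displacement 1 \<Gamma> gen_b (h a)) / \<epsilon>)"
          using finA \<epsilon> by (intro sum_mono2) (auto intro!: divide_nonneg_pos add_nonneg_nonneg Gam.displacement_nonneg)
        also have "\<dots> = ((\<Sum>a\<in>A. displacement 1 \<Gamma> gen_a (h a)) + (\<Sum>a\<in>A. displacement 1 \<Gamma> gen_b (h a))) / \<epsilon>"
          by (simp add: sum.distrib flip: sum_divide_distrib)
        also have "\<dots> \<le> (\<epsilon> / 16 + \<epsilon> / 16) / \<epsilon>"
          using order_trans[OF slices disp[OF C(4)[OF f(1)] K(2)]] order_trans[OF slices disp[OF C(5)[OF f(1)] K(3)]] \<epsilon>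
          by (intro divide_right_mono add_mono) auto
        also have "\<dots> = 1 / 8" using \<epsilon> by simp
        finally show ?thesis .
      qed
      show "8 * (\<Sum>g\<in>{g. h a g \<noteq> 0 \<and> site g \<in> Z}. h a g) \<le> (\<Sum>g\<in>{g. h a g \<noteq> 0}. h a g)"
        if "a \<notin> Bad" "finite Z" "card Z < level_size l (n - 1) * q div 16 + 1" for a Z
      proof (cases "w a = 0")
        case True
        then have "\<forall>g\<in>supp \<Gamma> (h a). h a g = 0" unfolding w_def using finh h0 by (simp add: sum_nonneg_eq_0_iff)
        then have "h a g = 0" for g by (auto simp: supp_h)
        then show ?thesis by simp
      next
        case False
        then have "8 * (\<Sum>g\<in>{g \<in> supp \<Gamma> (h a). site g \<in> Z}. h a g) \<le> w a"
          using that w0[of a] \<epsilon> n q finh h0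
          by (intro spread_on_group[where \<epsilon> = \<epsilon> and n = n and q = q]) (auto simp: w_def[symmetric] Bad_def)
        then show ?thesis by (simp add: w_def supp_h)
      qed
      show "(\<Sum>(a, g)\<in>T. \<bar>h (a(site g := a (site g) + 1)) g - h a g\<bar>) \<le> 1 / (128 * real q)" if T: "finite T" for T
      proof -
        let ?T = "T \<inter> Conf \<times> carrier \<Gamma>"
        have "(\<Sum>(a, g)\<in>T. \<bar>h (a(site g := a (site g) + 1)) g - h a g\<bar>) = (\<Sum>(a, g)\<in>?T. \<bar>h (a(site g := a (site g) + 1)) g - h a g\<bar>)"
        proof (rule sum.mono_neutral_right)
          have out: "h (a(site g := t)) g = 0 \<and> h a g = 0" if "\<not> (a \<in> Conf \<and> g \<in> carrier \<Gamma>)" for a g t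
          proof (cases "g \<in> carrier \<Gamma>")
            case True then show ?thesis using that by (simp add: h_def Conf_upd[OF site_S[OF True]])
          qed (simp add: h_def)
          show "\<forall>x\<in>T - ?T. (case x of (a, g) \<Rightarrow> \<bar>h (a(site g := a (site g) + 1)) g - h a g\<bar>) = 0"
          proof
            fix x assume "x \<in> T - ?T"
            then show "(case x of (a, g) \<Rightarrow> \<bar>h (a(site g := a (site g) + 1)) g - h a g\<bar>) = 0"
              using out[of "fst x" "snd x"] by (cases x) simp
          qed
        qed (use T in auto)
        also have "\<dots> \<le> (\<Sum>x\<in>?T. \<bar>f (lamp base 1 \<otimes>\<^bsub>W\<^esub> body x) - f (body x)\<bar> ^ 1)"
          by (intro sum_mono) (auto simp: h_def site_S Conf_upd lamp_body abs_triangle_ineq3)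
        also have "\<dots> = (\<Sum>x\<in>body ` ?T. \<bar>f (lamp base 1 \<otimes>\<^bsub>W\<^esub> x) - f x\<bar> ^ 1)"
        proof (subst sum.reindex)
          show "inj_on body ?T" by (rule inj_on_subset[OF bij_betw_imp_inj_on[OF body_bij]]) auto
        qed simp
        also have "\<dots> \<le> displacement 1 W (lamp base 1) f"
        proof (rule Wr.displacement_le)
          show "body ` ?T \<subseteq> carrier W" using bij_betwE[OF body_bij] by blast
        qed (use f T in auto)
        also have "\<dots> \<le> \<epsilon> / 16" by (rule disp[OF C(6)[OF f(1)] K(4)])
        also have "\<dots> \<le> 1 / (128 * real q)" using q2 by (simp add: \<epsilon>_def field_simps)
        finally show ?thesis .
      qed
      show "0 < 1 / (128 * real q)" "64 * (1 / (128 * real q)) * real (2 * q) \<le> 1" using q2 by auto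
    qed
    also have "\<dots> = card (supp W f)" using bij_betw_same_card[OF bij] by (simp add: Sp_def)
    finally show "(2 * q) ^ (level_size l (n - 1) * q div 16 + 1) \<le> card (supp W f)" .
  qed
qed
end

section \<open>Test functions from free actions\<close>

text \<open>
  On a free orbit a function on the space is a function on the group. Mass and energy are sums over
  the orbits, so one of the orbits has a ratio not larger than that of the whole space.
\<close>

lemma (in group) orbit_test_function:
  fixes act :: "'a \<Rightarrow> 'w \<Rightarrow> 'w" and F :: "'w \<Rightarrow> real"
  assumes closed: "\<And>x \<omega>. x \<in> carrier G \<Longrightarrow> \<omega> \<in> States \<Longrightarrow> act x \<omega> \<in> States"
    and mult: "\<And>x y \<omega>. x \<in> carrier G \<Longrightarrow> y \<in> carrier G \<Longrightarrow> \<omega> \<in> States \<Longrightarrow> act (x \<otimes> y) \<omega> = act x (act y \<omega>)"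
    and act_one: "\<And>\<omega>. \<omega> \<in> States \<Longrightarrow> act \<one> \<omega> = \<omega>"
    and free: "\<And>x y \<omega>. x \<in> carrier G \<Longrightarrow> y \<in> carrier G \<Longrightarrow> \<omega> \<in> States \<Longrightarrow> act x \<omega> = act y \<omega> \<Longrightarrow> x = y"
    and F: "finite Sp" "Sp \<subseteq> States" "\<And>\<omega>. \<omega> \<in> States \<Longrightarrow> \<omega> \<notin> Sp \<Longrightarrow> F \<omega> = 0"
    and M: "0 < (\<Sum>\<omega>\<in>Sp. (F \<omega>)\<^sup>2)"
    and H: "finite H" "H \<subseteq> carrier G"
    and inner: "\<And>s. s \<in> H \<Longrightarrow> (1 - \<kappa>) * (\<Sum>\<omega>\<in>Sp. (F \<omega>)\<^sup>2) \<le> (\<Sum>\<omega>\<in>Sp. F (act s \<omega>) * F \<omega>)"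
  shows "\<exists>f. finite (supp G f) \<and> lp_norm 2 G f = 1 \<and> card (supp G f) \<le> card Sp \<and>
     (\<Sum>s\<in>H. displacement 2 G s f) \<le> 2 * \<kappa> * real (card H)"
proof -
  let ?M = "\<Sum>\<omega>\<in>Sp. (F \<omega>)\<^sup>2"
  define T where "T = Sp \<union> (\<Union>s\<in>H. {\<omega> \<in> States. F (act s \<omega>) \<noteq> 0})"
  define e where "e s \<omega> = (F (act s \<omega>) - F \<omega>)\<^sup>2" for s \<omega>
  define orb where "orb \<omega> = {act x \<omega> |x. x \<in> carrier G}" for \<omega>
  have undo: "act (inv x) (act x \<omega>) = \<omega>" "act x (act (inv x) \<omega>) = \<omega>" if "x \<in> carrier G" "\<omega> \<in> States" for x \<omega>
    using that by (simp_all add: mult[symmetric] act_one)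
  have T: "finite T" "T \<subseteq> States" "Sp \<subseteq> T"
  proof -
    have "finite {\<omega> \<in> States. F (act s \<omega>) \<noteq> 0}" if "s \<in> H" for s
    proof (rule finite_subset)
      show "{\<omega> \<in> States. F (act s \<omega>) \<noteq> 0} \<subseteq> act (inv s) ` Sp"
      proof
        fix \<omega> assume w: "\<omega> \<in> {\<omega> \<in> States. F (act s \<omega>) \<noteq> 0}"
        then have "act s \<omega> \<in> Sp" using F(3)[of "act s \<omega>"] closed[of s \<omega>] that H by auto
        then show "\<omega> \<in> act (inv s) ` Sp" using undo(1)[of s \<omega>] w that H by (intro image_eqI[of _ _ "act s \<omega>"]) auto
      qed
    qed (use F in auto)
    then show "finite T" "T \<subseteq> States" "Sp \<subseteq> T" using F H by (auto simp: T_def)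
  qed
  have eT: "(\<Sum>\<omega>\<in>T. e s \<omega>) \<le> 2 * \<kappa> * ?M" if s: "s \<in> H" for s
  proof -
    have sc: "s \<in> carrier G" using s H by auto
    have "(\<Sum>\<omega>\<in>T. (F (act s \<omega>))\<^sup>2) = (\<Sum>\<omega>\<in>act s ` T. (F \<omega>)\<^sup>2)"
    proof (subst sum.reindex)
      show "inj_on (act s) T" using undo(1)[OF sc] T(2) by (metis inj_on_def subsetD)
    qed simp
    also have "\<dots> = (\<Sum>\<omega>\<in>act s ` T \<inter> Sp. (F \<omega>)\<^sup>2)"
    proof (rule sum.mono_neutral_right)
      have "F \<omega> = 0" if "\<omega> \<in> act s ` T" "\<omega> \<notin> Sp" for \<omega> using that T(2) closed[OF sc] F(3) by blast
      then show "\<forall>\<omega>\<in>act s ` T - act s ` T \<inter> Sp. (F \<omega>)\<^sup>2 = 0" by auto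
    qed (use T in auto)
    also have "\<dots> \<le> ?M" using F by (intro sum_mono2) auto
    finally have 1: "(\<Sum>\<omega>\<in>T. (F (act s \<omega>))\<^sup>2) \<le> ?M" .
    have 2: "(\<Sum>\<omega>\<in>T. (F \<omega>)\<^sup>2) = ?M" by (rule sum.mono_neutral_right) (use T F in auto)
    have 3: "(\<Sum>\<omega>\<in>T. F (act s \<omega>) * F \<omega>) = (\<Sum>\<omega>\<in>Sp. F (act s \<omega>) * F \<omega>)"
      by (rule sum.mono_neutral_right) (use T F in auto)
    have "(\<Sum>\<omega>\<in>T. e s \<omega>) = (\<Sum>\<omega>\<in>T. (F (act s \<omega>))\<^sup>2) + (\<Sum>\<omega>\<in>T. (F \<omega>)\<^sup>2) - 2 * (\<Sum>\<omega>\<in>T. F (act s \<omega>) * F \<omega>)"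
      by (simp add: e_def power2_diff sum.distrib sum_subtractf sum_distrib_left mult.assoc)
    then show ?thesis using 1 2 3 inner[OF s] by (simp add: algebra_simps)
  qed
  have orb_act: "orb (act x \<omega>) = orb \<omega>" if "x \<in> carrier G" "\<omega> \<in> States" for x \<omega>
  proof (intro equalityI subsetI)
    fix z assume "z \<in> orb (act x \<omega>)"
    then obtain y where "y \<in> carrier G" "z = act y (act x \<omega>)" by (auto simp: orb_def)
    then show "z \<in> orb \<omega>" using that mult[of y x \<omega>] by (auto simp: orb_def intro!: exI[of _ "y \<otimes> x"])
  next
    fix z assume "z \<in> orb \<omega>"
    then obtain y where y: "y \<in> carrier G" "z = act y \<omega>" by (auto simp: orb_def)
    then have "z = act (y \<otimes> inv x) (act x \<omega>)" using that closed[of x \<omega>] mult[of y "inv x" "act x \<omega>"] undo(1)[of x \<omega>] by simp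
    then show "z \<in> orb (act x \<omega>)" using that y by (auto simp: orb_def intro!: exI[of _ "y \<otimes> inv x"])
  qed
  define K where "K = orb ` Sp"
  define m where "m Q = (\<Sum>\<omega>\<in>{\<omega> \<in> Sp. orb \<omega> = Q}. (F \<omega>)\<^sup>2)" for Q
  define en where "en Q = (\<Sum>\<omega>\<in>{\<omega> \<in> T. orb \<omega> = Q}. \<Sum>s\<in>H. e s \<omega>)" for Q
  have Km: "(\<Sum>Q\<in>K. m Q) = ?M" unfolding m_def K_def using F by (intro sum.group) auto
  have Ke: "(\<Sum>Q\<in>K. en Q) \<le> 2 * \<kappa> * real (card H) * ?M"
  proof -
    have "(\<Sum>Q\<in>K. en Q) \<le> (\<Sum>Q\<in>orb ` T. en Q)"
      unfolding K_def en_def using T F by (intro sum_mono2) (auto intro!: sum_nonneg simp: e_def)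
    also have "\<dots> = (\<Sum>\<omega>\<in>T. \<Sum>s\<in>H. e s \<omega>)" unfolding en_def using T by (intro sum.group) auto
    also have "\<dots> = (\<Sum>s\<in>H. \<Sum>\<omega>\<in>T. e s \<omega>)" by (rule sum.swap)
    also have "\<dots> \<le> (\<Sum>s\<in>H. 2 * \<kappa> * ?M)" by (intro sum_mono eT)
    finally show ?thesis by (simp add: mult_ac)
  qed
  have "\<exists>Q\<in>K. en Q \<le> 2 * \<kappa> * real (card H) * m Q \<and> 0 < m Q"
  proof (rule ccontr)
    assume neg: "\<not> ?thesis"
    have m0: "0 \<le> m Q" for Q by (auto simp: m_def intro!: sum_nonneg)
    have en0: "0 \<le> en Q" for Q by (auto simp: en_def e_def intro!: sum_nonneg)
    have lt: "2 * \<kappa> * real (card H) * m Q < en Q" if "Q \<in> K" "m Q \<noteq> 0" for Q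
    proof (rule ccontr)
      assume "\<not> ?thesis"
      then have "en Q \<le> 2 * \<kappa> * real (card H) * m Q" "0 < m Q" using m0[of Q] that by auto
      then show False using neg that by blast
    qed
    have le: "2 * \<kappa> * real (card H) * m Q \<le> en Q" if "Q \<in> K" for Q
      using lt[OF that] en0[of Q] by (cases "m Q = 0") auto
    have "\<exists>Q\<in>K. m Q \<noteq> 0"
    proof (rule ccontr)
      assume "\<not> ?thesis"
      then have "sum m K = 0" by (intro sum.neutral) blast
      then show False using Km M by simp
    qed
    then obtain Q where Q: "Q \<in> K" "m Q \<noteq> 0" by blast
    have "(\<Sum>Q\<in>K. 2 * \<kappa> * real (card H) * m Q) < (\<Sum>Q\<in>K. en Q)"
      using F le Q lt[OF Q] by (intro sum_strict_mono_ex1) (auto simp: K_def)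
    then show False using Ke Km by (simp flip: sum_distrib_left)
  qed
  then obtain \<omega>0 where w0: "\<omega>0 \<in> Sp" "en (orb \<omega>0) \<le> 2 * \<kappa> * real (card H) * m (orb \<omega>0)" "0 < m (orb \<omega>0)"
    by (auto simp: K_def)
  have w0': "\<omega>0 \<in> States" using w0 F by auto
  let ?m = "m (orb \<omega>0)"
  define f where "f x = F (act x \<omega>0) / sqrt ?m" for x
  have bij: "bij_betw (\<lambda>x. act x \<omega>0) {x \<in> carrier G. act x \<omega>0 \<in> A} {\<omega> \<in> A. orb \<omega> = orb \<omega>0}" if A: "A \<subseteq> States" for A
  proof (rule bij_betw_imageI)
    show "inj_on (\<lambda>x. act x \<omega>0) {x \<in> carrier G. act x \<omega>0 \<in> A}" using free w0' by (auto simp: inj_on_def)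
    show "(\<lambda>x. act x \<omega>0) ` {x \<in> carrier G. act x \<omega>0 \<in> A} = {\<omega> \<in> A. orb \<omega> = orb \<omega>0}"
    proof (intro equalityI subsetI)
      fix \<omega> assume w: "\<omega> \<in> {\<omega> \<in> A. orb \<omega> = orb \<omega>0}"
      then have "\<omega> \<in> States" using A by auto
      then have "\<omega> \<in> orb \<omega>" using act_one[of \<omega>] by (auto simp: orb_def intro!: exI[of _ \<one>])
      then have "\<omega> \<in> orb \<omega>0" using w by simp
      then show "\<omega> \<in> (\<lambda>x. act x \<omega>0) ` {x \<in> carrier G. act x \<omega>0 \<in> A}" using w by (auto simp: orb_def)
    qed (use orb_act w0' in auto)
  qed
  have supp: "supp G f = {x \<in> carrier G. act x \<omega>0 \<in> {\<omega> \<in> Sp. F \<omega> \<noteq> 0}}"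
    using F(3) closed w0' w0(3) by (auto simp: supp_def f_def)
  have bs: "bij_betw (\<lambda>x. act x \<omega>0) (supp G f) {\<omega> \<in> {\<omega> \<in> Sp. F \<omega> \<noteq> 0}. orb \<omega> = orb \<omega>0}"
    unfolding supp using F by (intro bij) auto
  have fin: "finite (supp G f)" using bij_betw_finite[OF bs] F by simp
  have card: "card (supp G f) \<le> card Sp"
    unfolding bij_betw_same_card[OF bs] using F by (intro card_mono) auto
  have norm: "lp_norm 2 G f = 1"
  proof -
    have "(\<Sum>x\<in>supp G f. (f x)\<^sup>2) = (\<Sum>x\<in>supp G f. (F (act x \<omega>0))\<^sup>2 / ?m)"
      using w0(3) by (simp add: f_def power_divide)
    also have "\<dots> = (\<Sum>\<omega>\<in>{\<omega> \<in> {\<omega> \<in> Sp. F \<omega> \<noteq> 0}. orb \<omega> = orb \<omega>0}. (F \<omega>)\<^sup>2 / ?m)"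
      by (rule sum.reindex_bij_betw[OF bs])
    also have "\<dots> = (\<Sum>\<omega>\<in>{\<omega> \<in> Sp. orb \<omega> = orb \<omega>0}. (F \<omega>)\<^sup>2 / ?m)"
      by (rule sum.mono_neutral_left) (use F in auto)
    also have "\<dots> = 1" using w0(3) by (simp add: m_def flip: sum_divide_distrib)
    finally show ?thesis by (simp add: lp_norm_2[OF fin])
  qed
  have "(\<Sum>s\<in>H. displacement 2 G s f) = (\<Sum>s\<in>H. \<Sum>\<omega>\<in>{\<omega> \<in> T. orb \<omega> = orb \<omega>0}. e s \<omega> / ?m)"
  proof (rule sum.cong[OF refl])
    fix s assume s: "s \<in> H"
    then have sc: "s \<in> carrier G" using H by auto
    let ?TT = "{x \<in> carrier G. act x \<omega>0 \<in> T}"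
    have finTT: "finite ?TT" using bij_betw_finite[OF bij[OF T(2)]] T by simp
    have "displacement 2 G s f = (\<Sum>x\<in>?TT. \<bar>f (s \<otimes> x) - f x\<bar> ^ 2)"
    proof (rule displacement_finite[OF sc fin _ finTT])
      show "supp G f \<subseteq> ?TT" using supp T by auto
      show "{x \<in> carrier G. f (s \<otimes> x) \<noteq> 0} \<subseteq> ?TT"
      proof
        fix x assume "x \<in> {x \<in> carrier G. f (s \<otimes> x) \<noteq> 0}"
        then have "x \<in> carrier G" "F (act s (act x \<omega>0)) \<noteq> 0" using mult[OF sc _ w0'] by (auto simp: f_def)
        then show "x \<in> ?TT" using closed[OF _ w0'] s by (auto simp: T_def)
      qed
    qed auto
    also have "\<dots> = (\<Sum>x\<in>?TT. e s (act x \<omega>0) / ?m)"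
    proof (rule sum.cong[OF refl])
      fix x assume "x \<in> ?TT"
      then have "f (s \<otimes> x) - f x = (F (act s (act x \<omega>0)) - F (act x \<omega>0)) / sqrt ?m"
        using mult[OF sc _ w0'] by (simp add: f_def diff_divide_distrib)
      then show "\<bar>f (s \<otimes> x) - f x\<bar> ^ 2 = e s (act x \<omega>0) / ?m" using w0(3) by (simp add: e_def power_divide)
    qed
    also have "\<dots> = (\<Sum>\<omega>\<in>{\<omega> \<in> T. orb \<omega> = orb \<omega>0}. e s \<omega> / ?m)"
      by (rule sum.reindex_bij_betw[OF bij[OF T(2)], of "\<lambda>\<omega>. e s \<omega> / ?m"])
    finally show "displacement 2 G s f = (\<Sum>\<omega>\<in>{\<omega> \<in> T. orb \<omega> = orb \<omega>0}. e s \<omega> / ?m)" .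
  qed
  also have "\<dots> = en (orb \<omega>0) / ?m"
    unfolding en_def by (subst sum.swap) (simp add: sum_divide_distrib)
  also have "\<dots> \<le> 2 * \<kappa> * real (card H)" using w0 by (simp add: divide_le_eq)
  finally show ?thesis using fin norm card by blast
qed

section \<open>Products of tent functions\<close>

definition tent :: "int \<Rightarrow> int \<Rightarrow> real" where "tent R m = real_of_int (max 0 (R - \<bar>m\<bar>))"

lemma tent_nonneg: "0 \<le> tent R m" by (simp add: tent_def)

lemma tent_zero: "m \<notin> {-R..R} \<Longrightarrow> tent R m = 0" by (auto simp: tent_def)

lemma tent_square_lower:
  assumes "1 \<le> R" shows "real_of_int R ^ 3 / 4 \<le> (\<Sum>m\<in>{-R..R}. (tent R m)\<^sup>2)"
proof -
  let ?h = "R div 2"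
  have "real_of_int R ^ 3 / 4 = real_of_int R * (real_of_int R / 2)\<^sup>2" by (simp add: power2_eq_square power3_eq_cube)
  also have "\<dots> \<le> real (card {-?h..?h}) * (real_of_int R / 2)\<^sup>2"
  proof (rule mult_right_mono)
    have "R \<le> 2 * ?h + 1" by auto
    then show "real_of_int R \<le> real (card {-?h..?h})" using assms by simp
  qed simp
  also have "\<dots> = (\<Sum>m\<in>{-?h..?h}. (real_of_int R / 2)\<^sup>2)" by simp
  also have "\<dots> \<le> (\<Sum>m\<in>{-?h..?h}. (tent R m)\<^sup>2)"
  proof (rule sum_mono)
    fix m assume "m \<in> {-?h..?h}"
    then have "\<bar>m\<bar> \<le> R div 2" by auto
    then have "R \<le> 2 * (R - \<bar>m\<bar>)" by presburger
    then have "real_of_int R \<le> real_of_int (2 * (R - \<bar>m\<bar>))" by (simp only: of_int_le_iff)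
    also have "\<dots> \<le> real_of_int (2 * max 0 (R - \<bar>m\<bar>))" by (simp only: of_int_le_iff) (simp add: max_def)
    also have "\<dots> = 2 * tent R m" by (simp add: tent_def)
    finally show "(real_of_int R / 2)\<^sup>2 \<le> (tent R m)\<^sup>2" using assms by (intro power_mono) auto
  qed
  also have "\<dots> \<le> (\<Sum>m\<in>{-R..R}. (tent R m)\<^sup>2)" using assms by (intro sum_mono2) auto
  finally show ?thesis .
qed

text \<open>
  The energy of the tent is about \<open>2 R\<close>, its mass about \<open>2 R\<^sup>3 / 3\<close>.
\<close>

lemma tent_correlation:
  assumes "1 \<le> R"
  shows "(1 - 6 / real_of_int R ^ 2) * (\<Sum>m\<in>{-R..R}. (tent R m)\<^sup>2) \<le> (\<Sum>m\<in>{-R..R}. tent R m * tent R (m + 1))"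
proof -
  let ?Q = "\<Sum>m\<in>{-R..R}. (tent R m)\<^sup>2"
  have "(\<Sum>m\<in>{-R..R}. (tent R (m + 1))\<^sup>2) = (\<Sum>m\<in>{-R+1..R+1}. (tent R m)\<^sup>2)"
    by (rule sum.reindex_bij_witness[of _ "\<lambda>m. m - 1" "\<lambda>m. m + 1"]) auto
  also have "\<dots> = (\<Sum>m\<in>{-R+1..R}. (tent R m)\<^sup>2)"
    by (rule sum.mono_neutral_right) (auto simp: tent_def)
  also have "\<dots> = ?Q" by (rule sum.mono_neutral_left) (auto simp: tent_def)
  finally have shift: "(\<Sum>m\<in>{-R..R}. (tent R (m + 1))\<^sup>2) = ?Q" .
  have "(\<Sum>m\<in>{-R..R}. (tent R (m + 1) - tent R m)\<^sup>2) \<le> (\<Sum>m\<in>{-R..R}. 1)"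
  proof (rule sum_mono)
    fix m
    have "\<bar>tent R (m + 1) - tent R m\<bar> \<le> 1" by (auto simp: tent_def max_def)
    then show "(tent R (m + 1) - tent R m)\<^sup>2 \<le> 1" by (simp add: abs_square_le_1)
  qed
  also have "\<dots> \<le> 3 * real_of_int R" using assms by simp
  also have "\<dots> \<le> 12 / real_of_int R ^ 2 * ?Q"
    using tent_square_lower[OF assms] assms by (simp add: field_simps power2_eq_square power3_eq_cube)
  finally have diff: "(\<Sum>m\<in>{-R..R}. (tent R (m + 1) - tent R m)\<^sup>2) \<le> 12 / real_of_int R ^ 2 * ?Q" .
  have "(\<Sum>m\<in>{-R..R}. (tent R (m + 1) - tent R m)\<^sup>2)
      = (\<Sum>m\<in>{-R..R}. (tent R (m + 1))\<^sup>2) + ?Q - 2 * (\<Sum>m\<in>{-R..R}. tent R m * tent R (m + 1))"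
    by (simp add: power2_diff sum.distrib sum_subtractf sum_distrib_left mult_ac)
  then show ?thesis using diff shift by (simp add: algebra_simps)
qed

definition bump :: "'i set \<Rightarrow> ('i \<Rightarrow> int) \<Rightarrow> 'i \<Rightarrow> int" where
  "bump E p = (\<lambda>i. if i \<in> E then p i + 1 else p i)"

definition weight :: "'i set \<Rightarrow> int \<Rightarrow> ('i \<Rightarrow> int) \<Rightarrow> real" where
  "weight I R p = (\<Prod>i\<in>I. tent R (p i))"

text \<open>
  Which coordinates are moved may depend on the coordinate \<open>i0\<close>, which stays fixed itself: conditioned
  on its value, the sum is a product over the other coordinates.
\<close>

lemma weight_correlation:
  fixes E :: "int \<Rightarrow> 'i set"
  assumes I: "finite I" "i0 \<in> I" and R: "3 \<le> R"
    and E: "\<And>m. i0 \<notin> E m" "\<And>m. finite (E m)" "\<And>m. card (E m) \<le> 3"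
  shows "(1 - 18 / real_of_int R ^ 2) * (\<Sum>p\<in>PiE I (\<lambda>_. {-R..R}). (weight I R p)\<^sup>2)
     \<le> (\<Sum>p\<in>PiE I (\<lambda>_. {-R..R}). weight I R p * weight I R (bump (E (p i0)) p))"
proof -
  let ?D = "{-R..R}"
  let ?Q = "\<Sum>m\<in>?D. (tent R m)\<^sup>2"
  let ?k = "6 / real_of_int R ^ 2"
  define J where "J = I - {i0}"
  have J: "finite J" "i0 \<notin> J" "I = insert i0 J" using I by (auto simp: J_def)
  have R9: "9 \<le> real_of_int R ^ 2" using power_mono[of 3 "real_of_int R" 2] R by simp
  have k: "0 \<le> ?k" "?k \<le> 1" using R9 by (simp_all add: divide_le_eq)
  have split: "(\<Sum>p\<in>PiE I (\<lambda>_. ?D). h (p i0) * (\<Prod>i\<in>J. g (p i0) i (p i)))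
     = (\<Sum>m\<in>?D. h m * (\<Prod>i\<in>J. \<Sum>x\<in>?D. g m i x))" for h :: "int \<Rightarrow> real" and g :: "int \<Rightarrow> 'i \<Rightarrow> int \<Rightarrow> real"
  proof -
    have "(\<Sum>p\<in>PiE I (\<lambda>_. ?D). h (p i0) * (\<Prod>i\<in>J. g (p i0) i (p i)))
       = (\<Sum>(m, p)\<in>?D \<times> PiE J (\<lambda>_. ?D). h m * (\<Prod>i\<in>J. g m i (p i)))"
    proof (rule sum.reindex_bij_witness[where i = "\<lambda>(m, p). p(i0 := m)" and j = "\<lambda>p. (p i0, p(i0 := undefined))"])
      fix p assume p: "p \<in> PiE I (\<lambda>_. ?D)"
      show "(case (p i0, p(i0 := undefined)) of (m, p) \<Rightarrow> p(i0 := m)) = p" by simp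
      show "(p i0, p(i0 := undefined)) \<in> ?D \<times> PiE J (\<lambda>_. ?D)" using p J by (auto simp: PiE_def extensional_def Pi_def)
      have "(\<Prod>i\<in>J. g (p i0) i ((p(i0 := undefined)) i)) = (\<Prod>i\<in>J. g (p i0) i (p i))" using J by (intro prod.cong) auto
      then show "(case (p i0, p(i0 := undefined)) of (m, p) \<Rightarrow> h m * (\<Prod>i\<in>J. g m i (p i))) = h (p i0) * (\<Prod>i\<in>J. g (p i0) i (p i))"
        by simp
    next
      fix b assume b: "b \<in> ?D \<times> PiE J (\<lambda>_. ?D)"
      then show "((case b of (m, p) \<Rightarrow> p(i0 := m)) i0, (case b of (m, p) \<Rightarrow> p(i0 := m))(i0 := undefined)) = b"
        using J by (cases b) (auto simp: PiE_def extensional_def fun_eq_iff)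
      show "(case b of (m, p) \<Rightarrow> p(i0 := m)) \<in> PiE I (\<lambda>_. ?D)"
        using b J by (cases b) (auto simp: PiE_def extensional_def Pi_def)
    qed
    also have "\<dots> = (\<Sum>m\<in>?D. h m * (\<Sum>p\<in>PiE J (\<lambda>_. ?D). \<Prod>i\<in>J. g m i (p i)))"
      by (simp add: sum.cartesian_product[symmetric] sum_distrib_left)
    also have "\<dots> = (\<Sum>m\<in>?D. h m * (\<Prod>i\<in>J. \<Sum>x\<in>?D. g m i x))"
      using J by (subst prod_sum_PiE) auto
    finally show ?thesis .
  qed
  have w: "weight I R p = tent R (p i0) * (\<Prod>i\<in>J. tent R (p i))" for p
    using J by (simp add: weight_def)
  have lhs: "(\<Sum>p\<in>PiE I (\<lambda>_. ?D). (weight I R p)\<^sup>2) = (\<Sum>m\<in>?D. (tent R m)\<^sup>2 * (\<Prod>i\<in>J. ?Q))"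
    unfolding split[symmetric, of "\<lambda>m. (tent R m)\<^sup>2" "\<lambda>m i x. (tent R x)\<^sup>2"]
    by (intro sum.cong) (auto simp: w power_mult_distrib prod_power_distrib)
  have rhs: "(\<Sum>p\<in>PiE I (\<lambda>_. ?D). weight I R p * weight I R (bump (E (p i0)) p))
     = (\<Sum>m\<in>?D. (tent R m)\<^sup>2 * (\<Prod>i\<in>J. \<Sum>x\<in>?D. tent R x * tent R (if i \<in> E m then x + 1 else x)))"
    unfolding split[symmetric, of "\<lambda>m. (tent R m)\<^sup>2" "\<lambda>m i x. tent R x * tent R (if i \<in> E m then x + 1 else x)"]
    by (intro sum.cong) (auto simp: w bump_def E(1) prod.distrib power2_eq_square)
  have Q0: "0 \<le> ?Q" by (intro sum_nonneg) auto
  have "(1 - 3 * ?k) * (\<Prod>i\<in>J. ?Q) \<le> (\<Prod>i\<in>J. \<Sum>x\<in>?D. tent R x * tent R (if i \<in> E m then x + 1 else x))" for m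
  proof -
    have "1 - 3 * ?k \<le> (1 - ?k) ^ 3"
    proof -
      have "(1 - x) ^ 3 - (1 - 3 * x) = x ^ 2 * (3 - x)" for x :: real
        by (simp add: power3_eq_cube power2_eq_square algebra_simps)
      then have "(1 - ?k) ^ 3 - (1 - 3 * ?k) = ?k ^ 2 * (3 - ?k)" .
      moreover have "0 \<le> ?k ^ 2 * (3 - ?k)" using k by (intro mult_nonneg_nonneg) auto
      ultimately show ?thesis by linarith
    qed
    also have "\<dots> \<le> (1 - ?k) ^ card (J \<inter> E m)"
      using k E(3)[of m] card_mono[OF E(2), of "J \<inter> E m" m] by (intro power_decreasing) auto
    finally have "(1 - 3 * ?k) * (\<Prod>i\<in>J. ?Q) \<le> (1 - ?k) ^ card (J \<inter> E m) * (\<Prod>i\<in>J. ?Q)"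
      using Q0 by (intro mult_right_mono) (auto intro: prod_nonneg)
    also have "\<dots> = (\<Prod>i\<in>J. if i \<in> E m then 1 - ?k else 1) * (\<Prod>i\<in>J. ?Q)"
      using J by (simp add: prod.If_cases)
    also have "\<dots> = (\<Prod>i\<in>J. (if i \<in> E m then 1 - ?k else 1) * ?Q)" by (rule prod.distrib[symmetric])
    also have "\<dots> \<le> (\<Prod>i\<in>J. \<Sum>x\<in>?D. tent R x * tent R (if i \<in> E m then x + 1 else x))"
    proof (rule prod_mono)
      fix i
      have "(1 - ?k) * ?Q \<le> (\<Sum>x\<in>?D. tent R x * tent R (x + 1))" using R by (intro tent_correlation) auto
      then show "0 \<le> (if i \<in> E m then 1 - ?k else 1) * ?Q \<and> (if i \<in> E m then 1 - ?k else 1) * ?Q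
         \<le> (\<Sum>x\<in>?D. tent R x * tent R (if i \<in> E m then x + 1 else x))"
        using k Q0 by (auto simp: power2_eq_square)
    qed
    finally show ?thesis .
  qed
  then have "(\<Sum>m\<in>?D. (tent R m)\<^sup>2 * ((1 - 3 * ?k) * (\<Prod>i\<in>J. ?Q)))
     \<le> (\<Sum>m\<in>?D. (tent R m)\<^sup>2 * (\<Prod>i\<in>J. \<Sum>x\<in>?D. tent R x * tent R (if i \<in> E m then x + 1 else x)))"
    by (intro sum_mono mult_left_mono) auto
  then show ?thesis unfolding lhs rhs by (simp add: sum_distrib_left mult_ac)
qed

section \<open>Tree maps with lamps as states of the wreath product\<close>

context ns_sequence
begin

type_synonym ray = "nat \<Rightarrow> nat"
type_synonym state = "(ray \<Rightarrow> int) \<times> (ray \<Rightarrow> ray)"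

definition extend_zero :: "(ray \<Rightarrow> int) \<Rightarrow> ray \<Rightarrow> int" where "extend_zero \<phi> y = (if y \<in> S then \<phi> y else 0)"

text \<open>
  The wreath product acts on pairs of a map of the rays and lamps that are already pulled back by this
  map, as it acts on itself from the left in the coordinates of \<open>body\<close>.
\<close>

definition act :: "(ray \<Rightarrow> int) \<times> (nat list \<Rightarrow> nat list) \<Rightarrow> state \<Rightarrow> state" where
  "act = (\<lambda>(\<phi>, g) (\<eta>, h). (\<lambda>z. if z \<in> rays l then \<eta> z + extend_zero \<phi> (ray_action g (h z)) else \<eta> z,
     \<lambda>z\<in>rays l. ray_action g (h z)))"

text \<open>
  Since the map is onto, the action is free. Off the rays it has the default value, so that it is
  determined by its restriction to the rays.
\<close>

definition States :: "state set" where
  "States = {(\<eta>, h). h \<in> extensional (rays l) \<and> h ` rays l = rays l}"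

lemma ray_mult: "g \<in> carrier \<Gamma> \<Longrightarrow> h \<in> carrier \<Gamma> \<Longrightarrow> x \<in> rays l \<Longrightarrow>
    ray_action (g \<otimes>\<^bsub>\<Gamma>\<^esub> h) x = ray_action g (ray_action h x)" by (rule ray_action_mult)

lemma ray_inv: "g \<in> carrier \<Gamma> \<Longrightarrow> x \<in> rays l \<Longrightarrow> ray_action (inv\<^bsub>\<Gamma>\<^esub> g) (ray_action g x) = x"
  "g \<in> carrier \<Gamma> \<Longrightarrow> x \<in> rays l \<Longrightarrow> ray_action g (ray_action (inv\<^bsub>\<Gamma>\<^esub> g) x) = x"
  by (simp_all add: ray_mult[symmetric] ray_action_one)

lemma ray_onto: "g \<in> carrier \<Gamma> \<Longrightarrow> ray_action g ` rays l = rays l"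
  using ray_action_rays[of g l] ray_action_rays[of "inv\<^bsub>\<Gamma>\<^esub> g" l] ray_inv(2)[of g]
  by (auto simp: image_iff) (metis Gam.inv_closed)

lemma S_ray_iff: "g \<in> carrier \<Gamma> \<Longrightarrow> x \<in> rays l \<Longrightarrow> ray_action g x \<in> S \<longleftrightarrow> x \<in> S"
  by (metis S_closed ray_inv(1) Gam.inv_closed)

lemma act_closed:
  assumes "x \<in> carrier W" "\<omega> \<in> States" shows "act x \<omega> \<in> States"
proof -
  obtain \<phi> g \<eta> h where e: "x = (\<phi>, g)" "\<omega> = (\<eta>, h)" by (cases x; cases \<omega>) auto
  have g: "g \<in> carrier \<Gamma>" and h: "h ` rays l = rays l" using assms e by (auto simp: carrier_W States_def)
  have "(\<lambda>z\<in>rays l. ray_action g (h z)) ` rays l = ray_action g ` (h ` rays l)" by (auto simp: image_iff)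
  then show ?thesis using h ray_onto[OF g] by (simp add: e act_def States_def)
qed

lemma act_W_mult:
  assumes "x \<in> carrier W" "y \<in> carrier W" "\<omega> \<in> States"
  shows "act (x \<otimes>\<^bsub>W\<^esub> y) \<omega> = act x (act y \<omega>)"
proof -
  obtain \<phi> g \<phi>' g' \<eta> h where e: "x = (\<phi>, g)" "y = (\<phi>', g')" "\<omega> = (\<eta>, h)" by (cases x; cases y; cases \<omega>) auto
  have g: "g \<in> carrier \<Gamma>" "g' \<in> carrier \<Gamma>" and h: "\<And>z. z \<in> rays l \<Longrightarrow> h z \<in> rays l"
    using assms e by (auto simp: carrier_W States_def)
  have "extend_zero (\<lambda>x\<in>S. \<phi> x + \<phi>' (ray_action (inv\<^bsub>\<Gamma>\<^esub> g) x)) (ray_action (g \<otimes>\<^bsub>\<Gamma>\<^esub> g') z)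
     = extend_zero \<phi>' (ray_action g' z) + extend_zero \<phi> (ray_action g (ray_action g' z))" if "z \<in> rays l" for z
    using g that ray_action_rays[OF g(2) that] by (simp add: extend_zero_def ray_mult S_ray_iff ray_inv)
  then show ?thesis using g h by (auto simp: e act_def mult_W fun_eq_iff ray_mult)
qed

lemma act_W_one: "\<omega> \<in> States \<Longrightarrow> act \<one>\<^bsub>W\<^esub> \<omega> = \<omega>"
proof -
  assume w: "\<omega> \<in> States"
  obtain \<eta> h where e: "\<omega> = (\<eta>, h)" by (cases \<omega>)
  have h: "\<And>z. z \<in> rays l \<Longrightarrow> h z \<in> rays l" "h \<in> extensional (rays l)" using w e by (auto simp: States_def)
  then show ?thesis by (auto simp: e act_def one_W extend_zero_def fun_eq_iff ray_action_one extensional_def)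
qed

lemma faithful:
  assumes "g \<in> carrier \<Gamma>" "g' \<in> carrier \<Gamma>" "\<And>\<xi>. \<xi> \<in> rays l \<Longrightarrow> ray_action g \<xi> = ray_action g' \<xi>"
  shows "g = g'"
proof
  fix w
  show "g w = g' w"
  proof (cases "w \<in> words l 0")
    case True
    define \<xi> where "\<xi> i = (if i < length w then w ! i else 0)" for i
    have xi: "\<xi> \<in> rays l" using True l_pos by (auto simp: \<xi>_def rays_def words_def)
    have w: "w = map \<xi> [0..<length w]" by (rule nth_equalityI) (auto simp: \<xi>_def)
    show ?thesis using assms xi by (subst (1 2) w) (metis map_ray_action)
  next
    case False
    then show ?thesis using assms(1,2) ns_group_Bij[of g l] ns_group_Bij[of g' l]
      by (auto simp: Bij_def extensional_def)
  qed
qed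

lemma act_W_free:
  assumes "x \<in> carrier W" "y \<in> carrier W" "\<omega> \<in> States" "act x \<omega> = act y \<omega>"
  shows "x = y"
proof -
  obtain \<phi> g \<phi>' g' \<eta> h where e: "x = (\<phi>, g)" "y = (\<phi>', g')" "\<omega> = (\<eta>, h)" by (cases x; cases y; cases \<omega>) auto
  have g: "g \<in> carrier \<Gamma>" "g' \<in> carrier \<Gamma>" "\<phi> \<in> Conf" "\<phi>' \<in> Conf" and h: "h ` rays l = rays l"
    using assms e by (auto simp: carrier_W States_def)
  have eq: "ray_action g (h z) = ray_action g' (h z)" "extend_zero \<phi> (ray_action g (h z)) = extend_zero \<phi>' (ray_action g' (h z))"
    if "z \<in> rays l" for z
    using assms(4) that by (auto simp: e act_def fun_eq_iff split: if_splits)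
  have "ray_action g \<xi> = ray_action g' \<xi>" if "\<xi> \<in> rays l" for \<xi>
  proof -
    have "\<xi> \<in> h ` rays l" using that h by simp
    then obtain z where "z \<in> rays l" "\<xi> = h z" by blast
    then show ?thesis using eq(1) by simp
  qed
  then have gg: "g = g'" by (rule faithful[OF g(1,2)])
  have "\<phi> y = \<phi>' y" for y
  proof (cases "y \<in> S")
    case True
    then have "y \<in> ray_action g ` (h ` rays l)" using S_rays ray_onto[OF g(1)] h by auto
    then obtain z where z: "z \<in> rays l" "y = ray_action g (h z)" by auto
    then show ?thesis using eq(2)[OF z(1)] True gg by (simp add: extend_zero_def)
  next
    case False
    then show ?thesis using g by (auto simp: Conf_def extensional_def)
  qed
  then show ?thesis using gg e by auto
qed

text \<open>
  On a ray, the automorphism \<open>\<beta>\<close> of the tree that starts at position \<open>s\<close> adds 1 to the letter at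
  position \<open>j\<close> for the at most one \<open>j\<close> that satisfies this predicate.
\<close>

definition triggered :: "nat \<Rightarrow> nat \<Rightarrow> ray \<Rightarrow> bool" where
  "triggered s j \<xi> \<longleftrightarrow> s < j \<and> (\<forall>m\<in>{s..<j - 1}. \<xi> m = 0) \<and> \<xi> (j - 1) = half j"

lemma ns_beta_nth:
  "w \<in> words l i \<Longrightarrow> j < length w \<Longrightarrow> ns_beta l i w ! j =
    (if 0 < j \<and> (\<forall>m<j - 1. w ! m = 0) \<and> w ! (j - 1) = half (i + j) then (w ! j + 1) mod l (i + j + 1) else w ! j)"
proof (induction w arbitrary: i j)
  case (Cons x w)
  have hp: "0 < half (Suc i)" using half(1)[of "Suc i"] by simp
  show ?case
  proof (cases j)
    case 0 then show ?thesis using Cons.prems by auto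
  next
    case (Suc j')
    consider "x = 0" | "x = half (Suc i)" "x \<noteq> 0" | "x \<noteq> 0" "x \<noteq> half (Suc i)" by blast
    then show ?thesis
    proof cases
      case 1
      show ?thesis
      proof (cases j')
        case 0
        then show ?thesis using 1 Suc Cons hp by auto
      next
        case (Suc j'')
        have "(\<forall>m<Suc j''. (0 # w) ! m = 0) \<longleftrightarrow> (\<forall>m<j''. w ! m = 0)" by (auto simp: nth_Cons split: nat.splits)
        then show ?thesis using 1 \<open>j = Suc j'\<close> Suc Cons by auto
      qed
    next
      case 2
      then have neg: "\<not> (\<forall>m<j'. (x # w) ! m = 0)" if "0 < j'" using that by auto
      show ?thesis
      proof (cases "j' = 0")
        case True then show ?thesis using 2 Suc Cons.prems by (cases w) auto
      next
        case False then show ?thesis using 2 Suc Cons.prems neg by (cases w) (auto simp: nth_Cons split: nat.splits)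
      qed
    next
      case 3
      have neg: "\<not> (\<forall>m<j'. (x # w) ! m = 0)" if "0 < j'" using that 3 by auto
      then show ?thesis using 3 Suc by (cases "j' = 0") auto
    qed
  qed
qed simp

lemma ray_gen_b:
  assumes "\<xi> \<in> rays l"
  shows "ray_action gen_b \<xi> i = (if triggered 0 i \<xi> then (\<xi> i + 1) mod l (Suc i) else \<xi> i)"
proof -
  have w: "map \<xi> [0..<Suc i] \<in> words l 0" by (rule map_ray_words[OF assms])
  have nth: "map \<xi> [0..<Suc i] ! m = \<xi> m" if "m \<le> i" for m using that by (simp del: upt_Suc)
  have "ray_action gen_b \<xi> i = ns_beta l 0 (map \<xi> [0..<Suc i]) ! i" using w by (simp add: ray_action_def gen_b_def del: upt_Suc)
  also have "\<dots> = (if 0 < i \<and> (\<forall>m<i - 1. map \<xi> [0..<Suc i] ! m = 0) \<and> map \<xi> [0..<Suc i] ! (i - 1) = half (0 + i)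
     then (map \<xi> [0..<Suc i] ! i + 1) mod l (0 + i + 1) else map \<xi> [0..<Suc i] ! i)"
    by (rule ns_beta_nth[OF w]) simp
  also have "\<dots> = (if triggered 0 i \<xi> then (\<xi> i + 1) mod l (Suc i) else \<xi> i)"
    using nth by (auto simp: triggered_def simp del: upt_Suc)
  finally show ?thesis .
qed

lemma ray_gen_a:
  assumes "\<xi> \<in> rays l" "0 < i"
  shows "ray_action gen_a \<xi> i = \<xi> i"
proof -
  have w: "map \<xi> [0..<Suc i] \<in> words l 0" by (rule map_ray_words[OF assms(1)])
  have "ns_alpha l 0 w ! i = w ! i" for w using assms(2) by (cases w; cases i) auto
  then have "ray_action gen_a \<xi> i = map \<xi> [0..<Suc i] ! i" using w by (simp add: ray_action_def gen_a_def del: upt_Suc)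
  also have "\<dots> = \<xi> i" by (simp del: upt_Suc)
  finally show ?thesis .
qed

lemma triggered_zero: "triggered s m \<xi> \<Longrightarrow> triggered s j \<xi> \<Longrightarrow> m = j"
proof -
  have "False" if "triggered s m \<xi>" "triggered s j \<xi>" "m < j" for m j
  proof -
    have "\<xi> (m - 1) = half m" "s < m" using that by (auto simp: triggered_def)
    moreover have "m - 1 \<in> {s..<j - 1}" using that by (auto simp: triggered_def)
    then have "\<xi> (m - 1) = 0" using that(2) unfolding triggered_def by blast
    ultimately show False using half(1)[of m] by simp
  qed
  then show "triggered s m \<xi> \<Longrightarrow> triggered s j \<xi> \<Longrightarrow> m = j" by (metis nat_neq_iff)
qed

lemma triggered_cong: "(\<And>m. s \<le> m \<Longrightarrow> m < j \<Longrightarrow> \<xi> m = \<xi>' m) \<Longrightarrow> triggered s j \<xi> \<longleftrightarrow> triggered s j \<xi>'"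
proof (cases "s < j")
  case True
  assume eq: "\<And>m. s \<le> m \<Longrightarrow> m < j \<Longrightarrow> \<xi> m = \<xi>' m"
  have "\<xi> (j - 1) = \<xi>' (j - 1)" "\<forall>m\<in>{s..<j - 1}. \<xi> m = \<xi>' m" using eq True by auto
  then show ?thesis by (simp add: triggered_def)
qed (simp add: triggered_def)

text \<open>
  The letter that \<open>\<beta>\<close> moves comes after the letters that decide where it acts.
\<close>

lemma triggered_invariant:
  assumes "\<And>i. s \<le> i \<Longrightarrow> \<not> triggered s i \<xi> \<Longrightarrow> \<xi>' i = \<xi> i"
  shows "triggered s j \<xi>' \<longleftrightarrow> triggered s j \<xi>"
proof
  assume t: "triggered s j \<xi>"
  have "\<xi> m = \<xi>' m" if "s \<le> m" "m < j" for m
    using assms[of m] triggered_zero[OF t, of m] that by (metis nat_neq_iff)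
  then show "triggered s j \<xi>'" using t triggered_cong[of s j \<xi> \<xi>'] by simp
next
  assume t: "triggered s j \<xi>'"
  have no: "\<not> triggered s m \<xi>" if m: "m < j" for m
  proof
    assume tm: "triggered s m \<xi>"
    then have "s \<le> m - 1" "\<xi> (m - 1) = half m" "0 < m" by (auto simp: triggered_def)
    moreover have "\<not> triggered s (m - 1) \<xi>" using triggered_zero[OF tm, of "m - 1"] \<open>0 < m\<close> by auto
    ultimately have "\<xi>' (m - 1) = half m" using assms[of "m - 1"] by simp
    moreover have "m - 1 \<in> {s..<j - 1}" using m \<open>s \<le> m - 1\<close> \<open>0 < m\<close> by auto
    then have "\<xi>' (m - 1) = 0" using t unfolding triggered_def by blast
    ultimately show False using half(1)[of m] \<open>0 < m\<close> by simp
  qed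
  then show "triggered s j \<xi>" using t triggered_cong[of s j \<xi> \<xi>'] assms by auto
qed

lemma triggered_split:
  assumes "k \<le> j" "1 \<le> k"
  shows "triggered 0 j \<xi> \<longleftrightarrow> (if j = k then (\<forall>m<k - 1. \<xi> m = 0) \<and> \<xi> (k - 1) = half k
     else (\<forall>m<k. \<xi> m = 0) \<and> triggered k j \<xi>)"
proof (cases "j = k")
  case True then show ?thesis using assms by (auto simp: triggered_def)
next
  case False
  have "{0..<j - 1} = {0..<k} \<union> {k..<j - 1}" using False assms by auto
  then show ?thesis using False assms by (auto simp: triggered_def)
qed

lemma triggered_next:
  assumes "k < j"
  shows "triggered k j \<xi> \<longleftrightarrow> (if j = Suc k then \<xi> k = half (Suc k) else \<xi> k = 0 \<and> triggered (Suc k) j \<xi>)"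
proof (cases "j = Suc k")
  case False
  have "{k..<j - 1} = insert k {Suc k..<j - 1}" using False assms by auto
  then show ?thesis using False assms by (auto simp: triggered_def)
qed (simp add: triggered_def)
end

section \<open>Tree maps with parameters in a window\<close>

text \<open>
  The bound \<open>4 R + 4 \<le> l (k + 1)\<close> separates the letters within distance \<open>R\<close> of 0 from those within
  distance \<open>R\<close> of \<open>y\<close>, and makes parameters in \<open>{-R..R}\<close> recognizable modulo the \<open>l i\<close>.
\<close>

locale window = ns_sequence l for l +
  fixes k R :: nat
  assumes k1: "1 \<le> k" and R3: "3 \<le> R" and fits: "4 * R + 4 \<le> l (Suc k)"
begin

abbreviation "modulus \<equiv> l (Suc k)"

definition Level :: "nat list set" where "Level = {w \<in> words l 0. length w = k}"

definition zero_window :: "nat set" where "zero_window = {x. x < modulus \<and> (x \<le> R \<or> modulus \<le> x + R)}"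

definition half_window :: "nat set" where "half_window = {x. half (Suc k) \<le> x + R \<and> x \<le> half (Suc k) + R}"
type_synonym key = "nat \<times> nat list \<times> nat"

text \<open>
  Tag 0: the rotation of the letter below a vertex. Tag 1: the power of \<open>\<beta>\<close> or of \<open>\<alpha>\<close> below a vertex
  and a letter near 0 or near \<open>y\<close>. Tag 2: the lamp at the ray through a vertex and a letter near 0 that
  ends in zeros.
\<close>

definition Slots :: "key set" where
  "Slots = {0} \<times> Level \<times> {0} \<union> {1} \<times> Level \<times> (zero_window \<union> half_window) \<union> {2} \<times> Level \<times> zero_window"

definition pre :: "ray \<Rightarrow> nat list" where "pre \<xi> = map \<xi> [0..<k]"

text \<open>
  The amount added to the letter at position \<open>i\<close>. Writing it letter by letter covers negative powers of
  \<open>\<alpha>\<close> and \<open>\<beta>\<close> as well.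
\<close>

definition turn :: "(key \<Rightarrow> int) \<Rightarrow> ray \<Rightarrow> nat \<Rightarrow> int" where
  "turn p \<xi> i = (if i = k then p (0, pre \<xi>, 0)
     else if \<xi> k \<in> half_window \<and> i = Suc k \<or> \<xi> k \<in> zero_window \<and> triggered (Suc k) i \<xi> then p (1, pre \<xi>, \<xi> k) else 0)"

definition tree_map :: "(nat list \<Rightarrow> nat list) \<Rightarrow> (key \<Rightarrow> int) \<Rightarrow> ray \<Rightarrow> ray" where
  "tree_map \<pi> p = (\<lambda>\<xi>\<in>rays l. \<lambda>i. if i < k then \<pi> (pre \<xi>) ! i
     else nat ((int (\<xi> i) + turn p \<xi> i) mod int (l (Suc i))))"

definition lamps :: "(key \<Rightarrow> int) \<Rightarrow> ray \<Rightarrow> int" where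
  "lamps p z = (if z \<in> rays l \<and> z k \<in> zero_window \<and> (\<forall>i>k. z i = 0) then p (2, pre z, z k) else 0)"

definition state :: "(nat list \<Rightarrow> nat list) \<Rightarrow> (key \<Rightarrow> int) \<Rightarrow> state" where
  "state \<pi> p = (lamps p, tree_map \<pi> p)"

lemma windows: "zero_window \<inter> half_window = {}" "zero_window \<subseteq> {..<modulus}" "half_window \<subseteq> {..<modulus}"
  using fits half(3)[of "Suc k"] by (auto simp: zero_window_def half_window_def)

lemma pre_Level: "\<xi> \<in> rays l \<Longrightarrow> pre \<xi> \<in> Level"
  using map_ray_words[of \<xi> l k] by (simp add: pre_def Level_def)

lemma mod_shift:
  assumes "a < m" "c < m"
  shows "nat ((int a + s) mod int m) = c \<longleftrightarrow> a = nat ((int c - s) mod int m)"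
proof
  have m: "0 < m" using assms by simp
  assume "nat ((int a + s) mod int m) = c"
  then have c: "int c = (int a + s) mod int m" using m by auto
  have "(int c - s) mod int m = (int a + s - s) mod int m" unfolding c by (simp only: mod_diff_left_eq)
  then show "a = nat ((int c - s) mod int m)" using assms by simp
next
  have m: "0 < m" using assms by simp
  assume "a = nat ((int c - s) mod int m)"
  then have a: "int a = (int c - s) mod int m" using m by auto
  have "(int a + s) mod int m = (int c - s + s) mod int m" unfolding a by (simp only: mod_add_left_eq)
  then show "nat ((int a + s) mod int m) = c" using assms by simp
qed

lemma mod_Suc_shift:
  assumes "0 < m"
  shows "(nat ((a + s) mod int m) + 1) mod m = nat ((a + (s + 1)) mod int m)"
proof -
  have "int ((nat ((a + s) mod int m) + 1) mod m) = ((a + s) mod int m + 1) mod int m"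
    using assms by (simp add: zmod_int ac_simps)
  also have "\<dots> = (a + (s + 1)) mod int m" by (simp add: mod_add_left_eq add.assoc)
  finally show ?thesis by linarith
qed

context
  fixes \<pi> and p :: "key \<Rightarrow> int" assumes \<pi>: "\<pi> permutes Level"
begin

lemma pi_Level: "w \<in> Level \<Longrightarrow> \<pi> w \<in> Level" using \<pi> by (simp add: permutes_in_image)

lemma tree_map_rays:
  assumes "\<xi> \<in> rays l" shows "tree_map \<pi> p \<xi> \<in> rays l"
proof -
  have "\<pi> (pre \<xi>) ! i < l (Suc i)" if "i < k" for i
    using pi_Level[OF pre_Level[OF assms]] that by (auto simp: Level_def words_def)
  then show ?thesis using assms l_pos by (auto simp: rays_def tree_map_def nat_less_iff)
qed

lemma pre_tree_map:
  assumes "\<xi> \<in> rays l" shows "pre (tree_map \<pi> p \<xi>) = \<pi> (pre \<xi>)"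
  using pi_Level[OF pre_Level[OF assms]] assms by (intro nth_equalityI) (auto simp: pre_def tree_map_def Level_def)

lemma triggered_tree_map:
  assumes "\<xi> \<in> rays l" "\<xi> k \<in> zero_window"
  shows "triggered (Suc k) j (tree_map \<pi> p \<xi>) \<longleftrightarrow> triggered (Suc k) j \<xi>"
proof (rule triggered_invariant)
  fix i assume i: "Suc k \<le> i" "\<not> triggered (Suc k) i \<xi>"
  have "\<xi> k \<notin> half_window" using assms windows by auto
  moreover have "\<xi> i < l (Suc i)" using assms by (simp add: rays_def)
  ultimately show "tree_map \<pi> p \<xi> i = \<xi> i" using i assms by (simp add: tree_map_def turn_def)
qed

lemma tree_map_onto: "tree_map \<pi> p ` rays l = rays l"
proof (intro equalityI subsetI)
  fix \<zeta> assume z: "\<zeta> \<in> rays l"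
  define v where "v = inv_into UNIV \<pi> (pre \<zeta>)"
  have v: "v \<in> Level" "\<pi> v = pre \<zeta>"
    using permutes_in_image[OF permutes_inv[OF \<pi>], of "pre \<zeta>"] pre_Level[OF z] permutes_inverses(1)[OF \<pi>] by (auto simp: v_def)
  define x where "x = nat ((int (\<zeta> k) - p (0, v, 0)) mod int modulus)"
  define t where "t i = (if x \<in> half_window \<and> i = Suc k \<or> x \<in> zero_window \<and> triggered (Suc k) i \<zeta> then p (1, v, x) else 0)" for i
  define \<xi> where "\<xi> i = (if i < k then v ! i else if i = k then x else nat ((int (\<zeta> i) - t i) mod int (l (Suc i))))" for i
  have zl: "\<zeta> i < l (Suc i)" for i using z by (simp add: rays_def)
  have lp: "0 < l (Suc i)" for i using l_pos[of "Suc i"] by simp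
  have xi: "\<xi> \<in> rays l"
    using v lp by (auto simp: rays_def \<xi>_def x_def Level_def words_def nat_less_iff)
  have pre: "pre \<xi> = v" using v by (intro nth_equalityI) (auto simp: pre_def \<xi>_def Level_def)
  have xk: "\<xi> k = x" by (simp add: \<xi>_def)
  have tr: "triggered (Suc k) i \<xi> \<longleftrightarrow> triggered (Suc k) i \<zeta>" if "x \<in> zero_window" for i
  proof (rule triggered_invariant)
    fix i assume i: "Suc k \<le> i" "\<not> triggered (Suc k) i \<zeta>"
    have "x \<notin> half_window" using that windows by auto
    then show "\<xi> i = \<zeta> i" using i zl by (simp add: \<xi>_def t_def)
  qed
  have "tree_map \<pi> p \<xi> i = \<zeta> i" for i
  proof (cases "i < k")
    case True then show ?thesis using xi v pre by (simp add: tree_map_def) (simp add: pre_def)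
  next
    case False
    have "nat ((int (\<xi> i) + turn p \<xi> i) mod int (l (Suc i))) = \<zeta> i"
    proof (subst mod_shift)
      show "\<xi> i < l (Suc i)" using xi by (simp add: rays_def)
      have "turn p \<xi> i = (if i = k then p (0, v, 0) else t i)" using tr by (auto simp: turn_def t_def pre xk)
      then show "\<xi> i = nat ((int (\<zeta> i) - turn p \<xi> i) mod int (l (Suc i)))" using False by (simp add: \<xi>_def x_def)
    qed (rule zl)
    then show ?thesis using False xi by (simp add: tree_map_def)
  qed
  then have "tree_map \<pi> p \<xi> = \<zeta>" by auto
  then show "\<zeta> \<in> tree_map \<pi> p ` rays l" using xi by blast
qed (use tree_map_rays in blast)

lemma state_States: "state \<pi> p \<in> States"
  using tree_map_onto by (auto simp: state_def States_def tree_map_def)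

end

lemma finite_level: "finite {w \<in> words l i. length w = m} \<and> card {w \<in> words l i. length w = m} = (\<Prod>j=i+1..i+m. l j)"
proof (induction m arbitrary: i)
  case 0
  have "{w \<in> words l i. length w = 0} = {[]}" by auto
  then show ?case by simp
next
  case (Suc m)
  have eq: "{w \<in> words l i. length w = Suc m} = (\<lambda>(x, w). x # w) ` ({..<l (i + 1)} \<times> {w \<in> words l (Suc i). length w = m})"
    by (auto simp: length_Suc_conv image_iff)
  have "(\<Prod>j=i+1..i+Suc m. l j) = l (i + 1) * (\<Prod>j=Suc i+1..Suc i+m. l j)"
    by (simp add: prod.atLeast_Suc_atMost)
  then show ?case unfolding eq using Suc[of "Suc i"]
    by (subst card_image) (auto simp: inj_on_def card_cartesian_product)
qed

lemma finite_Level: "finite Level" "card Level = level_size l k"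
  using finite_level[of 0 k] by (simp_all add: Level_def level_size_def)

lemma finite_Slots: "finite Slots"
  using finite_Level windows by (auto simp: Slots_def intro: finite_subset)

definition Params :: "(key \<Rightarrow> int) set" where "Params = PiE Slots (\<lambda>_. {- int R..int R})"

lemma small_mod:
  assumes "\<bar>a\<bar> \<le> int R" "\<bar>b\<bar> \<le> int R" "2 * R < m" "nat (a mod int m) = nat (b mod int m)"
  shows "a = b"
proof -
  have "a mod int m = b mod int m" using assms by (simp add: eq_nat_nat_iff)
  then have "int m dvd a - b" by (simp add: mod_eq_dvd_iff)
  moreover have "\<bar>a - b\<bar> < int m" using assms by linarith
  ultimately show ?thesis using zdvd_imp_le[of "int m" "\<bar>a - b\<bar>"] by (cases "a = b") auto
qed

definition ray_of :: "nat list \<Rightarrow> nat \<Rightarrow> nat \<Rightarrow> ray" where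
  "ray_of v x a = (\<lambda>i. if i < k then v ! i else if i = k then x else if i = Suc k then a else 0)"

lemma ray_of:
  assumes "v \<in> Level" "x < modulus" "a < l (Suc (Suc k))"
  shows "ray_of v x a \<in> rays l" "pre (ray_of v x a) = v"
proof -
  have "0 < l (Suc i)" for i using l_pos[of "Suc i"] by simp
  then show "ray_of v x a \<in> rays l" using assms by (auto simp: rays_def ray_of_def Level_def words_def)
  show "pre (ray_of v x a) = v" using assms by (intro nth_equalityI) (auto simp: pre_def ray_of_def Level_def)
qed

lemma l_big: "Suc k \<le> i \<Longrightarrow> 2 * R < l i"
proof -
  assume i: "Suc k \<le> i"
  have "modulus \<le> l i" using i by (induction i rule: dec_induct) (use l_double in \<open>auto intro: order_trans\<close>, metis (full_types) Suc_leD Suc_le_mono add_leD1 k1 le_trans l_double mult_2 One_nat_def)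
  then show ?thesis using fits by simp
qed

lemma Params_bound: "p \<in> Params \<Longrightarrow> i \<in> Slots \<Longrightarrow> \<bar>p i\<bar> \<le> int R"
  using PiE_mem[of p Slots "\<lambda>_. {- int R..int R}" i] by (auto simp: Params_def abs_le_iff)

lemma Slots_mem: "v \<in> Level \<Longrightarrow> (0, v, 0) \<in> Slots" "v \<in> Level \<Longrightarrow> x \<in> zero_window \<Longrightarrow> (1, v, x) \<in> Slots" "v \<in> Level \<Longrightarrow> x \<in> half_window \<Longrightarrow> (1, v, x) \<in> Slots"
  "v \<in> Level \<Longrightarrow> x \<in> zero_window \<Longrightarrow> (2, v, x) \<in> Slots"
  by (auto simp: Slots_def)

text \<open>
  Every parameter can be read off from the image of a suitable ray or from a lamp.
\<close>

lemma state_inj: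
  assumes \<pi>: "\<pi> permutes Level" "\<pi>' permutes Level" and p: "p \<in> Params" "p' \<in> Params" and eq: "state \<pi> p = state \<pi>' p'"
  shows "\<pi> = \<pi>' \<and> p = p'"
proof -
  have lp: "0 < l (Suc i)" for i using l_pos[of "Suc i"] by simp
  have tree: "tree_map \<pi> p \<xi> = tree_map \<pi>' p' \<xi>" and lam: "lamps p \<xi> = lamps p' \<xi>" for \<xi>
    using eq by (auto simp: state_def)
  have turn_eq: "nat ((int (\<xi> i) + turn p \<xi> i) mod int (l (Suc i))) = nat ((int (\<xi> i) + turn p' \<xi> i) mod int (l (Suc i)))"
    if "\<xi> \<in> rays l" "k \<le> i" for \<xi> i
    using fun_cong[OF tree[of \<xi>], of i] that by (simp add: tree_map_def)
  have "\<pi> v = \<pi>' v" for v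
  proof (cases "v \<in> Level")
    case True
    have r: "ray_of v 0 0 \<in> rays l" "pre (ray_of v 0 0) = v" using ray_of[OF True] lp by auto
    then show ?thesis using pre_tree_map[OF \<pi>(1) r(1), of p] pre_tree_map[OF \<pi>(2) r(1), of p'] tree[of "ray_of v 0 0"] by simp
  next
    case False then show ?thesis using \<pi> by (simp add: permutes_not_in)
  qed
  moreover have "p i = p' i" for i
  proof (cases "i \<in> Slots")
    case True
    then consider (0) v where "i = (0, v, 0)" "v \<in> Level" | (1) v x where "i = (1, v, x)" "v \<in> Level" "x \<in> half_window"
      | (2) v x where "i = (1, v, x)" "v \<in> Level" "x \<in> zero_window" | (3) v x where "i = (2, v, x)" "v \<in> Level" "x \<in> zero_window"
      by (auto simp: Slots_def)
    then show ?thesis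
    proof cases
      case 0
      have r: "ray_of v 0 0 \<in> rays l" "pre (ray_of v 0 0) = v" using ray_of[OF 0(2)] lp by auto
      show ?thesis
      proof (rule small_mod)
        show "nat (p i mod int modulus) = nat (p' i mod int modulus)"
          using turn_eq[OF r(1), of k] r(2) by (simp add: turn_def 0(1)) (simp add: ray_of_def)
      qed (use l_big[of "Suc k"] Params_bound p True in auto)
    next
      case 1
      have x: "x < modulus" "x \<notin> zero_window" using 1 windows by auto
      have r: "ray_of v x 0 \<in> rays l" "pre (ray_of v x 0) = v" using ray_of[OF 1(2) x(1)] lp by auto
      show ?thesis
      proof (rule small_mod)
        show "nat (p i mod int (l (Suc (Suc k)))) = nat (p' i mod int (l (Suc (Suc k))))"
          using turn_eq[OF r(1), of "Suc k"] r(2) 1 by (simp add: turn_def) (simp add: ray_of_def)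
      qed (use l_big[of "Suc (Suc k)"] Params_bound p True in auto)
    next
      case 2
      have x: "x < modulus" "x \<notin> half_window" using 2 windows by auto
      let ?\<xi> = "ray_of v x (half (Suc (Suc k)))"
      have r: "?\<xi> \<in> rays l" "pre ?\<xi> = v" using ray_of[OF 2(2) x(1)] half(2)[of "Suc (Suc k)"] by auto
      have t: "triggered (Suc k) (Suc (Suc k)) ?\<xi>" by (simp add: triggered_def ray_of_def)
      show ?thesis
      proof (rule small_mod)
        show "nat (p i mod int (l (Suc (Suc (Suc k))))) = nat (p' i mod int (l (Suc (Suc (Suc k)))))"
          using turn_eq[OF r(1), of "Suc (Suc k)"] r(2) 2 t by (simp add: turn_def) (simp add: ray_of_def)
      qed (use l_big[of "Suc (Suc (Suc k))"] Params_bound p True in auto)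
    next
      case 3
      have x: "x < modulus" using 3 windows by auto
      have r: "ray_of v x 0 \<in> rays l" "pre (ray_of v x 0) = v" using ray_of[OF 3(2) x] lp by auto
      have "ray_of v x 0 k = x" "\<forall>i>k. ray_of v x 0 i = 0" by (auto simp: ray_of_def)
      then show ?thesis using lam[of "ray_of v x 0"] r 3 by (simp add: lamps_def)
    qed
  next
    case False then show ?thesis using p PiE_arb[of p Slots] PiE_arb[of p' Slots] by (simp add: Params_def)
  qed
  ultimately show ?thesis by auto
qed

definition alpha_level :: "nat list \<Rightarrow> nat list" where "alpha_level w = (if w \<in> Level then ns_alpha l 0 w else w)"

definition beta_level :: "nat list \<Rightarrow> nat list" where "beta_level w = (if w \<in> Level then ns_beta l 0 w else w)"

lemma permutes_level:
  assumes "restrict f (words l 0) \<in> Bij (words l 0)" "\<And>w. length (f w) = length w"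
  shows "(\<lambda>w. if w \<in> Level then f w else w) permutes Level"
proof -
  have b: "bij_betw f (words l 0) (words l 0)" using assms(1) by (simp add: Bij_def cong: bij_betw_cong)
  have "inj_on f Level" using bij_betw_imp_inj_on[OF b] by (rule inj_on_subset) (auto simp: Level_def)
  moreover have "f ` Level \<subseteq> Level" using bij_betwE[OF b] assms(2) by (auto simp: Level_def)
  ultimately have "bij_betw f Level Level" using finite_Level endo_inj_surj[of Level f] by (simp add: bij_betw_def)
  then have "bij_betw (\<lambda>w. if w \<in> Level then f w else w) Level Level" by (simp cong: bij_betw_cong)
  then show ?thesis by (rule bij_imp_permutes) simp
qed

lemma alpha_level_permutes: "alpha_level permutes Level"
  unfolding alpha_level_def by (rule permutes_level) (use ns_alpha_Bij[of l 0] l_pos in \<open>auto simp: ns_alpha_prefix\<close>)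

lemma beta_level_permutes: "beta_level permutes Level"
  unfolding beta_level_def by (rule permutes_level) (use ns_beta_Bij[of l 0] l_pos in \<open>auto simp: ns_beta_prefix\<close>)

lemma ray_action_pre:
  assumes "g \<in> carrier \<Gamma>" "\<zeta> \<in> rays l" "i < k"
  shows "ray_action g \<zeta> i = g (pre \<zeta>) ! i"
proof -
  have "map (ray_action g \<zeta>) [0..<k] ! i = g (pre \<zeta>) ! i" using map_ray_action[OF assms(1,2), of k] by (simp add: pre_def)
  then show ?thesis using assms(3) by simp
qed

lemma act_lift:
  assumes "g \<in> carrier \<Gamma>" shows "act (lift g) (\<eta>, h) = (\<eta>, \<lambda>z\<in>rays l. ray_action g (h z))"
  by (auto simp: act_def lift_def extend_zero_def fun_eq_iff)

lemma move_a:
  assumes \<pi>: "\<pi> permutes Level"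
  shows "act (lift gen_a) (state \<pi> p) = state (alpha_level \<circ> \<pi>) p"
proof -
  have "ray_action gen_a (tree_map \<pi> p \<xi>) i = tree_map (alpha_level \<circ> \<pi>) p \<xi> i" if xi: "\<xi> \<in> rays l" for \<xi> i
  proof (cases "i < k")
    case True
    have "\<pi> (pre \<xi>) \<in> Level" using pi_Level[OF \<pi> pre_Level[OF xi]] .
    then have "gen_a (\<pi> (pre \<xi>)) = alpha_level (\<pi> (pre \<xi>))" by (simp add: gen_a_def alpha_level_def Level_def)
    then show ?thesis using True ray_action_pre[OF gens(1) tree_map_rays[OF \<pi> xi] True, of p] pre_tree_map[OF \<pi> xi, of p] xi
      by (simp add: tree_map_def)
  next
    case False
    then have "ray_action gen_a (tree_map \<pi> p \<xi>) i = tree_map \<pi> p \<xi> i"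
      using k1 by (intro ray_gen_a tree_map_rays[OF \<pi> xi]) auto
    then show ?thesis using False xi by (simp add: tree_map_def)
  qed
  then have "(\<lambda>z\<in>rays l. ray_action gen_a (tree_map \<pi> p z)) = tree_map (alpha_level \<circ> \<pi>) p"
    by (auto simp: fun_eq_iff tree_map_def)
  then show ?thesis by (simp add: state_def act_lift)
qed

text \<open>
  The vertices that the permutation moves to \<open>0\<^sup>k\<close> and to \<open>0\<^sup>k\<^sup>-\<^sup>1 y\<^sub>k\<close>. Below them \<open>\<beta>\<close> is active.
\<close>

definition zero_vertex :: "(nat list \<Rightarrow> nat list) \<Rightarrow> nat list" where
  "zero_vertex \<pi> = inv_into UNIV \<pi> (replicate k 0)"

definition half_vertex :: "(nat list \<Rightarrow> nat list) \<Rightarrow> nat list" where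
  "half_vertex \<pi> = inv_into UNIV \<pi> (replicate (k - 1) 0 @ [half k])"

text \<open>
  The letters that a rotation by \<open>m\<close> moves to 0 and to \<open>y\<close>.
\<close>

definition zero_letter :: "int \<Rightarrow> nat" where "zero_letter m = nat ((- m) mod int modulus)"

definition half_letter :: "int \<Rightarrow> nat" where "half_letter m = nat ((int (half (Suc k)) - m) mod int modulus)"

lemma vertices_Level: "replicate k 0 \<in> Level" "replicate (k - 1) 0 @ [half k] \<in> Level"
proof -
  have "0 < l (Suc i)" for i using l_pos[of "Suc i"] by simp
  then show "replicate k 0 \<in> Level" by (auto simp: Level_def words_def)
  show "replicate (k - 1) 0 @ [half k] \<in> Level"
    using k1 half(2)[OF k1] zeros_words[of "k - 1" "[half k]" 0] by (simp add: Level_def)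
qed

lemma vertex_iff:
  assumes "\<pi> permutes Level"
  shows "\<pi> v = replicate k 0 \<longleftrightarrow> v = zero_vertex \<pi>" "\<pi> v = replicate (k - 1) 0 @ [half k] \<longleftrightarrow> v = half_vertex \<pi>"
  using permutes_inv_eq[OF assms] unfolding zero_vertex_def half_vertex_def by metis+

lemma vertex_Level: "\<pi> permutes Level \<Longrightarrow> zero_vertex \<pi> \<in> Level" "\<pi> permutes Level \<Longrightarrow> half_vertex \<pi> \<in> Level"
  using vertices_Level by (simp_all add: zero_vertex_def half_vertex_def permutes_in_image[OF permutes_inv])

lemma vertex_ne: assumes "\<pi> permutes Level" shows "zero_vertex \<pi> \<noteq> half_vertex \<pi>"
proof
  assume "zero_vertex \<pi> = half_vertex \<pi>"
  then have "replicate k 0 = replicate (k - 1) 0 @ [half k]" using vertex_iff[OF assms] by metis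
  then have "last (replicate k 0) = half k" by (metis last_snoc)
  then show False using k1 half(1)[OF k1] by (simp add: last_replicate)
qed

lemma letters:
  assumes "\<bar>m\<bar> \<le> int R"
  shows "zero_letter m \<in> zero_window" "half_letter m \<in> half_window"
proof -
  have l0: "0 < modulus" using fits by simp
  show "zero_letter m \<in> zero_window"
  proof (cases "m \<le> 0")
    case True
    then have "(- m) mod int modulus = - m" using assms fits by (intro mod_pos_pos_trivial) auto
    then show ?thesis using assms True fits by (auto simp: zero_letter_def zero_window_def)
  next
    case False
    have "(- m) mod int modulus = (- m + int modulus) mod int modulus" by simp
    also have "\<dots> = - m + int modulus" using assms fits False by (intro mod_pos_pos_trivial) auto
    finally show ?thesis using assms False fits by (auto simp: zero_letter_def zero_window_def nat_less_iff le_nat_iff)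
  qed
  have "(int (half (Suc k)) - m) mod int modulus = int (half (Suc k)) - m"
    using assms fits half(3)[of "Suc k"] by (intro mod_pos_pos_trivial) auto
  then show "half_letter m \<in> half_window" using assms by (auto simp: half_letter_def half_window_def)
qed

lemma letter_iff:
  assumes "a < modulus"
  shows "nat ((int a + m) mod int modulus) = 0 \<longleftrightarrow> a = zero_letter m"
    "nat ((int a + m) mod int modulus) = half (Suc k) \<longleftrightarrow> a = half_letter m"
proof -
  have "0 < modulus" "half (Suc k) < modulus" using assms half(2)[of "Suc k"] by auto
  then show "nat ((int a + m) mod int modulus) = 0 \<longleftrightarrow> a = zero_letter m"
    "nat ((int a + m) mod int modulus) = half (Suc k) \<longleftrightarrow> a = half_letter m"
    using mod_shift[OF assms, of 0 m] mod_shift[OF assms, of "half (Suc k)" m] by (auto simp: zero_letter_def half_letter_def)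
qed

definition beta_keys :: "(nat list \<Rightarrow> nat list) \<Rightarrow> int \<Rightarrow> key set" where
  "beta_keys \<pi> m = {(0, half_vertex \<pi>, 0), (1, zero_vertex \<pi>, zero_letter m), (1, zero_vertex \<pi>, half_letter m)}"

definition lamp_keys :: "(nat list \<Rightarrow> nat list) \<Rightarrow> int \<Rightarrow> key set" where
  "lamp_keys \<pi> m = {(2, zero_vertex \<pi>, zero_letter m)}"

lemma all_zero_iff: "(\<forall>m<k. \<zeta> m = 0) \<longleftrightarrow> pre \<zeta> = replicate k 0"
  by (auto simp: pre_def list_eq_iff_nth_eq)

lemma half_iff: "(\<forall>m<k - 1. \<zeta> m = 0) \<and> \<zeta> (k - 1) = half k \<longleftrightarrow> pre \<zeta> = replicate (k - 1) 0 @ [half k]"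
proof -
  obtain k' where k': "k = Suc k'" using k1 by (cases k) auto
  have "pre \<zeta> = map \<zeta> [0..<k]" by (rule pre_def)
  also have "\<dots> = map \<zeta> [0..<k'] @ [\<zeta> k']" by (simp add: k')
  finally have pre: "pre \<zeta> = map \<zeta> [0..<k'] @ [\<zeta> k']" .
  moreover have "map \<zeta> [0..<k'] = replicate k' 0 \<longleftrightarrow> (\<forall>m<k'. \<zeta> m = 0)" by (auto simp: list_eq_iff_nth_eq)
  moreover have "k - 1 = k'" "half k = half (Suc k')" by (simp_all add: k')
  ultimately show ?thesis by simp
qed

lemma turn_bump:
  assumes \<pi>: "\<pi> permutes Level" and p: "p \<in> Params" and xi: "\<xi> \<in> rays l" and i: "k \<le> i"
  defines "m \<equiv> p (0, zero_vertex \<pi>, 0)"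
  shows "turn (bump (beta_keys \<pi> m) p) \<xi> i = turn p \<xi> i + (if triggered 0 i (tree_map \<pi> p \<xi>) then 1 else 0)"
proof -
  let ?\<zeta> = "tree_map \<pi> p \<xi>"
  have pz: "pre ?\<zeta> = \<pi> (pre \<xi>)" by (rule pre_tree_map[OF \<pi> xi])
  have xk: "\<xi> k < modulus" using xi by (simp add: rays_def)
  have zk: "?\<zeta> k = nat ((int (\<xi> k) + p (0, pre \<xi>, 0)) mod int modulus)" using xi by (simp add: tree_map_def turn_def)
  have "\<bar>m\<bar> \<le> int R" unfolding m_def by (intro Params_bound p Slots_mem vertex_Level \<pi>)
  note lt = letters[OF this]
  show ?thesis
  proof (cases "i = k")
    case True
    have "triggered 0 k ?\<zeta> \<longleftrightarrow> pre \<xi> = half_vertex \<pi>"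
      using triggered_split[of k k ?\<zeta>] k1 half_iff[of ?\<zeta>] pz vertex_iff(2)[OF \<pi>] by simp
    then show ?thesis using True by (simp add: turn_def bump_def beta_keys_def)
  next
    case False
    then have ik: "k < i" using i by simp
    have t: "triggered 0 i ?\<zeta> \<longleftrightarrow> pre \<xi> = zero_vertex \<pi> \<and> (if i = Suc k then ?\<zeta> k = half (Suc k) else ?\<zeta> k = 0 \<and> triggered (Suc k) i ?\<zeta>)"
      using triggered_split[OF i k1, of ?\<zeta>] triggered_next[OF ik, of ?\<zeta>] False all_zero_iff[of ?\<zeta>] pz vertex_iff(1)[OF \<pi>] by simp
    show ?thesis
    proof (cases "pre \<xi> = zero_vertex \<pi>")
      case True
      have k0: "?\<zeta> k = 0 \<longleftrightarrow> \<xi> k = zero_letter m" "?\<zeta> k = half (Suc k) \<longleftrightarrow> \<xi> k = half_letter m"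
        using letter_iff[OF xk, of m] zk True by (auto simp: m_def)
      have tz: "triggered (Suc k) i ?\<zeta> \<longleftrightarrow> triggered (Suc k) i \<xi>" if "\<xi> k = zero_letter m"
        using that lt by (intro triggered_tree_map[OF \<pi> xi]) simp
      have ns: "\<not> triggered (Suc k) (Suc k) \<xi>" by (simp add: triggered_def)
      have disj: "zero_letter m \<notin> half_window" "half_letter m \<notin> zero_window" "zero_letter m \<noteq> half_letter m" using lt windows by auto
      show ?thesis
        using t True k0 tz ns lt disj False by (auto simp: turn_def bump_def beta_keys_def)
    next
      case no: False
      then show ?thesis using t False by (auto simp: turn_def bump_def beta_keys_def)
    qed
  qed
qed

text \<open>
  Below \<open>0\<^sup>k\<^sup>-\<^sup>1 y\<^sub>k\<close> the generator rotates the next letter; below \<open>0\<^sup>k\<close> it continues as \<open>\<beta>\<close> if the next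
  letter is 0 and as \<open>\<alpha>\<close> if it is \<open>y\<close>. These are the three parameters in \<open>beta_keys\<close>, and the
  rotation that selects the two letters is not among them.
\<close>

lemma move_b:
  assumes \<pi>: "\<pi> permutes Level" and p: "p \<in> Params"
  shows "act (lift gen_b) (state \<pi> p) = state (beta_level \<circ> \<pi>) (bump (beta_keys \<pi> (p (0, zero_vertex \<pi>, 0))) p)"
proof -
  let ?q = "bump (beta_keys \<pi> (p (0, zero_vertex \<pi>, 0))) p"
  have "ray_action gen_b (tree_map \<pi> p \<xi>) i = tree_map (beta_level \<circ> \<pi>) ?q \<xi> i" if xi: "\<xi> \<in> rays l" for \<xi> i
  proof (cases "i < k")
    case True
    have "\<pi> (pre \<xi>) \<in> Level" using pi_Level[OF \<pi> pre_Level[OF xi]] .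
    then have "gen_b (\<pi> (pre \<xi>)) = beta_level (\<pi> (pre \<xi>))" by (simp add: gen_b_def beta_level_def Level_def)
    then show ?thesis using True ray_action_pre[OF gens(2) tree_map_rays[OF \<pi> xi] True, of p] pre_tree_map[OF \<pi> xi, of p] xi
      by (simp add: tree_map_def)
  next
    case False
    let ?\<zeta> = "tree_map \<pi> p \<xi>"
    have z: "?\<zeta> i = nat ((int (\<xi> i) + turn p \<xi> i) mod int (l (Suc i)))" using False xi by (simp add: tree_map_def)
    have "ray_action gen_b ?\<zeta> i = (if triggered 0 i ?\<zeta> then (?\<zeta> i + 1) mod l (Suc i) else ?\<zeta> i)"
      by (rule ray_gen_b[OF tree_map_rays[OF \<pi> xi]])
    also have "\<dots> = nat ((int (\<xi> i) + turn ?q \<xi> i) mod int (l (Suc i)))"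
      using turn_bump[OF \<pi> p xi, of i] False mod_Suc_shift[of "l (Suc i)" "int (\<xi> i)" "turn p \<xi> i"] l_pos[of "Suc i"] z
      by simp
    finally show ?thesis using False xi by (simp add: tree_map_def)
  qed
  then have "(\<lambda>z\<in>rays l. ray_action gen_b (tree_map \<pi> p z)) = tree_map (beta_level \<circ> \<pi>) ?q"
    by (auto simp: fun_eq_iff tree_map_def)
  moreover have "lamps ?q = lamps p" by (auto simp: fun_eq_iff lamps_def bump_def beta_keys_def)
  ultimately show ?thesis by (simp add: state_def act_lift)
qed

text \<open>
  For the implication from left to right, a nonzero letter of a ray that \<open>\<beta>\<close> turns into zeros would be
  preceded by the letter \<open>y\<close>, which stays.
\<close>

lemma tree_map_base_iff:
  assumes \<pi>: "\<pi> permutes Level" and p: "p \<in> Params" and z: "z \<in> rays l"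
  shows "tree_map \<pi> p z = base \<longleftrightarrow> pre z = zero_vertex \<pi> \<and> z k = zero_letter (p (0, zero_vertex \<pi>, 0)) \<and> (\<forall>i>k. z i = 0)"
proof -
  let ?\<zeta> = "tree_map \<pi> p z" and ?m = "p (0, zero_vertex \<pi>, 0)"
  have pz: "pre ?\<zeta> = \<pi> (pre z)" by (rule pre_tree_map[OF \<pi> z])
  have zl: "z i < l (Suc i)" for i using z by (simp add: rays_def)
  have zk: "?\<zeta> k = nat ((int (z k) + p (0, pre z, 0)) mod int modulus)" using z by (simp add: tree_map_def turn_def)
  have "\<bar>?m\<bar> \<le> int R" by (intro Params_bound p Slots_mem vertex_Level \<pi>)
  then have X: "zero_letter ?m \<in> zero_window" "zero_letter ?m \<notin> half_window" using letters windows by auto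
  have zi: "?\<zeta> i = z i" if "k < i" "\<not> triggered (Suc k) i z" "z k = zero_letter ?m" for i
    using that X zl z by (simp add: tree_map_def turn_def)
  show ?thesis
  proof
    assume b: "?\<zeta> = base"
    then have "pre ?\<zeta> = replicate k 0" by (simp add: pre_def map_replicate_const)
    then have v: "pre z = zero_vertex \<pi>" using pz vertex_iff(1)[OF \<pi>] by simp
    then have k0: "z k = zero_letter ?m" using letter_iff(1)[OF zl[of k], of ?m] zk b by simp
    have "z i = 0" if "k < i" for i
      using that
    proof (induction i rule: less_induct)
      case (less i)
      have "\<not> triggered (Suc k) i z"
      proof
        assume "triggered (Suc k) i z"
        then have "Suc k < i" "z (i - 1) = half i" by (auto simp: triggered_def)
        then show False using less.IH[of "i - 1"] half(1)[of i] by simp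
      qed
      then show ?case using zi[OF less.prems _ k0] b by simp
    qed
    then show "pre z = zero_vertex \<pi> \<and> z k = zero_letter ?m \<and> (\<forall>i>k. z i = 0)" using v k0 by simp
  next
    assume a: "pre z = zero_vertex \<pi> \<and> z k = zero_letter ?m \<and> (\<forall>i>k. z i = 0)"
    have "?\<zeta> i = 0" for i
    proof -
      consider "i < k" | "i = k" | "k < i" by linarith
      then show ?thesis
      proof cases
        case 1
        then have "pre ?\<zeta> ! i = 0" using a pz vertex_iff(1)[OF \<pi>, of "pre z"] by simp
        then show ?thesis using 1 by (simp add: pre_def)
      next
        case 2 then show ?thesis using a zk letter_iff(1)[OF zl[of k], of ?m] by simp
      next
        case 3
        have "\<not> triggered (Suc k) i z" using a half(1)[of i] by (auto simp: triggered_def)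
        then show ?thesis using zi[OF 3] a 3 by simp
      qed
    qed
    then show "?\<zeta> = base" by auto
  qed
qed

lemma move_lamp:
  assumes \<pi>: "\<pi> permutes Level" and p: "p \<in> Params"
  shows "act (lamp base 1) (state \<pi> p) = state \<pi> (bump (lamp_keys \<pi> (p (0, zero_vertex \<pi>, 0))) p)"
proof -
  let ?m = "p (0, zero_vertex \<pi>, 0)"
  let ?q = "bump (lamp_keys \<pi> ?m) p"
  have "\<bar>?m\<bar> \<le> int R" by (intro Params_bound p Slots_mem vertex_Level \<pi>)
  then have X: "zero_letter ?m \<in> zero_window" using letters by auto
  have tq: "turn ?q = turn p" by (simp add: turn_def bump_def lamp_keys_def fun_eq_iff)
  have t: "tree_map \<pi> ?q = tree_map \<pi> p" unfolding tree_map_def tq by (rule refl)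
  have one: "ray_action \<one>\<^bsub>\<Gamma>\<^esub> (tree_map \<pi> p z) = tree_map \<pi> p z" if "z \<in> rays l" for z
    by (rule ray_action_one[OF tree_map_rays[OF \<pi> that]])
  have "lamps p z + extend_zero (\<lambda>x\<in>S. if x = base then 1 else 0) (tree_map \<pi> p z) = lamps ?q z" if z: "z \<in> rays l" for z
  proof -
    let ?on = "pre z = zero_vertex \<pi> \<and> z k = zero_letter ?m \<and> (\<forall>i>k. z i = 0)"
    have "extend_zero (\<lambda>x\<in>S. if x = base then 1 else 0) (tree_map \<pi> p z) = (if tree_map \<pi> p z = base then 1 else 0)"
      using base_S by (simp add: extend_zero_def)
    also have "\<dots> = (if ?on then 1 else 0)" by (simp only: tree_map_base_iff[OF \<pi> p z])
    finally have e: "extend_zero (\<lambda>x\<in>S. if x = base then 1 else 0) (tree_map \<pi> p z) = (if ?on then 1 else 0)" .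
    show ?thesis
    proof (cases "z k \<in> zero_window \<and> (\<forall>i>k. z i = 0)")
      case True
      then show ?thesis using z unfolding e by (simp add: lamps_def bump_def lamp_keys_def)
    next
      case False
      then have "\<not> ?on" using X by auto
      then show ?thesis using False unfolding e by (auto simp: lamps_def)
    qed
  qed
  moreover have "lamps ?q z = lamps p z" if "z \<notin> rays l" for z using that by (simp add: lamps_def)
  ultimately have 1: "(\<lambda>z. if z \<in> rays l then lamps p z + extend_zero (\<lambda>x\<in>S. if x = base then 1 else 0) (ray_action \<one>\<^bsub>\<Gamma>\<^esub> (tree_map \<pi> p z))
      else lamps p z) = lamps ?q"
    using one by (intro ext) simp
  have 2: "(\<lambda>z\<in>rays l. ray_action \<one>\<^bsub>\<Gamma>\<^esub> (tree_map \<pi> p z)) = tree_map \<pi> p"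
  proof
    fix z show "(\<lambda>z\<in>rays l. ray_action \<one>\<^bsub>\<Gamma>\<^esub> (tree_map \<pi> p z)) z = tree_map \<pi> p z"
      using one[of z] by (cases "z \<in> rays l") (simp, simp add: tree_map_def)
  qed
  show ?thesis unfolding state_def act_def lamp_def prod.case t 1 2 by (rule refl)
qed

lemma generators_distinct: "card {lift gen_a, lift gen_b, lamp base 1} \<le> 3"
  by (rule order_trans[OF card_insert_le_m1[of 3]]) (auto intro: card_insert_le_m1)

lemma Slots_card: "card Slots \<le> level_size l k * (10 * R)"
proof -
  have c0: "card zero_window \<le> 2 * R + 1"
  proof -
    have "zero_window \<subseteq> {..R} \<union> {modulus - R..<modulus}" by (auto simp: zero_window_def)
    then have "card zero_window \<le> card ({..R} \<union> {modulus - R..<modulus})" by (intro card_mono) auto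
    also have "\<dots> \<le> card {..R} + card {modulus - R..<modulus}" by (rule card_Un_le)
    finally show ?thesis by simp
  qed
  have c1: "card half_window \<le> 2 * R + 1"
  proof -
    have "half_window \<subseteq> {half (Suc k) - R..half (Suc k) + R}" by (auto simp: half_window_def)
    then have "card half_window \<le> card {half (Suc k) - R..half (Suc k) + R}" by (intro card_mono) auto
    then show ?thesis by simp
  qed
  have fin: "finite zero_window" "finite half_window" using windows by (auto intro: finite_subset)
  have "card Slots \<le> card ({0::nat} \<times> Level \<times> {0::nat}) + card ({1::nat} \<times> Level \<times> (zero_window \<union> half_window)) + card ({2::nat} \<times> Level \<times> zero_window)"
    unfolding Slots_def by (intro order_trans[OF card_Un_le] add_right_mono card_Un_le)
  also have "\<dots> = card Level * (1 + card (zero_window \<union> half_window) + card zero_window)" by (simp add: card_cartesian_product ring_distribs)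
  also have "\<dots> \<le> card Level * (10 * R)"
    using c0 c1 card_Un_le[of zero_window half_window] R3 by (intro mult_left_mono) auto
  finally show ?thesis by (simp add: finite_Level)
qed

lemma weight_zero: assumes "p \<in> extensional Slots" "p \<notin> Params" shows "weight Slots (int R) p = 0"
proof -
  have "\<exists>i\<in>Slots. p i \<notin> {- int R..int R}"
  proof (rule ccontr)
    assume no: "\<not> ?thesis"
    have "p \<in> PiE Slots (\<lambda>_. {- int R..int R})"
    proof (rule PiE_I)
      show "p i \<in> {- int R..int R}" if "i \<in> Slots" for i using no that by blast
      show "p i = undefined" if "i \<notin> Slots" for i using assms(1) that by (rule extensional_arb)
    qed
    then show False using assms(2) by (simp add: Params_def)
  qed
  then obtain i where "i \<in> Slots" "p i \<notin> {- int R..int R}" by blast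
  then show ?thesis unfolding weight_def using finite_Slots by (intro prod_zero) (auto intro!: bexI[of _ i] tent_zero)
qed

text \<open>
  The weight is supported on parameters in \<open>{-R..R}\<close> and vanishes at the ends, so moving a parameter
  out of the range does no harm.
\<close>

theorem test_function:
  "\<exists>f. finite (supp W f) \<and> lp_norm 2 W f = 1 \<and>
     card (supp W f) \<le> fact (level_size l k) * (2 * R + 1) ^ (level_size l k * (10 * R)) \<and>
     (\<Sum>s\<in>{lift gen_a, lift gen_b, lamp base 1}. displacement 2 W s f) \<le> 108 / real R ^ 2"
proof -
  define Pm where "Pm = {\<pi>. \<pi> permutes Level}"
  define Q where "Q = Pm \<times> Params"
  define st where "st = (\<lambda>(\<pi>, p). state \<pi> p)"
  let ?w = "weight Slots (int R)"
  have finPm: "finite Pm" "card Pm = fact (level_size l k)"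
    using finite_permutations[OF finite_Level(1)] card_permutations[of Level "level_size l k"] finite_Level by (auto simp: Pm_def)
  have finPar: "finite Params" unfolding Params_def using finite_Slots by (intro finite_PiE) auto
  have finQ: "finite Q" using finPm finPar by (simp add: Q_def)
  have inj: "inj_on st Q" using state_inj by (auto simp: inj_on_def st_def Q_def Pm_def)
  define F where "F \<omega> = (if \<omega> \<in> st ` Q then ?w (snd (inv_into Q st \<omega>)) else 0)" for \<omega>
  have Fst: "F (state \<pi> p) = ?w p" if "\<pi> \<in> Pm" "p \<in> Params" for \<pi> p
  proof -
    have q: "(\<pi>, p) \<in> Q" using that by (simp add: Q_def)
    then have "inv_into Q st (st (\<pi>, p)) = (\<pi>, p)" by (rule inv_into_f_f[OF inj])
    then show ?thesis using q by (force simp: F_def st_def)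
  qed
  have w0: "0 \<le> ?w p" for p by (auto simp: weight_def tent_nonneg intro: prod_nonneg)
  have F0: "0 \<le> F \<omega>" for \<omega> by (simp add: F_def w0)
  have Fge: "?w p \<le> F (state \<pi> p)" if "\<pi> \<in> Pm" "p \<in> extensional Slots" for \<pi> p
    using Fst[OF that(1)] weight_zero[OF that(2)] F0 by (cases "p \<in> Params") auto
  have sumF: "(\<Sum>\<omega>\<in>st ` Q. h \<omega>) = (\<Sum>\<pi>\<in>Pm. \<Sum>p\<in>Params. h (state \<pi> p))" for h :: "state \<Rightarrow> real"
  proof -
    have "(\<Sum>\<omega>\<in>st ` Q. h \<omega>) = (\<Sum>x\<in>Q. h (st x))" using sum.reindex[OF inj, of h] by simp
    then show ?thesis by (simp add: Q_def st_def sum.cartesian_product case_prod_beta)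
  qed
  define V where "V = (\<Sum>p\<in>Params. (?w p)\<^sup>2)"
  have Mass: "(\<Sum>\<omega>\<in>st ` Q. (F \<omega>)\<^sup>2) = real (card Pm) * V"
    by (simp add: sumF Fst V_def)
  have Vpos: "0 < V"
  proof -
    define p where "p = restrict (\<lambda>_. 0 :: int) Slots"
    have p: "p \<in> Params" by (auto simp: p_def Params_def)
    have "?w p = (\<Prod>i\<in>Slots. real R)" unfolding weight_def by (intro prod.cong) (auto simp: p_def tent_def)
    then have "0 < ?w p" using R3 by (simp add: prod_pos)
    then have "0 < (?w p)\<^sup>2" by simp
    also have "\<dots> \<le> V" unfolding V_def using p finPar by (intro member_le_sum) auto
    finally show ?thesis .
  qed
  have cardPm: "0 < card Pm" by (simp add: finPm)
  define \<kappa> where "\<kappa> = 18 / real R ^ 2"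
  have k0: "0 \<le> \<kappa>" by (simp add: \<kappa>_def)
  have ext_bump: "bump E p \<in> extensional Slots" if "p \<in> Params" "E \<subseteq> Slots" for E p
    using that by (auto simp: bump_def Params_def PiE_def extensional_def)
  have corr: "(1 - \<kappa>) * V \<le> (\<Sum>p\<in>Params. F (state \<pi>' (bump (E (p (0, zero_vertex \<pi>, 0))) p)) * ?w p)"
    if \<pi>: "\<pi> \<in> Pm" "\<pi>' \<in> Pm" and E: "\<And>m. (0, zero_vertex \<pi>, 0) \<notin> E m" "\<And>m. finite (E m)" "\<And>m. card (E m) \<le> 3"
      "\<And>m. \<bar>m\<bar> \<le> int R \<Longrightarrow> E m \<subseteq> Slots" for \<pi> \<pi>' E
  proof -
    have v: "(0, zero_vertex \<pi>, 0) \<in> Slots" using \<pi> by (intro Slots_mem vertex_Level) (simp add: Pm_def)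
    have "(1 - \<kappa>) * V \<le> (\<Sum>p\<in>Params. ?w p * ?w (bump (E (p (0, zero_vertex \<pi>, 0))) p))"
      using weight_correlation[OF finite_Slots v, of "int R" E] E R3 by (simp add: V_def \<kappa>_def Params_def)
    also have "\<dots> \<le> (\<Sum>p\<in>Params. F (state \<pi>' (bump (E (p (0, zero_vertex \<pi>, 0))) p)) * ?w p)"
    proof (rule sum_mono)
      fix p assume p: "p \<in> Params"
      have "bump (E (p (0, zero_vertex \<pi>, 0))) p \<in> extensional Slots" using p E(4) Params_bound[OF p v] by (intro ext_bump) auto
      then show "?w p * ?w (bump (E (p (0, zero_vertex \<pi>, 0))) p) \<le> F (state \<pi>' (bump (E (p (0, zero_vertex \<pi>, 0))) p)) * ?w p"
        using Fge[OF \<pi>(2)] w0 by (simp add: mult.commute mult_left_mono)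
    qed
    finally show ?thesis .
  qed
  have inner: "(1 - \<kappa>) * (\<Sum>\<omega>\<in>st ` Q. (F \<omega>)\<^sup>2) \<le> (\<Sum>\<omega>\<in>st ` Q. F (act s \<omega>) * F \<omega>)"
    if s: "s \<in> {lift gen_a, lift gen_b, lamp base 1}" for s
  proof -
    have "(1 - \<kappa>) * V \<le> (\<Sum>p\<in>Params. F (act s (state \<pi> p)) * F (state \<pi> p))" if \<pi>: "\<pi> \<in> Pm" for \<pi>
    proof -
      have \<pi>': "\<pi> permutes Level" using \<pi> by (simp add: Pm_def)
      have Pa: "alpha_level \<circ> \<pi> \<in> Pm" "beta_level \<circ> \<pi> \<in> Pm"
        using permutes_compose[OF \<pi>' alpha_level_permutes] permutes_compose[OF \<pi>' beta_level_permutes] by (auto simp: Pm_def)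
      consider "s = lift gen_a" | "s = lift gen_b" | "s = lamp base 1" using s by auto
      then show ?thesis
      proof cases
        case 1
        have "(1 - \<kappa>) * V \<le> V" using k0 Vpos by (simp add: algebra_simps)
        also have "V = (\<Sum>p\<in>Params. F (act s (state \<pi> p)) * F (state \<pi> p))"
          unfolding V_def by (intro sum.cong refl) (simp add: 1 move_a[OF \<pi>'] Fst Pa \<pi> power2_eq_square)
        finally show ?thesis .
      next
        case 2
        have "(1 - \<kappa>) * V \<le> (\<Sum>p\<in>Params. F (state (beta_level \<circ> \<pi>) (bump (beta_keys \<pi> (p (0, zero_vertex \<pi>, 0))) p)) * ?w p)"
        proof (rule corr[OF \<pi> Pa(2)])
          show "(0, zero_vertex \<pi>, 0) \<notin> beta_keys \<pi> m" for m using vertex_ne[OF \<pi>'] by (auto simp: beta_keys_def)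
          show "card (beta_keys \<pi> m) \<le> 3" for m
            unfolding beta_keys_def by (rule order_trans[OF card_insert_le_m1[of 3]]) (auto intro: card_insert_le_m1)
          show "beta_keys \<pi> m \<subseteq> Slots" if "\<bar>m\<bar> \<le> int R" for m
            using letters[OF that] vertex_Level[OF \<pi>'] by (auto simp: beta_keys_def Slots_def)
        qed (simp add: beta_keys_def)
        also have "\<dots> = (\<Sum>p\<in>Params. F (act s (state \<pi> p)) * F (state \<pi> p))"
          by (intro sum.cong refl) (simp add: 2 move_b[OF \<pi>'] Fst \<pi>)
        finally show ?thesis .
      next
        case 3
        have "(1 - \<kappa>) * V \<le> (\<Sum>p\<in>Params. F (state \<pi> (bump (lamp_keys \<pi> (p (0, zero_vertex \<pi>, 0))) p)) * ?w p)"
        proof (rule corr[OF \<pi> \<pi>])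
          show "lamp_keys \<pi> m \<subseteq> Slots" if "\<bar>m\<bar> \<le> int R" for m
            using letters[OF that] vertex_Level[OF \<pi>'] by (auto simp: lamp_keys_def Slots_def)
        qed (simp_all add: lamp_keys_def)
        also have "\<dots> = (\<Sum>p\<in>Params. F (act s (state \<pi> p)) * F (state \<pi> p))"
          by (intro sum.cong refl) (simp add: 3 move_lamp[OF \<pi>'] Fst \<pi>)
        finally show ?thesis .
      qed
    qed
    then have "(\<Sum>\<pi>\<in>Pm. (1 - \<kappa>) * V) \<le> (\<Sum>\<pi>\<in>Pm. \<Sum>p\<in>Params. F (act s (state \<pi> p)) * F (state \<pi> p))" by (rule sum_mono)
    then show ?thesis by (simp add: Mass sumF mult_ac)
  qed
  let ?H = "{lift gen_a, lift gen_b, lamp base 1}"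
  have "\<exists>f. finite (supp W f) \<and> lp_norm 2 W f = 1 \<and> card (supp W f) \<le> card (st ` Q) \<and>
     (\<Sum>s\<in>?H. displacement 2 W s f) \<le> 2 * \<kappa> * real (card ?H)"
  proof (rule Wr.orbit_test_function[OF act_closed act_W_mult act_W_one act_W_free])
    show "finite (st ` Q)" using finQ by simp
    show "st ` Q \<subseteq> States" using state_States by (auto simp: Q_def st_def Pm_def)
    show "0 < (\<Sum>\<omega>\<in>st ` Q. (F \<omega>)\<^sup>2)" unfolding Mass using cardPm Vpos by simp
  qed (use inner in \<open>auto simp: F_def\<close>)
  then obtain f where f: "finite (supp W f)" "lp_norm 2 W f = 1" "card (supp W f) \<le> card (st ` Q)"
     "(\<Sum>s\<in>?H. displacement 2 W s f) \<le> 2 * \<kappa> * real (card ?H)" by blast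
  have "card (st ` Q) = fact (level_size l k) * (2 * R + 1) ^ card Slots"
  proof -
    have "card (st ` Q) = card Pm * card Params" by (simp add: card_image[OF inj] card_cartesian_product Q_def[symmetric]) (simp add: Q_def card_cartesian_product)
    moreover have "card Params = (2 * R + 1) ^ card Slots"
      using finite_Slots by (simp add: Params_def card_PiE nat_add_distrib nat_mult_distrib)
    ultimately show ?thesis using finPm by simp
  qed
  also have "\<dots> \<le> fact (level_size l k) * (2 * R + 1) ^ (level_size l k * (10 * R))"
    using Slots_card by (intro mult_left_mono power_increasing) auto
  finally have c: "card (supp W f) \<le> fact (level_size l k) * (2 * R + 1) ^ (level_size l k * (10 * R))" using f(3) by simp
  have "2 * \<kappa> * real (card ?H) \<le> 2 * \<kappa> * 3" using generators_distinct k0 by (intro mult_left_mono) auto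
  also have "\<dots> = 108 / real R ^ 2" by (simp add: \<kappa>_def)
  finally show ?thesis using f c by (intro exI[of _ f]) auto
qed
end

section \<open>Generators of the wreath product\<close>

context ns_sequence
begin

lemma lift_mult: "g \<in> carrier \<Gamma> \<Longrightarrow> h \<in> carrier \<Gamma> \<Longrightarrow> lift g \<otimes>\<^bsub>W\<^esub> lift h = lift (g \<otimes>\<^bsub>\<Gamma>\<^esub> h)"
  by (auto simp: lift_def mult_W fun_eq_iff S_closed)

lemma lift_one: "lift \<one>\<^bsub>\<Gamma>\<^esub> = \<one>\<^bsub>W\<^esub>" by (simp add: lift_def one_W)

abbreviation "wreath_gens \<equiv> {lift gen_a, lift gen_b, lamp base 1}"

lemma wreath_gens_carrier: "wreath_gens \<subseteq> carrier W" by simp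

lemma lift_generate: "g \<in> carrier \<Gamma> \<Longrightarrow> lift g \<in> generate W wreath_gens"
proof -
  let ?B = "BijGroup (words l 0)"
  interpret B: group ?B by (rule group_BijGroup)
  have mult: "x \<otimes>\<^bsub>\<Gamma>\<^esub> y = x \<otimes>\<^bsub>?B\<^esub> y" for x y by (simp add: ns_group_def subgroup_generated_def)
  have one: "\<one>\<^bsub>\<Gamma>\<^esub> = \<one>\<^bsub>?B\<^esub>" by (simp add: ns_group_def subgroup_generated_def)
  have car: "carrier \<Gamma> = generate ?B (carrier ?B \<inter> {gen_a, gen_b})"
    by (simp add: ns_group_def carrier_subgroup_generated gen_a_def gen_b_def)
  assume "g \<in> carrier \<Gamma>"
  then have "g \<in> generate ?B (carrier ?B \<inter> {gen_a, gen_b})" by (simp add: car)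
  then show ?thesis
  proof (induction rule: generate.induct)
    case one
    then show ?case unfolding \<open>\<one>\<^bsub>\<Gamma>\<^esub> = \<one>\<^bsub>?B\<^esub>\<close>[symmetric] lift_one by (rule generate.one)
  next
    case (incl h)
    then show ?case by (auto intro: generate.incl)
  next
    case (inv h)
    then have h: "h \<in> carrier ?B" "h \<in> carrier \<Gamma>" "lift h \<in> wreath_gens" by auto
    have i: "inv\<^bsub>?B\<^esub> h \<in> carrier \<Gamma>" unfolding car by (rule generate.inv[OF inv])
    have "lift (inv\<^bsub>?B\<^esub> h) \<otimes>\<^bsub>W\<^esub> lift h = \<one>\<^bsub>W\<^esub>"
      using h i by (simp add: lift_mult mult lift_one[symmetric] one)
    then have "inv\<^bsub>W\<^esub> (lift h) = lift (inv\<^bsub>?B\<^esub> h)" using h i by (intro Wr.inv_equality) auto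
    then show ?case using generate.inv[OF h(3), of W] by simp
  next
    case (eng g h)
    then have "g \<in> carrier \<Gamma>" "h \<in> carrier \<Gamma>" by (simp_all add: car)
    then have "lift (g \<otimes>\<^bsub>?B\<^esub> h) = lift g \<otimes>\<^bsub>W\<^esub> lift h" by (simp add: lift_mult mult)
    then show ?case using generate.eng[OF eng.IH] by simp
  qed
qed

lemma lamp_add: "lamp s a \<otimes>\<^bsub>W\<^esub> lamp s b = lamp s (a + b)"
  by (auto simp: lamp_def mult_W fun_eq_iff act_one)

lemma lamp_zero: "lamp s 0 = \<one>\<^bsub>W\<^esub>" by (auto simp: lamp_def one_W)

text \<open>
  Conjugation by \<open>lift g\<close> moves the lamp from the base point to its image; with \<open>lamp_add\<close> all finitely
  supported lamp configurations are reached.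
\<close>

lemma lamp_conjugate:
  assumes g: "g \<in> carrier \<Gamma>"
  shows "lift g \<otimes>\<^bsub>W\<^esub> lamp base 1 \<otimes>\<^bsub>W\<^esub> lift (inv\<^bsub>\<Gamma>\<^esub> g) = lamp (ray_action g base) 1"
proof -
  have "ray_action (inv\<^bsub>\<Gamma>\<^esub> g) x = base \<longleftrightarrow> x = ray_action g base" if "x \<in> S" for x
    using act_inv[OF g] that base_S by metis
  then have "(\<lambda>x\<in>S. (\<lambda>x\<in>S. (\<lambda>x\<in>S. 0) x + (\<lambda>x\<in>S. if x = base then 1 else 0) (ray_action (inv\<^bsub>\<Gamma>\<^esub> g) x)) x
       + (\<lambda>x\<in>S. 0) (ray_action (inv\<^bsub>\<Gamma>\<^esub> g) x)) = (\<lambda>x\<in>S. if x = ray_action g base then 1 else (0::int))"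
    using g by (intro restrict_ext) (simp add: S_closed)
  then show ?thesis using g by (simp add: lift_def lamp_def mult_W)
qed

lemma lamp_generate: "s \<in> S \<Longrightarrow> lamp s m \<in> generate W wreath_gens"
proof -
  assume "s \<in> S"
  then obtain g where g: "g \<in> carrier \<Gamma>" "s = ray_action g base" by (auto simp: S_eq)
  have "lift g \<otimes>\<^bsub>W\<^esub> lamp base 1 \<otimes>\<^bsub>W\<^esub> lift (inv\<^bsub>\<Gamma>\<^esub> g) \<in> generate W wreath_gens"
    using g by (intro generate.eng lift_generate generate.incl) auto
  then have one: "lamp s 1 \<in> generate W wreath_gens" using lamp_conjugate[OF g(1)] g by simp
  have minus: "lamp s (- 1) \<in> generate W wreath_gens"
  proof -
    have "inv\<^bsub>W\<^esub> (lamp s 1) = lamp s (- 1)" by (intro Wr.inv_equality) (simp_all add: lamp_add lamp_zero)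
    then show ?thesis using Wr.generate_m_inv_closed[OF wreath_gens_carrier one] by simp
  qed
  show ?thesis
  proof (induction m rule: int_induct[where k = 0])
    case base
    then show ?case unfolding lamp_zero by (rule generate.one)
  next
    case (step1 i)
    then show ?case using generate.eng[OF step1(2) one] by (simp add: lamp_add)
  next
    case (step2 i)
    then show ?case using generate.eng[OF step2(2) minus] by (simp add: lamp_add)
  qed
qed

lemma generate_W: "generate W wreath_gens = carrier W"
proof (intro equalityI subsetI)
  fix x assume "x \<in> generate W wreath_gens"
  then show "x \<in> carrier W" using Wr.generate_in_carrier[OF wreath_gens_carrier] by blast
next
  fix x assume x: "x \<in> carrier W"
  obtain \<phi> g where e: "x = (\<phi>, g)" by (cases x)
  have g: "g \<in> carrier \<Gamma>" and \<phi>: "\<phi> \<in> Conf" using x e by (auto simp: carrier_W)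
  have "(\<phi>, \<one>\<^bsub>\<Gamma>\<^esub>) \<in> generate W wreath_gens" if "\<phi> \<in> Conf" for \<phi>
    using that
  proof (induction "card {x \<in> S. \<phi> x \<noteq> 0}" arbitrary: \<phi>)
    case 0
    then have "\<phi> = (\<lambda>x\<in>S. 0)" by (auto simp: Conf_def extensional_def fun_eq_iff)
    then show ?case using generate.one[of W wreath_gens] by (simp only: one_W)
  next
    case (Suc n)
    have "{x \<in> S. \<phi> x \<noteq> 0} \<noteq> {}" using Suc(2) by force
    then obtain s where s: "s \<in> S" "\<phi> s \<noteq> 0" by blast
    have fin: "finite {x \<in> S. \<phi> x \<noteq> 0}" using Suc by (simp add: Conf_def)
    have "{x \<in> S. (\<phi>(s := 0)) x \<noteq> 0} = {x \<in> S. \<phi> x \<noteq> 0} - {s}" by auto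
    then have "n = card {x \<in> S. (\<phi>(s := 0)) x \<noteq> 0}" using Suc(2) s fin by simp
    then have IH: "(\<phi>(s := 0), \<one>\<^bsub>\<Gamma>\<^esub>) \<in> generate W wreath_gens" using Suc.prems s by (intro Suc.hyps(1)) (simp_all add: Conf_upd)
    have "\<phi> \<in> extensional S" using Suc.prems by (simp add: Conf_def)
    then have "(\<lambda>x\<in>S. (\<lambda>x\<in>S. if x = s then \<phi> s else 0) x + (\<phi>(s := 0)) (ray_action \<one>\<^bsub>\<Gamma>\<^esub> x)) = \<phi>"
      by (intro ext) (auto simp: act_one extensional_def)
    then have "lamp s (\<phi> s) \<otimes>\<^bsub>W\<^esub> (\<phi>(s := 0), \<one>\<^bsub>\<Gamma>\<^esub>) = (\<phi>, \<one>\<^bsub>\<Gamma>\<^esub>)" by (simp add: lamp_def mult_W)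
    then show ?case using generate.eng[OF lamp_generate[OF s(1), of "\<phi> s"] IH] by simp
  qed
  from generate.eng[OF this[OF \<phi>] lift_generate[OF g]]
  have "(\<phi>, \<one>\<^bsub>\<Gamma>\<^esub>) \<otimes>\<^bsub>W\<^esub> lift g \<in> generate W wreath_gens" .
  moreover have "(\<phi>, \<one>\<^bsub>\<Gamma>\<^esub>) \<otimes>\<^bsub>W\<^esub> lift g = x"
  proof -
    have "\<phi> \<in> extensional S" using \<phi> by (simp add: Conf_def)
    then have "(\<lambda>x\<in>S. \<phi> x + (\<lambda>x\<in>S. 0) (ray_action \<one>\<^bsub>\<Gamma>\<^esub> x)) = \<phi>" by (auto simp: fun_eq_iff act_one extensional_def)
    then show ?thesis using g by (simp add: lift_def mult_W e)
  qed
  ultimately show "x \<in> generate W wreath_gens" by simp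
qed

section \<open>Bounds for the profiles\<close>

lemma level_size_pos: "0 < level_size l n"
  unfolding level_size_def using l_pos by (intro prod_pos) auto

lemma l_gt: "1 \<le> i \<Longrightarrow> i < l i"
proof (induction i rule: dec_induct)
  case base then show ?case using l_ge2[of 1] by simp
next
  case (step n) then show ?case using l_double[of n] by simp
qed

lemma l_mono: "1 \<le> i \<Longrightarrow> i \<le> j \<Longrightarrow> l i \<le> l j"
  using l_dvd_le[of i j] l_pos[of j] by (simp add: dvd_imp_le)

lemma level_size_mono: "i \<le> j \<Longrightarrow> level_size l i \<le> level_size l j"
proof (induction j rule: dec_induct)
  case (step n)
  have "level_size l (Suc n) = level_size l n * l (Suc n)" by (simp add: level_size_def)
  then show ?case using step l_pos[of "Suc n"] by (metis One_nat_def Suc_le_eq le_add1 le_trans mult.right_neutral mult_le_mono2 plus_1_eq_Suc)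
qed simp

lemma level_size_power: "level_size l n \<le> l n ^ n"
proof (cases "n = 0")
  case False
  have "level_size l n \<le> (\<Prod>i=1..n. l n)" unfolding level_size_def using l_mono by (intro prod_mono) auto
  then show ?thesis by simp
qed (simp add: level_size_def)

context
  fixes \<phi> :: "(((nat \<Rightarrow> nat) \<Rightarrow> int) \<times> (nat list \<Rightarrow> nat list)) pmf"
  assumes \<phi>: "finite (set_pmf \<phi>)" "set_pmf \<phi> \<subseteq> carrier W" "generate W (set_pmf \<phi>) = carrier W"
begin

abbreviation "\<Lambda>1 v \<equiv> profile 1 W \<phi> v"
abbreviation "\<Lambda>2 v \<equiv> profile 2 W \<phi> v"

lemma profile_le_1:
  assumes "1 \<le> v" "p = 1 \<or> p = 2"
  shows "profile p W \<phi> v \<le> 1"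
proof -
  define f where "f x = (if x = \<one>\<^bsub>W\<^esub> then 1 else 0 :: real)" for x
  have s: "supp W f = {\<one>\<^bsub>W\<^esub>}" by (auto simp: supp_def f_def)
  have norm: "lp_norm p W f = 1" using assms(2) Wr.lp_norm_1[of f] Wr.lp_norm_2[of f] by (auto simp: s f_def)
  have p0: "0 < p" using assms(2) by auto
  have disp: "displacement p W y f \<le> 2" if "y \<in> carrier W" for y
  proof -
    have eq: "y \<otimes>\<^bsub>W\<^esub> x = \<one>\<^bsub>W\<^esub> \<longleftrightarrow> x = inv\<^bsub>W\<^esub> y" if "x \<in> carrier W" for x
      using that \<open>y \<in> carrier W\<close> Wr.inv_equality Wr.inv_inv Wr.l_inv Wr.r_inv Wr.inv_closed by metis
    have "displacement p W y f = (\<Sum>x\<in>{\<one>\<^bsub>W\<^esub>, inv\<^bsub>W\<^esub> y}. \<bar>f (y \<otimes>\<^bsub>W\<^esub> x) - f x\<bar> ^ p)"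
      using that eq by (intro Wr.displacement_finite p0) (auto simp: s f_def)
    also have "\<dots> \<le> (\<Sum>x\<in>{\<one>\<^bsub>W\<^esub>, inv\<^bsub>W\<^esub> y}. 1)"
      by (intro sum_mono power_le_one) (auto simp: f_def)
    also have "\<dots> \<le> 2" using card_insert_le_m1[of 2 "{inv\<^bsub>W\<^esub> y}" "\<one>\<^bsub>W\<^esub>"] by simp
    finally show ?thesis .
  qed
  have "dirichlet p W \<phi> f = 1 / 2 * (\<Sum>y\<in>set_pmf \<phi>. pmf \<phi> y * displacement p W y f)"
    by (rule Wr.dirichlet_displacement[OF \<phi>(1,2) _ p0]) (simp add: s)
  also have "\<dots> \<le> 1 / 2 * (\<Sum>y\<in>set_pmf \<phi>. pmf \<phi> y * 2)"
    using \<phi> disp by (intro mult_left_mono sum_mono) auto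
  also have "\<dots> = 1" using \<phi>(1) by (simp add: sum_pmf_eq_1 flip: sum_distrib_right)
  finally have "ereal (dirichlet p W \<phi> f) \<le> 1" by simp
  moreover have "profile p W \<phi> v \<le> ereal (dirichlet p W \<phi> f)"
    unfolding profile_def using assms(1) norm s by (intro Inf_lower) auto
  ultimately show ?thesis by (rule order_trans[rotated])
qed

text \<open>
  There is no upper limit on \<open>r\<close>: for \<open>r\<close> in a later interval \<open>[l m, l (m + 1)]\<close> the bound of that
  interval is stronger, as \<open>level_size\<close> increases.
\<close>

lemma lower_bound:
  "\<exists>c>0. c \<le> 1 \<and> (\<forall>n\<ge>2. \<forall>r v. real (l (n - 1)) \<le> r \<longrightarrow> v \<le> exp (c * real (level_size l (n - 1)) * r * ln r) \<longrightarrow> ereal (c / r) \<le> \<Lambda>1 v)"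
proof -
  obtain c0 where c0: "0 < c0" and low: "\<And>n q f. 2 \<le> n \<Longrightarrow> l (n - 1) \<le> q \<Longrightarrow> q \<le> l n \<Longrightarrow> finite (supp W f) \<Longrightarrow> lp_norm 1 W f = 1 \<Longrightarrow>
     dirichlet 1 W \<phi> f < c0 / real q \<Longrightarrow> (2 * q) ^ (level_size l (n - 1) * q div 16 + 1) \<le> card (supp W f)"
    using support_lower_bound[OF \<phi>] by blast
  define c where "c = min c0 (1 / 64)"
  have c: "0 < c" "c \<le> c0" "c \<le> 1 / 64" using c0 by (auto simp: c_def)
  have "ereal (c / r) \<le> \<Lambda>1 v"
    if n: "2 \<le> n" and r: "real (l (n - 1)) \<le> r" and v: "v \<le> exp (c * real (level_size l (n - 1)) * r * ln r)" for n r v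
  proof -
    \<comment> \<open>the index of the interval that contains \<open>r\<close>\<close>
    define m where "m = Max {m. n - 1 \<le> m \<and> real (l m) \<le> r}"
    have fin: "finite {m. n - 1 \<le> m \<and> real (l m) \<le> r}"
    proof (rule finite_subset)
      show "{m. n - 1 \<le> m \<and> real (l m) \<le> r} \<subseteq> {..nat \<lceil>r\<rceil>}"
      proof
        fix m assume m: "m \<in> {m. n - 1 \<le> m \<and> real (l m) \<le> r}"
        then have "m < l m" using n by (intro l_gt) auto
        then have "real m \<le> real (l m)" by simp
        also have "\<dots> \<le> r" using m by simp
        finally have "real m \<le> r" .
        then show "m \<in> {..nat \<lceil>r\<rceil>}" by simp linarith
      qed
    qed simp
    have m: "n - 1 \<le> m" "real (l m) \<le> r" using Max_in[OF fin] r by (auto simp: m_def)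
    have m': "r < real (l (Suc m))"
    proof (rule ccontr)
      assume "\<not> ?thesis"
      then have "Suc m \<le> m" unfolding m_def using m(1) by (intro Max_ge fin) (auto simp: m_def)
      then show False by simp
    qed
    have m1: "1 \<le> m" using m n by auto
    have r2: "2 \<le> r" using m(2) l_ge2[OF m1] by linarith
    define q where "q = nat \<lfloor>r\<rfloor>"
    have q: "real q \<le> r" "r < real q + 1" using r2 by (auto simp: q_def)
    have q1: "l m \<le> q" using m(2) by (simp add: q_def le_nat_floor)
    have q2: "q \<le> l (Suc m)" using q m' by simp
    have qr: "r / 2 \<le> real q" "r \<le> real (2 * q)" using q r2 by auto
    let ?V = "level_size l m"
    have pos: "0 < real ?V * r * ln r" using level_size_pos[of m] r2 by simp
    have "c / r \<le> dirichlet 1 W \<phi> f"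
      if f: "finite (supp W f)" "real (card (supp W f)) \<le> v" "lp_norm 1 W f = 1" for f
    proof (rule ccontr)
      assume "\<not> ?thesis"
      then have "dirichlet 1 W \<phi> f < c / r" by simp
      also have "\<dots> \<le> c0 / real q" using c q r2 qr by (intro frac_le) auto
      finally have "(2 * q) ^ (?V * q div 16 + 1) \<le> card (supp W f)"
        using low[of "Suc m" q f] m1 q1 q2 f by simp
      then have card: "real ((2 * q) ^ (?V * q div 16 + 1)) \<le> v" using f(2) by (meson of_nat_le_iff order_trans)
      have "exp (c * real ?V * r * ln r) < exp (real ?V * r / 32 * ln r)"
      proof -
        have "c * (real ?V * r * ln r) < (1 / 32) * (real ?V * r * ln r)" using c pos by (intro mult_strict_right_mono) auto
        then show ?thesis by (simp add: mult.assoc)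
      qed
      also have "\<dots> \<le> exp (real (?V * q div 16 + 1) * ln r)"
      proof -
        have "real (?V * q) < 16 * (real (?V * q div 16) + 1)"
        proof -
          have "?V * q < 16 * (?V * q div 16 + 1)" using dividend_less_times_div[of 16 "?V * q"] by simp
          then have "real (?V * q) < real (16 * (?V * q div 16 + 1))" by (simp only: of_nat_less_iff)
          then show ?thesis by simp
        qed
        then have "real ?V * real q / 16 \<le> real (?V * q div 16 + 1)" by simp
        moreover have "real ?V * r / 32 \<le> real ?V * real q / 16" using qr level_size_pos[of m] by (simp add: field_simps)
        ultimately have "real ?V * r / 32 \<le> real (?V * q div 16 + 1)" by linarith
        then show ?thesis using r2 by (simp only: exp_le_cancel_iff mult_right_mono ln_ge_zero)
      qed
      also have "\<dots> = r ^ (?V * q div 16 + 1)" using r2 by (simp only: exp_of_nat_mult exp_ln)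
      also have "\<dots> \<le> real (2 * q) ^ (?V * q div 16 + 1)" using qr r2 by (intro power_mono) auto
      also have "\<dots> \<le> v" using card by (simp only: of_nat_power)
      also have "v \<le> exp (c * real (level_size l (n - 1)) * r * ln r)" by (rule v)
      also have "\<dots> \<le> exp (c * real ?V * r * ln r)"
        using level_size_mono[OF m(1)] c r2 by (simp add: mult_right_mono)
      finally show False by simp
    qed
    then show ?thesis unfolding profile_def by (intro Inf_greatest) auto
  qed
  then show ?thesis using c by (intro exI[of _ c]) auto
qed

lemma upper_bound:
  "\<exists>C\<ge>1. \<forall>n\<ge>2. \<forall>r v. real (l (n - 1)) \<le> r \<longrightarrow> r \<le> real (l n) \<longrightarrow> exp (C * real (level_size l (n - 1)) * r * ln r) \<le> v \<longrightarrow> \<Lambda>2 v \<le> ereal (C / r\<^sup>2)"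
proof -
  obtain C0 where C0: "0 < C0" and dir: "\<And>f. finite (supp W f) \<Longrightarrow> dirichlet 2 W \<phi> f \<le> C0 * (\<Sum>h\<in>wreath_gens. displacement 2 W h f)"
    using Wr.dirichlet_le_displacement[OF \<phi>(1,2) _ wreath_gens_carrier _ generate_W, of 2] by auto
  define C where "C = 256 + C0 * 108 * 64"
  have C: "256 \<le> C" "C0 * 108 * 64 \<le> C" using C0 by (auto simp: C_def)
  have "\<Lambda>2 v \<le> ereal (C / r\<^sup>2)"
    if n: "2 \<le> n" and r: "real (l (n - 1)) \<le> r" "r \<le> real (l n)" and v: "exp (C * real (level_size l (n - 1)) * r * ln r) \<le> v" for n r v
  proof -
    have l2: "2 \<le> real (l (n - 1))" using l_ge2[of "n - 1"] n by simp
    have r2: "2 \<le> r" using r l2 by linarith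
    let ?V = "level_size l (n - 1)"
    have X: "0 \<le> real ?V * r * ln r" using r2 by simp
    show ?thesis
    proof (cases "r < 16")
      case True
      have "0 \<le> C * (real ?V * r * ln r)" using mult_nonneg_nonneg[OF _ X, of C] C by simp
      then have "1 \<le> exp (C * real ?V * r * ln r)" by (simp only: one_le_exp_iff mult.assoc)
      then have "1 \<le> v" using v by (rule order_trans)
      then have "\<Lambda>2 v \<le> 1" by (intro profile_le_1) auto
      also have "1 \<le> ereal (C / r\<^sup>2)"
      proof -
        have "r\<^sup>2 \<le> 16\<^sup>2" using True r2 by (intro power_mono) auto
        then have "1 \<le> C / r\<^sup>2" using C r2 by (simp add: le_divide_eq)
        then show ?thesis by (simp add: one_ereal_def)
      qed
      finally show ?thesis .
    next
      case False
      \<comment> \<open>the largest \<open>R\<close> with \<open>4 R + 4 \<le> r\<close>; it is at least \<open>r / 8\<close> because \<open>16 \<le> r\<close>\<close>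
      define R where "R = nat \<lfloor>r / 4\<rfloor> - 1"
      have "real (nat \<lfloor>r / 4\<rfloor>) = of_int \<lfloor>r / 4\<rfloor>" using False by simp
      then have fl: "real (nat \<lfloor>r / 4\<rfloor>) \<le> r / 4" "r / 4 < real (nat \<lfloor>r / 4\<rfloor>) + 1"
        using of_int_floor_le[of "r / 4"] real_of_int_floor_add_one_gt[of "r / 4"] by linarith+
      have "4 \<le> nat \<lfloor>r / 4\<rfloor>" using False by (simp add: le_nat_floor)
      then have R3: "3 \<le> R" and Rr: "real R = real (nat \<lfloor>r / 4\<rfloor>) - 1" by (auto simp: R_def)
      have R8: "r / 8 \<le> real R" "real (4 * R + 4) \<le> r" "real (2 * R + 1) \<le> r" "real R \<le> r"
      proof -
        have "r / 4 - 2 < real R" "real R \<le> r / 4 - 1" "16 \<le> r" using Rr fl False by linarith+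
        moreover have "real (4 * R + 4) = 4 * real R + 4" "real (2 * R + 1) = 2 * real R + 1" by simp_all
        ultimately show "r / 8 \<le> real R" "real (4 * R + 4) \<le> r" "real (2 * R + 1) \<le> r" "real R \<le> r" by linarith+
      qed
      interpret w: window l "n - 1" R
      proof
        show "1 \<le> n - 1" "3 \<le> R" using n R3 by auto
        have "real (4 * R + 4) \<le> real (l n)" using R8 r by linarith
        then show "4 * R + 4 \<le> l (Suc (n - 1))" using n by simp
      qed
      obtain f where f: "finite (supp W f)" "lp_norm 2 W f = 1"
        "card (supp W f) \<le> fact ?V * (2 * R + 1) ^ (?V * (10 * R))"
        "(\<Sum>s\<in>wreath_gens. displacement 2 W s f) \<le> 108 / real R ^ 2" using w.test_function by blast
      have "real (card (supp W f)) \<le> v"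
      proof -
        have lnV: "ln (real ?V) \<le> r * ln r"
        proof -
          have "real ?V \<le> real (l (n - 1)) ^ (n - 1)" using level_size_power[of "n - 1"] by (metis of_nat_le_iff of_nat_power)
          then have "ln (real ?V) \<le> ln (real (l (n - 1)) ^ (n - 1))" using level_size_pos[of "n - 1"] l_pos[of "n - 1"] n by simp
          also have "\<dots> = real (n - 1) * ln (real (l (n - 1)))" using l_pos[of "n - 1"] n by (simp add: ln_realpow)
          also have "\<dots> \<le> r * ln r"
          proof (intro mult_mono)
            have "n - 1 < l (n - 1)" using n by (intro l_gt) auto
            then have "real (n - 1) \<le> real (l (n - 1))" "0 < real (l (n - 1))" by auto
            then show "real (n - 1) \<le> r" "ln (real (l (n - 1))) \<le> ln r" "0 \<le> ln (real (l (n - 1)))" using r r2 by auto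
          qed (use r2 in auto)
          finally show ?thesis .
        qed
        have "real (card (supp W f)) \<le> real (fact ?V * (2 * R + 1) ^ (?V * (10 * R)))" using f(3) by (simp only: of_nat_le_iff)
        also have "\<dots> = fact ?V * real (2 * R + 1) ^ (?V * (10 * R))" by simp
        also have "\<dots> \<le> exp (real ?V * (r * ln r)) * exp (real (?V * (10 * R)) * ln r)"
        proof (rule mult_mono)
          have "(fact ?V :: real) \<le> real ?V ^ ?V" using fact_le_power[of ?V, where 'a = real] by simp
          also have "\<dots> = exp (real ?V * ln (real ?V))" using level_size_pos[of "n - 1"] by (simp only: exp_of_nat_mult exp_ln of_nat_0_less_iff)
          also have "\<dots> \<le> exp (real ?V * (r * ln r))" using lnV by (simp add: mult_left_mono)
          finally show "(fact ?V :: real) \<le> exp (real ?V * (r * ln r))" .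
          have "real (2 * R + 1) ^ (?V * (10 * R)) \<le> r ^ (?V * (10 * R))" using R8 by (intro power_mono) auto
          also have "\<dots> = exp (real (?V * (10 * R)) * ln r)" using r2 by (simp only: exp_of_nat_mult exp_ln)
          finally show "real (2 * R + 1) ^ (?V * (10 * R)) \<le> exp (real (?V * (10 * R)) * ln r)" .
        qed auto
        also have "\<dots> = exp (real ?V * (r * ln r) + real ?V * (10 * real R) * ln r)" by (simp add: exp_add)
        also have "\<dots> \<le> exp (C * real ?V * r * ln r)"
        proof -
          have "real ?V * (10 * real R) * ln r \<le> real ?V * (10 * r) * ln r" using R8 r2 by (intro mult_right_mono mult_left_mono) auto
          moreover have "11 * (real ?V * r * ln r) \<le> C * (real ?V * r * ln r)" using C X by (intro mult_right_mono) auto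
          ultimately show ?thesis by (simp add: algebra_simps)
        qed
        also note v
        finally show ?thesis .
      qed
      then have "\<Lambda>2 v \<le> ereal (dirichlet 2 W \<phi> f)" unfolding profile_def using f by (intro Inf_lower) auto
      also have "\<dots> \<le> ereal (C / r\<^sup>2)"
      proof -
        have "dirichlet 2 W \<phi> f \<le> C0 * (108 / real R ^ 2)" using dir[OF f(1)] f(4) C0 by (meson mult_left_mono less_imp_le order_trans)
        also have "\<dots> \<le> C0 * (108 / (r / 8) ^ 2)"
          using C0 R8 r2 by (intro mult_left_mono divide_left_mono power_mono mult_pos_pos) auto
        also have "\<dots> = C0 * 108 * 64 / r\<^sup>2" by (simp add: power_divide)
        also have "\<dots> \<le> C / r\<^sup>2" using C by (intro divide_right_mono) auto
        finally show ?thesis by simp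
      qed
      finally show ?thesis .
    qed
  qed
  then show ?thesis using C by (intro exI[of _ C]) auto
qed

text \<open>
  To remove the constant \<open>C\<close> from the exponent, use \<open>upper_bound\<close> with \<open>r / C\<close>. If this leaves the
  interval, then \<open>r\<close> is comparable to \<open>l (n - 1)\<close>, the largest \<open>r\<close> of the previous interval. In terms of
  that interval the exponent is smaller by a factor of at least \<open>l (n - 1)\<close>, which compensates \<open>C\<close>
  unless \<open>l (n - 1) < C\<close>; in this case, and for \<open>n = 2\<close>, \<open>r\<close> is bounded.
\<close>

lemma regime_upper:
  "\<exists>b>0. \<forall>n\<ge>2. \<forall>r v. real (l (n - 1)) \<le> r \<longrightarrow> r \<le> real (l n) \<longrightarrow> exp (real (level_size l (n - 1)) * r * ln r) \<le> v \<longrightarrow> \<Lambda>2 v \<le> ereal (b / r\<^sup>2)"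
proof -
  obtain C where C: "1 \<le> C" and up: "\<And>n r v. 2 \<le> n \<Longrightarrow> real (l (n - 1)) \<le> r \<Longrightarrow> r \<le> real (l n) \<Longrightarrow>
     exp (C * real (level_size l (n - 1)) * r * ln r) \<le> v \<Longrightarrow> \<Lambda>2 v \<le> ereal (C / r\<^sup>2)" using upper_bound by blast
  define b where "b = C ^ 4 + (C * real (l 1))\<^sup>2"
  have b: "0 < b" "C ^ 4 \<le> b" "(C * real (l 1))\<^sup>2 \<le> b" using C by (auto simp: b_def add_pos_nonneg)
  have b3: "C ^ 3 \<le> b" using b(2) C power_increasing[of 3 4 C] by simp
  have "\<Lambda>2 v \<le> ereal (b / r\<^sup>2)"
    if n: "2 \<le> n" and r: "real (l (n - 1)) \<le> r" "r \<le> real (l n)" and v: "exp (real (level_size l (n - 1)) * r * ln r) \<le> v" for n r v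
  proof -
    have l2: "2 \<le> real (l (n - 1))" using l_ge2[of "n - 1"] n by simp
    have r2: "2 \<le> r" using r l2 by linarith
    let ?V = "level_size l (n - 1)"
    have V0: "0 < real ?V" using level_size_pos by simp
    have "1 \<le> exp (real ?V * r * ln r)" using r2 by simp
    then have v1: "1 \<le> v" using v by linarith
    have crude: ?thesis if "r\<^sup>2 \<le> b"
    proof -
      have "\<Lambda>2 v \<le> 1" using v1 by (intro profile_le_1) auto
      also have "1 \<le> ereal (b / r\<^sup>2)" using that r2 by (simp add: one_ereal_def le_divide_eq)
      finally show ?thesis .
    qed
    have le: ?thesis if "\<Lambda>2 v \<le> ereal (C / s\<^sup>2)" "r \<le> C * s" "0 < s" for s
    proof -
      have "r\<^sup>2 \<le> (C * s)\<^sup>2" using that r2 by (intro power_mono) auto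
      then have "C * r\<^sup>2 \<le> C ^ 3 * s\<^sup>2" using C by (simp add: power_mult_distrib power2_eq_square power3_eq_cube mult_ac)
      then have "C / s\<^sup>2 \<le> C ^ 3 / r\<^sup>2" using that r2 by (simp add: field_simps)
      also have "\<dots> \<le> b / r\<^sup>2" using b3 by (intro divide_right_mono) auto
      finally show ?thesis using that(1) by (meson ereal_less_eq(3) order_trans)
    qed
    show ?thesis
    proof (cases "real (l (n - 1)) \<le> r / C")
      case True
      have rC: "r / C \<le> r" using C r2 by (simp add: divide_le_eq)
      have "C * real ?V * (r / C) * ln (r / C) \<le> real ?V * r * ln r"
      proof -
        have "ln (r / C) \<le> ln r" using rC True l2 r2 by simp
        then have "real ?V * r * ln (r / C) \<le> real ?V * r * ln r" using r2 by (intro mult_left_mono) auto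
        then show ?thesis using C by simp
      qed
      then have "exp (C * real ?V * (r / C) * ln (r / C)) \<le> v" using v by (meson exp_le_cancel_iff order_trans)
      then have "\<Lambda>2 v \<le> ereal (C / (r / C)\<^sup>2)" using True rC r n by (intro up[of n "r / C"]) auto
      then show ?thesis using C r2 by (intro le[of "r / C"]) auto
    next
      case False
      then have rl: "r \<le> C * real (l (n - 1))" using C by (simp add: field_simps)
      consider "n = 2" | "real (l (n - 1)) < C" | "3 \<le> n" "C \<le> real (l (n - 1))" using n by linarith
      then show ?thesis
      proof cases
        case 1
        have "r\<^sup>2 \<le> (C * real (l 1))\<^sup>2" using rl 1 r2 by (intro power_mono) auto
        then show ?thesis using b by (intro crude) auto
      next
        case 2
        have "C * real (l (n - 1)) \<le> C * C" using C 2 by (intro mult_left_mono) auto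
        then have "r\<^sup>2 \<le> (C * C)\<^sup>2" using rl r2 by (intro power_mono) auto
        then show ?thesis using b by (intro crude) (simp add: power2_eq_square power4_eq_xxxx mult_ac)
      next
        case 3
        let ?s = "real (l (n - 1))"
        have Vs: "real ?V = real (level_size l (n - 2)) * ?s"
        proof -
          obtain j where j: "n = Suc (Suc j)" using n by (metis Suc_le_D numeral_2_eq_2 Suc_le_mono)
          show ?thesis by (simp add: level_size_def j)
        qed
        have ls: "0 \<le> ln ?s" "ln ?s \<le> ln r" using l2 r by auto
        have "C * real (level_size l (n - 2)) * ?s * ln ?s = C * (real ?V * ln ?s)" by (simp only: Vs mult_ac)
        also have "\<dots> \<le> ?s * (real ?V * ln ?s)" using 3 ls by (intro mult_right_mono) auto
        also have "\<dots> \<le> r * (real ?V * ln r)" using r ls by (intro mult_mono mult_left_mono) auto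
        finally have "C * real (level_size l (n - 2)) * ?s * ln ?s \<le> real ?V * r * ln r" by (simp add: mult_ac)
        then have ev: "exp (C * real (level_size l (n - 2)) * ?s * ln ?s) \<le> v" using v by (meson exp_le_cancel_iff order_trans)
        have "\<Lambda>2 v \<le> ereal (C / ?s\<^sup>2)"
        proof (rule up[of "n - 1"])
          show "2 \<le> n - 1" using 3 by simp
          have "l (n - 1 - 1) \<le> l (n - 1)" using 3 by (intro l_mono) auto
          then show "real (l (n - 1 - 1)) \<le> ?s" by simp
          show "exp (C * real (level_size l (n - 1 - 1)) * ?s * ln ?s) \<le> v" using ev by (simp add: numeral_2_eq_2)
        qed simp
        then show ?thesis using rl l2 by (intro le[of ?s]) auto
      qed
    qed
  qed
  then show ?thesis using b by blast
qed

text \<open>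
  Use \<open>lower_bound\<close> with \<open>r / c\<close> in place of \<open>r\<close>.
\<close>

lemma regime_lower:
  "\<exists>a>0. \<forall>n\<ge>2. \<forall>r v. real (l (n - 1)) \<le> r \<longrightarrow> v \<le> exp (real (level_size l (n - 1)) * r * ln r) \<longrightarrow> ereal (a / r) \<le> \<Lambda>1 v"
proof -
  obtain c where c: "0 < c" "c \<le> 1" and low: "\<And>n r v. 2 \<le> n \<Longrightarrow> real (l (n - 1)) \<le> r \<Longrightarrow>
     v \<le> exp (c * real (level_size l (n - 1)) * r * ln r) \<Longrightarrow> ereal (c / r) \<le> \<Lambda>1 v" using lower_bound by blast
  have "ereal (c\<^sup>2 / r) \<le> \<Lambda>1 v"
    if n: "2 \<le> n" and r: "real (l (n - 1)) \<le> r" and v: "v \<le> exp (real (level_size l (n - 1)) * r * ln r)" for n r v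
  proof -
    have l2: "2 \<le> real (l (n - 1))" using l_ge2[of "n - 1"] n by simp
    have r2: "2 \<le> r" using r l2 by linarith
    have rc: "r \<le> r / c" using c r2 by (simp add: le_divide_eq mult_left_le)
    have "real (level_size l (n - 1)) * r * ln r \<le> c * real (level_size l (n - 1)) * (r / c) * ln (r / c)"
    proof -
      have "real (level_size l (n - 1)) * r * ln r \<le> real (level_size l (n - 1)) * r * ln (r / c)"
        using rc r2 by (intro mult_left_mono) auto
      then show ?thesis using c by simp
    qed
    then have "v \<le> exp (c * real (level_size l (n - 1)) * (r / c) * ln (r / c))" using v by (meson exp_le_cancel_iff order_trans)
    then have "ereal (c / (r / c)) \<le> \<Lambda>1 v" using r rc n by (intro low) auto
    then show ?thesis by (simp add: power2_eq_square)
  qed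
  moreover have "0 < c\<^sup>2" using c by simp
  ultimately show ?thesis by blast
qed

theorem profiles_comparable:
  "comparable_on (regime l) (\<lambda>(v, r). (\<Lambda>1 v)\<^sup>2) (\<lambda>(v, r). \<Lambda>2 v)"
  "comparable_on (regime l) (\<lambda>(v, r). \<Lambda>2 v) (\<lambda>(v, r). ereal (1 / r\<^sup>2))"
proof -
  obtain b where b: "0 < b" "\<And>n r v. 2 \<le> n \<Longrightarrow> real (l (n - 1)) \<le> r \<Longrightarrow> r \<le> real (l n) \<Longrightarrow>
      exp (real (level_size l (n - 1)) * r * ln r) \<le> v \<Longrightarrow> \<Lambda>2 v \<le> ereal (b / r\<^sup>2)" using regime_upper by blast
  obtain a where a: "0 < a" "\<And>n r v. 2 \<le> n \<Longrightarrow> real (l (n - 1)) \<le> r \<Longrightarrow>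
      v \<le> exp (real (level_size l (n - 1)) * r * ln r) \<Longrightarrow> ereal (a / r) \<le> \<Lambda>1 v" using regime_lower by blast
  have reg: "2 \<le> r \<and> 1 \<le> v \<and> ereal (a / r) \<le> \<Lambda>1 v \<and> \<Lambda>2 v \<le> ereal (b / r\<^sup>2)" if vr: "(v, r) \<in> regime l" for v r
  proof -
    have v0: "0 < v" using vr by (auto simp: regime_def)
    obtain n where n: "2 \<le> n" "real (l (n - 1)) \<le> r" "r \<le> real (l n)" "real (level_size l (n - 1)) * r * ln r \<le> ln v"
      and low: "ln v = real (level_size l (n - 1)) * r * ln r \<or> (r = real (l n) \<and> ln v \<le> real (level_size l n) * r * ln r)"
    proof -
      from vr consider n where "n \<ge> 2" "r \<in> {real (l (n - 1))..real (l n)}" "ln v = real (level_size l (n - 1)) * r * ln r"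
        | n where "n \<ge> 2" "r = real (l n)" "ln v \<in> {real (level_size l (n - 1)) * real (l n) * ln (real (l n))
                 ..real (level_size l n) * real (l n) * ln (real (l n))}"
        by (auto simp: regime_def)
      then show thesis
      proof cases
        case 1 then show ?thesis by (intro that[of n]) auto
      next
        case 2
        have "l (n - 1) \<le> l n" using 2 by (intro l_mono) auto
        then show ?thesis using 2 by (intro that[of n]) auto
      qed
    qed
    have l2: "2 \<le> real (l (n - 1))" using l_ge2[of "n - 1"] n(1) by simp
    have r2: "2 \<le> r" using n(2) l2 by linarith
    have X: "0 \<le> real (level_size l (n - 1)) * r * ln r" using r2 by simp
    have v1: "1 \<le> v" using X n(4) v0 by (metis ln_ge_zero_iff order_trans)
    have ev: "exp (ln v) = v" using v0 by simp
    have "exp (real (level_size l (n - 1)) * r * ln r) \<le> exp (ln v)" using n(4) by (simp only: exp_le_cancel_iff)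
    then have "exp (real (level_size l (n - 1)) * r * ln r) \<le> v" by (simp only: ev)
    then have "\<Lambda>2 v \<le> ereal (b / r\<^sup>2)" by (rule b(2)[OF n(1,2,3)])
    moreover have "ereal (a / r) \<le> \<Lambda>1 v"
      using low
    proof
      assume "ln v = real (level_size l (n - 1)) * r * ln r"
      then have "v \<le> exp (real (level_size l (n - 1)) * r * ln r)" using ev by simp
      then show ?thesis by (rule a(2)[OF n(1,2)])
    next
      assume h: "r = real (l n) \<and> ln v \<le> real (level_size l n) * r * ln r"
      have "exp (ln v) \<le> exp (real (level_size l n) * r * ln r)" using conjunct2[OF h] by (simp only: exp_le_cancel_iff)
      then have "v \<le> exp (real (level_size l (Suc n - 1)) * r * ln r)" by (simp only: ev diff_Suc_1)
      then show ?thesis using n(1) h by (intro a(2)[of "Suc n"]) simp_all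
    qed
    ultimately show ?thesis using r2 v1 by blast
  qed
  have cheeger: "ereal (x\<^sup>2 / 2) \<le> \<Lambda>2 v" if "ereal x \<le> \<Lambda>1 v" "0 \<le> x" for x v
    by (rule Wr.profile_Cheeger[OF \<phi>(1,2) that])
  show "comparable_on (regime l) (\<lambda>(v, r). (\<Lambda>1 v)\<^sup>2) (\<lambda>(v, r). \<Lambda>2 v)"
    unfolding comparable_on_def
  proof (intro exI conjI ballI)
    show "(0::real) < 1 / 2" "0 < b / a\<^sup>2" using a b by auto
    fix i assume i: "i \<in> regime l"
    obtain v r where vr: "i = (v, r)" by (cases i)
    note R = reg[OF i[unfolded vr]]
    have ar: "0 < a / r" using R a by simp
    have "\<Lambda>1 v \<le> 1" using R by (intro profile_le_1) auto
    then obtain x where x: "\<Lambda>1 v = ereal x" using R by (cases "\<Lambda>1 v") auto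
    have xa: "a / r \<le> x" using R x by simp
    show "ereal (1 / 2) * (case i of (v, r) \<Rightarrow> (\<Lambda>1 v)\<^sup>2) \<le> (case i of (v, r) \<Rightarrow> \<Lambda>2 v)"
      using cheeger[of x v] x xa ar by (simp add: vr)
    have "b / r\<^sup>2 = b / a\<^sup>2 * (a / r)\<^sup>2" using a by (simp add: power_divide)
    also have "\<dots> \<le> b / a\<^sup>2 * x\<^sup>2" using xa ar b by (intro mult_left_mono power_mono) auto
    finally have "\<Lambda>2 v \<le> ereal (b / a\<^sup>2 * x\<^sup>2)" using R by (meson ereal_less_eq(3) order_trans)
    then show "(case i of (v, r) \<Rightarrow> \<Lambda>2 v) \<le> ereal (b / a\<^sup>2) * (case i of (v, r) \<Rightarrow> (\<Lambda>1 v)\<^sup>2)"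
      unfolding vr prod.case x by simp
  qed
  show "comparable_on (regime l) (\<lambda>(v, r). \<Lambda>2 v) (\<lambda>(v, r). ereal (1 / r\<^sup>2))"
    unfolding comparable_on_def
  proof (intro exI conjI ballI)
    show "0 < 1 / b" "0 < 2 / a\<^sup>2" using a b by auto
    fix i assume i: "i \<in> regime l"
    obtain v r where vr: "i = (v, r)" by (cases i)
    note R = reg[OF i[unfolded vr]]
    have ar: "0 < a / r" using R a by simp
    have p2: "ereal ((a / r)\<^sup>2 / 2) \<le> \<Lambda>2 v" using R ar by (intro cheeger) auto
    then obtain y where y: "\<Lambda>2 v = ereal y" using R by (cases "\<Lambda>2 v") auto
    have y2: "y \<le> b / r\<^sup>2" "(a / r)\<^sup>2 / 2 \<le> y" using R y p2 by auto
    show "ereal (1 / b) * (case i of (v, r) \<Rightarrow> \<Lambda>2 v) \<le> (case i of (v, r) \<Rightarrow> ereal (1 / r\<^sup>2))"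
      using y2(1) b by (simp add: vr y field_simps)
    have "1 / r\<^sup>2 = 2 / a\<^sup>2 * ((a / r)\<^sup>2 / 2)" using a by (simp add: power_divide)
    also have "\<dots> \<le> 2 / a\<^sup>2 * y" using y2(2) a by (intro mult_left_mono) auto
    finally show "(case i of (v, r) \<Rightarrow> ereal (1 / r\<^sup>2)) \<le> ereal (2 / a\<^sup>2) * (case i of (v, r) \<Rightarrow> \<Lambda>2 v)"
      by (simp add: vr y)
  qed
qed
end
end

theorem theorem6p15:
  fixes l \<kappa> :: "nat \<Rightarrow> nat"
    and \<phi> :: "(((nat \<Rightarrow> nat) \<Rightarrow> int) \<times> (nat list \<Rightarrow> nat list)) pmf"
  assumes "\<And>n. n \<ge> 1 \<Longrightarrow> l n = 2 ^ \<kappa> n"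
    and "\<And>n. n \<ge> 1 \<Longrightarrow> \<kappa> n \<ge> 1"
    and "\<And>n. n \<ge> 1 \<Longrightarrow> \<kappa> (n + 1) \<ge> \<kappa> n + 1"
    and "symmetric_measure (ns_wreath l) \<phi>"
    and "finite_generating_support (ns_wreath l) \<phi>"
  shows
    "(\<exists>c>0. \<exists>C>0. \<forall>n\<ge>2. \<forall>r\<in>{real (l (n - 1))..real (l n)}.
        (\<forall>v. v \<le> exp (c * real (level_size l (n - 1)) * r * ln r) \<longrightarrow>
             profile 1 (ns_wreath l) \<phi> v \<ge> ereal (c / r)) \<and>
        (\<forall>v. v \<ge> exp (C * real (level_size l (n - 1)) * r * ln r) \<longrightarrow>
             profile 2 (ns_wreath l) \<phi> v \<le> ereal (C / r\<^sup>2)))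
     \<and> comparable_on (regime l)
          (\<lambda>(v, r). (profile 1 (ns_wreath l) \<phi> v)\<^sup>2) (\<lambda>(v, r). profile 2 (ns_wreath l) \<phi> v)
     \<and> comparable_on (regime l)
          (\<lambda>(v, r). profile 2 (ns_wreath l) \<phi> v) (\<lambda>(v, r). ereal (1 / r\<^sup>2))"
proof -
  interpret ns_sequence l
  proof
    fix i :: nat assume i: "1 \<le> i"
    show "0 < l i" "even (l i)" using assms(1,2)[OF i] by auto
    have "2 * l i = 2 ^ (\<kappa> i + 1)" "l (Suc i) = 2 ^ \<kappa> (Suc i)" using assms(1)[of i] assms(1)[of "Suc i"] i by auto
    then show "2 * l i dvd l (Suc i)" using assms(3)[OF i] by (simp add: le_imp_power_dvd del: power_Suc)
  qed
  have \<phi>: "finite (set_pmf \<phi>)" "set_pmf \<phi> \<subseteq> carrier W" "generate W (set_pmf \<phi>) = carrier W"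
    using assms(4,5) by (auto simp: symmetric_measure_def finite_generating_support_def)
  obtain c where c: "0 < c" and low: "\<And>n r v. 2 \<le> n \<Longrightarrow> real (l (n - 1)) \<le> r \<Longrightarrow>
     v \<le> exp (c * real (level_size l (n - 1)) * r * ln r) \<Longrightarrow> ereal (c / r) \<le> profile 1 W \<phi> v" using lower_bound[OF \<phi>] by blast
  obtain C where C: "1 \<le> C" and up: "\<And>n r v. 2 \<le> n \<Longrightarrow> real (l (n - 1)) \<le> r \<Longrightarrow> r \<le> real (l n) \<Longrightarrow>
     exp (C * real (level_size l (n - 1)) * r * ln r) \<le> v \<Longrightarrow> profile 2 W \<phi> v \<le> ereal (C / r\<^sup>2)" using upper_bound[OF \<phi>] by blast
  have "\<exists>C>0. \<forall>n\<ge>2. \<forall>r\<in>{real (l (n - 1))..real (l n)}.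
        (\<forall>v. v \<le> exp (c * real (level_size l (n - 1)) * r * ln r) \<longrightarrow> profile 1 W \<phi> v \<ge> ereal (c / r)) \<and>
        (\<forall>v. v \<ge> exp (C * real (level_size l (n - 1)) * r * ln r) \<longrightarrow> profile 2 W \<phi> v \<le> ereal (C / r\<^sup>2))"
  proof (intro exI[of _ C] conjI ballI allI impI)
    show "0 < C" using C by auto
  qed (use low up in auto)
  then have "\<exists>c>0. \<exists>C>0. \<forall>n\<ge>2. \<forall>r\<in>{real (l (n - 1))..real (l n)}.
        (\<forall>v. v \<le> exp (c * real (level_size l (n - 1)) * r * ln r) \<longrightarrow> profile 1 W \<phi> v \<ge> ereal (c / r)) \<and>
        (\<forall>v. v \<ge> exp (C * real (level_size l (n - 1)) * r * ln r) \<longrightarrow> profile 2 W \<phi> v \<le> ereal (C / r\<^sup>2))"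
    using c by (intro exI[of _ c]) (rule conjI)
  then show ?thesis using profiles_comparable[OF \<phi>] by blast
qed

end
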